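(* Let $d\ge5$ and $Q\ge2$, let $L(s,F)$ be an $L$-function of degree $d$ satisfying the framework described in the context, and let $\delta\in(0,1)$. Assume: (A1) $|\lambda_F(n)|\le \tau_d(n)$ for all integers $n\ge 1$. (A2) For some fixed (but arbitrary) $\varepsilon>0$, $\sum_{X\le n\le X+Y}|\lambda_F(n)|^2\ll_F Y$ holds for all large $X\geq 2$ and all $X^{1-\varepsilon}\le Y\le X$. (A3) For any $2\le P_1\le P_2\le X$, $\displaystyle\sum_{n\le X,\ (n,\prod_{P_1\le p\le P_2}p)=1}|\lambda_F(n)|^2\ll_F X\frac{\log P_1}{\log P_2}$. (A5') There are a (large) fixed constant $C_F'>0$ and an (arbitrarily large) constant $A>0$ such that, for all $1-\frac1{2024}<\sigma<1$ and all $1\le T\le Q$, $$\sum_{Q\le q\le 2Q}\ \sum_{\chi\ (\mathrm{mod}\ q)}^{*}\mathcal{N}_F(\sigma,T;\chi)\ll_F Q^{C_F'(1-\sigma)}\log^A Q.$$ (A6) For all $Q\le q\le 2Q$ and all primitive Dirichlet characters $\chi$ modulo $q$, $$L\big(\tfrac12,F\times\chi\big)\ll_F\frac{q^{d/4}}{\exp(\log^{\delta}q)}.$$ Then, for any $\eta<\delta$, $$\sum_{Q\le q\le 2Q}\ \sum_{\chi\ (\mathrm{mod}\ q)}^{*}\Big|L\big(\tfrac12,F\times\chi\big)\Big|^2\ll_F\frac{Q^{d/2}}{\log^{\eta}Q}.$$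
   Context: Framework. $L(s,F)=\sum_{n\ge1}\lambda_F(n)n^{-s}=\prod_p\prod_{j=1}^d(1-\alpha_{j,F}(p)p^{-s})^{-1}$ is a Dirichlet series with Euler product of degree $d$, both absolutely convergent for $\Re(s)>1$; $\lambda_F$ is multiplicative with $\lambda_F(p^r)=\sum_{r_1,\dots,r_d\ge0,\ r_1+\cdots+r_d=r}\prod_{j=1}^d\alpha_{j,F}(p)^{r_j}$. For $q\ge2$ and a primitive Dirichlet character $\chi$ modulo $q$, $$L(s,F\times\chi)=\sum_{n\ge1}\frac{\lambda_F(n)\chi(n)}{n^s}=\prod_p\prod_{j=1}^d\Big(1-\frac{\alpha_{j,F}(p)\chi(p)}{p^s}\Big)^{-1},$$ both absolutely convergent for $\Re(s)>1$. Put $L_\infty(s,F\times\chi)=N^{s/2}\prod_{j=1}^d\Gamma_{\mathbb R}(s+\mu_j)$ with $\Gamma_{\mathbb R}(s)=\pi^{-s/2}\Gamma(s/2)$, where the conductor $N$ (a positive integer) depends only on $F$ and $q$, and the $\mu_j\in\mathbb C$ depend only on $F$ and $\chi(-1)$ and satisfy $\Re(\mu_j)\ge-1+\theta_F$ for some fixed $\theta_F$ with $\frac1{2d}<\theta_F<\frac12$. Let $\Lambda(s,F\times\chi)=L(s,F\times\chi)L_\infty(s,F\times\chi)$. It is assumed that: (1) $\Lambda(s,F\times\chi)$ extends to an entire function of order 1; (2) $\Lambda(s,F\times\chi)=\kappa\,\Lambda(1-s,\tilde F\times\overline\chi)$ for some $\kappa=\kappa_{F,\chi}$ with $|\kappa|=1$,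 where $\tilde F$ is the dual form with $\lambda_{\tilde F}(n)=\overline{\lambda_F(n)}$ (its completed $L$-function is formed in the same way, with the same $N$ and with parameters $\overline{\mu_j}$); (3) with the analytic conductor $C(s,F\times\chi)=N\prod_{j=1}^d(|s+\mu_j+3|)$ and $C(F\times\chi)=C(\frac12,F\times\chi)$, one has $C(F\times\chi)\ll_F N\ll_F q^d$ for large $q$. Notation. $\sum^{*}_{\chi\,(\mathrm{mod}\ q)}$ is the sum over all primitive Dirichlet characters modulo $q$. $\mathcal{N}_F(\sigma,T;\chi)$ is the number of zeros of $L(s,F\times\chi)$ in the region $\Re(s)\ge\sigma$, $|\Im(s)|\le T$. $\tau_d$ is the $d$-fold divisor function, $p$ denotes a prime, $\log^a x=(\log x)^a$. $F$ (and $d,\delta,\eta,A$) are fixed, all constants in the hypotheses are uniform in $q$, $Q$ and $\chi$, and the implied constant in the conclusion depends on $F$ and the fixed parameters but not on $Q$. *)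

theory Defs
  imports
    "HOL-Complex_Analysis.Complex_Analysis"
    "HOL-Computational_Algebra.Primes"
    "HOL-Number_Theory.Cong"
begin

section \<open>Dirichlet characters\<close>

text \<open>Characters are taken on the integers, so that the parity \<open>chi (- 1)\<close> makes sense.\<close>

definition dirichlet_character :: "nat \<Rightarrow> (int \<Rightarrow> complex) \<Rightarrow> bool" where
  "dirichlet_character q chi \<longleftrightarrow> q > 0 \<and>
     (\<forall>m n. chi (m * n) = chi m * chi n) \<and>
     (\<forall>n. chi (n + int q) = chi n) \<and>
     (\<forall>n. chi n \<noteq> 0 \<longleftrightarrow> coprime n (int q))"

definition induced_modulus :: "nat \<Rightarrow> (int \<Rightarrow> complex) \<Rightarrow> nat \<Rightarrow> bool" where
  "induced_modulus q chi k \<longleftrightarrow> k dvd q \<and>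
     (\<forall>n. coprime n (int q) \<longrightarrow> [n = 1] (mod int k) \<longrightarrow> chi n = 1)"

definition primitive_characters :: "nat \<Rightarrow> (int \<Rightarrow> complex) set" where
  "primitive_characters q =
     {chi. dirichlet_character q chi \<and> (\<forall>k<q. \<not> induced_modulus q chi k)}"

section \<open>Analytic preliminaries\<close>

definition divisor_fun :: "nat \<Rightarrow> nat \<Rightarrow> nat" where
  "divisor_fun d n = card {xs :: nat list. length xs = d \<and> prod_list xs = n}"

definition Gamma_R :: "complex \<Rightarrow> complex" where
  "Gamma_R s = of_real pi powr (- s / 2) * Gamma (s / 2)"

definition is_entire_extension :: "(complex \<Rightarrow> complex) \<Rightarrow> (complex \<Rightarrow> complex) \<Rightarrow> bool" where
  "is_entire_extension f g \<longleftrightarrow> g holomorphic_on UNIV \<and> (\<forall>s. Re s > 1 \<longrightarrow> g s = f s)"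

text \<open>Meaningful only if an extension exists; it is then unique by the identity theorem.\<close>

definition entire_extension :: "(complex \<Rightarrow> complex) \<Rightarrow> complex \<Rightarrow> complex" where
  "entire_extension f = (THE g. is_entire_extension f g)"

definition entire_order :: "(complex \<Rightarrow> complex) \<Rightarrow> ereal" where
  "entire_order f =
     Inf {ereal a |a. a \<ge> 0 \<and> (\<forall>\<^sub>F z in at_infinity. norm (f z) < exp (norm z powr a))}"

section \<open>\<open>L\<close>-functions and their twists\<close>

text \<open>
  The roots \<open>\<alpha>\<^sub>j(p)\<close> are \<open>L_root F j p\<close> and the archimedean parameters \<open>\<mu>\<^sub>j\<close> of the twists
  by characters with \<open>chi (- 1) = e\<close> are \<open>L_shift F e j\<close>, both with \<open>j < L_degree F\<close>.
  The conductor \<open>N\<close> of the twists by primitive characters modulo \<open>q\<close> is \<open>L_conductor F q\<close>.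
\<close>

record L_datum =
  L_degree :: nat
  L_root :: "nat \<Rightarrow> nat \<Rightarrow> complex"
  L_coeff :: "nat \<Rightarrow> complex"
  L_conductor :: "nat \<Rightarrow> nat"
  L_shift :: "complex \<Rightarrow> nat \<Rightarrow> complex"

definition dual :: "L_datum \<Rightarrow> L_datum" where
  "dual F = F\<lparr>L_root := \<lambda>j p. cnj (L_root F j p),
              L_coeff := \<lambda>n. cnj (L_coeff F n),
              L_shift := \<lambda>e j. cnj (L_shift F e j)\<rparr>"

definition twist_term :: "L_datum \<Rightarrow> (int \<Rightarrow> complex) \<Rightarrow> complex \<Rightarrow> nat \<Rightarrow> complex" where
  "twist_term F chi s n = L_coeff F n * chi (int n) / of_nat n powr s"

definition twist_series :: "L_datum \<Rightarrow> (int \<Rightarrow> complex) \<Rightarrow> complex \<Rightarrow> complex" where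
  "twist_series F chi s = (\<Sum>n. twist_term F chi s (Suc n))"

definition euler_factor :: "L_datum \<Rightarrow> (int \<Rightarrow> complex) \<Rightarrow> complex \<Rightarrow> nat \<Rightarrow> complex" where
  "euler_factor F chi s p =
     (if prime p
      then \<Prod>j<L_degree F. inverse (1 - L_root F j p * chi (int p) / of_nat p powr s)
      else 1)"

text \<open>
  The third conjunct says that all Euler factors are well defined, which the convention
  \<open>inverse 0 = 0\<close> would otherwise hide.
\<close>

definition has_euler_product :: "L_datum \<Rightarrow> (int \<Rightarrow> complex) \<Rightarrow> bool" where
  "has_euler_product F chi \<longleftrightarrow> (\<forall>s. Re s > 1 \<longrightarrow>
     summable (\<lambda>n. norm (twist_term F chi s (Suc n))) \<and>
     abs_convergent_prod (euler_factor F chi s) \<and>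
     (\<forall>p. prime p \<longrightarrow>
        (\<forall>j<L_degree F. 1 - L_root F j p * chi (int p) / of_nat p powr s \<noteq> 0)) \<and>
     euler_factor F chi s has_prod twist_series F chi s)"

definition L_twist :: "L_datum \<Rightarrow> (int \<Rightarrow> complex) \<Rightarrow> complex \<Rightarrow> complex" where
  "L_twist F chi = entire_extension (twist_series F chi)"

definition L_inf :: "L_datum \<Rightarrow> nat \<Rightarrow> (int \<Rightarrow> complex) \<Rightarrow> complex \<Rightarrow> complex" where
  "L_inf F q chi s =
     of_nat (L_conductor F q) powr (s / 2) *
     (\<Prod>j<L_degree F. Gamma_R (s + L_shift F (chi (- 1)) j))"

text \<open>
  The completed function is defined by continuation from \<open>Re s > 1\<close>, and not as the pointwise
  product \<open>L_twist F chi s * L_inf F q chi s\<close>: the latter takes wrong values at the poles of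
  \<open>L_inf\<close>, where \<open>Gamma\<close> is \<open>0\<close> by convention.
\<close>

definition L_completed :: "L_datum \<Rightarrow> nat \<Rightarrow> (int \<Rightarrow> complex) \<Rightarrow> complex \<Rightarrow> complex" where
  "L_completed F q chi = entire_extension (\<lambda>s. twist_series F chi s * L_inf F q chi s)"

definition analytic_conductor ::
    "L_datum \<Rightarrow> nat \<Rightarrow> (int \<Rightarrow> complex) \<Rightarrow> complex \<Rightarrow> real" where
  "analytic_conductor F q chi s =
     real (L_conductor F q) * (\<Prod>j<L_degree F. norm (s + L_shift F (chi (- 1)) j + 3))"

text \<open>The untwisted function \<open>L(s, F)\<close> is the twist by the constant function 1.\<close>

locale L_framework =
  fixes F :: L_datum
  assumes coeff_1: "L_coeff F 1 = 1"
    and coeff_mult: "\<And>m n. coprime m n \<Longrightarrow> m > 0 \<Longrightarrow> n > 0 \<Longrightarrow>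
          L_coeff F (m * n) = L_coeff F m * L_coeff F n"
    and coeff_prime_power: "\<And>p r. prime p \<Longrightarrow>
          L_coeff F (p ^ r) =
            (\<Sum>rs\<in>{rs :: nat list. length rs = L_degree F \<and> sum_list rs = r}.
               \<Prod>j<L_degree F. L_root F j p ^ (rs ! j))"
    and euler_product: "has_euler_product F (\<lambda>_. 1)"
    and euler_product_twist:
          "\<And>q chi. q \<ge> 2 \<Longrightarrow> chi \<in> primitive_characters q \<Longrightarrow> has_euler_product F chi"
    and conductor_pos:
          "\<And>q chi. q \<ge> 2 \<Longrightarrow> chi \<in> primitive_characters q \<Longrightarrow> L_conductor F q > 0"
    and shift_bound:
          "\<exists>\<theta>. 1 / (2 * real (L_degree F)) < \<theta> \<and> \<theta> < 1 / 2 \<and>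
               (\<forall>e\<in>{1, - 1}. \<forall>j<L_degree F. Re (L_shift F e j) \<ge> - 1 + \<theta>)"
    and completed_entire:
          "\<And>q chi. q \<ge> 2 \<Longrightarrow> chi \<in> primitive_characters q \<Longrightarrow>
             is_entire_extension (\<lambda>s. twist_series F chi s * L_inf F q chi s) (L_completed F q chi)"
    and completed_order:
          "\<And>q chi. q \<ge> 2 \<Longrightarrow> chi \<in> primitive_characters q \<Longrightarrow>
             entire_order (L_completed F q chi) = 1"
    and functional_equation:
          "\<And>q chi. q \<ge> 2 \<Longrightarrow> chi \<in> primitive_characters q \<Longrightarrow>
             \<exists>\<kappa>. norm \<kappa> = 1 \<and>
               (\<forall>s. L_completed F q chi s =
                      \<kappa> * L_completed (dual F) q (\<lambda>n. cnj (chi n)) (1 - s))"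
    and conductor_bound:
          "\<exists>K q0. \<forall>q\<ge>q0. q \<ge> 2 \<longrightarrow> (\<forall>chi\<in>primitive_characters q.
             analytic_conductor F q chi (1 / 2) \<le> K * real (L_conductor F q) \<and>
             real (L_conductor F q) \<le> K * real q ^ L_degree F)"

text \<open>
  Zeros are counted with multiplicity.  For \<open>\<sigma> > 0\<close> the framework together with
  \<open>|\<lambda>\<^sub>F(n)| \<le> \<tau>\<^sub>d(n)\<close> confines the zeros below to a bounded region
  (there are none with \<open>Re s > 1\<close>), so the sum is finite.
\<close>

definition zero_count :: "L_datum \<Rightarrow> (int \<Rightarrow> complex) \<Rightarrow> real \<Rightarrow> real \<Rightarrow> int" where
  "zero_count F chi \<sigma> T =
     (\<Sum>\<rho>\<in>{s. Re s \<ge> \<sigma> \<and> \<bar>Im s\<bar> \<le> T \<and> L_twist F chi s = 0}. zorder (L_twist F chi) \<rho>)"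

end

theory Submission
  imports Defs "HOL-Number_Theory.Number_Theory" "HOL-Real_Asymp.Real_Asymp"
begin

text \<open>
  Call a character bad if its twist vanishes somewhere in \<open>Re s > 1 - \<beta>\<close>, \<open>\<bar>Im s\<bar> < Q\<close>, where
  \<open>\<beta> = ln Q powr (\<delta> - 1) / C'\<close>. By (A5') there are at most \<open>exp (ln Q powr \<delta>)\<close> bad characters, up to a power of
  \<open>ln Q\<close>, and (A6) saves the square of this exponential for each of them. For the other characters an approximate
  functional equation replaces the central value by Dirichlet polynomials of length about \<open>Q powr (d / 2)\<close>, where the
  large sieve loses only constants; as the diagonal term dominates for \<open>d \<ge> 5\<close>, a weak form of the sieve suffices.
  The saving comes from Ramare's identity over the primes between \<open>exp (ln Q powr (1 - \<eta>))\<close> and a small power of \<open>Q\<close>: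
  integers without such a prime factor are sparse by (A3), and the remaining part factors into a sum over primes times a
  Dirichlet polynomial. The sum over primes is small at every point because \<open>log L\<close> continues to the zero-free
  rectangle, where the Borel--Caratheodory inequality bounds it.
\<close>

section \<open>The divisor functions\<close>

text \<open>The width \<beta> is fixed by
  \<open>Q powr (C' * \<beta>) = exp (ln Q powr \<delta>)\<close>: the count of bad characters is
  then one such exponential, against a saving of two. At primes of size P the zero-free strip saves
  about \<open>P powr (- \<beta> / 2)\<close>. With P at least
  \<open>exp (ln Q powr (1 - \<eta>))\<close> this is exponentially small in
  \<open>ln Q powr (\<delta> - \<eta>)\<close>, hence smaller than every power of
  \<open>ln Q\<close>; here \<eta> < \<delta> is used. So every estimate that contains a sum over
  primes may waste powers of \<open>ln Q\<close>: divisor bounds, the number of pairs of dyadic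
  blocks, the size of the continued prime series. The integers without a prime factor in the range
  allow no such waste, since (A3) saves just \<open>ln Q powr \<eta>\<close> there. On the analytic
  side an arbitrary entire approximant H is compared with L at Re s = 5/2 and H alone is moved to Re
  s = 1/2 + 1/50, so H may contain products of two polynomials and no dual L-function has to be
  estimated. The numbers 9/4, 1/100 and 1/50 are chosen to leave room below d / 2 >= 5/2.\<close>

definition factorizations :: "nat \<Rightarrow> nat \<Rightarrow> nat list set" where
  "factorizations d n = {xs. length xs = d \<and> prod_list xs = n}"

lemma divisor_fun_eq_card: "divisor_fun d n = card (factorizations d n)"
  by (simp add: divisor_fun_def factorizations_def)

lemma factorizations_0: "factorizations 0 n = (if n = 1 then {[]} else {})"
  by (auto simp: factorizations_def)

lemma divisor_fun_0: "divisor_fun 0 n = (if n = 1 then 1 else 0)"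
  by (simp add: divisor_fun_eq_card factorizations_0)

lemma factorizations_Suc:
  assumes "n > 0"
  shows "factorizations (Suc d) n = (\<Union>a\<in>{a. a dvd n}. (#) a ` factorizations d (n div a))"
proof (intro equalityI subsetI)
  fix xs assume "xs \<in> factorizations (Suc d) n"
  then obtain a ys where "xs = a # ys" "length ys = d" "a * prod_list ys = n"
    by (auto simp: factorizations_def length_Suc_conv)
  moreover from this assms have "a > 0" by (cases a) auto
  ultimately have "ys \<in> factorizations d (n div a)" "a dvd n"
    by (auto simp: factorizations_def)
  then show "xs \<in> (\<Union>a\<in>{a. a dvd n}. (#) a ` factorizations d (n div a))"
    using \<open>xs = a # ys\<close> by blast
qed (auto simp: factorizations_def)

lemma finite_factorizations:
  assumes "n > 0"
  shows "finite (factorizations d n)"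
  using assms
proof (induction d arbitrary: n)
  case (Suc d)
  have "n div a > 0" if "a dvd n" for a
    using that Suc.prems by (auto elim: dvdE)
  with Suc show ?case
    by (auto simp: factorizations_Suc)
qed (simp add: factorizations_0)

lemma divisor_fun_Suc:
  assumes "n > 0"
  shows "divisor_fun (Suc d) n = (\<Sum>a | a dvd n. divisor_fun d (n div a))"
proof -
  have pos: "n div a > 0" if "a dvd n" for a
    using that assms by (auto elim: dvdE)
  have "divisor_fun (Suc d) n = (\<Sum>a | a dvd n. card ((#) a ` factorizations d (n div a)))"
    unfolding divisor_fun_eq_card factorizations_Suc[OF assms]
    using assms pos by (intro card_UN_disjoint) (auto intro!: finite_imageI finite_factorizations)
  also have "\<dots> = (\<Sum>a | a dvd n. divisor_fun d (n div a))"
    by (intro sum.cong) (auto simp: divisor_fun_eq_card card_image)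
  finally show ?thesis .
qed

lemma divisor_fun_1 [simp]: "divisor_fun d (Suc 0) = 1"
  by (induction d) (simp_all add: divisor_fun_0 divisor_fun_Suc)

text \<open>Multiplying the first factor by \<open>n div m\<close> embeds the factorizations of m
  into those of n. For d = 0 there is no first factor, and only 1 has a factorization, hence the
  assumption d > 0.\<close>

lemma divisor_fun_mono:
  assumes "m dvd n" "n > 0" "d > 0"
  shows "divisor_fun d m \<le> divisor_fun d n"
proof -
  obtain e where Suc: "d = Suc e" using assms(3) by (cases d) auto
  obtain k where k: "n = m * k" using assms by (auto elim: dvdE)
  then have "k > 0" using assms by (cases k) auto
  define f where "f = (\<lambda>xs. (k * hd xs) # tl xs)"
  have "inj_on f (factorizations d m)"
  proof (intro inj_onI)
    fix xs ys assume "xs \<in> factorizations d m" "ys \<in> factorizations d m" "f xs = f ys"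
    then show "xs = ys"
      using \<open>k > 0\<close> Suc by (cases xs; cases ys) (auto simp: f_def factorizations_def)
  qed
  moreover have "f ` factorizations d m \<subseteq> factorizations d n"
  proof safe
    fix xs assume "xs \<in> factorizations d m"
    then show "f xs \<in> factorizations d n"
      using Suc k by (cases xs) (auto simp: f_def factorizations_def)
  qed
  ultimately show ?thesis
    unfolding divisor_fun_eq_card
    using card_inj_on_le finite_factorizations[OF assms(2)] by blast
qed

text \<open>Induction on d: a divisor a of m * n splits as \<open>gcd a m\<close> times a divisor of
  n. The splitting is injective and compatible with taking cofactors, so each summand is covered by
  the induction hypothesis.\<close>

lemma divisor_fun_mult_le:
  assumes "m > 0" "n > 0"
  shows "divisor_fun d (m * n) \<le> divisor_fun d m * divisor_fun d n"
  using assms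
proof (induction d arbitrary: m n)
  case (Suc d)
  define g where "g = (\<lambda>a. (gcd a m, a div gcd a m))"
  have g_mem: "g a \<in> {a. a dvd m} \<times> {b. b dvd n}" if "a dvd m * n" for a
  proof -
    have "a div gcd a m dvd n"
    proof (rule coprime_dvd_mult_right_iff[THEN iffD1])
      show "coprime (a div gcd a m) (m div gcd a m)"
        using Suc.prems by (intro div_gcd_coprime) auto
      have "a div gcd a m dvd (m * n) div gcd a m"
        using that by (simp add: div_dvd_div)
      then show "a div gcd a m dvd (m div gcd a m) * n"
        by (metis dvd_div_mult gcd_dvd2)
    qed
    then show ?thesis by (simp add: g_def)
  qed
  have inj: "inj_on g {a. a dvd m * n}"
    by (auto simp: inj_on_def g_def) (metis dvd_div_mult_self gcd_dvd1)
  have quot: "(m * n) div a = (m div fst (g a)) * (n div snd (g a))" if "a dvd m * n" for a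
  proof -
    have "fst (g a) dvd m" "snd (g a) dvd n" "a = fst (g a) * snd (g a)"
      using g_mem[OF that] by (auto simp: g_def)
    then show ?thesis
      by (metis div_mult_div_if_dvd)
  qed
  have "divisor_fun (Suc d) (m * n) = (\<Sum>a | a dvd m * n. divisor_fun d (m * n div a))"
    using Suc.prems by (simp add: divisor_fun_Suc)
  also have "\<dots> = (\<Sum>p\<in>g ` {a. a dvd m * n}. divisor_fun d ((m div fst p) * (n div snd p)))"
    by (subst sum.reindex[OF inj]) (simp add: quot)
  also have "\<dots> \<le> (\<Sum>p\<in>{a. a dvd m} \<times> {b. b dvd n}. divisor_fun d ((m div fst p) * (n div snd p)))"
  proof (intro sum_mono2)
    show "finite ({a. a dvd m} \<times> {b. b dvd n})" using Suc.prems by (simp add: finite_divisors_nat)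
    show "g ` {a. a dvd m * n} \<subseteq> {a. a dvd m} \<times> {b. b dvd n}" using g_mem by blast
  qed simp
  also have "\<dots> \<le> (\<Sum>p\<in>{a. a dvd m} \<times> {b. b dvd n}.
                     divisor_fun d (m div fst p) * divisor_fun d (n div snd p))"
  proof (intro sum_mono Suc.IH)
    fix p assume "p \<in> {a. a dvd m} \<times> {b. b dvd n}"
    then have "fst p dvd m" "snd p dvd n" by auto
    then show "m div fst p > 0" "n div snd p > 0"
      using Suc.prems by (metis dvd_div_eq_0_iff gr0I)+
  qed
  also have "\<dots> = divisor_fun (Suc d) m * divisor_fun (Suc d) n"
    using Suc.prems by (simp add: divisor_fun_Suc sum_product sum.cartesian_product case_prod_unfold)
  finally show ?case .
qed (auto simp: divisor_fun_0)

text \<open>The growth is polynomial in r; this is what later forces the local roots into the closed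
  unit disc.\<close>

lemma divisor_fun_prime_power_le:
  assumes "prime p"
  shows "divisor_fun d (p ^ r) \<le> (r + 1) ^ d"
proof (induction d arbitrary: r)
  case (Suc d)
  have pos: "p ^ r > 0" using assms by (simp add: prime_gt_0_nat)
  have dv: "{a. a dvd p ^ r} = (\<lambda>i. p ^ i) ` {..r}"
    using assms by (auto simp: divides_primepow_nat intro: le_imp_power_dvd)
  have inj: "inj_on (\<lambda>i. p ^ i) {..r}"
    using prime_gt_1_nat[OF assms] by (auto simp: inj_on_def)
  have "divisor_fun (Suc d) (p ^ r) = (\<Sum>i\<le>r. divisor_fun d (p ^ r div p ^ i))"
    using pos inj by (simp add: divisor_fun_Suc dv sum.reindex)
  also have "\<dots> \<le> (\<Sum>i\<le>r. (r + 1) ^ d)"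
  proof (intro sum_mono)
    fix i assume "i \<in> {..r}"
    then have "p ^ r div p ^ i = p ^ (r - i)"
      using assms by (simp add: power_diff prime_gt_0_nat)
    then have "divisor_fun d (p ^ r div p ^ i) \<le> (r - i + 1) ^ d" using Suc by simp
    also have "\<dots> \<le> (r + 1) ^ d" by (intro power_mono) auto
    finally show "divisor_fun d (p ^ r div p ^ i) \<le> (r + 1) ^ d" .
  qed
  finally show ?case by simp
qed (simp add: divisor_fun_0)

lemma divisor_fun_prime_le:
  assumes "prime p"
  shows "divisor_fun d p \<le> d"
proof -
  have "divisor_fun d p = d"
  proof (induction d)
    case (Suc d)
    have dv: "{a. a dvd p} = {1, p}" using assms by (auto simp: prime_nat_iff)
    have "p > 1" using assms prime_gt_1_nat by blast
    then show ?case
      using Suc by (subst divisor_fun_Suc) (auto simp: dv)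
  qed (use assms prime_gt_1_nat[of p] in \<open>auto simp: divisor_fun_0\<close>)
  then show ?thesis by simp
qed

text \<open>Writing n as a product of d factors, all at most x, bounds the left side by d
  independent sums. Admitting a submultiplicative weight g allows a second application with g =
  tau_d itself, which handles the sum of tau_d^2.\<close>

lemma sum_divisor_fun_mult_le:
  fixes g :: "nat \<Rightarrow> real"
  assumes nonneg: "\<And>n. g n \<ge> 0" and one: "g 1 \<le> 1"
    and submult: "\<And>m n. m > 0 \<Longrightarrow> n > 0 \<Longrightarrow> g (m * n) \<le> g m * g n"
  shows "(\<Sum>n\<in>{1..x}. real (divisor_fun d n) * g n / real n) \<le> (\<Sum>n\<in>{1..x}. g n / real n) ^ d"
proof (induction d)
  case 0
  have "(\<Sum>n\<in>{1..x}. real (divisor_fun 0 n) * g n / real n) \<le> (\<Sum>n\<in>{1..x}. if n = 1 then 1 else 0)"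
    using one by (intro sum_mono) (auto simp: divisor_fun_0)
  then show ?case by (simp split: if_splits)
next
  case (Suc d)
  let ?D = "\<lambda>n. real (divisor_fun d n) * g n / real n"
  have "(\<Sum>n\<in>{1..x}. real (divisor_fun (Suc d) n) * g n / real n) =
        (\<Sum>n\<in>{1..x}. \<Sum>a | a dvd n. real (divisor_fun d (n div a)) * g n / real n)"
    by (intro sum.cong refl) (auto simp: divisor_fun_Suc sum_distrib_right sum_divide_distrib)
  also have "\<dots> \<le> (\<Sum>n\<in>{1..x}. \<Sum>a | a dvd n. (g a / real a) * ?D (n div a))"
  proof (intro sum_mono)
    fix n a assume *: "n \<in> {1..x}" "a \<in> {a. a dvd n}"
    then obtain b where b: "n = a * b" by (auto elim: dvdE)
    with * have pos: "a > 0" "b > 0" by (auto intro: Nat.gr0I)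
    have "real (divisor_fun d b) * g (a * b) \<le> real (divisor_fun d b) * (g a * g b)"
      using pos by (intro mult_left_mono submult) auto
    then show "real (divisor_fun d (n div a)) * g n / real n \<le> (g a / real a) * ?D (n div a)"
      using pos by (simp add: b divide_right_mono field_simps)
  qed
  also have "\<dots> = (\<Sum>(n, a)\<in>(SIGMA n:{1..x}. {a. a dvd n}). (g a / real a) * ?D (n div a))"
    by (subst sum.Sigma) (auto simp: finite_divisors_nat)
  also have "\<dots> = (\<Sum>(a, b)\<in>(\<lambda>(n, a). (a, n div a)) ` (SIGMA n:{1..x}. {a. a dvd n}). (g a / real a) * ?D b)"
    by (subst sum.reindex) (auto simp: inj_on_def case_prod_unfold elim!: dvdE)
  also have "\<dots> \<le> (\<Sum>(a, b)\<in>{1..x} \<times> {1..x}. (g a / real a) * ?D b)"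
  proof (intro sum_mono2)
    show "(\<lambda>(n, a). (a, n div a)) ` (SIGMA n:{1..x}. {a. a dvd n}) \<subseteq> {1..x} \<times> {1..x}"
    proof safe
      fix n a :: nat assume *: "n \<in> {1..x}" "a dvd n"
      then obtain b where b: "n = a * b" by (auto elim: dvdE)
      with * have pos: "a > 0" "b > 0" by (auto intro: Nat.gr0I)
      have le: "a \<le> n" "b \<le> n" using pos b by auto
      have "n \<le> x" "n div a = b" using * pos b by auto
      with le pos show "a \<in> {1..x}" "n div a \<in> {1..x}"
        by auto
    qed
  qed (auto simp: nonneg)
  also have "\<dots> = (\<Sum>a\<in>{1..x}. g a / real a) * (\<Sum>b\<in>{1..x}. ?D b)"
    by (simp add: sum_product sum.cartesian_product)
  also have "\<dots> \<le> (\<Sum>a\<in>{1..x}. g a / real a) * (\<Sum>n\<in>{1..x}. g n / real n) ^ d"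
    using Suc by (intro mult_left_mono sum_nonneg) (auto simp: nonneg)
  finally show ?case by simp
qed

lemma sum_inverse_le: "x \<ge> 1 \<Longrightarrow> (\<Sum>n\<in>{1..x}. 1 / real n) \<le> 1 + ln (real x)"
proof (induction x rule: nat_induct_at_least)
  case (Suc x)
  have "1 / real (Suc x) \<le> ln (real (Suc x)) - ln (real x)"
  proof -
    have "ln (real x / real (Suc x)) \<le> real x / real (Suc x) - 1"
      using Suc by (intro ln_le_minus_one) auto
    also have "ln (real x / real (Suc x)) = ln (real x) - ln (real (Suc x))"
      using Suc by (subst ln_div) auto
    also have "real x / real (Suc x) - 1 = - 1 / real (Suc x)" by (simp add: field_simps)
    finally show ?thesis by simp
  qed
  with Suc show ?case by simp
qed simp

text \<open>One application of \<open>sum_divisor_fun_mult_le\<close> with weight 1 and a second one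
  with weight tau_d produce the exponent d * d.\<close>

lemma sum_divisor_fun_square_over_le:
  assumes "x \<ge> 1"
  shows "(\<Sum>n\<in>{1..x}. (real (divisor_fun d n))\<^sup>2 / real n) \<le> (1 + ln (real x)) ^ (d * d)"
proof -
  have "(\<Sum>n\<in>{1..x}. real (divisor_fun d n) * 1 / real n) \<le> (\<Sum>n\<in>{1..x}. 1 / real n) ^ d"
    by (rule sum_divisor_fun_mult_le) auto
  also have "\<dots> \<le> (1 + ln (real x)) ^ d"
    using assms by (intro power_mono sum_inverse_le sum_nonneg) auto
  finally have 1: "(\<Sum>n\<in>{1..x}. real (divisor_fun d n) / real n) \<le> (1 + ln (real x)) ^ d" by simp
  have "(\<Sum>n\<in>{1..x}. real (divisor_fun d n) * real (divisor_fun d n) / real n)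
          \<le> (\<Sum>n\<in>{1..x}. real (divisor_fun d n) / real n) ^ d"
    by (rule sum_divisor_fun_mult_le) (auto simp: of_nat_mult[symmetric] simp del: of_nat_mult intro: divisor_fun_mult_le)
  also have "\<dots> \<le> ((1 + ln (real x)) ^ d) ^ d"
    by (intro power_mono 1 sum_nonneg) auto
  finally show ?thesis by (simp add: power_mult power2_eq_square)
qed

lemma sum_divisor_fun_square_le:
  assumes "x \<ge> 1"
  shows "(\<Sum>n\<in>{1..x}. (real (divisor_fun d n))\<^sup>2) \<le> real x * (1 + ln (real x)) ^ (d * d)"
proof -
  have "(\<Sum>n\<in>{1..x}. (real (divisor_fun d n))\<^sup>2) \<le> (\<Sum>n\<in>{1..x}. real x * ((real (divisor_fun d n))\<^sup>2 / real n))"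
  proof (intro sum_mono)
    fix n assume "n \<in> {1..x}"
    then have "real n * (real (divisor_fun d n))\<^sup>2 \<le> real x * (real (divisor_fun d n))\<^sup>2"
      by (intro mult_right_mono) auto
    with \<open>n \<in> {1..x}\<close> show "(real (divisor_fun d n))\<^sup>2 \<le> real x * ((real (divisor_fun d n))\<^sup>2 / real n)"
      by (simp add: field_simps)
  qed
  also have "\<dots> = real x * (\<Sum>n\<in>{1..x}. (real (divisor_fun d n))\<^sup>2 / real n)"
    by (simp add: sum_distrib_left)
  also have "\<dots> \<le> real x * (1 + ln (real x)) ^ (d * d)"
    by (intro mult_left_mono sum_divisor_fun_square_over_le assms) auto
  finally show ?thesis .
qed

section \<open>Dirichlet characters\<close>

lemma of_real_norm_square: "(complex_of_real (norm z))\<^sup>2 = z * cnj z"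
  using complex_norm_square[of z] by simp

lemma periodic_int_mult:
  fixes f :: "int \<Rightarrow> 'a"
  assumes "\<And>n. f (n + p) = f n"
  shows "f (n + p * k) = f n"
proof (induction k rule: int_induct[where k = 0])
  case (step1 i)
  have "f (n + p * (i + 1)) = f ((n + p * i) + p)" by (simp add: algebra_simps)
  with step1 assms show ?case by simp
next
  case (step2 i)
  have "f (n + p * i) = f ((n + p * (i - 1)) + p)" by (simp add: algebra_simps)
  with step2 assms show ?case by simp
qed simp

lemma periodic_int_cong:
  fixes f :: "int \<Rightarrow> 'a"
  assumes "\<And>n. f (n + p) = f n" "[a = b] (mod p)"
  shows "f a = f b"
proof -
  obtain k where "b = a + p * k" using assms(2) by (auto simp: cong_iff_lin)
  then show ?thesis
    using periodic_int_mult[of f p a k] assms(1) by simp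
qed

context
  fixes q :: nat and chi :: "int \<Rightarrow> complex"
  assumes chi: "dirichlet_character q chi"
begin

lemma dirichlet_character_pos: "q > 0"
  and dirichlet_character_mult: "chi (m * n) = chi m * chi n"
  and dirichlet_character_periodic: "chi (n + int q) = chi n"
  and dirichlet_character_nonzero_iff: "chi n \<noteq> 0 \<longleftrightarrow> coprime n (int q)"
  using chi by (auto simp: dirichlet_character_def)

lemma dirichlet_character_1: "chi 1 = 1"
proof -
  have "chi 1 * chi 1 = chi 1" using dirichlet_character_mult[of 1 1] by simp
  moreover have "chi 1 \<noteq> 0" by (simp add: dirichlet_character_nonzero_iff)
  ultimately show ?thesis by simp
qed

lemma dirichlet_character_power: "chi (n ^ k) = chi n ^ k"
  by (induction k) (simp_all add: dirichlet_character_1 dirichlet_character_mult)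

lemma dirichlet_character_cong: "[a = b] (mod int q) \<Longrightarrow> chi a = chi b"
  by (rule periodic_int_cong[of chi "int q"]) (simp_all add: dirichlet_character_periodic)

lemma dirichlet_character_norm:
  assumes "coprime n (int q)"
  shows "norm (chi n) = 1"
proof -
  \<comment> \<open>Euler's theorem is about natural numbers, so n is replaced by its least
    nonnegative residue.\<close>
  define m where "m = nat (n mod int q)"
  have cong: "[int m = n] (mod int q)"
    using dirichlet_character_pos by (simp add: m_def cong_def)
  then have "coprime (int m) (int q)"
    using assms cong_imp_coprime cong_sym by blast
  then have "coprime m q" by simp
  then have "[m ^ totient q = 1] (mod q)" by (rule euler_theorem)
  then have "[int m ^ totient q = 1] (mod int q)"
    by (metis cong_int_iff of_nat_1 of_nat_power)
  then have "chi (int m) ^ totient q = 1"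
    using dirichlet_character_cong dirichlet_character_1 dirichlet_character_power by metis
  then have "chi n ^ totient q = 1"
    using dirichlet_character_cong[OF cong] by simp
  then have "norm (chi n) ^ totient q = 1"
    by (metis norm_one norm_power)
  then show ?thesis
    using dirichlet_character_pos
    by (metis norm_ge_zero power_eq_imp_eq_base power_one totient_gt_0_iff zero_le_one)
qed

lemma dirichlet_character_norm_le: "norm (chi n) \<le> 1"
  using dirichlet_character_norm[of n] dirichlet_character_nonzero_iff[of n]
  by (cases "coprime n (int q)") auto

lemma dirichlet_character_mult_cnj:
  "coprime n (int q) \<Longrightarrow> chi n * cnj (chi n) = 1"
  by (simp add: of_real_norm_square[symmetric] dirichlet_character_norm)

lemma dirichlet_character_minus_1: "chi (- 1) = 1 \<or> chi (- 1) = - 1"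
proof -
  have "chi (- 1) * chi (- 1) = 1"
    using dirichlet_character_mult[of "- 1" "- 1"] dirichlet_character_1 by simp
  then show ?thesis using square_eq_1_iff by blast
qed

end

lemma primitive_character_minus_1:
  assumes "chi \<in> primitive_characters q"
  shows "chi (- 1) \<in> {1, - 1}"
  using assms dirichlet_character_minus_1 by (auto simp: primitive_characters_def)

text \<open>Multiplication by b permutes the residues mod k, so \<psi> b * S = S for the sum S over
  a full period, while \<psi> b differs from 1. The start n of the period is arbitrary, as the box
  sums of the large sieve require.\<close>

lemma sum_multiplicative_eq_0:
  fixes \<psi> :: "int \<Rightarrow> complex"
  assumes "k > 0" and periodic: "\<And>n. \<psi> (n + int k) = \<psi> n"
    and mult: "\<And>n. \<psi> (b * n) = \<psi> b * \<psi> n" and "coprime b (int k)" "\<psi> b \<noteq> 1"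
  shows "(\<Sum>h<k. \<psi> (n + int h)) = 0"
proof -
  define S where "S = (\<Sum>m\<in>{0..<int k}. \<psi> m)"
  \<comment> \<open>A sum over any complete system of residues equals S; this is applied to b * m
    and to the shift m + n.\<close>
  have reduce: "(\<Sum>m\<in>A. \<psi> (g m)) = S" if "bij_betw (\<lambda>m. g m mod int k) A {0..<int k}" for A and g :: "int \<Rightarrow> int"
  proof -
    have "S = (\<Sum>m\<in>A. \<psi> (g m mod int k))"
      unfolding S_def by (rule sum.reindex_bij_betw[OF that, symmetric])
    also have "\<dots> = (\<Sum>m\<in>A. \<psi> (g m))"
    proof (intro sum.cong refl)
      fix m
      have "[g m mod int k = g m] (mod int k)" by (simp add: cong_def)
      then show "\<psi> (g m mod int k) = \<psi> (g m)"
        using periodic_int_cong[of \<psi> "int k"] periodic by blast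
    qed
    finally show ?thesis by simp
  qed
  have bij: "bij_betw (\<lambda>m. (c * m + e) mod int k) {0..<int k} {0..<int k}" if "coprime c (int k)" for c e
  proof -
    have "inj_on (\<lambda>m. (c * m + e) mod int k) {0..<int k}"
    proof (rule inj_onI)
      fix x y assume xy: "x \<in> {0..<int k}" "y \<in> {0..<int k}"
        "(c * x + e) mod int k = (c * y + e) mod int k"
      then have "[c * x + e = c * y + e] (mod int k)" by (simp add: cong_def)
      then have "[c * x = c * y] (mod int k)" by (simp add: cong_add_rcancel)
      then have "[x = y] (mod int k)" using that by (simp add: cong_mult_lcancel)
      then show "x = y" using xy by (simp add: cong_def)
    qed
    moreover have "(\<lambda>m. (c * m + e) mod int k) ` {0..<int k} \<subseteq> {0..<int k}"
      using assms(1) by auto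
    ultimately show ?thesis
      by (metis bij_betw_def endo_inj_surj finite_atLeastLessThan_int)
  qed
  have "\<psi> b * S = S"
  proof -
    have "\<psi> b * S = (\<Sum>m\<in>{0..<int k}. \<psi> (b * m + 0))"
      by (simp add: S_def sum_distrib_left mult)
    also have "\<dots> = S" using bij[OF assms(4), of 0] by (intro reduce) simp
    finally show ?thesis .
  qed
  then have "S = 0" using assms(5) by simp
  moreover have "(\<Sum>h<k. \<psi> (n + int h)) = (\<Sum>m\<in>{0..<int k}. \<psi> (1 * m + n))"
  proof -
    have "bij_betw int {..<k} {0..<int k}"
      by (rule bij_betwI[where g = nat]) auto
    then have "(\<Sum>m\<in>{0..<int k}. \<psi> (1 * m + n)) = (\<Sum>h<k. \<psi> (1 * int h + n))"
      by (rule sum.reindex_bij_betw[symmetric])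
    then show ?thesis by (simp add: add.commute)
  qed
  moreover have "\<dots> = S" using bij[of 1 n] by (intro reduce) simp
  ultimately show ?thesis by simp
qed

text \<open>The product q1 * q2 is a common period. Since |chi2 b| = 1, the values chi1 b and chi2 b
  differ exactly if chi1 b * cnj (chi2 b) is not 1.\<close>

lemma sum_character_mult_cnj:
  assumes "dirichlet_character q1 chi1" "dirichlet_character q2 chi2"
    and b: "coprime b (int (q1 * q2))" "chi1 b \<noteq> chi2 b"
  shows "(\<Sum>h<q1 * q2. chi1 (n + int h) * cnj (chi2 (n + int h))) = 0"
proof (rule sum_multiplicative_eq_0[where \<psi> = "\<lambda>n. chi1 n * cnj (chi2 n)" and b = b])
  show "q1 * q2 > 0"
    using assms dirichlet_character_pos by simp
  show "chi1 (n + int (q1 * q2)) * cnj (chi2 (n + int (q1 * q2))) = chi1 n * cnj (chi2 n)" for n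
    using periodic_int_mult[of chi1 "int q1" n "int q2", OF dirichlet_character_periodic[OF assms(1)]]
      periodic_int_mult[of chi2 "int q2" n "int q1", OF dirichlet_character_periodic[OF assms(2)]]
    by (simp add: mult.commute)
  show "chi1 (b * n) * cnj (chi2 (b * n)) = chi1 b * cnj (chi2 b) * (chi1 n * cnj (chi2 n))" for n
    by (simp add: dirichlet_character_mult[OF assms(1)] dirichlet_character_mult[OF assms(2)] algebra_simps)
  show "coprime b (int (q1 * q2))" by (fact b)
  have "chi2 b * cnj (chi2 b) = 1"
    using b(1) by (intro dirichlet_character_mult_cnj[OF assms(2)]) simp
  with b(2) show "chi1 b * cnj (chi2 b) \<noteq> 1"
    by (metis mult_cancel_right mult_zero_right zero_neq_one)
qed

text \<open>For q1 < q2, agreement at all b coprime to q1 * q2 would make chi2 equal to 1 at every n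
  coprime to q2 with n = 1 modulo gcd q1 q2, so chi2 would come from a smaller modulus. For equal
  moduli a point where the characters differ is automatically coprime to the modulus.\<close>

lemma primitive_characters_separated:
  assumes "chi1 \<in> primitive_characters q1" "chi2 \<in> primitive_characters q2"
    and "(q1, chi1) \<noteq> (q2, chi2)"
  shows "\<exists>b. coprime b (int (q1 * q2)) \<and> chi1 b \<noteq> chi2 b"
proof -
  have *: "\<exists>b. coprime b (int (q1 * q2)) \<and> chi1 b \<noteq> chi2 b"
    if "chi1 \<in> primitive_characters q1" "chi2 \<in> primitive_characters q2" "q1 < q2" for chi1 chi2 q1 q2
  proof (rule ccontr)
    assume "\<not> ?thesis"
    then have eq: "chi1 b = chi2 b" if "coprime b (int (q1 * q2))" for b
      using that by blast
    from that have c1: "dirichlet_character q1 chi1" and c2: "dirichlet_character q2 chi2"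
      by (auto simp: primitive_characters_def)
    define g where "g = gcd q1 q2"
    have pos: "q1 > 0" "q2 > 0" using c1 c2 dirichlet_character_pos by auto
    have "g \<le> q1" using pos by (simp add: g_def gcd_le1_nat)
    then have "g < q2" using \<open>q1 < q2\<close> by simp
    have "chi2 n = 1" if n: "coprime n (int q2)" "[n = 1] (mod int g)" for n
    proof -
      have "int g dvd 1 - n" using n(2) by (simp add: cong_iff_dvd_diff dvd_diff_commute)
      moreover have "int g = gcd (int q2) (int q1)" by (simp add: g_def gcd.commute gcd_int_int_eq)
      ultimately obtain u where u: "1 - n = gcd (int q2) (int q1) * u" by (auto elim: dvdE)
      \<comment> \<open>This prepares a solution of m = n (mod q2), m = 1 (mod q1), which exists
        because the gcd of the moduli divides 1 - n. The value chi2 n can then be read off from chi1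
        1.\<close>
      obtain v where "[int q2 * v = gcd (int q2) (int q1)] (mod int q1)"
        using cong_solve_int by blast
      then have "[(int q2 * v) * u = 1 - n] (mod int q1)"
        unfolding u by (rule cong_scalar_right)
      then obtain t where t: "[int q2 * t = 1 - n] (mod int q1)"
        by (metis mult.assoc)
      define m where "m = n + int q2 * t"
      have m2: "[m = n] (mod int q2)" by (simp add: m_def cong_iff_dvd_diff)
      have m1: "[m = 1] (mod int q1)"
        using cong_add[OF cong_refl[of n] t] by (simp add: m_def)
      have cop: "coprime m (int (q1 * q2))"
        using cong_imp_coprime[OF cong_sym[OF m2]] n(1) cong_imp_coprime[OF cong_sym[OF m1]] by simp
      have "chi2 n = chi2 m" by (rule dirichlet_character_cong[OF c2 cong_sym[OF m2]])
      also have "\<dots> = chi1 m" using eq[OF cop] by simp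
      also have "\<dots> = chi1 1" by (rule dirichlet_character_cong[OF c1 m1])
      finally show ?thesis using dirichlet_character_1[OF c1] by simp
    qed
    then have "induced_modulus q2 chi2 g"
      by (auto simp: induced_modulus_def g_def)
    with \<open>g < q2\<close> that show False by (auto simp: primitive_characters_def)
  qed
  consider "q1 < q2" | "q2 < q1" | "q1 = q2" by linarith
  then show ?thesis
  proof cases
    case 3
    then have c: "dirichlet_character q1 chi1" "dirichlet_character q1 chi2" "chi1 \<noteq> chi2"
      using assms by (auto simp: primitive_characters_def)
    then obtain b where "chi1 b \<noteq> chi2 b" by (meson ext)
    moreover from this have "coprime b (int q1)"
      using dirichlet_character_nonzero_iff[OF c(1), of b] dirichlet_character_nonzero_iff[OF c(2), of b] by auto
    ultimately show ?thesis using 3 by auto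
  next
    case 2
    then show ?thesis using *[OF assms(2,1)] by (metis mult.commute)
  qed (use * assms in blast)
qed

text \<open>For a set \<open>S\<close> of \<open>m\<close> characters and \<open>g = \<Sum>\<chi>\<in>S. \<chi>\<close>, orthogonality gives
  \<open>m\<^sup>2 = \<bar>g(1)\<bar>\<^sup>2 \<le> \<Sum>a. \<bar>g(a)\<bar>\<^sup>2 \<le> m * q\<close>.\<close>

lemma card_characters_le:
  assumes "finite S" "S \<subseteq> {chi. dirichlet_character q chi}" "q > 0"
  shows "card S \<le> q"
proof (cases "S = {}")
  case False
  define g where "g = (\<lambda>n. \<Sum>chi\<in>S. chi n)"
  have "complex_of_real (\<Sum>h<q. (norm (g (1 + int h)))\<^sup>2) = (\<Sum>h<q. g (1 + int h) * cnj (g (1 + int h)))"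
    by (simp add: of_real_norm_square)
  also have "\<dots> = (\<Sum>h<q. \<Sum>chi1\<in>S. \<Sum>chi2\<in>S. chi1 (1 + int h) * cnj (chi2 (1 + int h)))"
    by (simp add: g_def sum_product)
  also have "\<dots> = (\<Sum>chi1\<in>S. \<Sum>chi2\<in>S. \<Sum>h<q. chi1 (1 + int h) * cnj (chi2 (1 + int h)))"
    by (subst sum.swap, intro sum.cong refl, rule sum.swap)
  also have "\<dots> = (\<Sum>chi1\<in>S. \<Sum>chi2\<in>S. if chi1 = chi2 then (\<Sum>h<q. chi1 (1 + int h) * cnj (chi1 (1 + int h))) else 0)"
  proof (intro sum.cong refl)
    fix chi1 chi2 assume *: "chi1 \<in> S" "chi2 \<in> S"
    show "(\<Sum>h<q. chi1 (1 + int h) * cnj (chi2 (1 + int h))) =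
      (if chi1 = chi2 then (\<Sum>h<q. chi1 (1 + int h) * cnj (chi1 (1 + int h))) else 0)"
    proof (cases "chi1 = chi2")
      case False
      from * assms have c: "dirichlet_character q chi1" "dirichlet_character q chi2" by auto
      obtain b where b: "chi1 b \<noteq> chi2 b" using False by (meson ext)
      then have "coprime b (int q)"
        using dirichlet_character_nonzero_iff[OF c(1), of b] dirichlet_character_nonzero_iff[OF c(2), of b] by auto
      moreover from this have "chi2 b * cnj (chi2 b) = 1"
        by (rule dirichlet_character_mult_cnj[OF c(2)])
      with b have "chi1 b * cnj (chi2 b) \<noteq> 1"
        by (metis mult_cancel_right mult_zero_right zero_neq_one)
      ultimately have "(\<Sum>h<q. chi1 (1 + int h) * cnj (chi2 (1 + int h))) = 0"
        using sum_multiplicative_eq_0[where \<psi> = "\<lambda>n. chi1 n * cnj (chi2 n)" and b = b and k = q and n = 1] assms(3)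
        by (simp add: dirichlet_character_periodic[OF c(1)] dirichlet_character_periodic[OF c(2)]
            dirichlet_character_mult[OF c(1)] dirichlet_character_mult[OF c(2)] algebra_simps)
      with False show ?thesis by simp
    qed simp
  qed
  also have "\<dots> = (\<Sum>chi1\<in>S. \<Sum>h<q. chi1 (1 + int h) * cnj (chi1 (1 + int h)))"
    using assms(1) by (simp add: sum.delta)
  also have "\<dots> = complex_of_real (\<Sum>chi1\<in>S. \<Sum>h<q. (norm (chi1 (1 + int h)))\<^sup>2)"
    by (simp add: of_real_norm_square)
  finally have "(\<Sum>h<q. (norm (g (1 + int h)))\<^sup>2) = (\<Sum>chi1\<in>S. \<Sum>h<q. (norm (chi1 (1 + int h)))\<^sup>2)"
    by (simp only: of_real_eq_iff)
  also have "\<dots> \<le> (\<Sum>chi1\<in>S. \<Sum>h<q. 1)"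
    using assms(2) by (intro sum_mono) (auto intro!: power_le_one dirichlet_character_norm_le)
  finally have "(\<Sum>h<q. (norm (g (1 + int h)))\<^sup>2) \<le> real (card S) * real q" by simp
  moreover have "(norm (g (1 + int 0)))\<^sup>2 \<le> (\<Sum>h<q. (norm (g (1 + int h)))\<^sup>2)"
    using assms(3) by (intro member_le_sum) auto
  moreover have "g 1 = of_nat (card S)"
  proof -
    have "g 1 = (\<Sum>chi\<in>S. 1)"
      unfolding g_def using assms(2) by (intro sum.cong refl dirichlet_character_1) auto
    then show ?thesis by simp
  qed
  ultimately have "real (card S) * real (card S) \<le> real (card S) * real q"
    by (simp add: power2_eq_square)
  moreover have "card S > 0" using False assms(1) by (simp add: card_gt_0_iff)
  ultimately show ?thesis by simp
qed simp

lemma primitive_characters_finite_card: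
  assumes "q > 0"
  shows "finite (primitive_characters q)" "card (primitive_characters q) \<le> q"
proof -
  have sub: "primitive_characters q \<subseteq> {chi. dirichlet_character q chi}"
    by (auto simp: primitive_characters_def)
  show fin: "finite (primitive_characters q)"
  \<comment> \<open>The bound for finite sets of characters already excludes an infinite set, which
    would contain q + 1 of them.\<close>
  proof (rule ccontr)
    assume "infinite (primitive_characters q)"
    then obtain S where "finite S" "card S = q + 1" "S \<subseteq> primitive_characters q"
      using infinite_arbitrarily_large by blast
    with card_characters_le[of S q] sub assms show False by auto
  qed
  show "card (primitive_characters q) \<le> q"
    by (rule card_characters_le[OF fin sub assms])
qed

section \<open>A large sieve inequality\<close>

text \<open>Summing over \<open>r + 1\<close> nested boxes of length \<open>L\<close> multiplies the diagonal terms by about \<open>L\<close> to the power \<open>r + 1\<close>,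
  but a function with period \<open>k\<close> and mean zero by at most \<open>k\<close> to that power. This gives a large sieve for characters
  without Gauss sums, in which \<open>Q\<close> to the power \<open>9 / 4\<close> takes the place of \<open>Q\<^sup>2\<close>.\<close>

definition box_sum :: "nat \<Rightarrow> (int \<Rightarrow> 'a :: comm_monoid_add) \<Rightarrow> int \<Rightarrow> 'a" where
  "box_sum L f n = (\<Sum>h<L. f (n + int h))"

definition zero_sum :: "nat \<Rightarrow> (int \<Rightarrow> complex) \<Rightarrow> bool" where
  "zero_sum k f \<longleftrightarrow> (\<forall>n. (\<Sum>h<k. f (n + int h)) = 0)"

lemma zero_sum_box_sum:
  assumes "zero_sum k f"
  shows "zero_sum k (box_sum L f)"
  unfolding zero_sum_def
proof
  fix n
  have "(\<Sum>h<k. box_sum L f (n + int h)) = (\<Sum>h<k. \<Sum>j<L. f ((n + int j) + int h))"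
    by (simp add: box_sum_def add_ac)
  also have "\<dots> = (\<Sum>j<L. \<Sum>h<k. f ((n + int j) + int h))" by (rule sum.swap)
  also have "\<dots> = 0" using assms by (simp add: zero_sum_def)
  finally show "(\<Sum>h<k. box_sum L f (n + int h)) = 0" .
qed

text \<open>Full periods contribute nothing, so a box of any length reduces to one shorter than k,
  where the trivial bound applies.\<close>

lemma norm_box_sum_le:
  assumes "zero_sum k f" "k > 0" and bound: "\<And>n. norm (f n) \<le> B"
  shows "norm (box_sum L f n) \<le> real k * B"
proof (induction L arbitrary: n rule: less_induct)
  case (less L)
  have B: "B \<ge> 0" using bound[of 0] norm_ge_zero order_trans by blast
  show ?case
  proof (cases "L < k")
    case True
    have "norm (box_sum L f n) \<le> (\<Sum>h<L. B)"
      unfolding box_sum_def using bound by (intro sum_norm_le) auto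
    also have "\<dots> \<le> real k * B" using True B by (simp add: mult_right_mono)
    finally show ?thesis .
  next
    case False
    have "box_sum L f n = (\<Sum>h<k. f (n + int h)) + (\<Sum>h\<in>{k..<L}. f (n + int h))"
      using False unfolding box_sum_def
      by (subst sum.union_disjoint[symmetric]) (auto intro!: sum.cong)
    also have "(\<Sum>h\<in>{k..<L}. f (n + int h)) = box_sum (L - k) f (n + int k)"
      unfolding box_sum_def using False
      by (intro sum.reindex_bij_witness[of _ "\<lambda>h. h + k" "\<lambda>h. h - k"]) (auto simp: add_ac of_nat_diff)
    finally have "box_sum L f n = box_sum (L - k) f (n + int k)"
      using assms(1) by (simp add: zero_sum_def)
    then show ?thesis using less.IH[of "L - k" "n + int k"] False assms(2) by simp
  qed
qed

lemma norm_box_sum_iter_le: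
  assumes "zero_sum k f" "k > 0" "\<And>n. norm (f n) \<le> B"
  shows "zero_sum k ((box_sum L ^^ r) f) \<and> (\<forall>n. norm ((box_sum L ^^ r) f n) \<le> real k ^ r * B)"
proof (induction r)
  case (Suc r)
  then have "zero_sum k (box_sum L ((box_sum L ^^ r) f))"
    by (intro zero_sum_box_sum) simp
  moreover have "norm (box_sum L ((box_sum L ^^ r) f) n) \<le> real k * (real k ^ r * B)" for n
    using Suc assms by (intro norm_box_sum_le) auto
  ultimately show ?case by (simp add: mult_ac)
qed (use assms in simp)

lemma box_sum_iter_sum:
  fixes f :: "'i \<Rightarrow> int \<Rightarrow> 'a :: comm_monoid_add"
  shows "(box_sum L ^^ r) (\<lambda>n. \<Sum>i\<in>I. f i n) = (\<lambda>n. \<Sum>i\<in>I. (box_sum L ^^ r) (f i) n)"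
proof (induction r)
  case (Suc r)
  have "box_sum L (\<lambda>n. \<Sum>i\<in>I. g i n) = (\<lambda>n. \<Sum>i\<in>I. box_sum L (g i) n)" for g :: "'i \<Rightarrow> int \<Rightarrow> 'a"
    unfolding box_sum_def by (intro ext sum.swap)
  with Suc show ?case by simp
qed simp

lemma box_sum_iter_mult:
  fixes c :: "'a :: comm_semiring_1"
  shows "(box_sum L ^^ r) (\<lambda>n. c * f n) = (\<lambda>n. c * (box_sum L ^^ r) f n)"
  by (induction r) (simp_all add: box_sum_def sum_distrib_left)

lemma box_sum_iter_of_real:
  "(box_sum L ^^ r) (\<lambda>n. complex_of_real (f n)) = (\<lambda>n. complex_of_real ((box_sum L ^^ r) f n))"
  by (induction r) (simp_all add: box_sum_def)

lemma box_sum_iter_le: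
  fixes f :: "int \<Rightarrow> real"
  assumes "\<And>n. f n \<le> B"
  shows "(box_sum L ^^ r) f n \<le> real L ^ r * B"
proof (induction r arbitrary: n)
  case (Suc r)
  have "(\<Sum>h<L. (box_sum L ^^ r) f (n + int h)) \<le> (\<Sum>h<L. real L ^ r * B)"
    by (intro sum_mono Suc)
  then show ?case by (simp add: box_sum_def[of L "(box_sum L ^^ r) f"] mult_ac)
qed (use assms in simp)

lemma box_sum_iter_ge:
  fixes f :: "int \<Rightarrow> real"
  assumes "\<And>m. n \<le> m \<Longrightarrow> m \<le> n + int (r * L) \<Longrightarrow> c \<le> f m"
  shows "real L ^ r * c \<le> (box_sum L ^^ r) f n"
  using assms
proof (induction r arbitrary: n)
  case (Suc r)
  have "(\<Sum>h<L. real L ^ r * c) \<le> (\<Sum>h<L. (box_sum L ^^ r) f (n + int h))"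
  proof (intro sum_mono Suc.IH)
    fix h m assume "h \<in> {..<L}" "n + int h \<le> m" "m \<le> n + int h + int (r * L)"
    then show "c \<le> f m" by (intro Suc.prems) (auto simp: algebra_simps)
  qed
  then show ?case by (simp add: box_sum_def[of L "(box_sum L ^^ r) f"] mult_ac)
qed simp

text \<open>After averaging over nested boxes a diagonal pair contributes at most (r + 1) L^(r + 1),
  an off-diagonal pair at most K^(r + 1). By the condition on L all off-diagonal pairs together
  count like one more L^(r + 1), whence the constant r + 2 after division by L^r.\<close>

lemma dual_large_sieve:
  fixes f :: "'i \<Rightarrow> int \<Rightarrow> complex" and K :: real
  assumes "finite I" and f1: "\<And>i n. i \<in> I \<Longrightarrow> norm (f i n) \<le> 1"
    and zs: "\<And>i j. i \<in> I \<Longrightarrow> j \<in> I \<Longrightarrow> i \<noteq> j \<Longrightarrow>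
          \<exists>k>0. real k \<le> K \<and> zero_sum k (\<lambda>n. f i n * cnj (f j n))"
    and "K \<ge> 0" and L: "real (card I) * K ^ Suc r \<le> real L ^ Suc r" "L > 0"
  shows "(\<Sum>m<L. (norm (\<Sum>i\<in>I. c i * f i (N + int m)))\<^sup>2) \<le> (real r + 2) * real L * (\<Sum>i\<in>I. (norm (c i))\<^sup>2)"
proof -
  \<comment> \<open>The r boxes of length L move the starting point through [N - r L, N], and the
    long box of length (r + 1) L from any such point covers [N, N + L). So the average dominates L^r
    times the sum to be bounded.\<close>
  define n0 where "n0 = N - int (r * L)"
  define W where "W = (\<lambda>g :: int \<Rightarrow> complex. (box_sum L ^^ r) (box_sum (Suc r * L) g) n0)"
  define F where "F = (\<lambda>n. (norm (\<Sum>i\<in>I. c i * f i n))\<^sup>2)"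
  define T where "T = (\<Sum>m<L. F (N + int m))"
  define S where "S = (\<Sum>i\<in>I. (norm (c i))\<^sup>2)"
  have S0: "S \<ge> 0" by (simp add: S_def sum_nonneg)
  define B where "B = (box_sum L ^^ r) (box_sum (Suc r * L) F) n0"
  have "real L ^ r * T \<le> B"
    unfolding B_def
  proof (rule box_sum_iter_ge)
    fix m assume m: "n0 \<le> m" "m \<le> n0 + int (r * L)"
    have "T = (\<Sum>h\<in>(\<lambda>h. nat (N - m) + h) ` {..<L}. F (m + int h))"
    proof -
      have eq: "N + int h = m + int (nat (N - m) + h)" for h using m by (simp add: n0_def)
      show ?thesis unfolding T_def
        by (subst sum.reindex) (auto simp: inj_on_def eq)
    qed
    also have "\<dots> \<le> (\<Sum>h<Suc r * L. F (m + int h))"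
    proof (intro sum_mono2)
      have "nat (N - m) \<le> r * L" using m by (simp add: n0_def nat_le_iff)
      then show "(\<lambda>h. nat (N - m) + h) ` {..<L} \<subseteq> {..<Suc r * L}" by auto
    qed (auto simp: F_def)
    finally show "T \<le> box_sum (Suc r * L) F m" by (simp add: box_sum_def)
  qed
  moreover have "complex_of_real B = W (\<lambda>n. complex_of_real (F n))"
  proof -
    have "box_sum M (\<lambda>n. complex_of_real (F n)) = (\<lambda>n. complex_of_real (box_sum M F n))" for M
      by (simp add: box_sum_def fun_eq_iff)
    then show ?thesis
      unfolding W_def B_def by (simp add: box_sum_iter_of_real)
  qed
  ultimately have lower: "real L ^ r * T \<le> Re (W (\<lambda>n. complex_of_real (F n)))"
    using Re_complex_of_real[of B] by simp
  have "(\<lambda>n. complex_of_real (F n)) = (\<lambda>n. \<Sum>i\<in>I. \<Sum>j\<in>I. (c i * cnj (c j)) * (f i n * cnj (f j n)))"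
    by (intro ext) (simp add: F_def of_real_norm_square sum_product mult_ac)
  moreover have "box_sum M (\<lambda>n. \<Sum>i\<in>I. g i n) = (\<lambda>n. \<Sum>i\<in>I. box_sum M (g i) n)" for M and g :: "'i \<Rightarrow> int \<Rightarrow> complex"
    unfolding box_sum_def by (intro ext sum.swap)
  moreover have "box_sum M (\<lambda>n. z * g n) = (\<lambda>n. z * box_sum M g n)" for M z and g :: "int \<Rightarrow> complex"
    by (simp add: box_sum_def sum_distrib_left fun_eq_iff)
  ultimately have expand: "W (\<lambda>n. complex_of_real (F n)) = (\<Sum>i\<in>I. \<Sum>j\<in>I. (c i * cnj (c j)) * W (\<lambda>n. f i n * cnj (f j n)))"
    unfolding W_def by (simp add: box_sum_iter_sum box_sum_iter_mult)
  define D where "D = real L ^ r * (real (Suc r) * real L)"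
  define E where "E = K ^ Suc r"
  have W_diag: "norm (W (\<lambda>n. f i n * cnj (f i n))) \<le> D" if "i \<in> I" for i
  proof -
    have "W (\<lambda>n. f i n * cnj (f i n)) = W (\<lambda>n. complex_of_real ((norm (f i n))\<^sup>2))"
      by (simp add: of_real_norm_square)
    also have "\<dots> = complex_of_real ((box_sum L ^^ r) (box_sum (Suc r * L) (\<lambda>n. (norm (f i n))\<^sup>2)) n0)"
    proof -
      have "box_sum M (\<lambda>n. complex_of_real (G n)) = (\<lambda>n. complex_of_real (box_sum M G n))" for M G
        by (simp add: box_sum_def fun_eq_iff)
      then show ?thesis unfolding W_def by (simp add: box_sum_iter_of_real del: of_real_power)
    qed
    finally have "norm (W (\<lambda>n. f i n * cnj (f i n))) = \<bar>(box_sum L ^^ r) (box_sum (Suc r * L) (\<lambda>n. (norm (f i n))\<^sup>2)) n0\<bar>"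
      by simp
    also have "\<dots> = (box_sum L ^^ r) (box_sum (Suc r * L) (\<lambda>n. (norm (f i n))\<^sup>2)) n0"
    proof -
      have "real L ^ r * 0 \<le> (box_sum L ^^ r) (box_sum (Suc r * L) (\<lambda>n. (norm (f i n))\<^sup>2)) n0"
        by (rule box_sum_iter_ge) (simp add: box_sum_def sum_nonneg)
      then show ?thesis by simp
    qed
    also have "\<dots> \<le> real L ^ r * (real (Suc r * L))"
    proof (rule box_sum_iter_le)
      fix n
      have "(\<Sum>h<Suc r * L. (norm (f i (n + int h)))\<^sup>2) \<le> (\<Sum>h<Suc r * L. 1)"
        using f1[OF that] by (intro sum_mono) (auto intro: power_le_one)
      then show "box_sum (Suc r * L) (\<lambda>n. (norm (f i n))\<^sup>2) n \<le> real (Suc r * L)"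
        by (simp add: box_sum_def)
    qed
    finally show ?thesis by (simp add: D_def algebra_simps)
  qed
  have W_off: "norm (W (\<lambda>n. f i n * cnj (f j n))) \<le> E" if ij: "i \<in> I" "j \<in> I" "i \<noteq> j" for i j
  proof -
    obtain k where k: "k > 0" "real k \<le> K" "zero_sum k (\<lambda>n. f i n * cnj (f j n))"
      using zs[OF ij] by auto
    have "norm (box_sum (Suc r * L) (\<lambda>n. f i n * cnj (f j n)) n) \<le> real k * 1" for n
      using f1[OF ij(1)] f1[OF ij(2)]
      by (intro norm_box_sum_le k) (auto simp: norm_mult intro!: mult_le_one)
    then have "norm (W (\<lambda>n. f i n * cnj (f j n))) \<le> real k ^ r * (real k * 1)"
      unfolding W_def using norm_box_sum_iter_le[OF zero_sum_box_sum[OF k(3)] k(1)] by blast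
    also have "\<dots> = real k ^ Suc r" by (simp add: mult_ac)
    also have "\<dots> \<le> E" unfolding E_def using k by (intro power_mono) auto
    finally show ?thesis .
  qed
  have "Re (W (\<lambda>n. complex_of_real (F n))) \<le> norm (W (\<lambda>n. complex_of_real (F n)))" by (rule complex_Re_le_cmod)
  also have "\<dots> \<le> (\<Sum>i\<in>I. \<Sum>j\<in>I. norm ((c i * cnj (c j)) * W (\<lambda>n. f i n * cnj (f j n))))"
    unfolding expand by (intro order_trans[OF norm_sum] sum_mono order_trans[OF norm_sum] order_refl)
  \<comment> \<open>Replacing |c i| |c j| by half the sum of the squares lets the off-diagonal
    double sum factor into card I times the sum of the |c i|^2.\<close>
  also have "\<dots> \<le> (\<Sum>i\<in>I. \<Sum>j\<in>I. (if i = j then D * (norm (c i))\<^sup>2 else 0) + E * (((norm (c i))\<^sup>2 + (norm (c j))\<^sup>2) / 2))"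
  proof (intro sum_mono)
    fix i j assume ij: "i \<in> I" "j \<in> I"
    have E0: "E \<ge> 0" using \<open>K \<ge> 0\<close> by (simp add: E_def)
    show "norm ((c i * cnj (c j)) * W (\<lambda>n. f i n * cnj (f j n))) \<le>
      (if i = j then D * (norm (c i))\<^sup>2 else 0) + E * (((norm (c i))\<^sup>2 + (norm (c j))\<^sup>2) / 2)"
    proof (cases "i = j")
      case True
      have "(norm (c i))\<^sup>2 * norm (W (\<lambda>n. f i n * cnj (f i n))) \<le> (norm (c i))\<^sup>2 * D"
        by (intro mult_left_mono W_diag ij) auto
      moreover have "0 \<le> E * (norm (c i))\<^sup>2" using E0 by simp
      ultimately show ?thesis using True by (simp add: norm_mult power2_eq_square mult_ac)
    next
      case False
      have "norm (c i) * norm (c j) * norm (W (\<lambda>n. f i n * cnj (f j n))) \<le> norm (c i) * norm (c j) * E"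
        by (intro mult_left_mono W_off ij False) auto
      also have "norm (c i) * norm (c j) \<le> ((norm (c i))\<^sup>2 + (norm (c j))\<^sup>2) / 2"
        using sum_squares_bound[of "norm (c i)" "norm (c j)"] by simp
      finally show ?thesis using E0 False by (simp add: norm_mult mult_ac mult_right_mono)
    qed
  qed
  also have "\<dots> = D * S + E * (real (card I) * S)"
  proof -
    have 1: "(\<Sum>i\<in>I. \<Sum>j\<in>I. (if i = j then D * (norm (c i))\<^sup>2 else 0)) = D * S"
      using assms(1) by (simp add: S_def sum.delta sum_distrib_left)
    have 2: "(\<Sum>i\<in>I. \<Sum>j\<in>I. E * (((norm (c i))\<^sup>2 + (norm (c j))\<^sup>2) / 2)) = E * (real (card I) * S)"
    proof -
      have "(\<Sum>i\<in>I. \<Sum>j\<in>I. E * (((norm (c i))\<^sup>2 + (norm (c j))\<^sup>2) / 2)) =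
        (\<Sum>i\<in>I. E / 2 * (real (card I) * (norm (c i))\<^sup>2 + S))"
        by (intro sum.cong refl) (simp add: sum_distrib_left[symmetric] sum_divide_distrib[symmetric] sum.distrib S_def)
      also have "\<dots> = E / 2 * (real (card I) * S + real (card I) * S)"
      proof -
        have "(\<Sum>i\<in>I. real (card I) * (norm (c i))\<^sup>2 + S) = real (card I) * S + real (card I) * S"
          by (simp add: sum.distrib S_def sum_distrib_left)
        then show ?thesis by (simp only: sum_distrib_left[symmetric])
      qed
      finally show ?thesis by simp
    qed
    show ?thesis using 1 2 by (simp add: sum.distrib)
  qed
  also have "\<dots> \<le> D * S + real L ^ Suc r * S"
  proof -
    have "E * real (card I) * S \<le> real L ^ Suc r * S"
      using L(1) S0 by (intro mult_right_mono) (simp_all add: E_def mult.commute)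
    then show ?thesis by (simp add: mult_ac)
  qed
  also have "\<dots> = real L ^ r * ((real r + 2) * real L * S)" by (simp add: D_def algebra_simps)
  finally have "real L ^ r * T \<le> real L ^ r * ((real r + 2) * real L * S)" using lower by simp
  then have "T \<le> (real r + 2) * real L * S" using L(2) by simp
  then show ?thesis by (simp add: T_def F_def S_def)
qed

text \<open>With s i the inner sum, the choice c i = cnj (s i) writes T, the sum of the |s i|^2, as
  a sum over n. Cauchy-Schwarz and the dual inequality give T^2 <= D T times the sum of the |a n|^2,
  and one factor T cancels.\<close>

lemma large_sieve_duality:
  fixes x :: "'i \<Rightarrow> 'n \<Rightarrow> complex"
  assumes dual: "\<And>c. (\<Sum>n\<in>A. (norm (\<Sum>i\<in>I. c i * x i n))\<^sup>2) \<le> D * (\<Sum>i\<in>I. (norm (c i))\<^sup>2)" and "D \<ge> 0"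
  shows "(\<Sum>i\<in>I. (norm (\<Sum>n\<in>A. a n * x i n))\<^sup>2) \<le> D * (\<Sum>n\<in>A. (norm (a n))\<^sup>2)"
proof -
  define s where "s = (\<lambda>i. \<Sum>n\<in>A. a n * x i n)"
  define T where "T = (\<Sum>i\<in>I. (norm (s i))\<^sup>2)"
  have T0: "T \<ge> 0" by (simp add: T_def sum_nonneg)
  have "complex_of_real T = (\<Sum>i\<in>I. \<Sum>n\<in>A. a n * (cnj (s i) * x i n))"
  proof -
    have "complex_of_real ((norm (s i))\<^sup>2) = (\<Sum>n\<in>A. a n * (cnj (s i) * x i n))" for i
    proof -
      have "complex_of_real ((norm (s i))\<^sup>2) = (\<Sum>n\<in>A. a n * x i n) * cnj (s i)"
        by (simp only: complex_norm_square) (simp add: s_def)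
      then show ?thesis by (simp only: sum_distrib_right) (simp add: mult_ac)
    qed
    then show ?thesis by (simp add: T_def)
  qed
  also have "\<dots> = (\<Sum>n\<in>A. a n * (\<Sum>i\<in>I. cnj (s i) * x i n))"
    by (subst sum.swap) (simp add: sum_distrib_left)
  finally have "T = norm (\<Sum>n\<in>A. a n * (\<Sum>i\<in>I. cnj (s i) * x i n))"
    using T0 by (metis abs_of_nonneg norm_of_real)
  also have "\<dots> \<le> (\<Sum>n\<in>A. norm (a n) * norm (\<Sum>i\<in>I. cnj (s i) * x i n))"
    by (intro order_trans[OF norm_sum]) (simp add: norm_mult)
  finally have "T\<^sup>2 \<le> (\<Sum>n\<in>A. norm (a n) * norm (\<Sum>i\<in>I. cnj (s i) * x i n))\<^sup>2"
    using T0 by (intro power_mono)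
  also have "\<dots> \<le> (\<Sum>n\<in>A. (norm (a n))\<^sup>2) * (\<Sum>n\<in>A. (norm (\<Sum>i\<in>I. cnj (s i) * x i n))\<^sup>2)"
    by (rule Cauchy_Schwarz_ineq_sum)
  also have "\<dots> \<le> (\<Sum>n\<in>A. (norm (a n))\<^sup>2) * (D * T)"
    using dual[of "\<lambda>i. cnj (s i)"] by (intro mult_left_mono) (auto simp: T_def sum_nonneg)
  finally have "T * T \<le> (D * (\<Sum>n\<in>A. (norm (a n))\<^sup>2)) * T" by (simp add: power2_eq_square mult_ac)
  moreover have "D * (\<Sum>n\<in>A. (norm (a n))\<^sup>2) \<ge> 0"
    using assms(2) by (simp add: sum_nonneg)
  ultimately have "T \<le> D * (\<Sum>n\<in>A. (norm (a n))\<^sup>2)"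
    using T0 by (cases "T = 0") auto
  then show ?thesis by (simp add: T_def s_def)
qed

definition character_family :: "real \<Rightarrow> (nat \<times> (int \<Rightarrow> complex)) set" where
  "character_family Q = (SIGMA q:{q. Q \<le> real q \<and> real q \<le> 2 * Q}. primitive_characters q)"

lemma finite_moduli: "finite {q :: nat. Q \<le> real q \<and> real q \<le> 2 * Q}"
proof (rule finite_subset)
  show "{q :: nat. Q \<le> real q \<and> real q \<le> 2 * Q} \<subseteq> {..nat \<lceil>2 * Q\<rceil>}"
    by (auto simp: nat_le_iff) linarith
qed simp

lemma character_family_finite_card:
  assumes "Q \<ge> 2"
  shows "finite (character_family Q)" "real (card (character_family Q)) \<le> 6 * Q\<^sup>2"
proof -
  let ?M = "{q :: nat. Q \<le> real q \<and> real q \<le> 2 * Q}"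
  have pos: "q > 0" if "q \<in> ?M" for q using that assms by (cases q) auto
  show "finite (character_family Q)"
    unfolding character_family_def
    using finite_moduli primitive_characters_finite_card(1) pos by (intro finite_SigmaI) auto
  have "?M \<subseteq> {1..nat \<lfloor>2 * Q\<rfloor>}"
    using pos by (auto simp: le_nat_iff le_floor_iff Suc_le_eq)
  then have "card ?M \<le> nat \<lfloor>2 * Q\<rfloor>"
    using card_mono[of "{1..nat \<lfloor>2 * Q\<rfloor>}" ?M] by simp
  then have "real (card ?M) \<le> 2 * Q" using assms by linarith
  have "card (character_family Q) = (\<Sum>q\<in>?M. card (primitive_characters q))"
    unfolding character_family_def
    using finite_moduli primitive_characters_finite_card(1) pos by (intro card_SigmaI) auto
  also have "real \<dots> \<le> (\<Sum>q\<in>?M. 2 * Q)"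
  proof (unfold of_nat_sum, intro sum_mono)
    fix q assume q: "q \<in> ?M"
    then have "real (card (primitive_characters q)) \<le> real q"
      using primitive_characters_finite_card(2)[OF pos] by simp
    with q show "real (card (primitive_characters q)) \<le> 2 * Q" by simp
  qed
  also have "\<dots> \<le> 2 * Q * (2 * Q)" using \<open>real (card ?M) \<le> 2 * Q\<close> assms by simp
  also have "\<dots> \<le> 6 * Q\<^sup>2" using assms by (simp add: power2_eq_square)
  finally show "real (card (character_family Q)) \<le> 6 * Q\<^sup>2" .
qed

text \<open>This is \<open>dual_large_sieve\<close> with r = 7: about Q^2 characters and periods up
  to 4 Q^2 ask for L^8 of order Q^2 (Q^2)^8 = Q^18, that is L of order Q^(9 / 4). For general r the
  exponent is 2 + 2 / (r + 1); r = 7 puts it below 5 / 2 with room to spare.\<close>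

lemma large_sieve:
  fixes a :: "nat \<Rightarrow> complex"
  assumes "Q \<ge> 2"
  shows "(\<Sum>(q, chi)\<in>character_family Q. (norm (\<Sum>n\<in>{M..<M + N}. a n * chi (int n)))\<^sup>2)
    \<le> 100 * (Q powr (9 / 4) + real N) * (\<Sum>n\<in>{M..<M + N}. (norm (a n))\<^sup>2)"
proof -
  define I where "I = character_family Q"
  \<comment> \<open>The coefficients are padded with zeros up to length L, so that short sums fall
    under the same inequality.\<close>
  define L where "L = max N (nat \<lceil>8 * Q powr (9 / 4)\<rceil>)"
  have L8: "8 * Q powr (9 / 4) \<le> real L" unfolding L_def by linarith
  have Q94: "Q powr (9 / 4) > 1" using assms powr_less_mono2[of "9 / 4" 1 Q] by simp
  have L_pos: "L > 0" using L8 Q94 by (cases L) auto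
  have L_le: "real L \<le> 9 * Q powr (9 / 4) + real N" unfolding L_def using Q94 by linarith
  have fin: "finite I" and card_I: "real (card I) \<le> 6 * Q\<^sup>2"
    unfolding I_def using character_family_finite_card[OF assms] by auto
  define b where "b = (\<lambda>m. if m < N then a (M + m) else 0)"
  have "(\<Sum>i\<in>I. (norm (\<Sum>m<L. b m * snd i (int M + int m)))\<^sup>2)
          \<le> ((real 7 + 2) * real L) * (\<Sum>m<L. (norm (b m))\<^sup>2)"
  proof (rule large_sieve_duality)
    fix c :: "nat \<times> (int \<Rightarrow> complex) \<Rightarrow> complex"
    show "(\<Sum>n<L. (norm (\<Sum>i\<in>I. c i * snd i (int M + int n)))\<^sup>2)
         \<le> (real 7 + 2) * real L * (\<Sum>i\<in>I. (norm (c i))\<^sup>2)"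
    proof (rule dual_large_sieve[where K = "4 * Q\<^sup>2"])
      fix i n assume "i \<in> I"
      then show "norm (snd i n) \<le> 1"
        by (auto simp: I_def character_family_def primitive_characters_def intro: dirichlet_character_norm_le)
    next
      fix i j assume ij: "i \<in> I" "j \<in> I" "i \<noteq> j"
      obtain q1 chi1 q2 chi2 where eq: "i = (q1, chi1)" "j = (q2, chi2)" by (cases i, cases j)
      have mem: "chi1 \<in> primitive_characters q1" "chi2 \<in> primitive_characters q2"
        "Q \<le> real q1" "real q1 \<le> 2 * Q" "Q \<le> real q2" "real q2 \<le> 2 * Q"
        using ij by (auto simp: eq I_def character_family_def)
      obtain b where "coprime b (int (q1 * q2))" "chi1 b \<noteq> chi2 b"
        using primitive_characters_separated[OF mem(1,2)] ij(3) by (auto simp: eq)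
      then have "zero_sum (q1 * q2) (\<lambda>n. chi1 n * cnj (chi2 n))"
        using sum_character_mult_cnj[of q1 chi1 q2 chi2 b] mem(1,2)
        by (simp add: zero_sum_def primitive_characters_def)
      moreover have "q1 > 0" "q2 > 0" using mem assms by (auto intro: Nat.gr0I)
      moreover have "real (q1 * q2) \<le> (2 * Q) * (2 * Q)"
        unfolding of_nat_mult using mem assms by (intro mult_mono) auto
      ultimately show "\<exists>k>0. real k \<le> 4 * Q\<^sup>2 \<and> zero_sum k (\<lambda>n. snd i n * cnj (snd j n))"
        by (intro exI[of _ "q1 * q2"]) (auto simp: eq power2_eq_square)
    next
      have "real (card I) * (4 * Q\<^sup>2) ^ Suc 7 \<le> (6 * Q\<^sup>2) * (4 * Q\<^sup>2) ^ Suc 7"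
        using card_I by (intro mult_right_mono) auto
      also have "\<dots> = 6 * 4 ^ 8 * Q ^ 18"
      proof -
        have "(4 * Q\<^sup>2) ^ Suc 7 = 4 ^ 8 * (Q\<^sup>2) ^ 8" by (simp only: power_mult_distrib) simp
        moreover have "(Q\<^sup>2) ^ 8 = Q ^ 16" by (simp flip: power_mult)
        moreover have "Q\<^sup>2 * Q ^ 16 = Q ^ 18" by (simp flip: power_add)
        ultimately show ?thesis by (simp only: mult.assoc mult.left_commute[of "Q\<^sup>2"])
      qed
      also have "\<dots> \<le> 8 ^ 8 * Q ^ 18" using assms by (intro mult_right_mono) auto
      also have "Q ^ 18 = (Q powr (9 / 4)) ^ 8"
      proof -
        have "(Q powr (9 / 4)) ^ 8 = Q powr (real 8 * (9 / 4))" using assms by (intro powr_power) auto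
        moreover have "Q powr real 18 = Q ^ 18" using assms by (intro powr_realpow) auto
        ultimately show ?thesis by simp
      qed
      also have "8 ^ 8 * (Q powr (9 / 4)) ^ 8 = (8 * Q powr (9 / 4)) ^ 8" by (simp add: power_mult_distrib)
      also have "\<dots> \<le> real L ^ 8" using L8 Q94 by (intro power_mono) auto
      finally show "real (card I) * (4 * Q\<^sup>2) ^ Suc 7 \<le> real L ^ Suc 7" by simp
    qed (use fin L_pos in auto)
  qed simp
  also have "(\<Sum>m<L. (norm (b m))\<^sup>2) = (\<Sum>n\<in>{M..<M + N}. (norm (a n))\<^sup>2)"
  proof -
    have "(\<Sum>m<L. (norm (b m))\<^sup>2) = (\<Sum>m<N. (norm (b m))\<^sup>2)"
      by (intro sum.mono_neutral_right) (auto simp: b_def L_def)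
    also have "\<dots> = (\<Sum>n\<in>{M..<M + N}. (norm (a n))\<^sup>2)"
      by (intro sum.reindex_bij_witness[of _ "\<lambda>n. n - M" "\<lambda>m. M + m"]) (auto simp: b_def)
    finally show ?thesis .
  qed
  also have "(\<Sum>i\<in>I. (norm (\<Sum>m<L. b m * snd i (int M + int m)))\<^sup>2) =
      (\<Sum>(q, chi)\<in>I. (norm (\<Sum>n\<in>{M..<M + N}. a n * chi (int n)))\<^sup>2)"
  proof (intro sum.cong refl)
    fix i assume "i \<in> I"
    have "(\<Sum>m<L. b m * snd i (int M + int m)) = (\<Sum>m<N. b m * snd i (int M + int m))"
      by (intro sum.mono_neutral_right) (auto simp: b_def L_def)
    also have "\<dots> = (\<Sum>n\<in>{M..<M + N}. a n * snd i (int n))"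
      by (intro sum.reindex_bij_witness[of _ "\<lambda>n. n - M" "\<lambda>m. M + m"]) (auto simp: b_def)
    finally show "(norm (\<Sum>m<L. b m * snd i (int M + int m)))\<^sup>2 =
      (case i of (q, chi) \<Rightarrow> (norm (\<Sum>n\<in>{M..<M + N}. a n * chi (int n)))\<^sup>2)"
      by (simp add: case_prod_unfold)
  qed
  also have "((real 7 + 2) * real L) * (\<Sum>n\<in>{M..<M + N}. (norm (a n))\<^sup>2) \<le>
      100 * (Q powr (9 / 4) + real N) * (\<Sum>n\<in>{M..<M + N}. (norm (a n))\<^sup>2)"
    using L_le Q94 by (intro mult_right_mono sum_nonneg) auto
  finally show ?thesis by (simp add: I_def)
qed

section \<open>Integrals along vertical lines\<close>

text \<open>The integral runs over the parameter t, hence lacks the factor \<i> of the contour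
  integral. The truncation at T keeps all integrals proper.\<close>

definition vertical_integral :: "(complex \<Rightarrow> complex) \<Rightarrow> real \<Rightarrow> real \<Rightarrow> complex" where
  "vertical_integral f c T = integral {- T..T} (\<lambda>t. f (Complex c t))"

lemma continuous_on_vertical:
  assumes "continuous_on A f" "\<And>t. t \<in> {- T..T} \<Longrightarrow> Complex c t \<in> A"
  shows "continuous_on {- T..T} (\<lambda>t. f (Complex c t))"
proof (rule continuous_on_compose2[OF assms(1)])
  show "continuous_on {- T..T} (Complex c)"
    unfolding Complex_eq by (intro continuous_intros)
qed (use assms in auto)

lemma norm_vertical_integral_le:
  assumes "continuous_on A f" "\<And>t. t \<in> {- T..T} \<Longrightarrow> Complex c t \<in> A"
    and "g integrable_on {- T..T}" "\<And>t. t \<in> {- T..T} \<Longrightarrow> norm (f (Complex c t)) \<le> g t"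
  shows "norm (vertical_integral f c T) \<le> integral {- T..T} g"
  unfolding vertical_integral_def
  using assms by (intro integral_norm_bound_integral integrable_continuous_real[OF continuous_on_vertical[OF assms(1)]]) auto

text \<open>The two horizontal sides, of length b - a each, account for the whole difference. The
  value I of the closed integral is kept abstract, so that the rectangle may contain no pole, one
  pole, or the two poles of the Perron kernel.\<close>

lemma rectangle_integral:
  assumes "(f has_contour_integral I) (rectpath (Complex a (- T)) (Complex b T))"
    and cont: "continuous_on (path_image (rectpath (Complex a (- T)) (Complex b T))) f"
    and "a < b" "T > 0" and bound: "\<And>x. x \<in> {a..b} \<Longrightarrow> norm (f (Complex x T)) \<le> B \<and> norm (f (Complex x (- T))) \<le> B"
  shows "norm (\<i> * (vertical_integral f b T - vertical_integral f a T) - I) \<le> 2 * B * (b - a)"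
proof -
  define z1 z2 z3 z4 where "z1 = Complex a (- T)" and "z2 = Complex b (- T)" and "z3 = Complex b T" and "z4 = Complex a T"
  have rect: "rectpath z1 z3 = linepath z1 z2 +++ linepath z2 z3 +++ linepath z3 z4 +++ linepath z4 z1"
    by (simp add: rectpath_def Let_def z1_def z2_def z3_def z4_def)
  have img: "path_image (rectpath z1 z3) = closed_segment z1 z2 \<union> closed_segment z2 z3 \<union> closed_segment z3 z4 \<union> closed_segment z4 z1"
    by (simp add: rect path_image_join Un_assoc)
  have B0: "B \<ge> 0" using bound[of a] \<open>a < b\<close> norm_ge_zero order_trans by (metis atLeastAtMost_iff less_imp_le order_refl)
  have ints: "f contour_integrable_on linepath z1 z2" "f contour_integrable_on linepath z2 z3"
    "f contour_integrable_on linepath z3 z4" "f contour_integrable_on linepath z4 z1"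
    using cont unfolding z1_def[symmetric] z3_def[symmetric] img
    by (auto intro!: contour_integrable_continuous_linepath elim: continuous_on_subset)
  have "I = contour_integral (rectpath z1 z3) f"
    using assms(1) by (simp add: contour_integral_unique z1_def z3_def)
  also have "\<dots> = contour_integral (linepath z1 z2) f + contour_integral (linepath z2 z3) f
      + contour_integral (linepath z3 z4) f + contour_integral (linepath z4 z1) f"
    using ints by (simp add: rect)
  also have "contour_integral (linepath z2 z3) f = \<i> * vertical_integral f b T"
    unfolding vertical_integral_def
    using \<open>T > 0\<close> by (intro contour_integral_linepath_same_Re) (auto simp: z2_def z3_def)
  also have "contour_integral (linepath z4 z1) f = - contour_integral (linepath z1 z4) f"
    using contour_integral_reverse_linepath[of z1 z4 f] ints(4) cont
    unfolding z1_def[symmetric] z3_def[symmetric] img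
    by (metis Un_upper2 closed_segment_commute contour_integral_reverse_linepath continuous_on_subset)
  also have "contour_integral (linepath z1 z4) f = \<i> * vertical_integral f a T"
    unfolding vertical_integral_def
    using \<open>T > 0\<close> by (intro contour_integral_linepath_same_Re) (auto simp: z1_def z4_def)
  finally have "\<i> * (vertical_integral f b T - vertical_integral f a T) - I =
      - (contour_integral (linepath z1 z2) f + contour_integral (linepath z3 z4) f)"
    by (simp add: algebra_simps)
  moreover have "norm (contour_integral (linepath z1 z2) f) \<le> B * norm (z2 - z1)"
  proof (rule contour_integral_bound_linepath[OF ints(1) B0])
    fix x assume "x \<in> closed_segment z1 z2"
    then have "x = Complex (Re x) (- T)" "Re x \<in> {a..b}"
      using \<open>a < b\<close> by (auto simp: z1_def z2_def closed_segment_same_Im closed_segment_eq_real_ivl complex_eq_iff)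
    then show "norm (f x) \<le> B" using bound by metis
  qed
  moreover have "norm (contour_integral (linepath z3 z4) f) \<le> B * norm (z4 - z3)"
  proof (rule contour_integral_bound_linepath[OF ints(3) B0])
    fix x assume "x \<in> closed_segment z3 z4"
    then have "x = Complex (Re x) T" "Re x \<in> {a..b}"
      using \<open>a < b\<close> by (auto simp: z3_def z4_def closed_segment_same_Im closed_segment_eq_real_ivl complex_eq_iff)
    then show "norm (f x) \<le> B" using bound by metis
  qed
  moreover have "norm (z2 - z1) = b - a" "norm (z4 - z3) = b - a"
    using \<open>a < b\<close> by (simp_all add: z1_def z2_def z3_def z4_def cmod_def)
  ultimately show ?thesis
    using norm_triangle_ineq[of "contour_integral (linepath z1 z2) f" "contour_integral (linepath z3 z4) f"]
    by (simp only: norm_minus_cancel)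
qed

lemma rectangle_shift:
  assumes "f holomorphic_on S" "convex S" "cbox (Complex a (- T)) (Complex b T) \<subseteq> S"
    and "a < b" "T > 0" and "\<And>x. x \<in> {a..b} \<Longrightarrow> norm (f (Complex x T)) \<le> B \<and> norm (f (Complex x (- T))) \<le> B"
  shows "norm (vertical_integral f b T - vertical_integral f a T) \<le> 2 * B * (b - a)"
proof -
  let ?g = "rectpath (Complex a (- T)) (Complex b T)"
  have sub: "path_image ?g \<subseteq> S"
    using path_image_rectpath_subset_cbox[of "Complex a (- T)" "Complex b T"] assms by simp
  have "(f has_contour_integral 0) ?g"
    by (rule Cauchy_theorem_convex_simple[OF assms(1,2)]) (use sub in auto)
  moreover have "continuous_on (path_image ?g) f"
    using assms(1) sub holomorphic_on_imp_continuous_on continuous_on_subset by blast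
  ultimately have "norm (\<i> * (vertical_integral f b T - vertical_integral f a T) - 0) \<le> 2 * B * (b - a)"
    using assms by (intro rectangle_integral) auto
  then show ?thesis by (simp add: norm_mult)
qed

lemma rectangle_residue:
  fixes f :: "complex \<Rightarrow> complex"
  assumes "f holomorphic_on S" "convex S" "cbox (Complex a (- T)) (Complex b T) \<subseteq> S"
    and "a < b" "T > 0" and z: "z \<in> box (Complex a (- T)) (Complex b T)"
    and "\<And>x. x \<in> {a..b} \<Longrightarrow> norm (f (Complex x T) / (Complex x T - z)) \<le> B \<and>
           norm (f (Complex x (- T)) / (Complex x (- T) - z)) \<le> B"
  shows "norm (vertical_integral (\<lambda>w. f w / (w - z)) b T - vertical_integral (\<lambda>w. f w / (w - z)) a T - 2 * pi * f z)
      \<le> 2 * B * (b - a)"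
proof -
  let ?g = "rectpath (Complex a (- T)) (Complex b T)" and ?h = "\<lambda>w. f w / (w - z)"
  have zn: "z \<notin> path_image ?g"
    using z path_image_rectpath_inter_box[of "Complex a (- T)" "Complex b T"] assms by auto
  have sub: "path_image ?g \<subseteq> S"
    using path_image_rectpath_subset_cbox[of "Complex a (- T)" "Complex b T"] assms by simp
  have "box (Complex a (- T)) (Complex b T) \<subseteq> S" using assms(3) box_subset_cbox by blast
  then have "z \<in> interior S" using z interior_maximal[OF _ open_box] by blast
  then have "(?h has_contour_integral (2 * pi * \<i> * winding_number ?g z * f z)) ?g"
    using sub zn by (intro Cauchy_integral_formula_convex_simple[OF assms(2,1)]) auto
  then have "(?h has_contour_integral (2 * pi * \<i> * f z)) ?g"
    using winding_number_rectpath[OF z] by simp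
  moreover have "continuous_on (path_image ?g) ?h"
    using zn sub holomorphic_on_imp_continuous_on[OF assms(1)]
    by (intro continuous_intros) (auto elim: continuous_on_subset)
  ultimately have "norm (\<i> * (vertical_integral ?h b T - vertical_integral ?h a T) - 2 * pi * \<i> * f z) \<le> 2 * B * (b - a)"
    using assms by (intro rectangle_integral) auto
  also have "\<i> * (vertical_integral ?h b T - vertical_integral ?h a T) - 2 * pi * \<i> * f z =
    \<i> * (vertical_integral ?h b T - vertical_integral ?h a T - 2 * pi * f z)"
    by (simp add: algebra_simps)
  finally show ?thesis by (simp only: norm_mult norm_ii mult_1)
qed

lemma integral_inverse_square_le:
  "(\<lambda>t. 1 / (1 + t\<^sup>2)) integrable_on {- T..T :: real}" "integral {- T..T :: real} (\<lambda>t. 1 / (1 + t\<^sup>2)) \<le> pi"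
proof -
  have nz: "1 + t\<^sup>2 \<noteq> 0" for t :: real by (metis add_nonneg_eq_0_iff zero_le_one zero_le_power2 zero_neq_one)
  then show int: "(\<lambda>t. 1 / (1 + t\<^sup>2)) integrable_on {- T..T :: real}"
    by (intro integrable_continuous_real continuous_intros) auto
  show "integral {- T..T :: real} (\<lambda>t. 1 / (1 + t\<^sup>2)) \<le> pi"
  proof (cases "T \<ge> 0")
    case True
    have "((\<lambda>t. 1 / (1 + t\<^sup>2)) has_integral (arctan T - arctan (- T))) {- T..T}"
      using True nz
      by (intro fundamental_theorem_of_calculus)
         (auto simp flip: has_real_derivative_iff_has_vector_derivative intro!: derivative_eq_intros simp: divide_inverse)
    then have "integral {- T..T :: real} (\<lambda>t. 1 / (1 + t\<^sup>2)) = 2 * arctan T"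
      by (simp add: arctan_minus integral_unique)
    then show ?thesis using arctan_ubound[of T] by simp
  next
    case False
    then show ?thesis by simp
  qed
qed

lemma exp_neg_square_le: "exp (- (t\<^sup>2 / 4)) \<le> 4 * (1 / (1 + t\<^sup>2))" for t :: real
proof -
  have "1 + t\<^sup>2 / 4 \<le> exp (t\<^sup>2 / 4)" by (rule exp_ge_add_one_self)
  moreover have "(1 + t\<^sup>2) / 4 \<le> 1 + t\<^sup>2 / 4" by simp
  ultimately have le: "(1 + t\<^sup>2) / 4 \<le> exp (t\<^sup>2 / 4)" by (rule order_trans[rotated])
  have "0 < 1 + t\<^sup>2" by (simp add: add_pos_nonneg)
  then have "inverse (exp (t\<^sup>2 / 4)) \<le> inverse ((1 + t\<^sup>2) / 4)"
    using le by (intro le_imp_inverse_le) auto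
  then show ?thesis by (simp add: exp_minus)
qed

lemma integral_gaussian_le:
  "(\<lambda>t. exp (- (t\<^sup>2 / 4))) integrable_on {- T..T :: real}" "integral {- T..T :: real} (\<lambda>t. exp (- (t\<^sup>2 / 4))) \<le> 4 * pi"
proof -
  show int: "(\<lambda>t. exp (- (t\<^sup>2 / 4))) integrable_on {- T..T :: real}"
    by (intro integrable_continuous_real continuous_intros) auto
  have "integral {- T..T :: real} (\<lambda>t. exp (- (t\<^sup>2 / 4))) \<le> integral {- T..T} (\<lambda>t. 4 * (1 / (1 + t\<^sup>2)))"
    using integral_inverse_square_le
    by (intro integral_le int integrable_on_mult_right exp_neg_square_le) auto
  also have "\<dots> \<le> 4 * pi"
    using integral_inverse_square_le(2)[of T] by (subst integral_mult_right) simp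
  finally show "integral {- T..T :: real} (\<lambda>t. exp (- (t\<^sup>2 / 4))) \<le> 4 * pi" .
qed

lemma integral_Cauchy_Schwarz:
  fixes u k :: "real \<Rightarrow> real"
  assumes "continuous_on {a..b} u" "continuous_on {a..b} k" "\<And>t. k t \<ge> 0" "integral {a..b} k \<le> C" "C > 0"
  shows "(integral {a..b} (\<lambda>t. u t * k t))\<^sup>2 \<le> C * integral {a..b} (\<lambda>t. (u t)\<^sup>2 * k t)"
proof -
  define A B K where "A = integral {a..b} (\<lambda>t. u t * k t)" and "B = integral {a..b} (\<lambda>t. (u t)\<^sup>2 * k t)"
    and "K = integral {a..b} k"
  \<comment> \<open>The value that minimizes the quadratic in l below once the mass K of k is
    replaced by its bound C.\<close>
  define l where "l = A / C"
  have i: "(\<lambda>t. u t * k t) integrable_on {a..b}" "(\<lambda>t. (u t)\<^sup>2 * k t) integrable_on {a..b}" "k integrable_on {a..b}"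
    using assms by (auto intro!: integrable_continuous_real continuous_intros)
  have "0 \<le> integral {a..b} (\<lambda>t. (u t - l)\<^sup>2 * k t)"
    using assms by (intro integral_nonneg integrable_continuous_real continuous_intros) auto
  also have "(\<lambda>t. (u t - l)\<^sup>2 * k t) = (\<lambda>t. ((u t)\<^sup>2 * k t - (2 * l) * (u t * k t)) + l\<^sup>2 * k t)"
    by (simp add: fun_eq_iff power2_eq_square algebra_simps)
  also have "integral {a..b} \<dots> = B - 2 * l * A + l\<^sup>2 * K"
    unfolding A_def B_def K_def using i
    by (simp add: integral_add integral_diff integrable_diff integrable_on_mult_right del: mult.assoc)
  also have "\<dots> \<le> B - 2 * l * A + l\<^sup>2 * C"
    using assms(4) by (simp add: K_def mult_left_mono)
  also have "\<dots> = B - A\<^sup>2 / C" using assms(5) by (simp add: l_def field_simps power2_eq_square)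
  finally show ?thesis using assms(5) by (simp add: A_def B_def field_simps)
qed

section \<open>The Perron kernel\<close>

lemma norm_of_real_powr: "y > 0 \<Longrightarrow> norm (complex_of_real y powr s) = y powr Re s"
  by (simp add: norm_powr_real_powr)

text \<open>For y <= 1 the line is moved right to Re s = T + 2, past no pole. For y > 1 it is moved
  left to Re s = - T, past the poles 0 and - 1 with residues 1 and - 1 / y. Moving only a distance
  of about T keeps the rectangle finite, and its far side and horizontal sides are all of size y^2 /
  T.\<close>

lemma perron_kernel:
  assumes y: "y > 0" and T: "T \<ge> 2"
  shows "norm (vertical_integral (\<lambda>s. of_real y powr s / (s * (s + 1))) 2 T - of_real (2 * pi * max 0 (1 - 1 / y)))
      \<le> 64 * y\<^sup>2 / T"
proof (cases "y \<le> 1")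
  case True
  define f where "f = (\<lambda>s :: complex. of_real y powr s / (s * (s + 1)))"
  have "s \<noteq> 0 \<and> s + 1 \<noteq> 0" if "Re s > 0" for s :: complex
    using that by (metis add.commute add_less_same_cancel1 not_less_iff_gr_or_eq one_complex.sel(1) plus_complex.sel(1)
        pos_add_strict zero_complex.sel(1) zero_less_one)
  then have hol: "f holomorphic_on {s. Re s > 0}"
    unfolding f_def using y by (intro holomorphic_intros) auto
  have conv: "convex {s :: complex. Re s > 0}" by (rule convex_halfspace_Re_gt)
  have nf: "norm (f s) \<le> y\<^sup>2 / R\<^sup>2" if "Re s \<ge> 2" "norm s \<ge> R" "R > 0" for s R
  proof -
    have "norm (s + 1) \<ge> norm s"
      using that by (simp add: cmod_def power2_eq_square) (simp add: algebra_simps)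
    then have "R * R \<le> norm s * norm (s + 1)" using that by (intro mult_mono) auto
    moreover have "y powr Re s \<le> y powr 2" using True y that by (intro powr_mono') auto
    ultimately show ?thesis
      using y that unfolding f_def norm_divide norm_mult norm_of_real_powr[OF y]
      by (intro frac_le) (auto simp: power2_eq_square powr_numeral)
  qed
  have T0: "T > 0" using T by simp
  have "norm (vertical_integral f (T + 2) T - vertical_integral f 2 T) \<le> 2 * (y\<^sup>2 / T\<^sup>2) * (T + 2 - 2)"
  proof (rule rectangle_shift[OF hol conv])
    show "cbox (Complex 2 (- T)) (Complex (T + 2) T) \<subseteq> {s. Re s > 0}"
      by (auto simp: in_cbox_complex_iff)
    fix x assume "x \<in> {2..T + 2}"
    then show "norm (f (Complex x T)) \<le> y\<^sup>2 / T\<^sup>2 \<and> norm (f (Complex x (- T))) \<le> y\<^sup>2 / T\<^sup>2"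
      using T0 abs_Im_le_cmod[of "Complex x T"] abs_Im_le_cmod[of "Complex x (- T)"]
      by (intro conjI nf) auto
  qed (use T0 in auto)
  also have "\<dots> = 2 * y\<^sup>2 / T" using T0 by (simp add: power2_eq_square)
  finally have 1: "norm (vertical_integral f (T + 2) T - vertical_integral f 2 T) \<le> 2 * y\<^sup>2 / T" .
  have "norm (vertical_integral f (T + 2) T) \<le> integral {- T..T} (\<lambda>_. y\<^sup>2 / T\<^sup>2)"
  proof (rule norm_vertical_integral_le[OF holomorphic_on_imp_continuous_on[OF hol]])
    fix t assume "t \<in> {- T..T}"
    then show "norm (f (Complex (T + 2) t)) \<le> y\<^sup>2 / T\<^sup>2"
      using T0 abs_Re_le_cmod[of "Complex (T + 2) t"] by (intro nf) auto
  qed (use T0 in auto)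
  also have "\<dots> = 2 * y\<^sup>2 / T" using T0 by (simp add: power2_eq_square)
  finally have 2: "norm (vertical_integral f (T + 2) T) \<le> 2 * y\<^sup>2 / T" .
  have "norm (vertical_integral f 2 T) \<le> 4 * y\<^sup>2 / T"
    using norm_triangle_ineq4[of "vertical_integral f (T + 2) T" "vertical_integral f (T + 2) T - vertical_integral f 2 T"] 1 2
    by simp
  also have "\<dots> \<le> 64 * y\<^sup>2 / T" using T0 y by (intro divide_right_mono) auto
  finally have "norm (vertical_integral f 2 T) \<le> 64 * y\<^sup>2 / T" .
  moreover have "max 0 (1 - 1 / y) = 0" using True y by simp
  ultimately show ?thesis by (simp add: f_def)
next
  case False
  define g where "g = (\<lambda>s. of_real y powr s :: complex)"
  have hol: "g holomorphic_on UNIV"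
    unfolding g_def using y by (intro holomorphic_intros) auto
  have T0: "T > 0" using T by simp
  have ng: "norm (g s) \<le> y\<^sup>2" if "Re s \<le> 2" for s
    using that False powr_mono[of "Re s" 2 y] y by (simp add: g_def norm_of_real_powr powr_numeral)
  define f where "f = (\<lambda>s :: complex. of_real y powr s / (s * (s + 1)))"
  let ?r = "rectpath (Complex (- T) (- T)) (Complex 2 T)"
  have less: "Re (Complex (- T) (- T)) \<le> Re (Complex 2 T)" "Im (Complex (- T) (- T)) \<le> Im (Complex 2 T)"
    using T by auto
  have box: "0 \<in> box (Complex (- T) (- T)) (Complex 2 T)" "- 1 \<in> box (Complex (- T) (- T)) (Complex 2 T)"
    using T by (auto simp: in_box_complex_iff)
  then have nin: "0 \<notin> path_image ?r" "- 1 \<notin> path_image ?r"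
    using path_image_rectpath_inter_box[OF less] by blast+
  have res: "((\<lambda>w. g w / (w - z)) has_contour_integral (2 * pi * \<i> * g z)) ?r"
    if "z \<in> box (Complex (- T) (- T)) (Complex 2 T)" "z \<notin> path_image ?r" for z
  proof -
    have "((\<lambda>w. g w / (w - z)) has_contour_integral (2 * pi * \<i> * winding_number ?r z * g z)) ?r"
      using that by (intro Cauchy_integral_formula_convex_simple[OF _ hol]) auto
    then show ?thesis using winding_number_rectpath[OF that(1)] by simp
  qed
  \<comment> \<open>The partial fractions 1 / (s (s + 1)) = 1 / s - 1 / (s + 1) reduce the two poles
    to two applications of the Cauchy formula for g.\<close>
  have "((\<lambda>w. g w / (w - 0) - g w / (w - (- 1))) has_contour_integral (2 * pi * \<i> * g 0 - 2 * pi * \<i> * g (- 1))) ?r"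
    by (intro has_contour_integral_diff res box nin)
  moreover have "2 * pi * \<i> * g 0 - 2 * pi * \<i> * g (- 1) = 2 * pi * \<i> * (1 - 1 / y)"
  proof -
    have "g (- 1) = of_real (y powr (- 1))"
      using y unfolding g_def by (metis less_imp_le of_real_1 of_real_minus powr_of_real)
    moreover have "y powr (- 1) = 1 / y" using y by (simp add: powr_minus_divide)
    moreover have "g 0 = 1" using y by (simp add: g_def)
    ultimately show ?thesis by (simp add: algebra_simps)
  qed
  ultimately have "((\<lambda>w. g w / (w - 0) - g w / (w - (- 1))) has_contour_integral (2 * pi * \<i> * (1 - 1 / y))) ?r"
    by simp
  then have int: "(f has_contour_integral (2 * pi * \<i> * (1 - 1 / y))) ?r"
  proof (rule has_contour_integral_eq)
    fix w assume "w \<in> path_image ?r"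
    then have "w \<noteq> 0" "w + 1 \<noteq> 0" using nin by (auto simp: add_eq_0_iff2)
    then show "g w / (w - 0) - g w / (w - (- 1)) = f w"
      by (simp add: f_def g_def field_simps)
  qed
  have cont: "continuous_on A f" if "0 \<notin> A" "- 1 \<notin> A" for A
    unfolding f_def using that y by (intro continuous_intros) (auto simp: add_eq_0_iff2)
  have nf: "norm (f s) \<le> y\<^sup>2 / (R1 * R2)" if "Re s \<le> 2" "norm s \<ge> R1" "norm (s + 1) \<ge> R2" "R1 > 0" "R2 > 0" for s R1 R2
  proof -
    have "R1 * R2 \<le> norm s * norm (s + 1)" using that by (intro mult_mono) auto
    then show ?thesis
      using that ng[OF that(1)] unfolding f_def g_def norm_divide norm_mult
      by (intro frac_le) auto
  qed
  have "norm (\<i> * (vertical_integral f 2 T - vertical_integral f (- T) T) - 2 * pi * \<i> * (1 - 1 / y)) \<le> 2 * (y\<^sup>2 / (T * T)) * (2 - (- T))"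
  proof (rule rectangle_integral[OF int cont[OF nin]])
    fix x assume "x \<in> {- T..2}"
    then show "norm (f (Complex x T)) \<le> y\<^sup>2 / (T * T) \<and> norm (f (Complex x (- T))) \<le> y\<^sup>2 / (T * T)"
      using T0 abs_Im_le_cmod[of "Complex x T"] abs_Im_le_cmod[of "Complex x (- T)"]
        abs_Im_le_cmod[of "Complex x T + 1"] abs_Im_le_cmod[of "Complex x (- T) + 1"]
      by (intro conjI nf) auto
  qed (use T0 in auto)
  also have "\<i> * (vertical_integral f 2 T - vertical_integral f (- T) T) - 2 * pi * \<i> * (1 - 1 / y) =
     \<i> * (vertical_integral f 2 T - vertical_integral f (- T) T - 2 * pi * (1 - 1 / y))"
    by (simp add: algebra_simps)
  also have "2 * (y\<^sup>2 / (T * T)) * (2 - (- T)) \<le> 2 * (y\<^sup>2 / (T * T)) * (2 * T)"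
    using T by (intro mult_left_mono) auto
  also have "\<dots> = 4 * y\<^sup>2 / T" using T0 by simp
  finally have 1: "norm (vertical_integral f 2 T - vertical_integral f (- T) T - 2 * pi * (1 - 1 / y)) \<le> 4 * y\<^sup>2 / T"
    by (simp only: norm_mult norm_ii mult_1)
  have "norm (vertical_integral f (- T) T) \<le> integral {- T..T} (\<lambda>_. y\<^sup>2 / (T * (T / 2)))"
  proof (rule norm_vertical_integral_le[where A = "{s. Re s = - T}"])
    show "continuous_on {s. Re s = - T} f" using T by (intro cont) auto
    fix t assume "t \<in> {- T..T}"
    then show "norm (f (Complex (- T) t)) \<le> y\<^sup>2 / (T * (T / 2))"
      using T abs_Re_le_cmod[of "Complex (- T) t"] abs_Re_le_cmod[of "Complex (- T) t + 1"] by (intro nf) auto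
  qed (use T0 in auto)
  also have "\<dots> = 4 * y\<^sup>2 / T" using T0 by simp
  finally have 2: "norm (vertical_integral f (- T) T) \<le> 4 * y\<^sup>2 / T" .
  have "norm (vertical_integral f 2 T - 2 * pi * (1 - 1 / y)) \<le> 8 * y\<^sup>2 / T"
    using norm_triangle_ineq[of "vertical_integral f 2 T - vertical_integral f (- T) T - 2 * pi * (1 - 1 / y)" "vertical_integral f (- T) T"] 1 2
    by simp
  also have "\<dots> \<le> 64 * y\<^sup>2 / T" using T0 y by (intro divide_right_mono) auto
  finally have "norm (vertical_integral f 2 T - 2 * pi * (1 - 1 / y)) \<le> 64 * y\<^sup>2 / T" .
  moreover have "max 0 (1 - 1 / y) = 1 - 1 / y" using False y by simp
  ultimately show ?thesis by (simp add: f_def)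
qed

section \<open>The Borel--Caratheodory inequality\<close>

text \<open>The Schwarz lemma applied to f / (2 M - f), which stays in the unit disc because Re f <
  M puts f closer to 0 than to 2 M.\<close>

lemma borel_caratheodory:
  fixes f :: "complex \<Rightarrow> complex"
  assumes hol: "f holomorphic_on ball z0 R" and "R > 0" "f z0 = 0"
    and re: "\<And>z. z \<in> ball z0 R \<Longrightarrow> Re (f z) < M" and z: "norm (z - z0) \<le> r" and "r < R"
  shows "norm (f z) \<le> 2 * r * M / (R - r)"
proof -
  define w where "w = (z - z0) / of_real R"
  define g where "g = (\<lambda>w. f (z0 + of_real R * w) / (2 * of_real M - f (z0 + of_real R * w)))"
  have M: "M > 0" using re[of z0] assms by simp
  have r0: "r \<ge> 0" using z norm_ge_zero order_trans by blast
  have mem: "z0 + of_real R * w \<in> ball z0 R" if "w \<in> ball 0 1" for w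
    using that \<open>R > 0\<close> by (simp add: dist_norm norm_mult)
  have re2: "Re (2 * of_real M - f (z0 + of_real R * w)) > 0" if "w \<in> ball 0 1" for w
    using re[OF mem[OF that]] M by simp
  have nz: "2 * of_real M - f (z0 + of_real R * w) \<noteq> 0" if "w \<in> ball 0 1" for w
    using re2[OF that] by (metis less_irrefl zero_complex.sel(1))
  have "(\<lambda>w. f (z0 + of_real R * w)) holomorphic_on ball 0 1"
    using mem by (intro holomorphic_on_compose_gen[OF _ hol, unfolded o_def]) (auto intro!: holomorphic_intros)
  then have holg: "g holomorphic_on ball 0 1"
    unfolding g_def using nz by (intro holomorphic_intros) auto
  have g0: "g 0 = 0" using assms by (simp add: g_def)
  have g1: "norm (g w) < 1" if "norm w < 1" for w
  proof -
    let ?v = "f (z0 + of_real R * w)"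
    have "Re ?v < M" using that by (intro re mem) auto
    then have "(Re ?v)\<^sup>2 < (2 * M - Re ?v)\<^sup>2"
      using M by (simp add: power2_eq_square algebra_simps)
    then have "norm ?v < norm (2 * of_real M - ?v)"
      unfolding cmod_def by (intro real_sqrt_less_mono) simp
    then show ?thesis
      using nz[of w] that by (simp add: g_def norm_divide divide_less_eq)
  qed
  have nw: "norm w \<le> r / R" "norm w < 1"
    using z \<open>R > 0\<close> \<open>r < R\<close> by (auto simp: w_def norm_divide divide_right_mono)
  have "norm (g w) \<le> norm w" by (rule Schwarz_Lemma(1)[OF holg g0 g1 nw(2)])
  moreover have "z0 + of_real R * w = z" using \<open>R > 0\<close> by (simp add: w_def)
  ultimately have "norm (f z / (2 * of_real M - f z)) \<le> r / R" using nw by (simp add: g_def)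
  moreover have "2 * of_real M - f z \<noteq> 0" using nz[of w] nw \<open>z0 + of_real R * w = z\<close> by simp
  ultimately have "norm (f z) \<le> r / R * norm (2 * of_real M - f z)"
    by (simp add: norm_divide divide_le_eq)
  also have "\<dots> \<le> r / R * (2 * M + norm (f z))"
    using norm_triangle_ineq4[of "2 * of_real M" "f z"] M r0 \<open>R > 0\<close> by (intro mult_left_mono) (auto simp: norm_mult)
  finally have "norm (f z) * (R - r) \<le> 2 * r * M"
    using \<open>R > 0\<close> by (simp add: field_simps)
  then show ?thesis using \<open>r < R\<close> by (simp add: pos_le_divide_eq)
qed

section \<open>Bounds for the Gamma function\<close>

lemma norm_Gamma_le:
  assumes "Re z > 0"
  shows "norm (Gamma z) \<le> Gamma (Re z)"
proof -
  have "norm (integral {0..} (\<lambda>t. complex_of_real t powr (z - 1) / of_real (exp t))) \<le>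
      integral {0..} (\<lambda>t. t powr (Re z - 1) / exp t)"
  proof (rule integral_norm_bound_integral)
    show "(\<lambda>t. complex_of_real t powr (z - 1) / of_real (exp t)) integrable_on {0..}"
      using Gamma_integral_complex[OF assms] by blast
    show "(\<lambda>t. t powr (Re z - 1) / exp t) integrable_on {0..}"
      using Gamma_integral_real[OF assms] by blast
    fix t :: real assume "t \<in> {0..}"
    then show "norm (complex_of_real t powr (z - 1) / of_real (exp t)) \<le> t powr (Re z - 1) / exp t"
      by (cases "t = 0") (auto simp: norm_divide norm_powr_real_powr)
  qed
  then show ?thesis
    using Gamma_integral_complex[OF assms] Gamma_integral_real[OF assms]
    by (simp add: integral_unique)
qed

lemma Gamma_bounded_strip:
  assumes "a > 0"
  shows "\<exists>B\<ge>0. \<forall>z. a \<le> Re z \<longrightarrow> Re z \<le> b \<longrightarrow> norm (Gamma z) \<le> B"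
proof -
  have "continuous_on {a..b} (Gamma :: real \<Rightarrow> real)"
    using assms by (intro continuous_intros) (auto elim!: nonpos_Ints_cases)
  then have "bounded ((Gamma :: real \<Rightarrow> real) ` {a..b})"
    by (intro compact_imp_bounded compact_continuous_image) auto
  then obtain B where B: "\<And>x. x \<in> {a..b} \<Longrightarrow> norm (Gamma x :: real) \<le> B" "B > 0"
    unfolding bounded_pos by blast
  have "norm (Gamma z) \<le> B" if "a \<le> Re z" "Re z \<le> b" for z
  proof -
    have "norm (Gamma z) \<le> Gamma (Re z)" using that assms by (intro norm_Gamma_le) simp
    also have "\<dots> \<le> B" using B(1)[of "Re z"] that by simp
    finally show ?thesis .
  qed
  with B(2) show ?thesis by (intro exI[of _ B]) auto
qed

lemma norm_sin_le_exp: "norm (sin z) \<le> exp \<bar>Im z\<bar>" for z :: complex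
  using cmod_sin_le_exp[of 1 z] by simp

text \<open>For |Im z| >= 1 the recurrence shows that a step to the left does not decrease |rGamma|.
  After enough such steps reflection expresses rGamma through a sine, the source of the exponential,
  and a Gamma value in a bounded strip of the right half-plane. Such crude growth is enough for a
  Phragmen-Lindelof argument.\<close>

lemma rGamma_strip_bound:
  "\<exists>B\<ge>0. \<forall>z. a \<le> Re z \<longrightarrow> Re z \<le> b \<longrightarrow> \<bar>Im z\<bar> \<ge> 1 \<longrightarrow> norm (rGamma z) \<le> B * exp (pi * \<bar>Im z\<bar>)"
proof -
  have shift: "norm (rGamma z) \<le> norm (rGamma (z - of_nat m))" if "\<bar>Im z\<bar> \<ge> 1" for z :: complex and m
  proof (induction m)
    case (Suc m)
    have "rGamma (z - of_nat (Suc m)) = (z - of_nat (Suc m)) * rGamma (z - of_nat m)"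
      using rGamma_plus1[of "z - of_nat (Suc m)"] by (simp add: algebra_simps)
    moreover have "norm (z - of_nat (Suc m)) \<ge> 1"
      using that abs_Im_le_cmod[of "z - of_nat (Suc m)"] by simp
    ultimately show ?case
      using Suc by (simp add: norm_mult) (metis mult_le_cancel_right1 norm_ge_zero not_le order_trans)
  qed simp
  define m where "m = nat \<lceil>b\<rceil>"
  have m: "b - real m \<le> 0" unfolding m_def by linarith
  obtain B where B: "B \<ge> 0" "\<And>z. 1 \<le> Re z \<Longrightarrow> Re z \<le> 1 - a + real m \<Longrightarrow> norm (Gamma z) \<le> B"
    using Gamma_bounded_strip[of 1 "1 - a + real m"] by auto
  have "norm (rGamma z) \<le> B * exp (pi * \<bar>Im z\<bar>)" if z: "a \<le> Re z" "Re z \<le> b" "\<bar>Im z\<bar> \<ge> 1" for z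
  proof -
    define w where "w = z - of_nat m"
    have w: "1 \<le> Re (1 - w)" "Re (1 - w) \<le> 1 - a + real m" "Im w = Im z"
      using z m by (auto simp: w_def)
    have "Gamma (1 - w) \<noteq> 0"
    proof
      assume "Gamma (1 - w) = 0"
      then obtain n where "1 - w = of_int n" "n \<le> 0"
        by (auto simp: Gamma_eq_zero_iff elim!: nonpos_Ints_cases)
      then have "Re (1 - w) \<le> 0" by simp
      with w show False by simp
    qed
    then have "rGamma w = Gamma (1 - w) * (rGamma w * rGamma (1 - w))"
      by (simp add: rGamma_inverse_Gamma)
    also have "rGamma w * rGamma (1 - w) = sin (of_real pi * w) / of_real pi"
      by (rule rGamma_reflection_complex)
    finally have "norm (rGamma w) = norm (Gamma (1 - w)) * norm (sin (of_real pi * w)) / pi"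
      by (simp add: norm_mult norm_divide)
    also have "\<dots> \<le> B * exp (pi * \<bar>Im z\<bar>) / 1"
      using B w norm_sin_le_exp[of "of_real pi * w"] pi_gt3
      by (intro frac_le mult_mono) (auto simp: abs_mult)
    finally show ?thesis using shift[OF z(3), of m] by (simp add: w_def)
  qed
  with B(1) show ?thesis by blast
qed

section \<open>The completed functions\<close>

lemma is_entire_extension_unique:
  assumes "is_entire_extension f g" "is_entire_extension f h"
  shows "g = h"
proof
  fix z
  show "g z = h z"
  proof (rule analytic_continuation_open[of "{s. Re s > 1}" UNIV g h])
    show "{s :: complex. Re s > 1} \<noteq> {}" by (auto intro: exI[of _ 2])
  qed (use assms in \<open>auto simp: is_entire_extension_def open_halfspace_Re_gt\<close>)
qed

lemma entire_extension_eqI: "is_entire_extension f g \<Longrightarrow> entire_extension f = g"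
  unfolding entire_extension_def using is_entire_extension_unique by blast

text \<open>The reciprocal of \<open>Gamma_R\<close> as an entire function.\<close>

definition rGamma_R :: "complex \<Rightarrow> complex" where
  "rGamma_R s = of_real pi powr (s / 2) * rGamma (s / 2)"

text \<open>This is s times \<open>Gamma_R s\<close> with the pole at 0 removed; it is holomorphic
  for Re s > - 2.\<close>

definition Gamma_R_reg :: "complex \<Rightarrow> complex" where
  "Gamma_R_reg s = 2 * of_real pi powr (- s / 2) * Gamma (s / 2 + 1)"

lemma pi_powr_cancel: "complex_of_real pi powr s * of_real pi powr (- s) = 1"
  by (simp flip: powr_add)

lemma not_nonpos_Int_Re: "Re s > 0 \<Longrightarrow> s \<notin> \<int>\<^sub>\<le>\<^sub>0"
  by (auto elim!: nonpos_Ints_cases)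

lemma Gamma_R_mult_rGamma_R:
  assumes "Re s > 0"
  shows "Gamma_R s * rGamma_R s = 1"
proof -
  have "Gamma (s / 2) \<noteq> 0" using assms not_nonpos_Int_Re[of "s / 2"] by (simp add: Gamma_eq_zero_iff)
  then have "Gamma (s / 2) * rGamma (s / 2) = 1" by (simp add: rGamma_inverse_Gamma)
  moreover have "Gamma_R s * rGamma_R s =
      (of_real pi powr (s / 2) * of_real pi powr (- (s / 2))) * (Gamma (s / 2) * rGamma (s / 2))"
    by (simp add: Gamma_R_def rGamma_R_def mult_ac)
  ultimately show ?thesis by (simp only: pi_powr_cancel mult_1)
qed

lemma Gamma_R_mult_self:
  assumes "Re s > 0"
  shows "Gamma_R s * s = Gamma_R_reg s"
  using Gamma_plus1[OF not_nonpos_Int_Re[of "s / 2"]] assms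
  by (simp add: Gamma_R_def Gamma_R_reg_def mult_ac)

lemma rGamma_R_add_2: "rGamma_R s = rGamma_R (s + 2) * (s / (2 * of_real pi))"
proof -
  have "s / 2 * rGamma (s / 2 + 1) = rGamma (s / 2)" by (rule rGamma_plus1)
  moreover have "complex_of_real pi powr ((s + 2) / 2) = of_real pi powr (s / 2) * of_real pi"
    by (simp add: add_divide_distrib powr_add)
  ultimately show ?thesis
    by (simp add: rGamma_R_def add_divide_distrib mult_ac)
qed

lemma cnj_Gamma_R: "cnj (Gamma_R s) = Gamma_R (cnj s)"
  by (simp add: Gamma_R_def cnj_Gamma cnj_powr)

lemma rGamma_R_holomorphic [holomorphic_intros]:
  "f holomorphic_on A \<Longrightarrow> (\<lambda>s. rGamma_R (f s)) holomorphic_on A"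
  unfolding rGamma_R_def by (intro holomorphic_intros) auto

lemma Gamma_R_reg_holomorphic [holomorphic_intros]:
  assumes "f holomorphic_on A" "\<And>s. s \<in> A \<Longrightarrow> Re (f s) > - 2"
  shows "(\<lambda>s. Gamma_R_reg (f s)) holomorphic_on A"
proof -
  have "f s / 2 + 1 \<notin> \<int>\<^sub>\<le>\<^sub>0" if "s \<in> A" for s
    using assms(2)[OF that] by (intro not_nonpos_Int_Re) simp
  then show ?thesis
    unfolding Gamma_R_reg_def by (intro holomorphic_intros assms(1)) auto
qed

lemma powr_strip_bounded:
  fixes y :: real
  assumes "y > 0"
  shows "\<exists>B\<ge>0. \<forall>s :: complex. a \<le> Re s \<longrightarrow> Re s \<le> b \<longrightarrow> norm (complex_of_real y powr s) \<le> B"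
proof (intro exI[of _ "max (y powr a) (y powr b)"] conjI allI impI)
  fix s :: complex assume s: "a \<le> Re s" "Re s \<le> b"
  have "y powr Re s \<le> max (y powr a) (y powr b)"
  proof (cases "y \<ge> 1")
    case True
    then have "y powr Re s \<le> y powr b" using s by (intro powr_mono) auto
    then show ?thesis by simp
  next
    case False
    then have "y powr Re s \<le> y powr a" using s assms by (intro powr_mono') auto
    then show ?thesis by simp
  qed
  then show "norm (complex_of_real y powr s) \<le> max (y powr a) (y powr b)"
    using assms by (simp add: norm_of_real_powr)
qed (simp add: le_max_iff_disj)

lemma Gamma_R_reg_bounded:
  assumes "a > - 2"
  shows "\<exists>B\<ge>0. \<forall>s. a \<le> Re s \<longrightarrow> Re s \<le> b \<longrightarrow> norm (Gamma_R_reg s) \<le> B"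
proof -
  obtain B1 where B1: "B1 \<ge> 0" "\<And>s :: complex. - b / 2 \<le> Re s \<Longrightarrow> Re s \<le> - a / 2 \<Longrightarrow> norm (complex_of_real pi powr s) \<le> B1"
    using powr_strip_bounded[of pi "- b / 2" "- a / 2"] by auto
  obtain B2 where B2: "B2 \<ge> 0" "\<And>s. a / 2 + 1 \<le> Re s \<Longrightarrow> Re s \<le> b / 2 + 1 \<Longrightarrow> norm (Gamma s) \<le> B2"
    using Gamma_bounded_strip[of "a / 2 + 1" "b / 2 + 1"] assms by auto
  have "norm (Gamma_R_reg s) \<le> 2 * (B1 * B2)" if "a \<le> Re s" "Re s \<le> b" for s
  proof -
    have "norm (complex_of_real pi powr (- s / 2)) * norm (Gamma (s / 2 + 1)) \<le> B1 * B2"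
      using that B1(1) by (intro mult_mono B1 B2) auto
    then show ?thesis by (simp add: Gamma_R_reg_def norm_mult mult_ac)
  qed
  with B1(1) B2(1) show ?thesis by (intro exI[of _ "2 * (B1 * B2)"]) auto
qed

lemma rGamma_R_bounded:
  "\<exists>B\<ge>0. \<forall>s. a \<le> Re s \<longrightarrow> Re s \<le> b \<longrightarrow> \<bar>Im s\<bar> \<ge> 2 \<longrightarrow> norm (rGamma_R s) \<le> B * exp (pi * \<bar>Im s\<bar>)"
proof -
  obtain B1 where B1: "B1 \<ge> 0" "\<And>s :: complex. a / 2 \<le> Re s \<Longrightarrow> Re s \<le> b / 2 \<Longrightarrow> norm (complex_of_real pi powr s) \<le> B1"
    using powr_strip_bounded[of pi "a / 2" "b / 2"] by auto
  obtain B2 where B2: "B2 \<ge> 0" "\<And>s. a / 2 \<le> Re s \<Longrightarrow> Re s \<le> b / 2 \<Longrightarrow> \<bar>Im s\<bar> \<ge> 1 \<Longrightarrow> norm (rGamma s) \<le> B2 * exp (pi * \<bar>Im s\<bar>)"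
    using rGamma_strip_bound[of "a / 2" "b / 2"] by auto
  have "norm (rGamma_R s) \<le> (B1 * B2) * exp (pi * \<bar>Im s\<bar>)" if s: "a \<le> Re s" "Re s \<le> b" "\<bar>Im s\<bar> \<ge> 2" for s
  proof -
    have "norm (rGamma (s / 2)) \<le> B2 * exp (pi * \<bar>Im (s / 2)\<bar>)" using s by (intro B2) auto
    also have "\<dots> \<le> B2 * exp (pi * \<bar>Im s\<bar>)" using B2(1) by (intro mult_left_mono) auto
    finally have "norm (complex_of_real pi powr (s / 2)) * norm (rGamma (s / 2)) \<le> B1 * (B2 * exp (pi * \<bar>Im s\<bar>))"
      using s B1(1) by (intro mult_mono B1) auto
    then show ?thesis by (simp add: rGamma_R_def norm_mult mult_ac)
  qed
  with B1(1) B2(1) show ?thesis by (intro exI[of _ "B1 * B2"]) auto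
qed

lemma twist_series_dual:
  assumes "\<And>s. Re s > 1 \<Longrightarrow> summable (\<lambda>n. twist_term F chi s (Suc n))" "Re s > 1"
  shows "twist_series (dual F) (\<lambda>n. cnj (chi n)) s = cnj (twist_series F chi (cnj s))"
proof -
  have "twist_term (dual F) (\<lambda>n. cnj (chi n)) s (Suc n) = cnj (twist_term F chi (cnj s) (Suc n))" for n
    using cnj_powr[of "of_nat (Suc n)" s] by (simp add: twist_term_def dual_def cnj_powr del: of_nat_Suc)
  moreover have "(\<lambda>n. twist_term F chi (cnj s) (Suc n)) sums twist_series F chi (cnj s)"
    using assms by (simp add: twist_series_def summable_sums)
  ultimately show ?thesis
    unfolding twist_series_def[of "dual F"] by (simp add: sums_cnj sums_unique[symmetric])
qed

context L_framework
begin

abbreviation "dF \<equiv> L_degree F"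

definition theta :: real where
  "theta = (SOME \<theta>. 1 / (2 * real dF) < \<theta> \<and> \<theta> < 1 / 2 \<and>
               (\<forall>e\<in>{1, - 1}. \<forall>j<dF. Re (L_shift F e j) \<ge> - 1 + \<theta>))"

lemma theta: "0 < theta" "theta < 1 / 2"
  and shift_ge: "e \<in> {1, - 1} \<Longrightarrow> j < dF \<Longrightarrow> Re (L_shift F e j) \<ge> - 1 + theta"
proof -
  have *: "1 / (2 * real dF) < theta \<and> theta < 1 / 2 \<and>
               (\<forall>e\<in>{1, - 1}. \<forall>j<dF. Re (L_shift F e j) \<ge> - 1 + theta)"
    unfolding theta_def by (rule someI_ex[OF shift_bound])
  \<comment> \<open>In degree 0 the lower bound for \<open>theta\<close> is still nonnegative, as
    the quotient is then 0 by convention.\<close>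
  then show "0 < theta" by (smt (verit) divide_nonneg_nonneg of_nat_0_le_iff)
  from * show "theta < 1 / 2" by blast
  from * show "e \<in> {1, - 1} \<Longrightarrow> j < dF \<Longrightarrow> Re (L_shift F e j) \<ge> - 1 + theta" by blast
qed

text \<open>A single constant that bounds every twist, and every prime series, on Re s >= 3 / 2,
  uniformly in the character.\<close>

definition abs_series :: real where
  "abs_series = (\<Sum>n. norm (L_coeff F (Suc n)) / real (Suc n) powr (3 / 2))"

lemma summable_abs_coeff: "\<sigma> > 1 \<Longrightarrow> summable (\<lambda>n. norm (L_coeff F (Suc n)) / real (Suc n) powr \<sigma>)"
proof -
  assume "\<sigma> > 1"
  then have "summable (\<lambda>n. norm (twist_term F (\<lambda>_. 1) (of_real \<sigma>) (Suc n)))"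
    using euler_product unfolding has_euler_product_def by auto
  moreover have "norm (twist_term F (\<lambda>_. 1) (of_real \<sigma>) (Suc n)) = norm (L_coeff F (Suc n)) / real (Suc n) powr \<sigma>" for n
    using norm_of_real_powr[of "real (Suc n)" "of_real \<sigma>"] by (simp add: twist_term_def norm_divide del: of_nat_Suc)
  ultimately show ?thesis by simp
qed

lemma norm_twist_term_le:
  assumes "\<And>n. norm (chi n) \<le> 1"
  shows "norm (twist_term F chi s (Suc n)) \<le> norm (L_coeff F (Suc n)) / real (Suc n) powr Re s"
proof -
  have "norm (L_coeff F (Suc n)) * norm (chi (int (Suc n))) \<le> norm (L_coeff F (Suc n)) * 1"
    by (intro mult_left_mono assms) auto
  then show ?thesis
    using norm_of_real_powr[of "real (Suc n)" s]
    by (simp add: twist_term_def norm_divide norm_mult divide_right_mono del: of_nat_Suc)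
qed

lemma norm_twist_series_le:
  assumes "\<And>n. norm (chi n) \<le> 1" "Re s \<ge> 3 / 2"
  shows "norm (twist_series F chi s) \<le> abs_series"
proof -
  have le: "norm (twist_term F chi s (Suc n)) \<le> norm (L_coeff F (Suc n)) / real (Suc n) powr (3 / 2)" for n
  proof -
    have "real (Suc n) powr (3 / 2) \<le> real (Suc n) powr Re s"
      using assms(2) by (intro powr_mono) auto
    then have "norm (L_coeff F (Suc n)) / real (Suc n) powr Re s \<le> norm (L_coeff F (Suc n)) / real (Suc n) powr (3 / 2)"
      by (intro divide_left_mono) auto
    then show ?thesis using norm_twist_term_le[where chi = chi and s = s and n = n, OF assms(1)] by linarith
  qed
  show ?thesis
    unfolding twist_series_def abs_series_def
    by (rule norm_suminf_le[OF le summable_abs_coeff]) simp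
qed

lemma abs_series_ge_1: "abs_series \<ge> 1"
proof -
  have "(\<Sum>n\<in>{0}. norm (L_coeff F (Suc n)) / real (Suc n) powr (3 / 2)) \<le> abs_series"
    unfolding abs_series_def by (intro sum_le_suminf summable_abs_coeff) auto
  then show ?thesis using coeff_1 by simp
qed

context
  fixes q :: nat and chi :: "int \<Rightarrow> complex"
  assumes q: "q \<ge> 2" and chi: "chi \<in> primitive_characters q"
begin

abbreviation (input) "N \<equiv> L_conductor F q"
abbreviation (input) "mu \<equiv> L_shift F (chi (- 1))"
abbreviation (input) "Lam \<equiv> L_completed F q chi"

lemma chi_dirichlet: "dirichlet_character q chi"
  using chi by (simp add: primitive_characters_def)

lemma chi_norm_le: "norm (chi n) \<le> 1"
  by (rule dirichlet_character_norm_le[OF chi_dirichlet])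

lemma chi_sign: "chi (- 1) \<in> {1, - 1}"
  by (rule primitive_character_minus_1[OF chi])

lemma N_pos: "N > 0" by (rule conductor_pos[OF q chi])

lemma mu_ge: "j < dF \<Longrightarrow> Re (mu j) \<ge> - 1 + theta"
  using shift_ge chi_sign by blast

lemma Lam_holomorphic: "Lam holomorphic_on A"
  using completed_entire[OF q chi] holomorphic_on_subset by (auto simp: is_entire_extension_def)

lemma Lam_eq: "Re s > 1 \<Longrightarrow> Lam s = twist_series F chi s * L_inf F q chi s"
  using completed_entire[OF q chi] by (auto simp: is_entire_extension_def)

lemma L_inf_inverse:
  assumes "Re s > 1"
  shows "L_inf F q chi s * (of_nat N powr (- s / 2) * (\<Prod>j<dF. rGamma_R (s + mu j))) = 1"
proof -
  have "(\<Prod>j<dF. Gamma_R (s + mu j)) * (\<Prod>j<dF. rGamma_R (s + mu j)) =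
      (\<Prod>j<dF. Gamma_R (s + mu j) * rGamma_R (s + mu j))"
    by (simp add: prod.distrib)
  also have "\<dots> = (\<Prod>j<dF. 1)"
  proof (intro prod.cong refl Gamma_R_mult_rGamma_R)
    fix j assume "j \<in> {..<dF}"
    then show "0 < Re (s + mu j)" using mu_ge[of j] assms theta by simp
  qed
  finally have 1: "(\<Prod>j<dF. Gamma_R (s + mu j)) * (\<Prod>j<dF. rGamma_R (s + mu j)) = 1" by simp
  have 2: "(of_nat N :: complex) powr (s / 2) * of_nat N powr (- s / 2) = 1"
    using N_pos by (simp flip: powr_add)
  show ?thesis
    unfolding L_inf_def using 1 2 by (simp add: mult_ac)
qed

text \<open>The framework provides an entire completed function. Dividing by the Gamma factors means
  multiplying by their entire reciprocals, so the twist itself is entire as well.\<close>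

lemma L_twist_entire: "is_entire_extension (twist_series F chi)
    (\<lambda>s. Lam s * (of_nat N powr (- s / 2) * (\<Prod>j<dF. rGamma_R (s + mu j))))"
  unfolding is_entire_extension_def
proof (intro conjI allI impI)
  show "(\<lambda>s. Lam s * (of_nat N powr (- s / 2) * (\<Prod>j<dF. rGamma_R (s + mu j)))) holomorphic_on UNIV"
    using N_pos by (intro holomorphic_intros Lam_holomorphic) auto
  fix s :: complex assume "Re s > 1"
  then show "Lam s * (of_nat N powr (- s / 2) * (\<Prod>j<dF. rGamma_R (s + mu j))) = twist_series F chi s"
    by (simp only: Lam_eq mult.assoc L_inf_inverse mult_1_right)
qed

lemma L_twist_eq: "L_twist F chi s = Lam s * (of_nat N powr (- s / 2) * (\<Prod>j<dF. rGamma_R (s + mu j)))"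
  unfolding L_twist_def entire_extension_eqI[OF L_twist_entire] ..

lemma L_twist_holomorphic: "L_twist F chi holomorphic_on A"
  unfolding L_twist_def entire_extension_eqI[OF L_twist_entire]
  using L_twist_entire holomorphic_on_subset by (auto simp: is_entire_extension_def)

lemma L_twist_series: "Re s > 1 \<Longrightarrow> L_twist F chi s = twist_series F chi s"
  unfolding L_twist_def entire_extension_eqI[OF L_twist_entire]
  using L_twist_entire by (auto simp: is_entire_extension_def)

lemma twist_summable: "Re s > 1 \<Longrightarrow> summable (\<lambda>n. norm (twist_term F chi s (Suc n)))"
  using euler_product_twist[OF q chi] by (simp add: has_euler_product_def)

text \<open>By uniqueness of the continuation the completed dual twist is cnj (Lam (cnj s)): the
  sign \<open>chi (- 1)\<close> is real, so the conjugate character selects the conjugates of the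
  same parameters. The functional equation thus becomes a relation for \<open>Lam\<close>
  alone.\<close>

lemma Lam_functional: "\<exists>\<kappa>. norm \<kappa> = 1 \<and> (\<forall>s. Lam s = \<kappa> * cnj (Lam (1 - cnj s)))"
proof -
  let ?g = "\<lambda>s. cnj (Lam (cnj s))"
  have surj: "cnj ` UNIV = UNIV" by (metis complex_cnj_cnj surjI)
  have "is_entire_extension (\<lambda>s. twist_series (dual F) (\<lambda>n. cnj (chi n)) s * L_inf (dual F) q (\<lambda>n. cnj (chi n)) s) ?g"
    unfolding is_entire_extension_def
  proof (intro conjI allI impI)
    have "(cnj \<circ> Lam \<circ> cnj) holomorphic_on cnj ` UNIV"
      by (intro holomorphic_on_compose_cnj_cnj) (auto intro: Lam_holomorphic simp: surj)
    then show "?g holomorphic_on UNIV" by (simp add: o_def surj)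
    fix s :: complex assume s: "Re s > 1"
    have "twist_series (dual F) (\<lambda>n. cnj (chi n)) s = cnj (twist_series F chi (cnj s))"
      by (rule twist_series_dual[OF summable_norm_cancel[OF twist_summable] s])
    moreover have "L_inf (dual F) q (\<lambda>n. cnj (chi n)) s = cnj (L_inf F q chi (cnj s))"
    proof -
      have "cnj (chi (- 1)) = chi (- 1)" using chi_sign by auto
      then show ?thesis
        using N_pos by (simp add: L_inf_def dual_def cnj_Gamma_R cnj_powr)
    qed
    ultimately show "?g s = twist_series (dual F) (\<lambda>n. cnj (chi n)) s * L_inf (dual F) q (\<lambda>n. cnj (chi n)) s"
      using s by (simp add: Lam_eq)
  qed
  then have "L_completed (dual F) q (\<lambda>n. cnj (chi n)) = ?g"
    unfolding L_completed_def by (rule entire_extension_eqI)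
  then show ?thesis using functional_equation[OF q chi] by simp
qed

text \<open>Order 1 gives exponents arbitrarily close to 1; 3 / 2 is a convenient one below 2, so
  that the Gaussian factors used later dominate.\<close>

lemma Lam_growth: "\<exists>R. \<forall>s. norm s \<ge> R \<longrightarrow> norm (Lam s) \<le> exp (norm s powr (3 / 2))"
proof -
  have "Inf {ereal a |a. a \<ge> 0 \<and> (\<forall>\<^sub>F z in at_infinity. norm (Lam z) < exp (norm z powr a))} < ereal (3 / 2)"
    using completed_order[OF q chi] by (simp add: entire_order_def one_ereal_def)
  then obtain a where a: "a < 3 / 2" "\<forall>\<^sub>F z in at_infinity. norm (Lam z) < exp (norm z powr a)"
    by (auto simp: Inf_less_iff)
  then obtain R where R: "\<And>z. norm z \<ge> R \<Longrightarrow> norm (Lam z) < exp (norm z powr a)"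
    by (auto simp: eventually_at_infinity)
  have "norm (Lam z) \<le> exp (norm z powr (3 / 2))" if "norm z \<ge> max R 1" for z
  proof -
    have "norm (Lam z) < exp (norm z powr a)" using R that by simp
    also have "\<dots> \<le> exp (norm z powr (3 / 2))" using a(1) that by (simp add: powr_mono)
    finally show ?thesis by simp
  qed
  then show ?thesis by blast
qed

end

end

section \<open>Polynomial growth of the twists by the Phragmen-Lindelof principle\<close>

lemma frontier_cbox_Complex:
  assumes "z \<in> frontier (cbox (Complex a c) (Complex b d))"
  shows "a \<le> Re z \<and> Re z \<le> b \<and> c \<le> Im z \<and> Im z \<le> d \<and> (Re z = a \<or> Re z = b \<or> Im z = c \<or> Im z = d)"
  using assms by (auto simp: frontier_def interior_cbox in_cbox_complex_iff in_box_complex_iff)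

text \<open>The multiplier exp ((s - s0)^2) is 1 at s0, at most exp ((b - a)^2) on the strip, and of
  size exp (- T^2) on horizontal sides at distance T, which beats growth of exponent 3 / 2. The
  maximum principle on a rectangle centred at the height of s0 then leaves only the vertical
  edges.\<close>

lemma phragmen_lindelof_strip:
  fixes g :: "complex \<Rightarrow> complex"
  assumes hol: "g holomorphic_on UNIV"
    and growth: "\<And>s. a \<le> Re s \<Longrightarrow> Re s \<le> b \<Longrightarrow> \<bar>Im s\<bar> \<ge> R \<Longrightarrow> norm (g s) \<le> B * exp ((norm s) powr (3 / 2) + k * norm s)"
    and edge: "\<And>s. Re s = a \<or> Re s = b \<Longrightarrow> norm (g s) \<le> A" and A: "A > 0"
    and ab: "a \<le> Re s0" "Re s0 \<le> b" "k \<ge> 0" "B \<ge> 0"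
  shows "norm (g s0) \<le> exp ((b - a)\<^sup>2) * A"
proof -
  define f where "f = (\<lambda>s. g s * exp ((s - s0)\<^sup>2))"
  define c where "c = \<bar>a\<bar> + \<bar>b\<bar> + \<bar>Im s0\<bar>"
  define E where "E = exp ((b - a)\<^sup>2) * A"
  have c0: "c \<ge> 0" by (simp add: c_def)
  have E0: "E > 0" using A by (simp add: E_def)
  have expn: "norm (exp ((s - s0)\<^sup>2)) \<le> exp ((b - a)\<^sup>2 - (Im s - Im s0)\<^sup>2)" if "a \<le> Re s" "Re s \<le> b" for s
  proof -
    have "(Re s - Re s0)\<^sup>2 \<le> (b - a)\<^sup>2"
      using that ab by (intro power2_le_iff_abs_le[THEN iffD2]) auto
    then show ?thesis by (simp add: Re_power2)
  qed
  have "((\<lambda>T. (B * exp ((T + c) powr (3 / 2) + k * (T + c))) * exp ((b - a)\<^sup>2 - T\<^sup>2)) \<longlongrightarrow> 0) at_top"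
    by real_asymp
  then have "\<forall>\<^sub>F T in at_top. (B * exp ((T + c) powr (3 / 2) + k * (T + c))) * exp ((b - a)\<^sup>2 - T\<^sup>2) < E"
    using E0 by (rule order_tendstoD)
  then have "\<forall>\<^sub>F T in at_top. (B * exp ((T + c) powr (3 / 2) + k * (T + c))) * exp ((b - a)\<^sup>2 - T\<^sup>2) < E \<and> T \<ge> \<bar>R\<bar> + c + 1"
    by (rule eventually_conj[OF _ eventually_ge_at_top])
  then obtain T where T: "(B * exp ((T + c) powr (3 / 2) + k * (T + c))) * exp ((b - a)\<^sup>2 - T\<^sup>2) < E" "T \<ge> \<bar>R\<bar> + c + 1"
    using eventually_happens'[OF trivial_limit_at_top_linorder] by blast
  let ?S = "cbox (Complex a (Im s0 - T)) (Complex b (Im s0 + T))"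
  have "norm (f s0) \<le> E"
  proof (rule maximum_modulus_frontier[of f ?S])
    show "f holomorphic_on interior ?S"
      unfolding f_def using hol by (intro holomorphic_intros) (auto elim: holomorphic_on_subset)
    show "continuous_on (closure ?S) f"
      unfolding f_def using hol
      by (intro holomorphic_on_imp_continuous_on holomorphic_intros) (auto elim: holomorphic_on_subset)
    show "bounded ?S" by (rule bounded_cbox)
    show "s0 \<in> ?S" using ab T c0 by (auto simp: in_cbox_complex_iff)
    fix s assume "s \<in> frontier ?S"
    then have s: "a \<le> Re s" "Re s \<le> b" "Im s0 - T \<le> Im s" "Im s \<le> Im s0 + T"
      "Re s = a \<or> Re s = b \<or> Im s = Im s0 - T \<or> Im s = Im s0 + T"
      using frontier_cbox_Complex by blast+
    show "norm (f s) \<le> E"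
    proof (cases "Re s = a \<or> Re s = b")
      case True
      have "norm (f s) \<le> A * exp ((b - a)\<^sup>2)"
        unfolding f_def norm_mult
      proof (intro mult_mono edge True)
        show "norm (exp ((s - s0)\<^sup>2)) \<le> exp ((b - a)\<^sup>2)"
          using expn[OF s(1,2)] by (rule order_trans) simp
      qed (use A in auto)
      then show ?thesis by (simp add: E_def mult.commute)
    next
      case False
      then have im: "\<bar>Im s - Im s0\<bar> = T" using s(5) T(2) c0 by auto
      then have "(Im s - Im s0)\<^sup>2 = T\<^sup>2" by (metis power2_abs)
      have "norm s \<le> \<bar>Re s\<bar> + \<bar>Im s\<bar>" by (rule cmod_le)
      also have "\<dots> \<le> T + c" using im s by (simp add: c_def)
      finally have ns: "norm s \<le> T + c" .
      have "norm (g s) \<le> B * exp ((norm s) powr (3 / 2) + k * norm s)"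
        using s im T(2) by (intro growth) (auto simp: c_def)
      also have "\<dots> \<le> B * exp ((T + c) powr (3 / 2) + k * (T + c))"
        using ns ab by (intro mult_left_mono) (auto intro!: add_mono powr_mono2 mult_left_mono)
      finally have "norm (f s) \<le> (B * exp ((T + c) powr (3 / 2) + k * (T + c))) * exp ((b - a)\<^sup>2 - T\<^sup>2)"
        unfolding f_def norm_mult
        using expn[OF s(1,2)] \<open>(Im s - Im s0)\<^sup>2 = T\<^sup>2\<close> ab by (intro mult_mono) auto
      with T(1) show ?thesis by linarith
    qed
  qed
  then show ?thesis by (simp add: f_def E_def)
qed

lemma one_plus_power_le_exp:
  fixes t :: real
  shows "(1 + \<bar>t\<bar>) ^ d \<le> exp ((real d)\<^sup>2 / 2) * exp (t\<^sup>2 / 2)"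
proof -
  have "(1 + \<bar>t\<bar>) ^ d \<le> exp \<bar>t\<bar> ^ d" by (intro power_mono) (auto intro: exp_ge_add_one_self)
  also have "\<dots> = exp (real d * \<bar>t\<bar>)" by (simp add: exp_of_nat_mult)
  also have "\<dots> \<le> exp ((real d)\<^sup>2 / 2 + t\<^sup>2 / 2)"
    using sum_squares_bound[of "real d" "\<bar>t\<bar>"] by simp
  finally show ?thesis by (simp add: exp_add)
qed

context L_framework
begin

definition shift_size :: real where
  "shift_size = 3 + (\<Sum>e\<in>{1, - 1}. \<Sum>j<dF. norm (L_shift F e j))"

lemma norm_shift_le: "e \<in> {1, - 1} \<Longrightarrow> j < dF \<Longrightarrow> norm (L_shift F e j) \<le> shift_size - 3"
proof -
  assume e: "e \<in> {1, - 1}" and j: "j < dF"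
  have "norm (L_shift F e j) \<le> (\<Sum>j<dF. norm (L_shift F e j))"
    using j by (intro member_le_sum) auto
  also have "\<dots> \<le> (\<Sum>e\<in>{1, - 1}. \<Sum>j<dF. norm (L_shift F e j))"
    using e by (intro member_le_sum[of e "{1, - 1}" "\<lambda>e. \<Sum>j<dF. norm (L_shift F e j)"]) (auto intro: sum_nonneg)
  finally show ?thesis by (simp add: shift_size_def)
qed

lemma shift_size_ge: "shift_size \<ge> 3"
  by (simp add: shift_size_def sum_nonneg)

text \<open>The factors \<open>1 / \<Gamma>\<^sub>R(s + \<mu> + 2)\<close> make the completed function bounded on both lines
  \<open>Re s = 3/2\<close> and \<open>Re s = - 1/2\<close>: on the second one they cancel the Gamma factors coming from the
  functional equation exactly in absolute value, so that Stirling's formula is not needed.\<close>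

lemma L_twist_bound:
  "\<exists>C\<ge>1. \<forall>q chi s. q \<ge> 2 \<longrightarrow> chi \<in> primitive_characters q \<longrightarrow> Re s \<ge> - 1 / 2 \<longrightarrow>
     norm (L_twist F chi s) \<le> C * real (L_conductor F q) * (1 + \<bar>Im s\<bar>) ^ dF"
proof -
  obtain B where B: "B \<ge> 0" "\<And>s. - 1 \<le> Re s \<Longrightarrow> Re s \<le> 4 + shift_size \<Longrightarrow> \<bar>Im s\<bar> \<ge> 2 \<Longrightarrow>
      norm (rGamma_R s) \<le> B * exp (pi * \<bar>Im s\<bar>)"
    using rGamma_R_bounded[of "- 1" "4 + shift_size"] by auto
  \<comment> \<open>\<open>exp 4\<close> is the loss exp ((b - a)^2) for the strip from - 1 / 2 to 3
    / 2, \<open>(4 * pi) ^ dF\<close> comes from the right edge, and the last factor from the linear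
    factors that restore the twist.\<close>
  define C where "C = exp 4 * abs_series * (4 * pi) ^ dF * shift_size ^ dF"
  have pi4: "(4 * pi) ^ dF \<ge> 1" using pi_gt3 by (intro one_le_power) simp
  have sh: "shift_size ^ dF \<ge> 1" using shift_size_ge by (intro one_le_power) simp
  have C_ge: "C \<ge> abs_series" "C \<ge> 1"
  proof -
    have "1 * (1 * 1) \<le> exp 4 * ((4 * pi) ^ dF * shift_size ^ dF)"
      using pi4 sh by (intro mult_mono) auto
    then have "abs_series * 1 \<le> abs_series * (exp 4 * ((4 * pi) ^ dF * shift_size ^ dF))"
      using abs_series_ge_1 by (intro mult_left_mono) auto
    then show "C \<ge> abs_series" by (simp add: C_def mult_ac)
    then show "C \<ge> 1" using abs_series_ge_1 by simp
  qed
  have main: "norm (L_twist F chi s0) \<le> C * real (L_conductor F q) * (1 + \<bar>Im s0\<bar>) ^ dF"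
    if q: "q \<ge> 2" and chi: "chi \<in> primitive_characters q" and s0: "Re s0 \<ge> - 1 / 2" for q chi s0
  proof -
    define N where "N = L_conductor F q"
    define mu where "mu = L_shift F (chi (- 1))"
    define Lam where "Lam = L_completed F q chi"
    have N1: "real N \<ge> 1" using N_pos[OF q chi] by (simp add: N_def)
    have nrm: "norm (chi n) \<le> 1" for n by (rule chi_norm_le[OF q chi])
    have mu_re: "Re (mu j) \<ge> - 1 + theta" if "j < dF" for j
      unfolding mu_def by (rule mu_ge[OF q chi that])
    have mu_norm: "norm (mu j) \<le> shift_size - 3" if "j < dF" for j
      unfolding mu_def using norm_shift_le chi_sign[OF q chi] that by blast
    show ?thesis
    proof (cases "Re s0 \<ge> 3 / 2")
      case True
      have "norm (L_twist F chi s0) \<le> abs_series"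
        using True L_twist_series[OF q chi, of s0] norm_twist_series_le[where chi = chi and s = s0, OF nrm] by simp
      also have "\<dots> \<le> C * 1 * 1 ^ dF" using C_ge by simp
      also have "\<dots> \<le> C * real N * (1 + \<bar>Im s0\<bar>) ^ dF"
        using C_ge N1 by (intro mult_mono power_mono) auto
      finally show ?thesis by (simp add: N_def)
    next
      case False
      define g where "g = (\<lambda>s. Lam s * (\<Prod>j<dF. rGamma_R (s + mu j + 2)))"
      have hol: "g holomorphic_on UNIV"
        unfolding g_def Lam_def by (intro holomorphic_intros Lam_holomorphic[OF q chi])
      define A where "A = abs_series * real N powr (3 / 4) * (4 * pi) ^ dF"
      have A0: "A > 0" using abs_series_ge_1 N1 by (simp add: A_def)
      have Lam32: "norm (Lam s) \<le> abs_series * real N powr (3 / 4) * norm (\<Prod>j<dF. Gamma_R (s + mu j))"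
        if "Re s = 3 / 2" for s
      proof -
        have "Re s / 2 = 3 / 4" using that by linarith
        then have "norm (of_nat N powr (s / 2) :: complex) = real N powr (3 / 4)"
          using norm_of_real_powr[of "real N" "s / 2"] N1 by (simp only: of_real_of_nat_eq Re_divide_numeral)
        moreover have "Lam s = twist_series F chi s * (of_nat N powr (s / 2) * (\<Prod>j<dF. Gamma_R (s + mu j)))"
          using Lam_eq[OF q chi, of s] that by (simp add: Lam_def L_inf_def N_def mu_def)
        ultimately have "norm (Lam s) = norm (twist_series F chi s) * (real N powr (3 / 4) * norm (\<Prod>j<dF. Gamma_R (s + mu j)))"
          by (simp only: norm_mult)
        also have "\<dots> \<le> abs_series * (real N powr (3 / 4) * norm (\<Prod>j<dF. Gamma_R (s + mu j)))"
          using that by (intro mult_right_mono norm_twist_series_le nrm) auto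
        finally show ?thesis by (simp add: mult_ac)
      qed
      have edge_right: "norm (g s) \<le> A" if s: "Re s = 3 / 2" for s
      proof -
        have "norm (\<Prod>j<dF. Gamma_R (s + mu j) * rGamma_R (s + mu j + 2)) \<le> (\<Prod>j<dF. 4 * pi)"
          unfolding prod_norm[symmetric]
        proof (intro prod_mono conjI norm_ge_zero)
          fix j assume "j \<in> {..<dF}"
          then have re: "Re (s + mu j) \<ge> 1 / 2" using mu_re[of j] theta s by simp
          then have nz: "s + mu j \<noteq> 0" by (metis zero_complex.sel(1) not_less zero_less_divide_1_iff zero_less_numeral)
          have "1 = Gamma_R (s + mu j) * rGamma_R (s + mu j)"
            using re by (intro Gamma_R_mult_rGamma_R[symmetric]) simp
          also have "\<dots> = Gamma_R (s + mu j) * rGamma_R (s + mu j + 2) * ((s + mu j) / (2 * of_real pi))"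
            by (subst rGamma_R_add_2) (simp add: mult_ac)
          finally have "Gamma_R (s + mu j) * rGamma_R (s + mu j + 2) = 2 * of_real pi / (s + mu j)"
            using nz by (simp add: field_simps)
          moreover have "norm (s + mu j) \<ge> 1 / 2" using re complex_Re_le_cmod[of "s + mu j"] by linarith
          ultimately have "norm (Gamma_R (s + mu j) * rGamma_R (s + mu j + 2)) \<le> 2 * pi / (1 / 2)"
            by (simp only: norm_divide) (intro frac_le, auto simp: norm_mult)
          then show "norm (Gamma_R (s + mu j) * rGamma_R (s + mu j + 2)) \<le> 4 * pi" by simp
        qed
        then have "norm (\<Prod>j<dF. Gamma_R (s + mu j)) * norm (\<Prod>j<dF. rGamma_R (s + mu j + 2)) \<le> (4 * pi) ^ dF"
          by (simp add: prod.distrib norm_mult)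
        then have "abs_series * real N powr (3 / 4) * (norm (\<Prod>j<dF. Gamma_R (s + mu j)) * norm (\<Prod>j<dF. rGamma_R (s + mu j + 2))) \<le> A"
          unfolding A_def using abs_series_ge_1 by (intro mult_left_mono) auto
        moreover have "norm (g s) \<le> abs_series * real N powr (3 / 4) * norm (\<Prod>j<dF. Gamma_R (s + mu j)) * norm (\<Prod>j<dF. rGamma_R (s + mu j + 2))"
          unfolding g_def norm_mult[of "Lam s"] by (intro mult_right_mono Lam32 s) auto
        ultimately show ?thesis by (simp add: mult.assoc)
      qed
      have edge_left: "norm (g s) \<le> A" if s: "Re s = - 1 / 2" for s
      proof -
        define s' where "s' = 1 - cnj s"
        \<comment> \<open>On the line Re s = - 1 / 2 the reflected point 1 - cnj s is s + 2, so the
          reciprocal Gamma factors in g are taken exactly at the reflected point.\<close>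
        have s': "Re s' = 3 / 2" "s + 2 = s'" using s by (auto simp: s'_def complex_eq_iff)
        obtain \<kappa> where "norm \<kappa> = 1" "\<And>s. Lam s = \<kappa> * cnj (Lam (1 - cnj s))"
          using Lam_functional[OF q chi] by (auto simp: Lam_def)
        then have "norm (Lam s) = norm (Lam s')" by (metis complex_mod_cnj mult_1 norm_mult s'_def)
        moreover have "norm (\<Prod>j<dF. Gamma_R (s' + mu j)) * norm (\<Prod>j<dF. rGamma_R (s + mu j + 2)) = 1"
        proof -
          have "(\<Prod>j<dF. Gamma_R (s' + mu j)) * (\<Prod>j<dF. rGamma_R (s + mu j + 2)) =
              (\<Prod>j<dF. Gamma_R (s' + mu j) * rGamma_R (s' + mu j))"
            unfolding s'(2)[symmetric] by (simp add: prod.distrib add_ac)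
          also have "\<dots> = (\<Prod>j<dF. 1)"
          proof (intro prod.cong refl Gamma_R_mult_rGamma_R)
            fix j assume "j \<in> {..<dF}"
            then show "0 < Re (s' + mu j)" using mu_re[of j] s' theta by simp
          qed
          finally show ?thesis by (simp add: norm_mult[symmetric])
        qed
        moreover have "norm (g s) \<le> abs_series * real N powr (3 / 4) * norm (\<Prod>j<dF. Gamma_R (s' + mu j)) * norm (\<Prod>j<dF. rGamma_R (s + mu j + 2))"
          unfolding g_def norm_mult[of "Lam s"] calculation(1) by (intro mult_right_mono Lam32 s') auto
        ultimately have "norm (g s) \<le> abs_series * real N powr (3 / 4) * 1"
          by (simp add: mult.assoc)
        also have "\<dots> \<le> A" unfolding A_def using pi4 abs_series_ge_1 by (intro mult_left_mono) auto
        finally show ?thesis .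
      qed
      obtain R where R: "\<And>s. norm s \<ge> R \<Longrightarrow> norm (Lam s) \<le> exp (norm s powr (3 / 2))"
        using Lam_growth[OF q chi] by (auto simp: Lam_def)
      define E where "E = exp (pi * shift_size) * B"
      have E0: "E \<ge> 0" using B by (simp add: E_def)
      have growth: "norm (g s) \<le> E ^ dF * exp ((norm s) powr (3 / 2) + (pi * real dF) * norm s)"
        if s: "- 1 / 2 \<le> Re s" "Re s \<le> 3 / 2" "\<bar>Im s\<bar> \<ge> max R (shift_size + 2)" for s
      proof -
        have "norm (\<Prod>j<dF. rGamma_R (s + mu j + 2)) \<le> (\<Prod>j<dF. E * exp (pi * norm s))"
          unfolding prod_norm[symmetric]
        proof (intro prod_mono conjI norm_ge_zero)
          fix j assume "j \<in> {..<dF}"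
          then have j: "j < dF" by simp
          have mj: "\<bar>Im (mu j)\<bar> \<le> shift_size - 3" "\<bar>Re (mu j)\<bar> \<le> shift_size - 3"
            using mu_norm[OF j] abs_Im_le_cmod[of "mu j"] abs_Re_le_cmod[of "mu j"] by linarith+
          have "norm (rGamma_R (s + mu j + 2)) \<le> B * exp (pi * \<bar>Im (s + mu j + 2)\<bar>)"
            using mj s mu_re[OF j] theta by (intro B) (auto simp: abs_le_iff)
          also have "\<dots> \<le> B * exp (pi * (shift_size + norm s))"
          proof (intro mult_left_mono B(1))
            have "\<bar>Im (s + mu j + 2)\<bar> \<le> shift_size + norm s"
              using mj abs_Im_le_cmod[of s] by simp
            then show "exp (pi * \<bar>Im (s + mu j + 2)\<bar>) \<le> exp (pi * (shift_size + norm s))" by simp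
          qed
          also have "\<dots> = E * exp (pi * norm s)" by (simp add: E_def algebra_simps exp_add)
          finally show "norm (rGamma_R (s + mu j + 2)) \<le> E * exp (pi * norm s)" .
        qed
        also have "\<dots> = E ^ dF * exp ((pi * real dF) * norm s)"
          by (simp add: power_mult_distrib exp_of_nat_mult[symmetric] mult_ac)
        finally have "norm (Lam s) * norm (\<Prod>j<dF. rGamma_R (s + mu j + 2)) \<le> exp (norm s powr (3 / 2)) * (E ^ dF * exp ((pi * real dF) * norm s))"
          using s abs_Im_le_cmod[of s] by (intro mult_mono R) auto
        then show ?thesis by (simp add: g_def norm_mult exp_add mult_ac)
      qed
      have "norm (g s0) \<le> exp ((3 / 2 - (- 1 / 2))\<^sup>2) * A"
      proof (rule phragmen_lindelof_strip[where R = "max R (shift_size + 2)", OF hol growth])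
        show "norm (g s) \<le> A" if "Re s = - 1 / 2 \<or> Re s = 3 / 2" for s
          using that edge_left edge_right by blast
      qed (use A0 s0 False E0 in auto)
      then have g_le: "norm (g s0) \<le> exp 4 * A" by (simp add: power2_eq_square)
      \<comment> \<open>Passing from g back to the twist costs one linear factor in s0 for each j,
        the source of the power (1 + |Im s0|)^dF.\<close>
      have "(\<Prod>j<dF. rGamma_R (s0 + mu j)) = (\<Prod>j<dF. rGamma_R (s0 + mu j + 2) * ((s0 + mu j) / (2 * of_real pi)))"
        by (subst rGamma_R_add_2) simp
      then have "L_twist F chi s0 = g s0 * (of_nat N powr (- s0 / 2) * (\<Prod>j<dF. (s0 + mu j) / (2 * of_real pi)))"
        using L_twist_eq[OF q chi, of s0]
        by (simp only: prod.distrib g_def Lam_def N_def mu_def mult_ac)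
      then have eq: "norm (L_twist F chi s0) = norm (g s0) * (real N powr (- Re s0 / 2) * norm (\<Prod>j<dF. (s0 + mu j) / (2 * of_real pi)))"
        using norm_of_real_powr[of "real N" "- s0 / 2"] N1 by (simp add: norm_mult)
      have "norm (\<Prod>j<dF. (s0 + mu j) / (2 * of_real pi)) \<le> (\<Prod>j<dF. shift_size * (1 + \<bar>Im s0\<bar>))"
        unfolding prod_norm[symmetric]
      proof (intro prod_mono conjI norm_ge_zero)
        fix j assume "j \<in> {..<dF}"
        then have "norm (s0 + mu j) \<le> \<bar>Re s0\<bar> + \<bar>Im s0\<bar> + (shift_size - 3)"
          using norm_triangle_ineq[of s0 "mu j"] cmod_le[of s0] mu_norm[of j] by simp
        also have "\<dots> \<le> shift_size * (1 + \<bar>Im s0\<bar>)"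
        proof -
          have "1 * \<bar>Im s0\<bar> \<le> shift_size * \<bar>Im s0\<bar>" using shift_size_ge by (intro mult_right_mono) auto
          moreover have "\<bar>Re s0\<bar> \<le> 3" using s0 False by (simp add: abs_le_iff)
          ultimately show ?thesis by (simp add: algebra_simps)
        qed
        finally have "norm (s0 + mu j) / (2 * pi) \<le> shift_size * (1 + \<bar>Im s0\<bar>) / 1"
          using pi_gt3 shift_size_ge by (intro frac_le) auto
        then show "norm ((s0 + mu j) / (2 * of_real pi)) \<le> shift_size * (1 + \<bar>Im s0\<bar>)"
          by (simp add: norm_divide norm_mult)
      qed
      also have "\<dots> = shift_size ^ dF * (1 + \<bar>Im s0\<bar>) ^ dF" by (simp add: power_mult_distrib)
      finally have pr: "norm (\<Prod>j<dF. (s0 + mu j) / (2 * of_real pi)) \<le> shift_size ^ dF * (1 + \<bar>Im s0\<bar>) ^ dF" .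
      have "real N powr (- Re s0 / 2) \<le> real N powr (1 / 4)"
        using N1 s0 by (intro powr_mono) auto
      then have "norm (L_twist F chi s0) \<le> (exp 4 * A) * (real N powr (1 / 4) * (shift_size ^ dF * (1 + \<bar>Im s0\<bar>) ^ dF))"
        unfolding eq using g_le pr A0 by (intro mult_mono) auto
      also have "\<dots> = C * (real N powr (3 / 4) * real N powr (1 / 4)) * (1 + \<bar>Im s0\<bar>) ^ dF"
        by (simp add: A_def C_def mult_ac)
      also have "real N powr (3 / 4) * real N powr (1 / 4) = real N"
        using N1 by (simp flip: powr_add)
      finally show ?thesis by (simp add: N_def)
    qed
  qed
  show ?thesis using C_ge(2) main by (intro exI[of _ C]) blast
qed

end

section \<open>An approximate functional equation with a free approximant\<close>

context L_framework
begin

text \<open>With b j = 1 / 2 + mu j this is exp (w^2) times the Gamma factors at 1 / 2 + w times the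
  product of (b j + w) (cnj (b j) - w); the factor b j + w is absorbed into
  \<open>Gamma_R_reg\<close>.\<close>

definition kern :: "complex \<Rightarrow> complex \<Rightarrow> complex" where
  "kern e w = exp (w\<^sup>2) * (\<Prod>j<dF. Gamma_R_reg (1 / 2 + L_shift F e j + w) * (cnj (1 / 2 + L_shift F e j) - w))"

lemma kern_holomorphic:
  assumes "e \<in> {1, - 1}"
  shows "kern e holomorphic_on {w. Re w > - 1}"
proof -
  have "Re (1 / 2 + L_shift F e j + w) > - 2" if "Re w > - 1" "j < dF" for j w
    using shift_ge[OF assms that(2)] that theta by simp
  then show ?thesis
    unfolding kern_def by (intro holomorphic_intros) auto
qed

text \<open>Half of the Gaussian decay exp (- t^2) pays for the linear factors cnj (b j) - w; the
  regularized Gamma factors are bounded on this strip.\<close>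

lemma kern_bound:
  "\<exists>C>0. \<forall>e\<in>{1, - 1}. \<forall>w. 0 \<le> Re w \<longrightarrow> Re w \<le> 2 \<longrightarrow> norm (kern e w) \<le> C * exp (- ((Im w)\<^sup>2 / 2))"
proof -
  obtain B where B: "B \<ge> 0" "\<And>s. - 1 \<le> Re s \<Longrightarrow> Re s \<le> 3 + shift_size \<Longrightarrow> norm (Gamma_R_reg s) \<le> B"
    using Gamma_R_reg_bounded[of "- 1" "3 + shift_size"] by auto
  define C where "C = exp 4 * ((B + 1) * (shift_size + 3)) ^ dF * exp ((real dF)\<^sup>2 / 2)"
  have ss: "shift_size \<ge> 3" by (rule shift_size_ge)
  have "C > 0" using B ss by (simp add: C_def)
  moreover have "norm (kern e w) \<le> C * exp (- ((Im w)\<^sup>2 / 2))"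
    if e: "e \<in> {1, - 1}" and w: "0 \<le> Re w" "Re w \<le> 2" for e w
  proof -
    have "norm (exp (w\<^sup>2)) = exp ((Re w)\<^sup>2 - (Im w)\<^sup>2)" by (simp add: Re_power2)
    also have "\<dots> \<le> exp (4 - (Im w)\<^sup>2)"
      using w power_mono[of "Re w" 2 2] by simp
    finally have 1: "norm (exp (w\<^sup>2)) \<le> exp (4 - (Im w)\<^sup>2)" .
    have "norm (\<Prod>j<dF. Gamma_R_reg (1 / 2 + L_shift F e j + w) * (cnj (1 / 2 + L_shift F e j) - w))
       \<le> (\<Prod>j<dF. ((B + 1) * (shift_size + 3)) * (1 + \<bar>Im w\<bar>))"
      unfolding prod_norm[symmetric]
    proof (intro prod_mono conjI norm_ge_zero)
      fix j assume "j \<in> {..<dF}"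
      then have j: "j < dF" by simp
      have mj: "norm (L_shift F e j) \<le> shift_size - 3" by (rule norm_shift_le[OF e j])
      have "norm (Gamma_R_reg (1 / 2 + L_shift F e j + w)) \<le> B + 1"
      proof -
        have "- 1 \<le> Re (1 / 2 + L_shift F e j + w)" "Re (1 / 2 + L_shift F e j + w) \<le> 3 + shift_size"
          using shift_ge[OF e j] theta w mj abs_Re_le_cmod[of "L_shift F e j"] by (simp_all add: abs_le_iff)
        then have "norm (Gamma_R_reg (1 / 2 + L_shift F e j + w)) \<le> B" by (rule B(2))
        then show ?thesis by simp
      qed
      moreover have "norm (cnj (1 / 2 + L_shift F e j) - w) \<le> (shift_size + 3) * (1 + \<bar>Im w\<bar>)"
      proof -
        have "norm (cnj (1 / 2 + L_shift F e j) - w) \<le> norm (1 / 2 + L_shift F e j) + norm w"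
          by (metis complex_mod_cnj norm_triangle_ineq4)
        also have "norm (1 / 2 + L_shift F e j) \<le> 1 / 2 + norm (L_shift F e j)"
          using norm_triangle_ineq[of "1 / 2" "L_shift F e j"] by simp
        also have "norm w \<le> 2 + \<bar>Im w\<bar>" using cmod_le[of w] w by simp
        finally have "norm (cnj (1 / 2 + L_shift F e j) - w) \<le> shift_size + \<bar>Im w\<bar>" using mj by simp
        also have "\<dots> \<le> (shift_size + 3) * (1 + \<bar>Im w\<bar>)"
        proof -
          have "1 * \<bar>Im w\<bar> \<le> (shift_size + 3) * \<bar>Im w\<bar>" using ss by (intro mult_right_mono) auto
          then show ?thesis by (simp add: algebra_simps)
        qed
        finally show ?thesis .
      qed
      ultimately have "norm (Gamma_R_reg (1 / 2 + L_shift F e j + w)) * norm (cnj (1 / 2 + L_shift F e j) - w)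
          \<le> (B + 1) * ((shift_size + 3) * (1 + \<bar>Im w\<bar>))"
        using B by (intro mult_mono) auto
      then show "norm (Gamma_R_reg (1 / 2 + L_shift F e j + w) * (cnj (1 / 2 + L_shift F e j) - w)) \<le>
          ((B + 1) * (shift_size + 3)) * (1 + \<bar>Im w\<bar>)"
        by (simp only: norm_mult mult.assoc)
    qed
    also have "\<dots> = ((B + 1) * (shift_size + 3)) ^ dF * (1 + \<bar>Im w\<bar>) ^ dF" by (simp add: power_mult_distrib)
    also have "\<dots> \<le> ((B + 1) * (shift_size + 3)) ^ dF * (exp ((real dF)\<^sup>2 / 2) * exp ((Im w)\<^sup>2 / 2))"
      using B ss by (intro mult_left_mono one_plus_power_le_exp) auto
    finally have 2: "norm (\<Prod>j<dF. Gamma_R_reg (1 / 2 + L_shift F e j + w) * (cnj (1 / 2 + L_shift F e j) - w))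
       \<le> ((B + 1) * (shift_size + 3)) ^ dF * (exp ((real dF)\<^sup>2 / 2) * exp ((Im w)\<^sup>2 / 2))" .
    have "norm (kern e w) \<le> exp (4 - (Im w)\<^sup>2) * (((B + 1) * (shift_size + 3)) ^ dF * (exp ((real dF)\<^sup>2 / 2) * exp ((Im w)\<^sup>2 / 2)))"
      unfolding kern_def norm_mult using 1 2 by (intro mult_mono) auto
    also have "\<dots> = C * (exp (- (Im w)\<^sup>2) * exp ((Im w)\<^sup>2 / 2))"
    proof -
      have "exp (4 - (Im w)\<^sup>2) = exp 4 * exp (- (Im w)\<^sup>2)" by (simp flip: exp_add)
      then show ?thesis unfolding C_def by (simp only: mult_ac)
    qed
    also have "exp (- (Im w)\<^sup>2) * exp ((Im w)\<^sup>2 / 2) = exp (- ((Im w)\<^sup>2 / 2))" by (simp flip: exp_add)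
    finally show ?thesis .
  qed
  ultimately show ?thesis by blast
qed

text \<open>The factors \<open>(b\<^sub>j + w) (cnj b\<^sub>j - w)\<close> with \<open>b\<^sub>j = 1/2 + \<mu>\<^sub>j\<close> remove the poles of the Gamma factors on the right
  of the central line and are compatible with the functional equation.\<close>

theorem approximate_functional_equation:
  assumes c: "0 < c" "c < 2"
  shows "\<exists>C>0. \<forall>q chi H B. q \<ge> 2 \<longrightarrow> chi \<in> primitive_characters q \<longrightarrow> H holomorphic_on UNIV \<longrightarrow>
     (\<forall>w. 0 \<le> Re w \<longrightarrow> Re w \<le> 2 \<longrightarrow> norm (H (1 / 2 + w)) \<le> B) \<longrightarrow>
     (\<forall>\<epsilon>>0. \<forall>\<^sub>F T in at_top. norm (L_twist F chi (1 / 2)) \<le>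
        C * (real (L_conductor F q) powr (c / 2) * integral {- T..T} (\<lambda>t. norm (H (Complex (1 / 2 + c) t)) * exp (- (t\<^sup>2 / 2)))
          + real (L_conductor F q) * integral {- T..T} (\<lambda>t. norm (L_twist F chi (Complex (5 / 2) t) - H (Complex (5 / 2) t)) * exp (- (t\<^sup>2 / 2)))) + \<epsilon>)"
proof -
  obtain C0 where C0: "C0 > 0" "\<And>e w. e \<in> {1, - 1} \<Longrightarrow> 0 \<le> Re w \<Longrightarrow> Re w \<le> 2 \<Longrightarrow> norm (kern e w) \<le> C0 * exp (- ((Im w)\<^sup>2 / 2))"
    using kern_bound by blast
  \<comment> \<open>\<open>P e\<close> is the size at w = 0 of the auxiliary product by which
    \<open>Lam\<close> gets multiplied, and \<open>Rr e\<close> that of the reciprocal Gamma factors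
    at 1 / 2. If \<open>P e = 0\<close> the quotient in \<open>C1\<close> is 0 by convention, and
    \<open>L_half\<close> treats this case separately.\<close>
  define P where "P = (\<lambda>e. (\<Prod>j<dF. norm (1 / 2 + L_shift F e j)) * (\<Prod>j<dF. norm (1 / 2 + L_shift F e j)))"
  define Rr where "Rr = (\<lambda>e. norm (\<Prod>j<dF. rGamma_R (1 / 2 + L_shift F e j)))"
  define C1 where "C1 = Rr 1 / P 1 + Rr (- 1) / P (- 1) + 1"
  have P0: "P e \<ge> 0" for e by (simp add: P_def prod_nonneg)
  have C1: "C1 > 0" "Rr e / P e \<le> C1" if "e \<in> {1, - 1}" for e
  proof -
    have "Rr 1 / P 1 \<ge> 0" "Rr (- 1) / P (- 1) \<ge> 0" using P0 by (simp_all add: Rr_def)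
    then show "C1 > 0" "Rr e / P e \<le> C1" using that by (auto simp: C1_def)
  qed
  define C where "C = C1 * (C0 / c)"
  have "C > 0" using C1(1)[of 1] C0 c by (simp add: C_def)
  have main: "\<forall>\<^sub>F T in at_top. norm (L_twist F chi (1 / 2)) \<le>
        C * (real (L_conductor F q) powr (c / 2) * integral {- T..T} (\<lambda>t. norm (H (Complex (1 / 2 + c) t)) * exp (- (t\<^sup>2 / 2)))
          + real (L_conductor F q) * integral {- T..T} (\<lambda>t. norm (L_twist F chi (Complex (5 / 2) t) - H (Complex (5 / 2) t)) * exp (- (t\<^sup>2 / 2)))) + \<epsilon>"
    if q: "q \<ge> 2" and chi: "chi \<in> primitive_characters q" and H: "H holomorphic_on UNIV"
      and HB: "\<And>w. 0 \<le> Re w \<Longrightarrow> Re w \<le> 2 \<Longrightarrow> norm (H (1 / 2 + w)) \<le> B" and \<epsilon>: "\<epsilon> > 0" for q chi H B \<epsilon>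
  proof -
    define N where "N = L_conductor F q"
    define e where "e = chi (- 1)"
    define b where "b = (\<lambda>j. 1 / 2 + L_shift F e j)"
    define Lam where "Lam = L_completed F q chi"
    have e: "e \<in> {1, - 1}" unfolding e_def by (rule chi_sign[OF q chi])
    have N1: "real N \<ge> 1" using N_pos[OF q chi] by (simp add: N_def)
    \<comment> \<open>Replacing w by - cnj w swaps the two linear factors up to conjugation, so h
      inherits the functional equation of \<open>Lam\<close>.\<close>
    define G where "G = (\<lambda>w. exp (w\<^sup>2) * (\<Prod>j<dF. (b j + w) * (cnj (b j) - w)))"
    define h where "h = (\<lambda>w. Lam (1 / 2 + w) * G w)"
    define K where "K = (\<lambda>w. of_nat N powr ((1 / 2 + w) / 2) * kern e w / w)"
    have h_hol: "h holomorphic_on UNIV"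
    proof -
      have "(Lam \<circ> (\<lambda>w. 1 / 2 + w)) holomorphic_on UNIV"
        unfolding Lam_def by (rule holomorphic_on_compose_gen[OF _ Lam_holomorphic[OF q chi, of UNIV]]) (auto intro!: holomorphic_intros)
      then have "(\<lambda>w. Lam (1 / 2 + w)) holomorphic_on UNIV" by (simp add: o_def)
      then show ?thesis unfolding h_def G_def by (intro holomorphic_intros)
    qed
    have K_hol: "K holomorphic_on {w. Re w > 0}"
    proof -
      have "kern e holomorphic_on {w. Re w > 0}"
        by (rule holomorphic_on_subset[OF kern_holomorphic[OF e]]) auto
      then show ?thesis unfolding K_def using N1 by (intro holomorphic_intros) auto
    qed
    have K_le: "norm (K w) \<le> real N powr (1 / 4) * real N powr (Re w / 2) * (C0 / c) * exp (- ((Im w)\<^sup>2 / 2))"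
      if "c \<le> Re w" "Re w \<le> 2" for w
    proof -
      have "norm (K w) = real N powr (1 / 4 + Re w / 2) * (norm (kern e w) / norm w)"
        using N1 norm_of_real_powr[of "real N" "(1 / 2 + w) / 2"] by (simp add: K_def norm_mult norm_divide add_divide_distrib)
      also have "norm (kern e w) / norm w \<le> C0 * exp (- ((Im w)\<^sup>2 / 2)) / c"
        using that c C0 e complex_Re_le_cmod[of w] by (intro frac_le C0(2)) auto
      finally have "norm (K w) \<le> real N powr (1 / 4 + Re w / 2) * (C0 * exp (- ((Im w)\<^sup>2 / 2)) / c)"
        by (simp add: mult_left_mono)
      then show ?thesis using N1 by (simp add: powr_add mult_ac)
    qed
    have h_right: "h w / w = L_twist F chi (1 / 2 + w) * K w" if "Re w = 2" for w
    proof -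
      have "(\<Prod>j<dF. Gamma_R (1 / 2 + w + L_shift F e j)) * (\<Prod>j<dF. (b j + w) * (cnj (b j) - w)) =
          (\<Prod>j<dF. Gamma_R_reg (b j + w) * (cnj (b j) - w))"
        unfolding prod.distrib[symmetric]
      proof (intro prod.cong refl)
        fix j assume "j \<in> {..<dF}"
        then have "Re (b j + w) > 0" using shift_ge[OF e, of j] theta that by (simp add: b_def)
        from Gamma_R_mult_self[OF this]
        show "Gamma_R (1 / 2 + w + L_shift F e j) * ((b j + w) * (cnj (b j) - w)) = Gamma_R_reg (b j + w) * (cnj (b j) - w)"
          by (simp add: b_def add_ac)
      qed
      then have k: "exp (w\<^sup>2) * ((\<Prod>j<dF. Gamma_R (1 / 2 + w + L_shift F e j)) * (\<Prod>j<dF. (b j + w) * (cnj (b j) - w))) = kern e w"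
        by (simp add: kern_def b_def)
      have "Lam (1 / 2 + w) = L_twist F chi (1 / 2 + w) * L_inf F q chi (1 / 2 + w)"
        using that Lam_eq[OF q chi] L_twist_series[OF q chi] by (simp add: Lam_def)
      then have "h w = L_twist F chi (1 / 2 + w) * (of_nat N powr ((1 / 2 + w) / 2) * kern e w)"
        unfolding k[symmetric] by (simp add: h_def G_def L_inf_def N_def e_def mult_ac)
      then show ?thesis by (simp add: K_def)
    qed
    obtain \<kappa> where \<kappa>: "norm \<kappa> = 1" "\<And>s. Lam s = \<kappa> * cnj (Lam (1 - cnj s))"
      using Lam_functional[OF q chi] by (auto simp: Lam_def)
    have h_left: "h (- cnj w) = \<kappa> * cnj (h w)" for w
    proof -
      have "G (- cnj w) = cnj (G w)"
        by (simp add: G_def exp_cnj mult.commute)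
      moreover have "Lam (1 / 2 + - cnj w) = \<kappa> * cnj (Lam (1 / 2 + w))"
        by (subst \<kappa>(2)) (simp add: add_divide_distrib algebra_simps)
      ultimately show ?thesis by (simp add: h_def)
    qed
    define J where "J = (\<lambda>T. vertical_integral (\<lambda>w. h w / w) 2 T)"
    \<comment> \<open>On the opposite line the integral is minus \<kappa> times the conjugate of J,
      so both vertical sides of the rectangle are controlled by |J|, without a separate estimate for
      the dual twist.\<close>
    have J_left: "vertical_integral (\<lambda>w. h w / w) (- 2) T = - (\<kappa> * cnj (J T))" for T
    proof -
      have "h (Complex (- 2) t) / Complex (- 2) t = - \<kappa> * cnj (h (Complex 2 t) / Complex 2 t)" for t
      proof -
        have "Complex (- 2) t = - cnj (Complex 2 t)" by (simp add: complex_eq_iff)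
        then show ?thesis using h_left[of "Complex 2 t"] by simp
      qed
      then have "vertical_integral (\<lambda>w. h w / w) (- 2) T = integral {- T..T} (\<lambda>t. - \<kappa> * cnj (h (Complex 2 t) / Complex 2 t))"
        unfolding vertical_integral_def by simp
      also have "\<dots> = - \<kappa> * integral {- T..T} (\<lambda>t. cnj (h (Complex 2 t) / Complex 2 t))"
        by (rule integral_mult_right)
      also have "integral {- T..T} (\<lambda>t. cnj (h (Complex 2 t) / Complex 2 t)) = cnj (J T)"
        unfolding J_def vertical_integral_def by (rule integral_cnj[symmetric])
      finally show ?thesis by simp
    qed
    obtain R0 where R0: "\<And>s. norm s \<ge> R0 \<Longrightarrow> norm (Lam s) \<le> exp (norm s powr (3 / 2))"
      using Lam_growth[OF q chi] by (auto simp: Lam_def)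
    define E where "E = (\<lambda>T. exp ((T + 3) powr (3 / 2)) * (exp (4 - T\<^sup>2) * (shift_size + T) ^ (2 * dF)))"
    have h_horizontal: "norm (h w) \<le> E T" if "\<bar>Re w\<bar> \<le> 2" "\<bar>Im w\<bar> = T" "T \<ge> R0 + 1" "T \<ge> 1" for w T
    proof -
      have nw: "norm w \<le> T + 2" "norm w \<ge> T" using that cmod_le[of w] abs_Im_le_cmod[of w] by auto
      have 1: "norm (Lam (1 / 2 + w)) \<le> exp ((T + 3) powr (3 / 2))"
      proof -
        have a: "norm (1 / 2 + w) \<le> T + 3" "R0 \<le> norm (1 / 2 + w)"
          using norm_triangle_ineq[of "1 / 2" w] norm_diff_ineq[of w "1 / 2"] nw that by (simp_all add: add.commute)
        have "norm (Lam (1 / 2 + w)) \<le> exp (norm (1 / 2 + w) powr (3 / 2))" by (rule R0[OF a(2)])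
        also have "\<dots> \<le> exp ((T + 3) powr (3 / 2))" using a(1) by (simp add: powr_mono2)
        finally show ?thesis .
      qed
      have "(Re w)\<^sup>2 \<le> 4" using that power_mono[of "\<bar>Re w\<bar>" 2 2] by simp
      moreover have "(Im w)\<^sup>2 = T\<^sup>2" using that(2) by (metis power2_abs)
      ultimately have 2: "norm (exp (w\<^sup>2)) \<le> exp (4 - T\<^sup>2)" by (simp add: Re_power2)
      have "norm (\<Prod>j<dF. (b j + w) * (cnj (b j) - w)) \<le> (\<Prod>j<dF. (shift_size + T) * (shift_size + T))"
        unfolding prod_norm[symmetric]
      proof (intro prod_mono conjI norm_ge_zero)
        fix j assume "j \<in> {..<dF}"
        then have "norm (L_shift F e j) \<le> shift_size - 3" by (intro norm_shift_le[OF e]) simp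
        then have bj: "norm (b j) \<le> shift_size - 2" using norm_triangle_ineq[of "1 / 2" "L_shift F e j"] by (simp add: b_def)
        have "norm (b j + w) \<le> shift_size + T" using norm_triangle_ineq[of "b j" w] bj nw by simp
        moreover have "norm (cnj (b j) - w) \<le> shift_size + T" using norm_triangle_ineq4[of "cnj (b j)" w] bj nw by simp
        ultimately show "norm ((b j + w) * (cnj (b j) - w)) \<le> (shift_size + T) * (shift_size + T)"
          unfolding norm_mult using shift_size_ge that by (intro mult_mono) auto
      qed
      also have "\<dots> = (shift_size + T) ^ (2 * dF)" by (simp add: power_mult power2_eq_square)
      finally have "norm (G w) \<le> exp (4 - T\<^sup>2) * (shift_size + T) ^ (2 * dF)"
        unfolding G_def norm_mult using 2 by (intro mult_mono) auto
      with 1 show ?thesis unfolding h_def E_def norm_mult by (intro mult_mono) auto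
    qed
    have main_T: "norm (h 0) \<le> norm (J T) / pi + 8 * E T" if T: "T \<ge> R0 + 1" "T \<ge> 1" for T
    proof -
      have E0: "E T \<ge> 0" using T shift_size_ge by (simp add: E_def)
      have edge: "norm (h w / (w - 0)) \<le> E T" if "\<bar>Re w\<bar> \<le> 2" "\<bar>Im w\<bar> = T" for w
      proof -
        have "norm (h w) / norm w \<le> E T / 1"
          using h_horizontal[OF that T] abs_Im_le_cmod[of w] that T E0 by (intro frac_le) auto
        then show ?thesis by (simp add: norm_divide)
      qed
      have "norm (vertical_integral (\<lambda>w. h w / (w - 0)) 2 T - vertical_integral (\<lambda>w. h w / (w - 0)) (- 2) T - 2 * pi * h 0) \<le> 2 * E T * (2 - (- 2))"
      proof (rule rectangle_residue[OF h_hol])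
        fix x :: real assume "x \<in> {- 2..2}"
        then show "norm (h (Complex x T) / (Complex x T - 0)) \<le> E T \<and> norm (h (Complex x (- T)) / (Complex x (- T) - 0)) \<le> E T"
          using edge[of "Complex x T"] edge[of "Complex x (- T)"] T by auto
      qed (use T in \<open>auto simp: in_box_complex_iff\<close>)
      then have "norm (J T - vertical_integral (\<lambda>w. h w / w) (- 2) T - 2 * pi * h 0) \<le> 8 * E T"
        by (simp add: J_def)
      then have "norm (J T - - (\<kappa> * cnj (J T)) - 2 * pi * h 0) \<le> 8 * E T"
        unfolding J_left .
      then have "norm (2 * pi * h 0) \<le> norm (J T + \<kappa> * cnj (J T)) + 8 * E T"
        using norm_triangle_sub[of "2 * pi * h 0" "J T + \<kappa> * cnj (J T)"] by (simp add: norm_minus_commute)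
      also have "norm (J T + \<kappa> * cnj (J T)) \<le> 2 * norm (J T)"
        using norm_triangle_ineq[of "J T" "\<kappa> * cnj (J T)"] \<kappa>(1) by (simp add: norm_mult)
      finally have "2 * pi * norm (h 0) \<le> 2 * norm (J T) + 8 * E T" by (simp add: norm_mult)
      then have "norm (h 0) \<le> (2 * norm (J T) + 8 * E T) / (2 * pi)"
        by (simp add: field_simps)
      also have "\<dots> = norm (J T) / pi + 8 * E T / (2 * pi)" by (simp add: add_divide_distrib)
      also have "8 * E T / (2 * pi) \<le> 8 * E T / 1"
        using T shift_size_ge pi_gt3 by (intro divide_left_mono) (auto simp: E_def)
      finally show ?thesis by simp
    qed
    have B0: "B \<ge> 0" using HB[of 0] norm_ge_zero order_trans by (metis order_refl zero_complex.sel(1) zero_le_numeral)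
    define E' where "E' = (\<lambda>T :: real. B * (real N powr (1 / 4) * real N * (C0 / c) * exp (- (T\<^sup>2 / 2))))"
    define IH where "IH = (\<lambda>T. integral {- T..T} (\<lambda>t. norm (H (Complex (1 / 2 + c) t)) * exp (- (t\<^sup>2 / 2))))"
    define IR where "IR = (\<lambda>T. integral {- T..T} (\<lambda>t. norm (L_twist F chi (Complex (5 / 2) t) - H (Complex (5 / 2) t)) * exp (- (t\<^sup>2 / 2))))"
    have H_shift: "(\<lambda>w. H (1 / 2 + w)) holomorphic_on A" for A
    proof -
      have "(H \<circ> (\<lambda>w. 1 / 2 + w)) holomorphic_on A"
        by (rule holomorphic_on_compose_gen[OF _ H]) (auto intro!: holomorphic_intros)
      then show ?thesis by (simp add: o_def)
    qed
    have L_shift: "(\<lambda>w. L_twist F chi (1 / 2 + w)) holomorphic_on A" for A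
    proof -
      have "(L_twist F chi \<circ> (\<lambda>w. 1 / 2 + w)) holomorphic_on A"
        by (rule holomorphic_on_compose_gen[OF _ L_twist_holomorphic[OF q chi, of UNIV]]) (auto intro!: holomorphic_intros)
      then show ?thesis by (simp add: o_def)
    qed
    have half_plus: "1 / 2 + Complex x t = Complex (1 / 2 + x) t" for x t by (simp add: complex_eq_iff)
    have cont_line: "continuous_on {- T..T} (\<lambda>t. f (Complex x t))" if "f holomorphic_on UNIV" for f x T
      by (rule continuous_on_vertical[OF holomorphic_on_imp_continuous_on[OF that]]) simp
    have J_le: "norm (J T) \<le> real N powr (1 / 4) * (C0 / c) * (real N powr (c / 2) * IH T + real N * IR T) + 4 * E' T"
      if T: "T \<ge> 1" for T
    proof -
      \<comment> \<open>On Re w = 2 the twist is H plus the error L - H. Only the term with H is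
        moved to Re w = c, where the conductor enters as N^(c / 2); the error is estimated where it
        stands, at the cost of a full factor N.\<close>
      let ?HK = "\<lambda>w. H (1 / 2 + w) * K w" and ?RK = "\<lambda>w. (L_twist F chi (1 / 2 + w) - H (1 / 2 + w)) * K w"
      have HK_hol: "?HK holomorphic_on {w. Re w > 0}" by (intro holomorphic_intros H_shift K_hol)
      have RK_hol: "?RK holomorphic_on {w. Re w > 0}" by (intro holomorphic_intros H_shift L_shift K_hol)
      have "J T = vertical_integral (\<lambda>w. ?HK w + ?RK w) 2 T"
        unfolding J_def vertical_integral_def
        by (intro integral_cong) (simp add: h_right algebra_simps)
      also have "\<dots> = vertical_integral ?HK 2 T + vertical_integral ?RK 2 T"
        unfolding vertical_integral_def
        using HK_hol RK_hol
        by (intro integral_add integrable_continuous_real continuous_on_vertical[OF holomorphic_on_imp_continuous_on]) auto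
      finally have J_eq: "J T = vertical_integral ?HK 2 T + vertical_integral ?RK 2 T" .
      have "norm (vertical_integral ?HK 2 T - vertical_integral ?HK c T) \<le> 2 * E' T * (2 - c)"
      proof (rule rectangle_shift[OF HK_hol convex_halfspace_Re_gt])
        show "cbox (Complex c (- T)) (Complex 2 T) \<subseteq> {w. 0 < Re w}"
          using c by (auto simp: in_cbox_complex_iff)
        have "norm (?HK (Complex x t)) \<le> E' T" if "x \<in> {c..2}" "\<bar>t\<bar> = T" for x t
          unfolding norm_mult E'_def
        proof (intro mult_mono)
          show "norm (H (1 / 2 + Complex x t)) \<le> B" using that c by (intro HB) auto
          have "norm (K (Complex x t)) \<le> real N powr (1 / 4) * real N powr (x / 2) * (C0 / c) * exp (- (t\<^sup>2 / 2))"
            using K_le[of "Complex x t"] that by simp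
          also have "t\<^sup>2 = T\<^sup>2" using that(2) by (metis power2_abs)
          also have "real N powr (1 / 4) * real N powr (x / 2) * (C0 / c) * exp (- (T\<^sup>2 / 2))
              \<le> real N powr (1 / 4) * real N powr 1 * (C0 / c) * exp (- (T\<^sup>2 / 2))"
            using that N1 C0(1) c by (intro mult_right_mono mult_left_mono powr_mono) auto
          finally show "norm (K (Complex x t)) \<le> real N powr (1 / 4) * real N * (C0 / c) * exp (- (T\<^sup>2 / 2))"
            using N1 by simp
        qed (use B0 in auto)
        then show "norm (?HK (Complex x T)) \<le> E' T \<and> norm (?HK (Complex x (- T))) \<le> E' T" if "x \<in> {c..2}" for x
          using that T by auto
      qed (use c T in auto)
      also have "\<dots> \<le> 2 * E' T * 2"
        using c B0 N1 C0 by (intro mult_left_mono) (auto simp: E'_def)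
      finally have 1: "norm (vertical_integral ?HK 2 T) \<le> norm (vertical_integral ?HK c T) + 4 * E' T"
        using norm_triangle_sub[of "vertical_integral ?HK 2 T" "vertical_integral ?HK c T"] by simp
      have "norm (vertical_integral ?HK c T) \<le> integral {- T..T} (\<lambda>t. real N powr (1 / 4) * (C0 / c) * real N powr (c / 2) * (norm (H (Complex (1 / 2 + c) t)) * exp (- (t\<^sup>2 / 2))))"
      proof (rule norm_vertical_integral_le[OF holomorphic_on_imp_continuous_on[OF HK_hol]])
        fix t
        have "norm (?HK (Complex c t)) \<le> norm (H (Complex (1 / 2 + c) t)) * (real N powr (1 / 4) * real N powr (c / 2) * (C0 / c) * exp (- (t\<^sup>2 / 2)))"
          unfolding norm_mult half_plus using K_le[of "Complex c t"] c by (intro mult_left_mono) auto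
        then show "norm (?HK (Complex c t)) \<le> real N powr (1 / 4) * (C0 / c) * real N powr (c / 2) * (norm (H (Complex (1 / 2 + c) t)) * exp (- (t\<^sup>2 / 2)))"
          by (simp add: mult_ac)
      next
        show "(\<lambda>t. real N powr (1 / 4) * (C0 / c) * real N powr (c / 2) * (norm (H (Complex (1 / 2 + c) t)) * exp (- (t\<^sup>2 / 2)))) integrable_on {- T..T}"
          by (intro integrable_continuous_real continuous_intros cont_line H) auto
      qed (use c in auto)
      also have "\<dots> = real N powr (1 / 4) * (C0 / c) * real N powr (c / 2) * IH T"
        unfolding IH_def by (rule integral_mult_right)
      finally have 2: "norm (vertical_integral ?HK c T) \<le> real N powr (1 / 4) * (C0 / c) * real N powr (c / 2) * IH T" .
      have "norm (vertical_integral ?RK 2 T) \<le> integral {- T..T} (\<lambda>t. real N powr (1 / 4) * (C0 / c) * real N * (norm (L_twist F chi (Complex (5 / 2) t) - H (Complex (5 / 2) t)) * exp (- (t\<^sup>2 / 2))))"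
      proof (rule norm_vertical_integral_le[OF holomorphic_on_imp_continuous_on[OF RK_hol]])
        fix t
        have eq: "1 / 2 + Complex 2 t = Complex (5 / 2) t" by (simp add: complex_eq_iff)
        have "norm (?RK (Complex 2 t)) \<le> norm (L_twist F chi (Complex (5 / 2) t) - H (Complex (5 / 2) t)) * (real N powr (1 / 4) * real N powr (2 / 2) * (C0 / c) * exp (- (t\<^sup>2 / 2)))"
          unfolding norm_mult eq using K_le[of "Complex 2 t"] c by (intro mult_left_mono) auto
        then show "norm (?RK (Complex 2 t)) \<le> real N powr (1 / 4) * (C0 / c) * real N * (norm (L_twist F chi (Complex (5 / 2) t) - H (Complex (5 / 2) t)) * exp (- (t\<^sup>2 / 2)))"
          using N1 by (simp add: mult_ac)
      next
        show "(\<lambda>t. real N powr (1 / 4) * (C0 / c) * real N * (norm (L_twist F chi (Complex (5 / 2) t) - H (Complex (5 / 2) t)) * exp (- (t\<^sup>2 / 2)))) integrable_on {- T..T}"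
          by (intro integrable_continuous_real continuous_intros cont_line H L_twist_holomorphic[OF q chi]) auto
      qed auto
      also have "\<dots> = real N powr (1 / 4) * (C0 / c) * real N * IR T"
        unfolding IR_def by (rule integral_mult_right)
      finally have 3: "norm (vertical_integral ?RK 2 T) \<le> real N powr (1 / 4) * (C0 / c) * real N * IR T" .
      show ?thesis
        using norm_triangle_ineq[of "vertical_integral ?HK 2 T" "vertical_integral ?RK 2 T"] 1 2 3
        unfolding J_eq by (simp add: algebra_simps)
    qed
    have L_half: "norm (L_twist F chi (1 / 2)) \<le> C1 * real N powr (- 1 / 4) * norm (h 0)"
    proof -
      have "norm (h 0) = norm (Lam (1 / 2)) * P e"
      proof -
        have "G 0 = (\<Prod>j<dF. b j * cnj (b j))" by (simp add: G_def)
        then have "norm (G 0) = (\<Prod>j<dF. norm (b j) * norm (b j))"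
          by (simp only: prod_norm[symmetric] norm_mult complex_mod_cnj)
        also have "\<dots> = P e" by (simp only: P_def b_def prod.distrib)
        finally show ?thesis by (simp add: h_def norm_mult)
      qed
      moreover have "norm (L_twist F chi (1 / 2)) = norm (Lam (1 / 2)) * (real N powr (- 1 / 4) * Rr e)"
        using L_twist_eq[OF q chi, of "1 / 2"] norm_of_real_powr[of "real N" "- (1 / 2) / 2"] N1
        by (simp add: Lam_def N_def Rr_def e_def norm_mult)
      moreover have "norm (Lam (1 / 2)) * (real N powr (- 1 / 4) * Rr e) \<le> C1 * real N powr (- 1 / 4) * (norm (Lam (1 / 2)) * P e)"
      proof (cases "P e = 0")
        \<comment> \<open>Then some b j is 0, where \<open>rGamma_R\<close> vanishes, and with it
          the central value.\<close>
        case True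
        then obtain j where "j < dF" "1 / 2 + L_shift F e j = 0" by (auto simp: P_def)
        then have "Rr e = 0" by (auto simp: Rr_def rGamma_R_def intro!: bexI[of _ j])
        with True show ?thesis by simp
      next
        case False
        with P0[of e] have "P e > 0" by simp
        with C1(2)[OF e] have "Rr e \<le> C1 * P e" by (simp add: pos_divide_le_eq)
        then have "(norm (Lam (1 / 2)) * real N powr (- 1 / 4)) * Rr e \<le> (norm (Lam (1 / 2)) * real N powr (- 1 / 4)) * (C1 * P e)"
          by (intro mult_left_mono) auto
        then show ?thesis by (simp add: mult_ac)
      qed
      ultimately show ?thesis by simp
    qed
    \<comment> \<open>All errors from the horizontal sides contain a Gaussian in T that dominates
      the growth of \<open>Lam\<close>, so they fall below any \<epsilon>.\<close>
    have "((\<lambda>T. C1 * real N powr (- 1 / 4) * (4 * E' T + 8 * E T)) \<longlongrightarrow> 0) at_top"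
      unfolding E'_def E_def by real_asymp
    then have "\<forall>\<^sub>F T in at_top. C1 * real N powr (- 1 / 4) * (4 * E' T + 8 * E T) < \<epsilon>"
      using \<epsilon> by (rule order_tendstoD)
    moreover have "\<forall>\<^sub>F T in at_top. T \<ge> max 1 (R0 + 1)" by (rule eventually_ge_at_top)
    ultimately show ?thesis
    proof eventually_elim
      case (elim T)
      have "norm (h 0) \<le> norm (J T) / pi + 8 * E T" using elim by (intro main_T) auto
      also have "norm (J T) / pi \<le> norm (J T) / 1" using pi_gt3 by (intro divide_left_mono) auto
      also have "norm (J T) \<le> real N powr (1 / 4) * (C0 / c) * (real N powr (c / 2) * IH T + real N * IR T) + 4 * E' T"
        using elim by (intro J_le) auto
      finally have "norm (h 0) \<le> real N powr (1 / 4) * (C0 / c) * (real N powr (c / 2) * IH T + real N * IR T) + (4 * E' T + 8 * E T)"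
        by simp
      then have "C1 * real N powr (- 1 / 4) * norm (h 0) \<le> C1 * real N powr (- 1 / 4) *
         (real N powr (1 / 4) * (C0 / c) * (real N powr (c / 2) * IH T + real N * IR T) + (4 * E' T + 8 * E T))"
        using C1(1)[of 1] by (intro mult_left_mono) auto
      also have "\<dots> = (real N powr (- 1 / 4) * real N powr (1 / 4)) * (C * (real N powr (c / 2) * IH T + real N * IR T)) + C1 * real N powr (- 1 / 4) * (4 * E' T + 8 * E T)"
        by (simp add: C_def algebra_simps)
      also have "real N powr (- 1 / 4) * real N powr (1 / 4) = 1" using N1 by (simp flip: powr_add)
      finally show ?case using L_half elim by (simp add: IH_def IR_def N_def)
    qed
  qed
  show ?thesis
    using \<open>C > 0\<close> main by (intro exI[of _ C]) blast
qed

end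

section \<open>The logarithm of the twists\<close>

text \<open>A linear factor combines two neighbouring coefficients, so the exponent m is preserved
  and only the constant grows.\<close>

lemma norm_fps_linear_factors_le:
  fixes \<alpha> :: "'j \<Rightarrow> complex" and f :: "complex fps"
  assumes "finite J" "\<And>n. norm (fps_nth f n) \<le> C * (real n + 1) ^ m" "C \<ge> 0"
  shows "\<exists>C'\<ge>0. \<forall>n. norm (fps_nth ((\<Prod>j\<in>J. 1 - fps_const (\<alpha> j) * fps_X) * f) n) \<le> C' * (real n + 1) ^ m"
  using assms(1)
proof (induction J)
  case empty
  then show ?case using assms by (intro exI[of _ C]) auto
next
  case (insert i J)
  define g where "g = (\<Prod>j\<in>J. 1 - fps_const (\<alpha> j) * fps_X) * f"
  obtain C' where C': "C' \<ge> 0" "\<And>n. norm (fps_nth g n) \<le> C' * (real n + 1) ^ m"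
    using insert by (auto simp: g_def)
  have "norm (fps_nth ((1 - fps_const (\<alpha> i) * fps_X) * g) n) \<le> (C' + norm (\<alpha> i) * C') * (real n + 1) ^ m" for n
  proof -
    have eq: "fps_nth ((1 - fps_const (\<alpha> i) * fps_X) * g) n = fps_nth g n - \<alpha> i * (if n = 0 then 0 else fps_nth g (n - 1))"
      by (simp add: algebra_simps mult.assoc)
    have "norm (if n = 0 then 0 else fps_nth g (n - 1)) \<le> C' * (real n + 1) ^ m"
    proof (cases "n = 0")
      case False
      have "norm (fps_nth g (n - 1)) \<le> C' * (real (n - 1) + 1) ^ m" by (rule C')
      also have "\<dots> \<le> C' * (real n + 1) ^ m" using False C' by (intro mult_left_mono power_mono) auto
      finally show ?thesis using False by simp
    qed (use C' in auto)
    then have "norm (\<alpha> i * (if n = 0 then 0 else fps_nth g (n - 1))) \<le> norm (\<alpha> i) * (C' * (real n + 1) ^ m)"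
      unfolding norm_mult by (intro mult_left_mono) auto
    then show ?thesis
      unfolding eq using C'(2)[of n] norm_triangle_ineq4[of "fps_nth g n" "\<alpha> i * (if n = 0 then 0 else fps_nth g (n - 1))"]
      by (simp add: algebra_simps)
  qed
  moreover have "(\<Prod>j\<in>insert i J. 1 - fps_const (\<alpha> j) * fps_X) * f = (1 - fps_const (\<alpha> i) * fps_X) * g"
    using insert by (simp add: g_def mult.assoc)
  ultimately show ?case
    using C' by (intro exI[of _ "C' + norm (\<alpha> i) * C'"]) auto
qed

lemma fps_geometric_inverse: "(1 - fps_const a * fps_X) * Abs_fps (\<lambda>n. a ^ n) = (1 :: 'a :: comm_ring_1 fps)"
proof (rule fps_ext)
  fix n
  show "fps_nth ((1 - fps_const a * fps_X) * Abs_fps (\<lambda>n. a ^ n)) n = fps_nth 1 n"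
    by (cases n) (simp_all add: algebra_simps mult.assoc)
qed

lemma power_le_polynomial_imp_le_1:
  assumes "\<And>n. (a :: real) ^ n \<le> C * (real n + 1) ^ m"
  shows "a \<le> 1"
proof (rule ccontr)
  assume "\<not> a \<le> 1"
  then have a: "a > 1" by simp
  have "((\<lambda>n. C * (real n + 1) ^ m / a ^ n) \<longlongrightarrow> 0) at_top"
    using a by real_asymp
  then have "\<forall>\<^sub>F n in at_top. C * (real n + 1) ^ m / a ^ n < 1"
    by (rule order_tendstoD) simp
  then obtain n where "C * (real n + 1) ^ m / a ^ n < 1"
    using eventually_happens'[OF sequentially_bot] by blast
  then have "C * (real n + 1) ^ m < a ^ n" using a by (simp add: divide_less_eq)
  with assms[of n] show False by simp
qed

lemma dirichlet_series_holomorphic: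
  fixes a :: "nat \<Rightarrow> complex"
  assumes sm: "\<And>\<sigma>. \<sigma> > 1 \<Longrightarrow> summable (\<lambda>n. norm (a n) / real (Suc n) powr \<sigma>)"
  shows "(\<lambda>s. \<Sum>n. a n / of_nat (Suc n) powr s) holomorphic_on {s. Re s > 1}"
proof (rule holomorphic_uniform_sequence)
  show "open {s :: complex. Re s > 1}" by (rule open_halfspace_Re_gt)
  show "(\<lambda>s. \<Sum>n<M. a n / of_nat (Suc n) powr s) holomorphic_on {s. Re s > 1}" for M
    by (intro holomorphic_intros) (auto simp del: of_nat_Suc)
next
  fix s :: complex assume s: "s \<in> {s. Re s > 1}"
  define d where "d = (Re s - 1) / 2"
  have d: "d > 0" using s by (simp add: d_def)
  have re: "Re z \<ge> 1 + d" if "z \<in> cball s d" for z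
    using that abs_Re_le_cmod[of "s - z"] by (simp add: dist_norm d_def abs_le_iff field_simps)
  have "uniform_limit (cball s d) (\<lambda>M s. \<Sum>n<M. a n / of_nat (Suc n) powr s) (\<lambda>s. \<Sum>n. a n / of_nat (Suc n) powr s) sequentially"
  proof (rule Weierstrass_m_test)
    show "summable (\<lambda>n. norm (a n) / real (Suc n) powr (1 + d))" using d by (intro sm) simp
    fix n z assume "z \<in> cball s d"
    then have "real (Suc n) powr (1 + d) \<le> real (Suc n) powr Re z" by (intro powr_mono re) auto
    then show "norm (a n / of_nat (Suc n) powr z) \<le> norm (a n) / real (Suc n) powr (1 + d)"
      using norm_of_real_powr[of "real (Suc n)" z] by (simp add: norm_divide divide_left_mono del: of_nat_Suc)
  qed
  moreover have "cball s d \<subseteq> {s. Re s > 1}" using re d by force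
  ultimately show "\<exists>d>0. cball s d \<subseteq> {s. 1 < Re s} \<and>
     uniform_limit (cball s d) (\<lambda>M s. \<Sum>n<M. a n / of_nat (Suc n) powr s) (\<lambda>s. \<Sum>n. a n / of_nat (Suc n) powr s) sequentially"
    using d by blast
qed

text \<open>The derivative of exp \<phi> is exp \<phi> times that of \<phi>, so the latter vanishes.
  This serves to compare two logarithms of the same function.\<close>

lemma exp_constant_imp_constant:
  fixes \<phi> :: "complex \<Rightarrow> complex"
  assumes hol: "\<phi> holomorphic_on S" and S: "open S" "convex S" and e: "\<And>s. s \<in> S \<Longrightarrow> exp (\<phi> s) = 1"
  shows "\<exists>k. \<forall>s\<in>S. \<phi> s = k"
proof (rule has_field_derivative_zero_constant[OF S(2)])
  fix x assume x: "x \<in> S"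
  have d: "(\<phi> has_field_derivative deriv \<phi> x) (at x)" by (rule holomorphic_derivI[OF hol S(1) x])
  have "((\<lambda>s. exp (\<phi> s)) has_field_derivative exp (\<phi> x) * deriv \<phi> x) (at x)"
    by (rule DERIV_chain2[OF DERIV_exp d])
  moreover have "((\<lambda>s. exp (\<phi> s)) has_field_derivative 0) (at x)"
    by (rule has_field_derivative_transform_within_open[OF _ S(1) x, of "\<lambda>_. 1"]) (use e in auto)
  ultimately have "exp (\<phi> x) * deriv \<phi> x = 0" by (rule DERIV_unique)
  then have "deriv \<phi> x = 0" by simp
  with d show "(\<phi> has_field_derivative 0) (at x within S)"
    using has_field_derivative_at_within by metis
qed

locale L_framework_divisor_bound = L_framework +
  assumes coeff_le: "n \<ge> 1 \<Longrightarrow> norm (L_coeff F n) \<le> real (divisor_fun (L_degree F) n)"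
begin

text \<open>The formula for the coefficients at powers of p says that they are those of a product of
  geometric series. Degree 0, the empty product, stands apart.\<close>

lemma local_factor:
  assumes "prime p"
  shows "fps_nth (\<Prod>j<dF. Abs_fps (\<lambda>n. L_root F j p ^ n)) r = L_coeff F (p ^ r)"
proof (cases dF)
  case 0
  then have "{rs :: nat list. length rs = dF \<and> sum_list rs = r} = (if r = 0 then {[]} else {})"
    by auto
  then show ?thesis using coeff_prime_power[OF assms, of r] 0 by (cases "r = 0") simp_all
next
  case (Suc m)
  then have set: "{..<dF} = {0..m}" by auto
  have "fps_nth (\<Prod>j<dF. Abs_fps (\<lambda>n. L_root F j p ^ n)) r =
      (\<Sum>v\<in>natpermute r (m + 1). \<Prod>j\<in>{0..m}. L_root F j p ^ (v ! j))"
    unfolding set by (simp add: fps_prod_nth)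
  also have "natpermute r (m + 1) = {rs. length rs = dF \<and> sum_list rs = r}"
    using Suc by (auto simp: natpermute_def)
  finally show ?thesis using coeff_prime_power[OF assms, of r] by (simp only: set)
qed

lemma coeff_prime_power_le:
  assumes "prime p"
  shows "norm (L_coeff F (p ^ r)) \<le> 1 * (real r + 1) ^ dF"
proof -
  have "norm (L_coeff F (p ^ r)) \<le> real (divisor_fun dF (p ^ r))"
    using assms by (intro coeff_le) (simp add: Suc_le_eq prime_gt_0_nat)
  also have "\<dots> \<le> real ((r + 1) ^ dF)" using divisor_fun_prime_power_le[OF assms] by (simp only: of_nat_le_iff)
  finally show ?thesis by (simp add: add.commute)
qed

text \<open>Multiplying the local power series, whose coefficients grow polynomially, by all of its linear factors but one
  leaves a geometric series.\<close>

lemma norm_root_le_1: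
  assumes "prime p" "i < dF"
  shows "norm (L_root F i p) \<le> 1"
proof -
  define geo where "geo = (\<lambda>j. Abs_fps (\<lambda>n. L_root F j p ^ n))"
  define G where "G = (\<Prod>j<dF. geo j)"
  have "norm (fps_nth G n) \<le> 1 * (real n + 1) ^ dF" for n
    using coeff_prime_power_le[OF assms(1)] local_factor[OF assms(1), of n] by (simp add: G_def geo_def)
  then obtain C where C: "\<And>n. norm (fps_nth ((\<Prod>j\<in>{..<dF} - {i}. 1 - fps_const (L_root F j p) * fps_X) * G) n) \<le> C * (real n + 1) ^ dF"
    using norm_fps_linear_factors_le[of "{..<dF} - {i}" G 1 dF "\<lambda>j. L_root F j p"] by auto
  have "G = geo i * (\<Prod>j\<in>{..<dF} - {i}. geo j)"
    unfolding G_def using assms by (subst prod.remove[of _ i]) auto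
  moreover have "(\<Prod>j\<in>{..<dF} - {i}. 1 - fps_const (L_root F j p) * fps_X) * (\<Prod>j\<in>{..<dF} - {i}. geo j) = 1"
    unfolding prod.distrib[symmetric] geo_def by (simp add: fps_geometric_inverse)
  ultimately have eq: "(\<Prod>j\<in>{..<dF} - {i}. 1 - fps_const (L_root F j p) * fps_X) * G = geo i"
    by (simp only: mult.left_commute[of _ "geo i"] mult_1_right)
  have "norm (L_root F i p) ^ n \<le> C * (real n + 1) ^ dF" for n
    using C[of n] unfolding eq by (simp add: geo_def norm_power)
  then show ?thesis by (rule power_le_polynomial_imp_le_1)
qed

lemma coeff_prime:
  assumes "prime p"
  shows "L_coeff F p = (\<Sum>j<dF. L_root F j p)"
proof -
  have "fps_nth (\<Prod>j\<in>J. Abs_fps (\<lambda>n. L_root F j p ^ n)) 0 = 1 \<and>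
      fps_nth (\<Prod>j\<in>J. Abs_fps (\<lambda>n. L_root F j p ^ n)) 1 = (\<Sum>j\<in>J. L_root F j p)" if "finite J" for J
    using that by (induction J) (auto simp: fps_mult_nth)
  from this[of "{..<dF}"] show ?thesis using local_factor[OF assms, of 1] by simp
qed

lemma norm_coeff_prime_le:
  assumes "prime p"
  shows "norm (L_coeff F p) \<le> real dF"
proof -
  have "norm (L_coeff F p) \<le> (\<Sum>j<dF. 1)"
    unfolding coeff_prime[OF assms] using norm_root_le_1[OF assms] by (intro sum_norm_le) auto
  then show ?thesis by simp
qed

definition prime_coeff :: "(int \<Rightarrow> complex) \<Rightarrow> nat \<Rightarrow> complex" where
  "prime_coeff chi n = (if prime n then L_coeff F n * chi (int n) else 0)"

definition prime_series :: "(int \<Rightarrow> complex) \<Rightarrow> complex \<Rightarrow> complex" where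
  "prime_series chi s = (\<Sum>n. prime_coeff chi (Suc n) / of_nat (Suc n) powr s)"

text \<open>The contribution to log L of the squares and higher powers of the local roots. It is of
  size p^(- 3 / 2) already for Re s >= 3 / 4, so near the line Re s = 1 continuing log L and
  continuing the prime series are the same problem.\<close>

definition higher_term :: "(int \<Rightarrow> complex) \<Rightarrow> complex \<Rightarrow> nat \<Rightarrow> complex" where
  "higher_term chi s p = (if prime p then \<Sum>j<dF. - Ln (1 - L_root F j p * chi (int p) / of_nat p powr s)
       - L_root F j p * chi (int p) / of_nat p powr s else 0)"

definition higher_series :: "(int \<Rightarrow> complex) \<Rightarrow> complex \<Rightarrow> complex" where
  "higher_series chi s = (\<Sum>n. higher_term chi s (Suc n))"

definition higher_bound :: real where
  "higher_bound = (\<Sum>n. 3 * real dF / real (Suc n) powr (3 / 2))"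

lemma summable_higher_bound: "summable (\<lambda>n. 3 * real dF / real (Suc n) powr (3 / 2))"
proof -
  have "summable (\<lambda>n. real (Suc n) powr (- 3 / 2))"
    using summable_real_powr_iff[of "- 3 / 2"] by (subst summable_Suc_iff) simp
  then have "summable (\<lambda>n. 3 * real dF * real (Suc n) powr (- 3 / 2))" by (rule summable_mult)
  moreover have "3 * real dF * real (Suc n) powr (- 3 / 2) = 3 * real dF / real (Suc n) powr (3 / 2)" for n
    using powr_minus_divide[of "real (Suc n)" "3 / 2"] by (simp del: of_nat_Suc)
  ultimately show ?thesis by (simp only:)
qed

lemma higher_bound_nonneg: "higher_bound \<ge> 0"
  unfolding higher_bound_def
  by (intro suminf_nonneg summable_higher_bound) auto

context
  fixes q :: nat and chi :: "int \<Rightarrow> complex"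
  assumes q: "q \<ge> 2" and chi: "chi \<in> primitive_characters q"
begin

lemma norm_prime_term_le: "norm (prime_coeff chi (Suc n) / of_nat (Suc n) powr s) \<le> norm (L_coeff F (Suc n)) / real (Suc n) powr Re s"
proof -
  have "norm (prime_coeff chi (Suc n)) \<le> norm (L_coeff F (Suc n)) * 1"
    using chi_norm_le[OF q chi, of "int (Suc n)"] by (auto simp: prime_coeff_def norm_mult intro!: mult_left_le simp del: of_nat_Suc)
  then show ?thesis
    using norm_of_real_powr[of "real (Suc n)" s] by (simp add: norm_divide divide_right_mono del: of_nat_Suc)
qed

lemma norm_prime_coeff_le: "norm (prime_coeff chi n) \<le> real dF"
proof (cases "prime n")
  case True
  have "norm (L_coeff F n) * norm (chi (int n)) \<le> real dF * 1"
    using norm_coeff_prime_le[OF True] chi_norm_le[OF q chi] by (intro mult_mono) auto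
  with True show ?thesis by (simp add: prime_coeff_def norm_mult)
qed (simp add: prime_coeff_def)

lemma summable_prime_series:
  assumes "Re s > 1"
  shows "summable (\<lambda>n. norm (prime_coeff chi (Suc n) / of_nat (Suc n) powr s))"
  by (rule summable_comparison_test'[OF summable_abs_coeff[OF assms]])
     (use norm_prime_term_le in \<open>simp del: of_nat_Suc\<close>)

lemma prime_series_holomorphic: "prime_series chi holomorphic_on {s. Re s > 1}"
proof -
  have "summable (\<lambda>n. norm (prime_coeff chi (Suc n)) / real (Suc n) powr \<sigma>)" if "\<sigma> > 1" for \<sigma>
    using summable_prime_series[of "of_real \<sigma>"] that norm_of_real_powr[of "real (Suc _)" "of_real \<sigma>"]
    by (simp add: norm_divide del: of_nat_Suc)
  then show ?thesis
    unfolding prime_series_def[abs_def] by (rule dirichlet_series_holomorphic)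
qed

lemma norm_prime_series_le:
  assumes "Re s \<ge> 3 / 2"
  shows "norm (prime_series chi s) \<le> abs_series"
proof -
  have le: "norm (prime_coeff chi (Suc n) / of_nat (Suc n) powr s) \<le> norm (L_coeff F (Suc n)) / real (Suc n) powr (3 / 2)" for n
  proof -
    have "real (Suc n) powr (3 / 2) \<le> real (Suc n) powr Re s"
      using assms by (intro powr_mono) auto
    then have "norm (L_coeff F (Suc n)) / real (Suc n) powr Re s \<le> norm (L_coeff F (Suc n)) / real (Suc n) powr (3 / 2)"
      by (intro divide_left_mono) auto
    then show ?thesis using norm_prime_term_le[of n s] by linarith
  qed
  show ?thesis
    unfolding prime_series_def abs_series_def
    by (rule norm_suminf_le[OF le summable_abs_coeff]) simp
qed

lemma norm_local_root_le:
  assumes "prime p" "j < dF" "Re s \<ge> 3 / 4"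
  shows "norm (L_root F j p * chi (int p) / of_nat p powr s) \<le> 1 / real p powr (3 / 4)"
    and "1 / real p powr (3 / 4) \<le> 3 / 5"
proof -
  have p: "real p \<ge> 2" using prime_ge_2_nat[OF assms(1)] by simp
  have "norm (L_root F j p) * norm (chi (int p)) \<le> 1 * 1"
    using norm_root_le_1[OF assms(1,2)] chi_norm_le[OF q chi] by (intro mult_mono) auto
  moreover have "real p powr (3 / 4) \<le> real p powr Re s" using p assms by (intro powr_mono) auto
  ultimately have "norm (L_root F j p) * norm (chi (int p)) / (real p powr Re s) \<le> 1 / real p powr (3 / 4)"
    using p by (intro frac_le) auto
  then show "norm (L_root F j p * chi (int p) / of_nat p powr s) \<le> 1 / real p powr (3 / 4)"
    using norm_of_real_powr[of "real p" s] p by (simp add: norm_divide norm_mult)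
  \<comment> \<open>2^(3 / 4) >= 5 / 3, as 625 / 81 < 8. This keeps the local terms within radius 3
    / 5, and 1 / (1 - 3 / 5) = 5 / 2 fits under the constant 3 of
    \<open>higher_bound\<close>.\<close>
  have "(5 / 3 :: real) \<le> real p powr (3 / 4)"
  proof (rule power_le_imp_le_base)
    have "(5 / 3 :: real) ^ Suc 3 \<le> 2 ^ 3" by (simp add: power_divide)
    also have "\<dots> \<le> real p ^ 3" using p by (intro power_mono) auto
    also have "\<dots> = (real p powr (3 / 4)) ^ Suc 3"
    proof -
      have "(real p powr (3 / 4)) ^ 4 = real p powr (real 4 * (3 / 4))" using p by (intro powr_power) auto
      also have "\<dots> = real p powr real 3" by simp
      also have "\<dots> = real p ^ 3" using p by (intro powr_realpow) auto
      finally show ?thesis by (simp add: eval_nat_numeral)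
    qed
    finally show "(5 / 3 :: real) ^ Suc 3 \<le> (real p powr (3 / 4)) ^ Suc 3" .
  qed simp
  then have "1 / real p powr (3 / 4) \<le> 1 / (5 / 3)" using p by (intro divide_left_mono) auto
  then show "1 / real p powr (3 / 4) \<le> 3 / 5" by simp
qed

lemma norm_higher_term_le:
  assumes "Re s \<ge> 3 / 4"
  shows "norm (higher_term chi s (Suc n)) \<le> 3 * real dF / real (Suc n) powr (3 / 2)"
proof (cases "prime (Suc n)")
  case True
  define p where "p = Suc n"
  note pr = True[folded p_def]
  have "norm (- Ln (1 - L_root F j p * chi (int p) / of_nat p powr s) - L_root F j p * chi (int p) / of_nat p powr s)
      \<le> 3 / real p powr (3 / 2)" if "j < dF" for j
  proof -
    define z where "z = L_root F j p * chi (int p) / of_nat p powr s"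
    have z: "norm z \<le> 1 / real p powr (3 / 4)" "norm z \<le> 3 / 5"
      using norm_local_root_le[OF pr that assms] by (auto simp: z_def)
    have "norm (- Ln (1 - z) - z) = norm (ln (1 + (- z)) - (- z))"
    proof -
      have "- Ln (1 - z) - z = - (ln (1 + (- z)) - (- z))" by simp
      then show ?thesis by (simp only: norm_minus_cancel)
    qed
    also have "\<dots> \<le> (norm (- z))\<^sup>2 / (1 - norm (- z))" using z by (intro Ln_approx_linear) auto
    also have "\<dots> \<le> (1 / real p powr (3 / 4))\<^sup>2 / (2 / 5)"
      using z by (intro frac_le power_mono) auto
    also have "(1 / real p powr (3 / 4))\<^sup>2 = 1 / real p powr (3 / 2)"
      by (simp add: power2_eq_square powr_add[symmetric])
    also have "\<dots> / (2 / 5) \<le> 3 / real p powr (3 / 2)"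
    proof -
      have "0 < real p powr (3 / 2)" by (simp add: p_def del: of_nat_Suc)
      then show ?thesis by (simp add: divide_simps)
    qed
    finally show ?thesis by (simp add: z_def)
  qed
  then have "norm (\<Sum>j<dF. - Ln (1 - L_root F j p * chi (int p) / of_nat p powr s) - L_root F j p * chi (int p) / of_nat p powr s)
      \<le> (\<Sum>j<dF. 3 / real p powr (3 / 2))"
    by (intro sum_norm_le) auto
  then show ?thesis using True by (simp add: higher_term_def p_def mult.commute del: of_nat_Suc)
qed (simp add: higher_term_def)

lemma norm_higher_series_le: "Re s \<ge> 3 / 4 \<Longrightarrow> norm (higher_series chi s) \<le> higher_bound"
  unfolding higher_series_def higher_bound_def
  by (rule norm_suminf_le[OF norm_higher_term_le summable_higher_bound])

lemma higher_series_holomorphic: "higher_series chi holomorphic_on {s. Re s > 3 / 4}"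
proof (rule holomorphic_uniform_sequence)
  show "open {s :: complex. Re s > 3 / 4}" by (rule open_halfspace_Re_gt)
  fix M
  have "higher_term chi s (Suc n) = (if prime (Suc n) then \<Sum>j<dF. - Ln (1 - L_root F j (Suc n) * chi (int (Suc n)) / of_nat (Suc n) powr s)
       - L_root F j (Suc n) * chi (int (Suc n)) / of_nat (Suc n) powr s else 0)" for n s
    by (simp add: higher_term_def)
  moreover have "(\<lambda>s. if prime (Suc n) then \<Sum>j<dF. - Ln (1 - L_root F j (Suc n) * chi (int (Suc n)) / of_nat (Suc n) powr s)
       - L_root F j (Suc n) * chi (int (Suc n)) / of_nat (Suc n) powr s else 0) holomorphic_on {s. Re s > 3 / 4}" for n
  proof (cases "prime (Suc n)")
    case True
    have "1 - L_root F j (Suc n) * chi (int (Suc n)) / of_nat (Suc n) powr s \<notin> \<real>\<^sub>\<le>\<^sub>0" if "j < dF" "Re s > 3 / 4" for j s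
    proof -
      have "norm (L_root F j (Suc n) * chi (int (Suc n)) / of_nat (Suc n) powr s) \<le> 3 / 5"
        using norm_local_root_le[OF True that(1), of s] that(2) by linarith
      then have "Re (L_root F j (Suc n) * chi (int (Suc n)) / of_nat (Suc n) powr s) \<le> 3 / 5"
        using complex_Re_le_cmod order_trans by blast
      then show ?thesis by (auto simp: complex_nonpos_Reals_iff simp del: of_nat_Suc)
    qed
    then show ?thesis using True
      by (simp del: of_nat_Suc) (intro holomorphic_intros, auto simp del: of_nat_Suc)
  qed (auto intro: holomorphic_intros)
  ultimately show "(\<lambda>s. \<Sum>n<M. higher_term chi s (Suc n)) holomorphic_on {s. Re s > 3 / 4}"
    by (intro holomorphic_intros) (simp del: of_nat_Suc)
next
  fix s :: complex assume "s \<in> {s. Re s > 3 / 4}"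
  then obtain d where d: "d > 0" "cball s d \<subseteq> {s. Re s > 3 / 4}"
    using open_halfspace_Re_gt open_contains_cball by blast
  have "uniform_limit (cball s d) (\<lambda>M s. \<Sum>n<M. higher_term chi s (Suc n)) (\<lambda>s. \<Sum>n. higher_term chi s (Suc n)) sequentially"
    using d by (intro Weierstrass_m_test[OF _ summable_higher_bound] norm_higher_term_le) auto
  then show "\<exists>d>0. cball s d \<subseteq> {s. 3 / 4 < Re s} \<and>
       uniform_limit (cball s d) (\<lambda>M s. \<Sum>n<M. higher_term chi s (Suc n)) (higher_series chi) sequentially"
    using d by (intro exI[of _ d]) (simp add: higher_series_def[abs_def])
qed

text \<open>For each prime the two terms add up to minus the sum of the logarithms of its linear
  factors, which are nonzero by \<open>has_euler_product\<close>. Hence the exponentials of partial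
  sums are partial Euler products, and both sides are their limit.\<close>

lemma exp_prime_series:
  assumes s: "Re s > 1"
  shows "exp (prime_series chi s + higher_series chi s) = twist_series F chi s"
proof -
  define u where "u = (\<lambda>n. prime_coeff chi n / of_nat n powr s + higher_term chi s n)"
  have nz: "1 - L_root F j p * chi (int p) / of_nat p powr s \<noteq> 0" if "prime p" "j < dF" for p j
    using euler_product_twist[OF q chi] s that by (simp add: has_euler_product_def)
  have u_exp: "exp (u p) = euler_factor F chi s p" for p
  proof (cases "prime p")
    case True
    have "u p = (\<Sum>j<dF. - Ln (1 - L_root F j p * chi (int p) / of_nat p powr s))"
      using True by (simp add: u_def prime_coeff_def higher_term_def coeff_prime sum_distrib_right sum_divide_distrib sum_subtractf)
    then have "exp (u p) = (\<Prod>j<dF. exp (- Ln (1 - L_root F j p * chi (int p) / of_nat p powr s)))"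
      by (simp add: exp_sum)
    also have "\<dots> = (\<Prod>j<dF. inverse (1 - L_root F j p * chi (int p) / of_nat p powr s))"
      using nz[OF True] by (intro prod.cong refl) (simp add: exp_minus)
    finally show ?thesis using True by (simp add: euler_factor_def)
  qed (simp add: u_def prime_coeff_def higher_term_def euler_factor_def)
  have u0: "u 0 = 0" by (simp add: u_def prime_coeff_def higher_term_def)
  have "(\<lambda>n. prime_coeff chi (Suc n) / of_nat (Suc n) powr s) sums prime_series chi s"
    unfolding prime_series_def by (rule summable_sums[OF summable_norm_cancel[OF summable_prime_series[OF s]]])
  moreover have "(\<lambda>n. higher_term chi s (Suc n)) sums higher_series chi s"
    unfolding higher_series_def
    by (intro summable_sums summable_comparison_test'[OF summable_higher_bound norm_higher_term_le]) (use s in auto)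
  ultimately have "(\<lambda>n. u (Suc n)) sums (prime_series chi s + higher_series chi s)"
    unfolding u_def by (rule sums_add)
  then have "u sums (prime_series chi s + higher_series chi s)"
    using u0 sums_Suc_iff[of u] by simp
  then have "(\<lambda>n. exp (\<Sum>k<n. u k)) \<longlonglongrightarrow> exp (prime_series chi s + higher_series chi s)"
    unfolding sums_def by (intro tendsto_exp)
  moreover have "(\<lambda>n. exp (\<Sum>k<n. u k)) = (\<lambda>n. \<Prod>k<n. euler_factor F chi s k)"
    by (simp add: exp_sum u_exp)
  moreover have "(\<lambda>n. \<Prod>k<n. euler_factor F chi s k) \<longlonglongrightarrow> twist_series F chi s"
    using euler_product_twist[OF q chi] s by (intro has_prod_imp_tendsto') (simp add: has_euler_product_def)
  ultimately show ?thesis using LIMSEQ_unique by auto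
qed

lemma L_twist_nonzero: "Re s > 1 \<Longrightarrow> L_twist F chi s \<noteq> 0"
  using exp_prime_series[of s] L_twist_series[OF q chi, of s] by (metis exp_not_eq_zero)

end

text \<open>A holomorphic logarithm g of the twist exists on the convex zero-free rectangle, and g
  minus \<open>higher_series\<close> agrees with the prime series for Re s > 1 up to a constant k.
  Borel-Caratheodory around the point 2 + \<i> Im s bounds g: Re g is bounded above through the
  polynomial growth of the twist, and at the centre by absolute convergence. The radii 1 + \<beta> /
  2 and 1 + \<beta> differ by \<beta> / 2, which costs the factor 1 / \<beta>.\<close>

lemma prime_series_extension:
  "\<exists>C\<ge>1. \<forall>q chi \<beta> Q. q \<ge> 2 \<longrightarrow> chi \<in> primitive_characters q \<longrightarrow> 0 < \<beta> \<longrightarrow> \<beta> \<le> 1 / 4 \<longrightarrow> Q \<ge> 4 \<longrightarrow>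
     (\<forall>s. Re s > 1 - \<beta> \<longrightarrow> \<bar>Im s\<bar> < Q \<longrightarrow> L_twist F chi s \<noteq> 0) \<longrightarrow>
     (\<exists>f. f holomorphic_on {s. Re s > 1 - \<beta> \<and> \<bar>Im s\<bar> < Q} \<and>
        (\<forall>s. Re s > 1 \<longrightarrow> \<bar>Im s\<bar> < Q \<longrightarrow> f s = prime_series chi s) \<and>
        (\<forall>s. 1 - \<beta> / 2 \<le> Re s \<longrightarrow> Re s \<le> 2 \<longrightarrow> \<bar>Im s\<bar> \<le> Q / 2 \<longrightarrow>
           norm (f s) \<le> C * (1 + ln (real (L_conductor F q)) + ln (1 + Q)) / \<beta>))"
proof -
  obtain C1 where C1: "C1 \<ge> 1" "\<And>q chi s. q \<ge> 2 \<Longrightarrow> chi \<in> primitive_characters q \<Longrightarrow> Re s \<ge> - 1 / 2 \<Longrightarrow>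
     norm (L_twist F chi s) \<le> C1 * real (L_conductor F q) * (1 + \<bar>Im s\<bar>) ^ dF"
    using L_twist_bound by blast
  define D where "D = ln C1 + abs_series + higher_bound + 1 + real dF"
  have D1: "D \<ge> 1" "D \<ge> abs_series" "D \<ge> higher_bound"
    using C1(1) abs_series_ge_1 higher_bound_nonneg by (auto simp: D_def)
  define C where "C = 12 * D"
  have main: "\<exists>f. f holomorphic_on {s. Re s > 1 - \<beta> \<and> \<bar>Im s\<bar> < Q} \<and>
        (\<forall>s. Re s > 1 \<longrightarrow> \<bar>Im s\<bar> < Q \<longrightarrow> f s = prime_series chi s) \<and>
        (\<forall>s. 1 - \<beta> / 2 \<le> Re s \<longrightarrow> Re s \<le> 2 \<longrightarrow> \<bar>Im s\<bar> \<le> Q / 2 \<longrightarrow>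
           norm (f s) \<le> C * (1 + ln (real (L_conductor F q)) + ln (1 + Q)) / \<beta>)"
    if q: "q \<ge> 2" and chi: "chi \<in> primitive_characters q" and \<beta>: "0 < \<beta>" "\<beta> \<le> 1 / 4" and Q: "Q \<ge> 4"
      and zf: "\<And>s. Re s > 1 - \<beta> \<Longrightarrow> \<bar>Im s\<bar> < Q \<Longrightarrow> L_twist F chi s \<noteq> 0" for q chi \<beta> Q
  proof -
    define \<Omega> where "\<Omega> = {s. Re s > 1 - \<beta> \<and> \<bar>Im s\<bar> < Q}"
    define \<Omega>1 where "\<Omega>1 = {s. Re s > 1 \<and> \<bar>Im s\<bar> < Q}"
    define N where "N = real (L_conductor F q)"
    have N1: "N \<ge> 1" using N_pos[OF q chi] by (simp add: N_def)
    define Y where "Y = 1 + ln N + ln (1 + Q)"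
    have Y1: "Y \<ge> 1" using N1 Q by (simp add: Y_def)
    have \<Omega>_eq: "\<Omega> = {s. Re s > 1 - \<beta>} \<inter> {s. Im s < Q} \<inter> {s. Im s > - Q}" by (auto simp: \<Omega>_def)
    have \<Omega>1_eq: "\<Omega>1 = {s. Re s > 1} \<inter> {s. Im s < Q} \<inter> {s. Im s > - Q}" by (auto simp: \<Omega>1_def)
    have conv: "convex \<Omega>" "convex \<Omega>1" "open \<Omega>" "open \<Omega>1"
      unfolding \<Omega>_eq \<Omega>1_eq
      by (intro convex_Int open_Int convex_halfspace_Re_gt convex_halfspace_Im_gt convex_halfspace_Im_lt
          open_halfspace_Re_gt open_halfspace_Im_gt open_halfspace_Im_lt)+
    obtain g where g: "g holomorphic_on \<Omega>" "\<And>s. s \<in> \<Omega> \<Longrightarrow> L_twist F chi s = exp (g s)"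
      using contractible_imp_holomorphic_log[OF L_twist_holomorphic[OF q chi, of \<Omega>] convex_imp_contractible[OF conv(1)]] zf
      by (auto simp: \<Omega>_def)
    define P where "P = (\<lambda>s. g s - higher_series chi s)"
    have P_hol: "P holomorphic_on \<Omega>"
      unfolding P_def using \<beta>
      by (intro holomorphic_intros g holomorphic_on_subset[OF higher_series_holomorphic[OF q chi]]) (auto simp: \<Omega>_def)
    have sub: "\<Omega>1 \<subseteq> \<Omega>" using \<beta> by (auto simp: \<Omega>_def \<Omega>1_def)
    have expP: "exp (P s - prime_series chi s) = 1" if "s \<in> \<Omega>1" for s
    proof -
      have "exp (g s) = exp (prime_series chi s + higher_series chi s)"
        using that sub g(2)[of s] L_twist_series[OF q chi, of s] exp_prime_series[OF q chi, of s] by (auto simp: \<Omega>1_def)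
      then show ?thesis by (simp add: P_def exp_diff exp_add)
    qed
    have "(\<lambda>s. P s - prime_series chi s) holomorphic_on \<Omega>1"
      by (intro holomorphic_intros holomorphic_on_subset[OF P_hol sub] holomorphic_on_subset[OF prime_series_holomorphic[OF q chi]])
         (auto simp: \<Omega>1_def)
    then have "\<exists>k. \<forall>s\<in>\<Omega>1. P s - prime_series chi s = k"
      by (rule exp_constant_imp_constant[OF _ conv(4,2) expP])
    then obtain k where k: "\<And>s. s \<in> \<Omega>1 \<Longrightarrow> P s - prime_series chi s = k" by blast
    define f where "f = (\<lambda>s. P s - k)"
    have f_eq: "f s = prime_series chi s" if "s \<in> \<Omega>1" for s using k[OF that] by (simp add: f_def algebra_simps)
    have f_bound: "norm (f s) \<le> C * Y / \<beta>" if s: "1 - \<beta> / 2 \<le> Re s" "Re s \<le> 2" "\<bar>Im s\<bar> \<le> Q / 2" for s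
    proof -
      define z0 where "z0 = Complex 2 (Im s)"
      have z0: "z0 \<in> \<Omega>1" "Re z0 \<ge> 3 / 2" using s Q by (auto simp: z0_def \<Omega>1_def)
      \<comment> \<open>So k is a multiple of 2 \<pi> \<i>, of unknown size but with real part 0.
        Only Re g at the centre enters the argument, and k itself cancels in the final formula for
        f.\<close>
      have "exp k = 1" using expP[OF z0(1)] k[OF z0(1)] by simp
      then have "norm (exp k) = 1" by simp
      then have "Re k = 0" by simp
      have g0: "g z0 = prime_series chi z0 + higher_series chi z0 + k" using k[OF z0(1)] by (simp add: P_def algebra_simps)
      have A0: "norm (prime_series chi z0) \<le> abs_series" by (rule norm_prime_series_le[OF q chi z0(2)])
      have H0: "norm (higher_series chi z) \<le> higher_bound" if "Re z \<ge> 3 / 4" for z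
        by (rule norm_higher_series_le[OF q chi that])
      \<comment> \<open>The disc reaches from abscissa 2 exactly to the edge 1 - \<beta>; as |Im s|
        <= Q / 2, Q >= 4 and the radius is at most 5 / 4, it stays below height Q.\<close>
      have ball: "z \<in> \<Omega> \<and> Re z \<ge> - 1 / 2" if "z \<in> ball z0 (1 + \<beta>)" for z
      proof -
        have "norm (z0 - z) < 1 + \<beta>" using that by (simp add: dist_norm)
        then have "\<bar>Re (z0 - z)\<bar> < 1 + \<beta>" "\<bar>Im (z0 - z)\<bar> < 1 + \<beta>"
          using abs_Re_le_cmod abs_Im_le_cmod le_less_trans by blast+
        then show ?thesis using s \<beta> Q by (auto simp: \<Omega>_def z0_def abs_less_iff abs_le_iff)
      qed
      have re_g: "Re (g z) - Re (g z0) < D * Y" if "z \<in> ball z0 (1 + \<beta>)" for z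
      proof -
        have z: "z \<in> \<Omega>" "Re z \<ge> - 1 / 2" using ball[OF that] by auto
        have "exp (Re (g z)) = norm (L_twist F chi z)" using g(2)[OF z(1)] by simp
        also have "\<dots> \<le> C1 * N * (1 + \<bar>Im z\<bar>) ^ dF" unfolding N_def by (rule C1(2)[OF q chi z(2)])
        also have "\<dots> \<le> C1 * N * (1 + Q) ^ dF"
          using z(1) C1(1) N1 by (intro mult_left_mono power_mono) (auto simp: \<Omega>_def)
        also have "\<dots> = exp (ln C1 + ln N + real dF * ln (1 + Q))"
          using C1(1) N1 Q by (simp add: exp_add exp_of_nat_mult)
        finally have 1: "Re (g z) \<le> ln C1 + ln N + real dF * ln (1 + Q)" by simp
        have "- Re (g z0) = - Re (prime_series chi z0) - Re (higher_series chi z0)"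
          using g0 \<open>Re k = 0\<close> by simp
        also have "\<dots> \<le> abs_series + higher_bound"
          using A0 H0[of z0] z0(2) abs_Re_le_cmod[of "prime_series chi z0"] abs_Re_le_cmod[of "higher_series chi z0"] by linarith
        finally have 2: "- Re (g z0) \<le> abs_series + higher_bound" .
        have "D * ln N \<ge> 1 * ln N" "D * ln (1 + Q) \<ge> real dF * ln (1 + Q)"
          using D1(1) N1 Q C1(1) abs_series_ge_1 higher_bound_nonneg
          by (intro mult_right_mono; auto simp: D_def)+
        moreover have "D * Y = D + D * ln N + D * ln (1 + Q)" by (simp add: Y_def algebra_simps)
        moreover have "ln C1 + abs_series + higher_bound < D" by (simp add: D_def)
        ultimately show ?thesis using 1 2 by linarith
      qed
      have "norm (g s - g z0) \<le> 2 * (1 + \<beta> / 2) * (D * Y) / ((1 + \<beta>) - (1 + \<beta> / 2))"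
      proof (rule borel_caratheodory[of "\<lambda>z. g z - g z0" z0 "1 + \<beta>" "D * Y" s "1 + \<beta> / 2"])
        show "(\<lambda>z. g z - g z0) holomorphic_on ball z0 (1 + \<beta>)"
          using ball by (intro holomorphic_intros holomorphic_on_subset[OF g(1)]) auto
        have "s - z0 = of_real (Re s - 2)" by (simp add: z0_def complex_eq_iff)
        then have "norm (s - z0) = \<bar>Re s - 2\<bar>" by (metis norm_of_real real_norm_def)
        then show "norm (s - z0) \<le> 1 + \<beta> / 2" using s by simp
      qed (use re_g \<beta> in auto)
      also have "\<dots> = (4 + 2 * \<beta>) * (D * Y) / \<beta>" using \<beta> by (simp add: field_simps)
      also have "\<dots> \<le> 5 * (D * Y) / \<beta>" using \<beta> D1 Y1 by (intro divide_right_mono mult_right_mono) auto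
      finally have 1: "norm (g s - g z0) \<le> 5 * (D * Y) / \<beta>" .
      have "f s = (g s - g z0) + prime_series chi z0 + higher_series chi z0 - higher_series chi s"
        by (simp add: f_def P_def g0)
      then have "norm (f s) \<le> norm (g s - g z0) + norm (prime_series chi z0) + norm (higher_series chi z0) + norm (higher_series chi s)"
        by (smt (verit) norm_triangle_ineq norm_triangle_ineq4)
      also have "\<dots> \<le> 5 * (D * Y) / \<beta> + abs_series + higher_bound + higher_bound"
        using s \<beta> z0 by (intro add_mono 1 A0 H0) auto
      also have "\<dots> \<le> 5 * (D * Y) / \<beta> + 3 * (D * Y) / \<beta>"
      proof -
        have "D \<le> D * Y" using D1(1) Y1 by simp
        moreover have "3 * (D * Y) * 1 \<le> 3 * (D * Y) / \<beta>" using \<beta> D1 Y1 by (simp add: field_simps)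
        ultimately show ?thesis using D1 by linarith
      qed
      also have "\<dots> = 8 * (D * Y) / \<beta>" by simp
      also have "\<dots> \<le> C * Y / \<beta>" using \<beta> D1 Y1 by (intro divide_right_mono) (auto simp: C_def)
      finally show ?thesis .
    qed
    show ?thesis
    proof (intro exI[of _ f] conjI allI impI)
      show "f holomorphic_on {s. 1 - \<beta> < Re s \<and> \<bar>Im s\<bar> < Q}"
        using P_hol unfolding f_def \<Omega>_def[symmetric] by (intro holomorphic_intros)
    qed (use f_eq f_bound in \<open>auto simp: \<Omega>1_def Y_def N_def\<close>)
  qed
  show ?thesis
    using main D1(1) by (intro exI[of _ C]) (auto simp: C_def)
qed

end

section \<open>Prime sums twisted by characters without zeros close to the line Re s = 1\<close>

lemma of_real_divide_powr:
  assumes "x > 0" "y > 0"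
  shows "complex_of_real (x / y) powr s = of_real x powr s / of_real y powr s"
proof -
  have "Ln (of_real (x / y)) = Ln (of_real x) - Ln (of_real y)"
  proof -
    have "ln (x / y) = ln x - ln y" using assms by (simp add: ln_div)
    then show ?thesis using assms by (simp only: Ln_of_real divide_pos_pos of_real_diff)
  qed
  then show ?thesis
    using assms by (simp add: powr_def exp_diff right_diff_distrib)
qed

text \<open>Abel summation: the increments of f telescope to f m - f M, so the bound D for the
  partial sums is multiplied by f m only.\<close>

lemma norm_sum_antimono_le:
  fixes f :: "nat \<Rightarrow> real" and c :: "nat \<Rightarrow> complex"
  assumes anti: "\<And>n. n \<ge> m \<Longrightarrow> f (Suc n) \<le> f n" and nonneg: "\<And>n. n \<ge> m \<Longrightarrow> f n \<ge> 0"
    and D: "\<And>k. m \<le> k \<Longrightarrow> k \<le> M \<Longrightarrow> norm (\<Sum>n\<in>{m..<k}. c n) \<le> D" and "m \<le> M"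
  shows "norm (\<Sum>n\<in>{m..<M}. of_real (f n) * c n) \<le> D * f m"
proof -
  have id: "(\<Sum>n\<in>{m..<k}. of_real (f n) * c n) =
      of_real (f k) * (\<Sum>n\<in>{m..<k}. c n) + (\<Sum>n\<in>{m..<k}. of_real (f n - f (Suc n)) * (\<Sum>l\<in>{m..<Suc n}. c l))" if "m \<le> k" for k
    using that
  proof (induction k rule: dec_induct)
    case (step k)
    then show ?case by (simp add: algebra_simps)
  qed simp
  have "norm (\<Sum>n\<in>{m..<M}. of_real (f n) * c n) \<le>
      norm (of_real (f M) * (\<Sum>n\<in>{m..<M}. c n)) + norm (\<Sum>n\<in>{m..<M}. of_real (f n - f (Suc n)) * (\<Sum>l\<in>{m..<Suc n}. c l))"
    unfolding id[OF \<open>m \<le> M\<close>] by (rule norm_triangle_ineq)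
  also have "\<dots> \<le> f M * D + (\<Sum>n\<in>{m..<M}. (f n - f (Suc n)) * D)"
  proof (intro add_mono sum_norm_le)
    show "norm (of_real (f M) * (\<Sum>n\<in>{m..<M}. c n)) \<le> f M * D"
      using D[of M] \<open>m \<le> M\<close> nonneg[of M] by (simp add: norm_mult mult_left_mono)
    fix n assume n: "n \<in> {m..<M}"
    then have "f n - f (Suc n) \<ge> 0" using anti[of n] by simp
    moreover have "norm (\<Sum>l\<in>{m..<Suc n}. c l) \<le> D" using n by (intro D) auto
    ultimately show "norm (of_real (f n - f (Suc n)) * (\<Sum>l\<in>{m..<Suc n}. c l)) \<le> (f n - f (Suc n)) * D"
      unfolding norm_mult norm_of_real by (simp add: mult_left_mono)
  qed
  also have "(\<Sum>n\<in>{m..<M}. (f n - f (Suc n)) * D) = (f m - f M) * D"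
  proof -
    have "(\<Sum>n\<in>{m..<k}. f n - f (Suc n)) = f m - f k" if "m \<le> k" for k
      using that by (induction k rule: dec_induct) auto
    then show ?thesis using \<open>m \<le> M\<close> by (simp flip: sum_distrib_right)
  qed
  finally show ?thesis by (simp add: algebra_simps)
qed

context L_framework_divisor_bound
begin

text \<open>The oscillating factor n^(- \<i> v) is put into the coefficients, so that only the
  monotone weight n^(- \<sigma>) is left for partial summation.\<close>

definition shifted_coeff :: "(int \<Rightarrow> complex) \<Rightarrow> real \<Rightarrow> nat \<Rightarrow> complex" where
  "shifted_coeff chi v n = prime_coeff chi n / of_nat n powr (\<i> * of_real v)"

text \<open>The Riesz mean has an absolutely convergent Perron integral; differencing it recovers the sharp cutoff.\<close>

definition riesz :: "(int \<Rightarrow> complex) \<Rightarrow> real \<Rightarrow> real \<Rightarrow> complex" where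
  "riesz chi v x = (\<Sum>n\<in>{1..nat \<lfloor>x\<rfloor>}. shifted_coeff chi v n * of_real (x - real n))"

context
  fixes q :: nat and chi :: "int \<Rightarrow> complex"
  assumes q: "q \<ge> 2" and chi: "chi \<in> primitive_characters q"
begin

lemma norm_shifted_coeff: "norm (shifted_coeff chi v (Suc n)) = norm (prime_coeff chi (Suc n))"
  using norm_of_real_powr[of "real (Suc n)" "\<i> * of_real v"]
  by (simp add: shifted_coeff_def norm_divide del: of_nat_Suc)

lemma norm_shifted_coeff_le: "norm (shifted_coeff chi v n) \<le> real dF"
  using norm_shifted_coeff[of v "n - 1"] norm_prime_coeff_le[OF q chi, of n]
  by (cases n) (simp_all add: shifted_coeff_def prime_coeff_def)

lemma shifted_coeff_sum_le:
  "(\<Sum>n<M. norm (shifted_coeff chi v (Suc n)) / (real (Suc n))\<^sup>2) \<le> abs_series"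
proof -
  have "(\<Sum>n<M. norm (shifted_coeff chi v (Suc n)) / (real (Suc n))\<^sup>2) \<le> (\<Sum>n<M. norm (L_coeff F (Suc n)) / real (Suc n) powr (3 / 2))"
  proof (rule sum_mono)
    fix n
    have "norm (prime_coeff chi (Suc n)) \<le> norm (L_coeff F (Suc n)) * 1"
      using chi_norm_le[OF q chi, of "int (Suc n)"] by (auto simp: prime_coeff_def norm_mult intro!: mult_left_le simp del: of_nat_Suc)
    moreover have "real (Suc n) powr (3 / 2) \<le> (real (Suc n))\<^sup>2"
      using powr_mono[of "3 / 2" 2 "real (Suc n)"] by (simp add: powr_numeral del: of_nat_Suc)
    ultimately show "norm (shifted_coeff chi v (Suc n)) / (real (Suc n))\<^sup>2 \<le> norm (L_coeff F (Suc n)) / real (Suc n) powr (3 / 2)"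
      unfolding norm_shifted_coeff by (intro frac_le) (auto simp del: of_nat_Suc)
  qed
  also have "\<dots> \<le> abs_series"
    unfolding abs_series_def by (intro sum_le_suminf summable_abs_coeff) auto
  finally show ?thesis .
qed

text \<open>Perron's formula term by term. The series is first cut at a finite M, so that no
  infinite sum is exchanged with an integral; its tail contributes 2 and the kernel error 64 to the
  constant 66.\<close>

lemma riesz_perron:
  assumes x: "x \<ge> 1" and T: "T \<ge> 2"
  shows "norm (vertical_integral (\<lambda>s. prime_series chi (s + \<i> * of_real v) * (of_real x powr (s + 1) / (s * (s + 1)))) 2 T
      - of_real (2 * pi) * riesz chi v x) \<le> 66 * abs_series * x ^ 3 / T"
proof -
  define c where "c = shifted_coeff chi v"
  define k where "k = (\<lambda>s. of_real x powr (s + 1) / (s * (s + 1)) :: complex)"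
  define a where "a = (\<lambda>n s. c (Suc n) / of_nat (Suc n) powr s)"
  have x0: "x > 0" and T0: "T > 0" using x T by auto
  have cont_k: "continuous_on {s. Re s = 2} k"
    unfolding k_def using x0 by (intro continuous_intros) (auto simp: add_eq_0_iff2)
  have cont_a: "continuous_on A (a n)" for A n
    unfolding a_def by (intro continuous_intros) (auto simp del: of_nat_Suc)
  have nk: "norm (k s) \<le> x ^ 3" if "Re s = 2" for s
  proof -
    have "norm s \<ge> 1" "norm (s + 1) \<ge> 1"
      using that abs_Re_le_cmod[of s] abs_Re_le_cmod[of "s + 1"] by auto
    then have "1 * 1 \<le> norm s * norm (s + 1)" by (intro mult_mono) auto
    moreover have "norm (of_real x powr (s + 1)) = x ^ 3"
      using that x0 norm_of_real_powr[OF x0, of "s + 1"] by (simp add: powr_numeral)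
    ultimately show ?thesis
      using x0 divide_left_mono[of 1 "norm s * norm (s + 1)" "x ^ 3"] by (simp add: k_def norm_divide norm_mult)
  qed
  have na: "norm (a n s) = norm (c (Suc n)) / (real (Suc n))\<^sup>2" if "Re s = 2" for n s
    using norm_of_real_powr[of "real (Suc n)" s] that by (simp add: a_def norm_divide powr_numeral del: of_nat_Suc)
  have sm: "summable (\<lambda>n. norm (c (Suc n)) / (real (Suc n))\<^sup>2)"
  proof (rule bounded_imp_summable)
    show "(\<Sum>n\<le>M. norm (c (Suc n)) / (real (Suc n))\<^sup>2) \<le> abs_series" for M
      using shifted_coeff_sum_le[of v "Suc M"] by (simp add: c_def lessThan_Suc_atMost del: of_nat_Suc)
  qed auto
  have a_sums: "(\<lambda>n. a n s) sums prime_series chi (s + \<i> * of_real v)" if "Re s = 2" for s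
  proof -
    have "a n s = prime_coeff chi (Suc n) / of_nat (Suc n) powr (s + \<i> * of_real v)" for n
      by (simp add: a_def c_def shifted_coeff_def powr_add del: of_nat_Suc)
    moreover have "(\<lambda>n. prime_coeff chi (Suc n) / of_nat (Suc n) powr (s + \<i> * of_real v)) sums prime_series chi (s + \<i> * of_real v)"
      unfolding prime_series_def using that
      by (intro summable_sums[OF summable_norm_cancel[OF summable_prime_series[OF q chi]]]) simp
    ultimately show ?thesis by simp
  qed
  \<comment> \<open>Small enough that the tail, against a kernel of size at most x^3 on a segment of
    length 2 T, stays within the error x^3 / T.\<close>
  define r where "r = abs_series / (T * T)"
  have r0: "r > 0" using abs_series_ge_1 T0 by (simp add: r_def)
  obtain M0 where M0: "\<And>n. n \<ge> M0 \<Longrightarrow> norm (\<Sum>i. norm (c (Suc (i + n))) / (real (Suc (i + n)))\<^sup>2) < r"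
    using suminf_exist_split[OF r0 sm] by auto
  \<comment> \<open>M is also at least the floor of x, so that the finite sum contains the whole
    Riesz mean; for n beyond x the main term of the kernel is 0.\<close>
  define M where "M = max M0 (nat \<lfloor>x\<rfloor>)"
  define AM where "AM = (\<lambda>s. \<Sum>n<M. a n s)"
  have tail: "norm (prime_series chi (s + \<i> * of_real v) - AM s) \<le> r" if "Re s = 2" for s
  proof -
    have "prime_series chi (s + \<i> * of_real v) - AM s = (\<Sum>n. a (n + M) s)"
      using suminf_minus_initial_segment[OF sums_summable[OF a_sums[OF that]], of M] sums_unique[OF a_sums[OF that]]
      by (simp add: AM_def)
    also have "norm \<dots> \<le> (\<Sum>n. norm (c (Suc (n + M))) / (real (Suc (n + M)))\<^sup>2)"
    proof (rule norm_suminf_le)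
      show "norm (a (n + M) s) \<le> norm (c (Suc (n + M))) / (real (Suc (n + M)))\<^sup>2" for n
        using na[OF that, of "n + M"] by simp
      show "summable (\<lambda>n. norm (c (Suc (n + M))) / (real (Suc (n + M)))\<^sup>2)"
        using summable_ignore_initial_segment[OF sm, of M] by simp
    qed
    also have "\<dots> \<le> r" using M0[of M] by (simp add: M_def)
    finally show ?thesis .
  qed
  let ?P = "\<lambda>s. prime_series chi (s + \<i> * of_real v)"
  have cont_P: "continuous_on {s. Re s = 2} ?P"
  proof (rule continuous_on_compose2[OF holomorphic_on_imp_continuous_on[OF prime_series_holomorphic[OF q chi]]])
    show "continuous_on {s. Re s = 2} (\<lambda>s. s + \<i> * of_real v)" by (intro continuous_intros)
  qed auto
  have cont_AM: "continuous_on {s. Re s = 2} AM"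
    unfolding AM_def by (intro continuous_intros cont_a)
  have int: "(\<lambda>t. f (Complex 2 t)) integrable_on {- T..T}" if "continuous_on {s. Re s = 2} f" for f :: "complex \<Rightarrow> complex"
    by (rule integrable_continuous_real[OF continuous_on_vertical[OF that]]) simp
  have "vertical_integral (\<lambda>s. ?P s * k s) 2 T - vertical_integral (\<lambda>s. AM s * k s) 2 T =
      vertical_integral (\<lambda>s. (?P s - AM s) * k s) 2 T"
    unfolding vertical_integral_def left_diff_distrib
    by (rule integral_diff[symmetric]) (intro int continuous_intros cont_P cont_AM cont_k)+
  also have "norm \<dots> \<le> integral {- T..T} (\<lambda>_. r * x ^ 3)"
  proof (rule norm_vertical_integral_le[where A = "{s. Re s = 2}"])
    show "continuous_on {s. Re s = 2} (\<lambda>s. (?P s - AM s) * k s)" by (intro continuous_intros cont_P cont_AM cont_k)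
    show "norm ((?P (Complex 2 t) - AM (Complex 2 t)) * k (Complex 2 t)) \<le> r * x ^ 3" for t
      unfolding norm_mult using r0 by (intro mult_mono tail nk) auto
  qed auto
  also have "\<dots> = 2 * abs_series * x ^ 3 / T" using T0 by (simp add: r_def)
  finally have 1: "norm (vertical_integral (\<lambda>s. ?P s * k s) 2 T - vertical_integral (\<lambda>s. AM s * k s) 2 T) \<le> 2 * abs_series * x ^ 3 / T" .
  define y where "y = (\<lambda>n. x / real (Suc n))"
  have y0: "y n > 0" for n using x0 by (simp add: y_def)
  have ak: "a n s * k s = (c (Suc n) * of_real x) * (of_real (y n) powr s / (s * (s + 1)))" for n s
  proof -
    have "of_real (y n) powr s = of_real x powr s / of_nat (Suc n) powr s"
      using of_real_divide_powr[of x "real (Suc n)" s] x0 by (simp add: y_def del: of_nat_Suc)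
    moreover have "of_real x powr (s + 1) = of_real x powr s * of_real x" using x0 by (simp add: powr_add)
    ultimately show ?thesis by (simp add: a_def k_def mult_ac)
  qed
  have cont_y: "continuous_on {s. Re s = 2} (\<lambda>s. of_real (y n) powr s / (s * (s + 1)) :: complex)" for n
    using y0[of n] by (intro continuous_intros) (auto simp: add_eq_0_iff2)
  have "vertical_integral (\<lambda>s. AM s * k s) 2 T = integral {- T..T} (\<lambda>t. \<Sum>n<M. (c (Suc n) * of_real x) * (of_real (y n) powr Complex 2 t / (Complex 2 t * (Complex 2 t + 1))))"
    unfolding vertical_integral_def AM_def sum_distrib_right ak ..
  also have "\<dots> = (\<Sum>n<M. integral {- T..T} (\<lambda>t. (c (Suc n) * of_real x) * (of_real (y n) powr Complex 2 t / (Complex 2 t * (Complex 2 t + 1)))))"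
    by (rule integral_sum) (simp, rule integrable_on_mult_right[OF int[OF cont_y]])
  also have "\<dots> = (\<Sum>n<M. (c (Suc n) * of_real x) * vertical_integral (\<lambda>s. of_real (y n) powr s / (s * (s + 1))) 2 T)"
    unfolding vertical_integral_def by (intro sum.cong refl integral_mult_right)
  finally have AM_eq: "vertical_integral (\<lambda>s. AM s * k s) 2 T = \<dots>" .
  have R_eq: "of_real (2 * pi) * riesz chi v x = (\<Sum>n<M. (c (Suc n) * of_real x) * of_real (2 * pi * max 0 (1 - 1 / y n)))"
  proof -
    have "riesz chi v x = (\<Sum>n<nat \<lfloor>x\<rfloor>. c (Suc n) * of_real (x - real (Suc n)))"
      unfolding riesz_def c_def
      by (intro sum.reindex_bij_witness[of _ Suc "\<lambda>n. n - 1"]) auto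
    also have "\<dots> = (\<Sum>n<nat \<lfloor>x\<rfloor>. c (Suc n) * of_real (max 0 (x - real (Suc n))))"
    proof (intro sum.cong refl)
      fix n assume "n \<in> {..<nat \<lfloor>x\<rfloor>}"
      then have "real (Suc n) \<le> x" by simp linarith
      then show "c (Suc n) * of_real (x - real (Suc n)) = c (Suc n) * of_real (max 0 (x - real (Suc n)))" by (simp add: max_def)
    qed
    also have "\<dots> = (\<Sum>n<M. c (Suc n) * of_real (max 0 (x - real (Suc n))))"
    proof (intro sum.mono_neutral_left ballI)
      fix n assume "n \<in> {..<M} - {..<nat \<lfloor>x\<rfloor>}"
      then have "x - real (Suc n) \<le> 0" by simp linarith
      then show "c (Suc n) * of_real (max 0 (x - real (Suc n))) = 0" by (simp add: max_def)
    qed (auto simp: M_def)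
    finally have eq: "riesz chi v x = (\<Sum>n<M. c (Suc n) * of_real (max 0 (x - real (Suc n))))" .
    have "x * max 0 (1 - 1 / y n) = max 0 (x - real (Suc n))" for n
      using x0 by (simp add: y_def max_mult_distrib_left algebra_simps del: of_nat_Suc)
    then have "of_real x * of_real (2 * pi * max 0 (1 - 1 / y n)) = (of_real (2 * pi) * of_real (max 0 (x - real (Suc n))) :: complex)" for n
      by (metis mult.left_commute of_real_mult)
    then show ?thesis
      unfolding eq sum_distrib_left by (intro sum.cong refl) (simp only: mult.assoc mult.left_commute)
  qed
  have "norm (vertical_integral (\<lambda>s. AM s * k s) 2 T - of_real (2 * pi) * riesz chi v x) \<le>
      (\<Sum>n<M. norm (c (Suc n)) * x * (64 * (y n)\<^sup>2 / T))"
    unfolding AM_eq R_eq sum_subtractf[symmetric] right_diff_distrib[symmetric]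
  proof (intro sum_norm_le)
    fix n
    have "norm (c (Suc n) * of_real x) * norm (vertical_integral (\<lambda>s. of_real (y n) powr s / (s * (s + 1))) 2 T - of_real (2 * pi * max 0 (1 - 1 / y n)))
       \<le> (norm (c (Suc n)) * x) * (64 * (y n)\<^sup>2 / T)"
      using perron_kernel[OF y0 T] x0 by (intro mult_mono) (auto simp: norm_mult)
    then show "norm (c (Suc n) * of_real x * (vertical_integral (\<lambda>s. of_real (y n) powr s / (s * (s + 1))) 2 T - of_real (2 * pi * max 0 (1 - 1 / y n))))
       \<le> norm (c (Suc n)) * x * (64 * (y n)\<^sup>2 / T)" by (simp only: norm_mult)
  qed
  also have "\<dots> = 64 * x ^ 3 / T * (\<Sum>n<M. norm (c (Suc n)) / (real (Suc n))\<^sup>2)"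
    unfolding sum_distrib_left
    by (intro sum.cong refl) (simp add: y_def power_divide power2_eq_square power3_eq_cube mult_ac del: of_nat_Suc)
  also have "\<dots> \<le> 64 * x ^ 3 / T * abs_series"
    unfolding c_def using x0 T0 by (intro mult_left_mono shifted_coeff_sum_le) auto
  finally have 2: "norm (vertical_integral (\<lambda>s. AM s * k s) 2 T - of_real (2 * pi) * riesz chi v x) \<le> 64 * abs_series * x ^ 3 / T"
    by (simp add: mult_ac)
  have "norm (vertical_integral (\<lambda>s. ?P s * k s) 2 T - of_real (2 * pi) * riesz chi v x) \<le> 2 * abs_series * x ^ 3 / T + 64 * abs_series * x ^ 3 / T"
    using norm_triangle_mono[OF 1 2] by simp
  also have "\<dots> = 66 * abs_series * x ^ 3 / T" by (simp add: add_divide_distrib[symmetric])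
  finally show ?thesis by (simp add: k_def)
qed

text \<open>The Perron integral up to height T = Q / 4 is moved to Re s = 1 - \<beta> / 2, where
  |x^(s + 1)| = x^(2 - \<beta> / 2). With |v| <= Q / 4 the shifted argument stays in |Im| <= Q / 2,
  the range where f is bounded by M. The term x^3 / Q collects the truncation error and the
  horizontal sides.\<close>

lemma norm_riesz_le:
  assumes f: "f holomorphic_on {s. Re s > 1 - \<beta> \<and> \<bar>Im s\<bar> < Q}"
    and f_eq: "\<And>s. Re s > 1 \<Longrightarrow> \<bar>Im s\<bar> < Q \<Longrightarrow> f s = prime_series chi s"
    and f_le: "\<And>s. 1 - \<beta> / 2 \<le> Re s \<Longrightarrow> Re s \<le> 2 \<Longrightarrow> \<bar>Im s\<bar> \<le> Q / 2 \<Longrightarrow> norm (f s) \<le> M"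
    and \<beta>: "0 < \<beta>" "\<beta> \<le> 1 / 4" and Q: "Q \<ge> 8" and v: "\<bar>v\<bar> \<le> Q / 4" and x: "x \<ge> 1"
  shows "norm (riesz chi v x) \<le> 300 * (abs_series + M) * (x powr (2 - \<beta> / 2) + x ^ 3 / Q)"
proof -
  define T where "T = Q / 4"
  have T: "T \<ge> 2" using Q by (simp add: T_def)
  have x0: "x > 0" using x by simp
  have M0: "M \<ge> 0" using f_le[of 1] \<beta> Q norm_ge_zero[of "f 1"] by (simp del: norm_ge_zero)
  define k where "k = (\<lambda>s. of_real x powr (s + 1) / (s * (s + 1)) :: complex)"
  define g where "g = (\<lambda>s. f (s + \<i> * of_real v) * k s)"
  define b where "b = 1 - \<beta> / 2"
  define S where "S = {s. Re s > 1 - \<beta>} \<inter> {s. Im s > - Q - v} \<inter> {s. Im s < Q - v}"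
  have conv: "convex S" unfolding S_def
    by (intro convex_Int convex_halfspace_Re_gt convex_halfspace_Im_gt convex_halfspace_Im_lt)
  have k_hol: "k holomorphic_on {s. Re s > 1 - \<beta>}"
  proof -
    have "s \<noteq> 0 \<and> s + 1 \<noteq> 0" if "Re s > 1 - \<beta>" for s
    proof -
      have "Re s > 0" "Re (s + 1) > 0" using that \<beta> by simp_all
      then show ?thesis by (metis less_irrefl zero_complex.sel(1))
    qed
    then show ?thesis unfolding k_def using x0 by (intro holomorphic_intros) auto
  qed
  have "(f \<circ> (\<lambda>s. s + \<i> * of_real v)) holomorphic_on S"
    by (rule holomorphic_on_compose_gen[OF _ f]) (auto intro!: holomorphic_intros simp: S_def)
  then have g_hol: "g holomorphic_on S"
    unfolding g_def using k_hol
    by (intro holomorphic_intros) (auto simp: o_def S_def elim: holomorphic_on_subset)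
  have g2: "vertical_integral (\<lambda>s. prime_series chi (s + \<i> * of_real v) * k s) 2 T = vertical_integral g 2 T"
    unfolding vertical_integral_def g_def
  proof (intro integral_cong)
    fix t assume "t \<in> {- T..T}"
    then have "f (Complex 2 t + \<i> * of_real v) = prime_series chi (Complex 2 t + \<i> * of_real v)"
      using v Q by (intro f_eq) (auto simp: T_def abs_le_iff abs_less_iff)
    then show "prime_series chi (Complex 2 t + \<i> * of_real v) * k (Complex 2 t) = f (Complex 2 t + \<i> * of_real v) * k (Complex 2 t)"
      by simp
  qed
  have fM: "norm (f (s + \<i> * of_real v)) \<le> M" if "b \<le> Re s" "Re s \<le> 2" "\<bar>Im s\<bar> \<le> T" for s
    using that v abs_triangle_ineq[of "Im s" v] by (intro f_le) (auto simp: b_def T_def)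
  have nx: "norm (of_real x powr (s + 1)) = x powr (Re s + 1)" for s
    using norm_of_real_powr[OF x0, of "s + 1"] by simp
  have "norm (vertical_integral g 2 T - vertical_integral g b T) \<le> 2 * (M * (x ^ 3 / (T * T))) * (2 - b)"
  proof (rule rectangle_shift[OF g_hol conv])
    show "cbox (Complex b (- T)) (Complex 2 T) \<subseteq> S"
      using \<beta> v Q by (auto simp: in_cbox_complex_iff S_def b_def T_def abs_le_iff)
    have "norm (g s) \<le> M * (x ^ 3 / (T * T))" if s: "b \<le> Re s" "Re s \<le> 2" "\<bar>Im s\<bar> = T" for s
      unfolding g_def norm_mult
    proof (intro mult_mono fM)
      have "norm s \<ge> T" "norm (s + 1) \<ge> T" using s abs_Im_le_cmod[of s] abs_Im_le_cmod[of "s + 1"] by auto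
      then have "T * T \<le> norm s * norm (s + 1)" using T by (intro mult_mono) auto
      moreover have "x powr (Re s + 1) \<le> x ^ 3"
        using x s powr_mono[of "Re s + 1" 3 x] by (simp add: powr_numeral)
      ultimately show "norm (k s) \<le> x ^ 3 / (T * T)"
        unfolding k_def norm_divide norm_mult nx using T x0 by (intro frac_le) auto
    qed (use s M0 in auto)
    then show "norm (g (Complex y T)) \<le> M * (x ^ 3 / (T * T)) \<and> norm (g (Complex y (- T))) \<le> M * (x ^ 3 / (T * T))" if "y \<in> {b..2}" for y
      using that T by auto
  qed (use \<beta> T in \<open>auto simp: b_def\<close>)
  also have "\<dots> \<le> 2 * (M * (x ^ 3 / (T * T))) * 2"
    using \<beta> M0 x0 T by (intro mult_left_mono) (auto simp: b_def)
  also have "\<dots> \<le> 4 * M * (x ^ 3 / T)"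
  proof -
    have "x ^ 3 / (T * T) \<le> x ^ 3 / (T * 1)" using x0 T by (intro divide_left_mono mult_left_mono) auto
    then have "M * (x ^ 3 / (T * T)) \<le> M * (x ^ 3 / T)" using M0 by (intro mult_left_mono) auto
    then show ?thesis by simp
  qed
  finally have 1: "norm (vertical_integral g 2 T - vertical_integral g b T) \<le> 4 * M * (x ^ 3 / T)" .
  have "norm (vertical_integral g b T) \<le> integral {- T..T} (\<lambda>t. 2 * M * x powr (2 - \<beta> / 2) * (1 / (1 + t\<^sup>2)))"
  proof (rule norm_vertical_integral_le[OF holomorphic_on_imp_continuous_on[OF g_hol]])
    fix t assume t: "t \<in> {- T..T}"
    then show "Complex b t \<in> S" using \<beta> v Q by (auto simp: S_def b_def T_def abs_le_iff)
    define s where "s = Complex b t"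
    \<comment> \<open>From b >= 7 / 8 follows b^2 >= 1 / 2 and |s|^2 >= (1 + t^2) / 2, so the
      integral over t is dominated by that of the derivative of arctan, independently of T.\<close>
    have b2: "b \<ge> 7 / 8" using \<beta> by (simp add: b_def)
    have "(7 / 8)\<^sup>2 \<le> b\<^sup>2" using b2 by (intro power_mono) auto
    then have "1 / 2 \<le> b\<^sup>2" by (simp add: power_divide)
    moreover have "(norm s)\<^sup>2 = b\<^sup>2 + t\<^sup>2" by (simp add: s_def cmod_power2)
    moreover have "t\<^sup>2 \<ge> 0" by simp
    ultimately have "(1 + t\<^sup>2) / 2 \<le> (norm s)\<^sup>2" by argo
    also have "(norm s)\<^sup>2 \<le> norm s * norm (s + 1)"
    proof -
      have "norm s \<le> norm (s + 1)" using b2 by (simp add: cmod_def s_def power2_eq_square algebra_simps)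
      then show ?thesis by (simp add: power2_eq_square mult_left_mono)
    qed
    finally have den: "(1 + t\<^sup>2) / 2 \<le> norm s * norm (s + 1)" .
    have pos: "(1 + t\<^sup>2) / 2 > 0" by (simp add: add_pos_nonneg)
    have "norm (k s) \<le> x powr (2 - \<beta> / 2) / ((1 + t\<^sup>2) / 2)"
      unfolding k_def norm_divide norm_mult nx using den pos by (intro frac_le) (auto simp: s_def b_def)
    then have "norm (f (s + \<i> * of_real v)) * norm (k s) \<le> M * (x powr (2 - \<beta> / 2) / ((1 + t\<^sup>2) / 2))"
      using t M0 b2 \<beta> by (intro mult_mono fM) (auto simp: s_def b_def)
    then show "norm (g (Complex b t)) \<le> 2 * M * x powr (2 - \<beta> / 2) * (1 / (1 + t\<^sup>2))"
      by (simp add: g_def norm_mult s_def mult_ac)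
  qed (intro integrable_on_mult_right integral_inverse_square_le)
  also have "\<dots> = 2 * M * x powr (2 - \<beta> / 2) * integral {- T..T} (\<lambda>t. 1 / (1 + t\<^sup>2))"
    by (rule integral_mult_right)
  also have "\<dots> \<le> 2 * M * x powr (2 - \<beta> / 2) * pi"
    using M0 by (intro mult_left_mono integral_inverse_square_le) auto
  finally have 2: "norm (vertical_integral g b T) \<le> 2 * M * x powr (2 - \<beta> / 2) * pi" .
  have 3: "norm (vertical_integral g 2 T - of_real (2 * pi) * riesz chi v x) \<le> 66 * abs_series * (x ^ 3 / T)"
    using riesz_perron[OF x T, of v] unfolding g2[symmetric] by (simp add: k_def)
  have "norm (of_real (2 * pi) * riesz chi v x) \<le> norm (vertical_integral g 2 T - of_real (2 * pi) * riesz chi v x) +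
      norm (vertical_integral g 2 T - vertical_integral g b T) + norm (vertical_integral g b T)"
  proof -
    have "norm r \<le> norm (a - r) + norm (a - b) + norm b" for r a b :: complex
      using norm_triangle_ineq4[of "b + (a - b)" "a - r"] norm_triangle_ineq[of b "a - b"] by simp
    then show ?thesis .
  qed
  also have "\<dots> \<le> 66 * abs_series * (x ^ 3 / T) + 4 * M * (x ^ 3 / T) + 2 * M * x powr (2 - \<beta> / 2) * pi"
    by (intro add_mono 1 2 3)
  finally have fin: "2 * pi * norm (riesz chi v x) \<le> 66 * abs_series * (x ^ 3 / T) + 4 * M * (x ^ 3 / T) + 2 * M * x powr (2 - \<beta> / 2) * pi"
    by (simp add: norm_mult)
  have "1 * norm (riesz chi v x) \<le> 2 * pi * norm (riesz chi v x)" using pi_gt3 by (intro mult_right_mono) auto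
  also note fin
  also have "2 * M * x powr (2 - \<beta> / 2) * pi \<le> 2 * M * x powr (2 - \<beta> / 2) * 4"
    using M0 pi_less_4 by (intro mult_left_mono) auto
  also have "x ^ 3 / T = 4 * (x ^ 3 / Q)" by (simp add: T_def)
  finally have "norm (riesz chi v x) \<le> 264 * abs_series * (x ^ 3 / Q) + 16 * M * (x ^ 3 / Q) + 8 * M * x powr (2 - \<beta> / 2)" by simp
  also have "\<dots> \<le> 300 * (abs_series + M) * (x ^ 3 / Q) + 300 * (abs_series + M) * x powr (2 - \<beta> / 2)"
  proof -
    have "264 * abs_series * (x ^ 3 / Q) + 16 * M * (x ^ 3 / Q) = (264 * abs_series + 16 * M) * (x ^ 3 / Q)" by (simp add: algebra_simps)
    also have "\<dots> \<le> 300 * (abs_series + M) * (x ^ 3 / Q)"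
      using M0 abs_series_ge_1 x0 Q by (intro mult_right_mono) auto
    finally have "264 * abs_series * (x ^ 3 / Q) + 16 * M * (x ^ 3 / Q) \<le> 300 * (abs_series + M) * (x ^ 3 / Q)" .
    moreover have "8 * M * x powr (2 - \<beta> / 2) \<le> 300 * (abs_series + M) * x powr (2 - \<beta> / 2)"
      using M0 abs_series_ge_1 by (intro mult_right_mono) auto
    ultimately show ?thesis by linarith
  qed
  finally show ?thesis by (simp add: algebra_simps)
qed

text \<open>The difference of the Riesz means at x + h and x is h times the sharp sum, up to the
  terms with x < n <= x + h. There are at most 2 h of these, each of size at most dF * h; division
  by h turns them into the last summand.\<close>

lemma norm_prime_sum_le:
  assumes f: "f holomorphic_on {s. Re s > 1 - \<beta> \<and> \<bar>Im s\<bar> < Q}"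
    and f_eq: "\<And>s. Re s > 1 \<Longrightarrow> \<bar>Im s\<bar> < Q \<Longrightarrow> f s = prime_series chi s"
    and f_le: "\<And>s. 1 - \<beta> / 2 \<le> Re s \<Longrightarrow> Re s \<le> 2 \<Longrightarrow> \<bar>Im s\<bar> \<le> Q / 2 \<Longrightarrow> norm (f s) \<le> M"
    and \<beta>: "0 < \<beta>" "\<beta> \<le> 1 / 4" and Q: "Q \<ge> 8" and v: "\<bar>v\<bar> \<le> Q / 4" and h: "1 \<le> h" "h \<le> x"
  shows "norm (\<Sum>n\<in>{1..nat \<lfloor>x\<rfloor>}. shifted_coeff chi v n) \<le>
     3000 * (abs_series + M) * (x powr (2 - \<beta> / 2) + x ^ 3 / Q) / h + 2 * real dF * h"
proof -
  define c where "c = shifted_coeff chi v"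
  define S where "S = (\<Sum>n\<in>{1..nat \<lfloor>x\<rfloor>}. c n)"
  define X where "X = x powr (2 - \<beta> / 2)"
  have x: "x \<ge> 1" using h by simp
  have M0: "M \<ge> 0" using f_le[of 1] \<beta> Q norm_ge_zero[of "f 1"] by (simp del: norm_ge_zero)
  define E where "E = (\<Sum>n\<in>{nat \<lfloor>x\<rfloor><..nat \<lfloor>x + h\<rfloor>}. c n * of_real (x + h - real n))"
  have "{1..nat \<lfloor>x + h\<rfloor>} = {1..nat \<lfloor>x\<rfloor>} \<union> {nat \<lfloor>x\<rfloor><..nat \<lfloor>x + h\<rfloor>}"
  proof -
    have "nat \<lfloor>x\<rfloor> \<le> nat \<lfloor>x + h\<rfloor>" using h by (intro nat_mono floor_mono) simp
    then show ?thesis by auto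
  qed
  then have "riesz chi v (x + h) = (\<Sum>n\<in>{1..nat \<lfloor>x\<rfloor>}. c n * of_real (x + h - real n)) + E"
    unfolding riesz_def E_def c_def by (subst sum.union_disjoint[symmetric]) auto
  also have "(\<Sum>n\<in>{1..nat \<lfloor>x\<rfloor>}. c n * of_real (x + h - real n)) = of_real h * S + riesz chi v x"
    unfolding riesz_def S_def c_def sum_distrib_left sum.distrib[symmetric]
    by (intro sum.cong refl) (simp add: algebra_simps)
  finally have eq: "of_real h * S = riesz chi v (x + h) - riesz chi v x - E" by simp
  have "norm E \<le> (\<Sum>n\<in>{nat \<lfloor>x\<rfloor><..nat \<lfloor>x + h\<rfloor>}. real dF * h)"
    unfolding E_def
  proof (intro sum_norm_le)
    fix n assume "n \<in> {nat \<lfloor>x\<rfloor><..nat \<lfloor>x + h\<rfloor>}"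
    then have "nat \<lfloor>x\<rfloor> < n" "n \<le> nat \<lfloor>x + h\<rfloor>" by auto
    then have "x \<le> real n" "real n \<le> x + h" using x h by linarith+
    then have "norm (c n) * \<bar>x + h - real n\<bar> \<le> real dF * h"
      unfolding c_def by (intro mult_mono norm_shifted_coeff_le) auto
    then show "norm (c n * of_real (x + h - real n)) \<le> real dF * h" by (simp only: norm_mult norm_of_real)
  qed
  also have "\<dots> = real (nat \<lfloor>x + h\<rfloor> - nat \<lfloor>x\<rfloor>) * (real dF * h)" by simp
  also have "\<dots> \<le> (2 * h) * (real dF * h)"
  proof (intro mult_right_mono)
    show "real (nat \<lfloor>x + h\<rfloor> - nat \<lfloor>x\<rfloor>) \<le> 2 * h" using h by linarith
  qed (use h in auto)
  finally have 1: "norm E \<le> 2 * real dF * h * h" by (simp add: mult_ac)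
  have r1: "norm (riesz chi v x) \<le> 300 * (abs_series + M) * (X + x ^ 3 / Q)"
    unfolding X_def by (rule norm_riesz_le[OF f f_eq f_le \<beta> Q v x])
  have "norm (riesz chi v (x + h)) \<le> 300 * (abs_series + M) * ((x + h) powr (2 - \<beta> / 2) + (x + h) ^ 3 / Q)"
    using x h by (intro norm_riesz_le[OF f f_eq f_le \<beta> Q v]) auto
  also have "\<dots> \<le> 300 * (abs_series + M) * (4 * X + 8 * x ^ 3 / Q)"
  proof (intro mult_left_mono add_mono divide_right_mono)
    have "(x + h) powr (2 - \<beta> / 2) \<le> (2 * x) powr (2 - \<beta> / 2)" using h \<beta> by (intro powr_mono2) auto
    also have "\<dots> = 2 powr (2 - \<beta> / 2) * X" using x by (simp add: X_def powr_mult)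
    also have "\<dots> \<le> 2 powr 2 * X" using \<beta> by (intro mult_right_mono powr_mono) (auto simp: X_def)
    finally show "(x + h) powr (2 - \<beta> / 2) \<le> 4 * X" by (simp add: powr_numeral)
    have "(x + h) ^ 3 \<le> (2 * x) ^ 3" using h by (intro power_mono) auto
    then show "(x + h) ^ 3 \<le> 8 * x ^ 3" by (simp add: power_mult_distrib)
  qed (use Q M0 abs_series_ge_1 in auto)
  finally have r2: "norm (riesz chi v (x + h)) \<le> 300 * (abs_series + M) * (4 * X + 8 * x ^ 3 / Q)" .
  have "h * norm S = norm (of_real h * S)" using h by (simp add: norm_mult)
  also have "\<dots> \<le> norm (riesz chi v (x + h)) + norm (riesz chi v x) + norm E"
    unfolding eq
    using norm_triangle_ineq4[of "riesz chi v (x + h) - riesz chi v x" E]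
      norm_triangle_ineq4[of "riesz chi v (x + h)" "riesz chi v x"] by linarith
  also have "\<dots> \<le> 300 * (abs_series + M) * (4 * X + 8 * x ^ 3 / Q) + 300 * (abs_series + M) * (X + x ^ 3 / Q) + 2 * real dF * h * h"
    by (intro add_mono r1 r2 1)
  also have "\<dots> = 300 * (abs_series + M) * (5 * X + 9 * (x ^ 3 / Q)) + 2 * real dF * h * h" by (simp add: algebra_simps)
  also have "\<dots> \<le> 300 * (abs_series + M) * (10 * (X + x ^ 3 / Q)) + 2 * real dF * h * h"
  proof (intro add_right_mono mult_left_mono)
    have "X \<ge> 0" "x ^ 3 / Q \<ge> 0" using x Q by (simp_all add: X_def)
    then show "5 * X + 9 * (x ^ 3 / Q) \<le> 10 * (X + x ^ 3 / Q)" by argo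
  qed (use M0 abs_series_ge_1 in auto)
  also have "300 * (abs_series + M) * (10 * (X + x ^ 3 / Q)) = 3000 * (abs_series + M) * (X + x ^ 3 / Q)"
    by (simp only: mult.assoc mult.left_commute[of _ "10 :: real"])
  finally have "h * norm S \<le> 3000 * (abs_series + M) * (X + x ^ 3 / Q) + 2 * real dF * h * h" .
  then have "norm S \<le> (3000 * (abs_series + M) * (X + x ^ 3 / Q) + 2 * real dF * h * h) / h"
    using h by (subst pos_le_divide_eq) (simp_all add: mult.commute[of "norm S"])
  also have "\<dots> = 3000 * (abs_series + M) * (X + x ^ 3 / Q) / h + 2 * real dF * h"
    using h by (simp add: add_divide_distrib)
  finally show ?thesis by (simp add: S_def X_def c_def)
qed

text \<open>Partial summation with the weight n^(- \<sigma>). A sum starting at m is a difference of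
  two initial sums, which explains the factor 2 and why D has to hold from m - 1 on.\<close>

lemma norm_prime_block_le:
  assumes "m \<ge> 1" "m \<le> M" "\<sigma> \<ge> 0"
    and D: "\<And>k. m - 1 \<le> k \<Longrightarrow> k < M \<Longrightarrow> norm (\<Sum>n\<in>{1..k}. shifted_coeff chi v n) \<le> D"
  shows "norm (\<Sum>n\<in>{m..<M}. prime_coeff chi n / of_nat n powr Complex \<sigma> v) \<le> 2 * D * real m powr (- \<sigma>)"
proof -
  have "(\<Sum>n\<in>{m..<M}. prime_coeff chi n / of_nat n powr Complex \<sigma> v) =
      (\<Sum>n\<in>{m..<M}. of_real (real n powr (- \<sigma>)) * shifted_coeff chi v n)"
  proof (intro sum.cong refl)
    fix n assume "n \<in> {m..<M}"
    then have n: "n > 0" using assms by auto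
    have "Complex \<sigma> v = of_real \<sigma> + \<i> * of_real v" by (simp add: complex_eq_iff)
    then have "of_nat n powr Complex \<sigma> v = of_nat n powr of_real \<sigma> * of_nat n powr (\<i> * of_real v)"
      using n by (simp add: powr_add)
    moreover have "of_nat n powr of_real \<sigma> = complex_of_real (real n powr \<sigma>)"
      using powr_of_real[of "real n" \<sigma>] by simp
    ultimately show "prime_coeff chi n / of_nat n powr Complex \<sigma> v = of_real (real n powr (- \<sigma>)) * shifted_coeff chi v n"
      using n by (simp add: shifted_coeff_def powr_minus divide_inverse mult_ac)
  qed
  also have "norm \<dots> \<le> (2 * D) * real m powr (- \<sigma>)"
  proof (rule norm_sum_antimono_le[OF _ _ _ assms(2)])
    show "real (Suc n) powr (- \<sigma>) \<le> real n powr (- \<sigma>)" if "m \<le> n" for n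
      using that assms by (intro powr_mono2') auto
    fix k assume k: "m \<le> k" "k \<le> M"
    show "norm (\<Sum>n\<in>{m..<k}. shifted_coeff chi v n) \<le> 2 * D"
    proof (cases "k = m")
      case True
      have "D \<ge> 0"
        by (rule order_trans[OF norm_ge_zero D[of "m - 1"]]) (use assms in auto)
      with True show ?thesis by simp
    next
      case False
      have "{1..k - 1} = {1..m - 1} \<union> {m..<k}" using k assms by auto
      moreover have "(\<Sum>n\<in>{1..m - 1} \<union> {m..<k}. shifted_coeff chi v n) =
          (\<Sum>n\<in>{1..m - 1}. shifted_coeff chi v n) + (\<Sum>n\<in>{m..<k}. shifted_coeff chi v n)"
        by (rule sum.union_disjoint) (use assms in auto)
      ultimately have "(\<Sum>n\<in>{m..<k}. shifted_coeff chi v n) = (\<Sum>n\<in>{1..k - 1}. shifted_coeff chi v n) - (\<Sum>n\<in>{1..m - 1}. shifted_coeff chi v n)"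
        by simp
      also have "norm \<dots> \<le> D + D"
        using k assms False by (intro order_trans[OF norm_triangle_ineq4] add_mono D) auto
      finally show ?thesis by simp
    qed
  qed auto
  finally show ?thesis .
qed

end

end

section \<open>The identity of Ramare\<close>

definition prime_range :: "nat \<Rightarrow> nat \<Rightarrow> nat set" where
  "prime_range a b = {p. prime p \<and> a \<le> p \<and> p < b}"

lemma finite_prime_range [simp]: "finite (prime_range a b)"
  by (rule finite_subset[of _ "{..<b}"]) (auto simp: prime_range_def)

lemma sum_inverse_square_le:
  assumes "a \<ge> 2" "finite S" "\<And>n. n \<in> S \<Longrightarrow> a \<le> n"
  shows "(\<Sum>n\<in>S. 1 / (real n)\<^sup>2) \<le> 2 / real a"
proof -
  have tel: "(\<Sum>n\<in>{a..<b}. 1 / (real n)\<^sup>2) \<le> 1 / (real a - 1) - 1 / (real b - 1)" if "a \<le> b" for b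
    using that
  proof (induction b rule: dec_induct)
    case (step b)
    have b: "real b \<ge> 2" using step assms by simp
    have "1 / (real b)\<^sup>2 \<le> 1 / ((real b - 1) * real b)"
      using b by (intro divide_left_mono) (auto simp: power2_eq_square)
    also have "\<dots> = 1 / (real b - 1) - 1 / real b" using b by (simp add: field_simps)
    finally show ?case using step by simp
  qed simp
  define b where "b = Suc (Max (insert a S))"
  have sub: "S \<subseteq> {a..<b}" using assms by (auto simp: b_def less_Suc_eq_le)
  have "a \<le> b" using assms(2) by (auto simp: b_def intro: le_SucI)
  have "(\<Sum>n\<in>S. 1 / (real n)\<^sup>2) \<le> (\<Sum>n\<in>{a..<b}. 1 / (real n)\<^sup>2)"
    using sub by (intro sum_mono2) auto
  also have "\<dots> \<le> 1 / (real a - 1) - 1 / (real b - 1)" by (rule tel[OF \<open>a \<le> b\<close>])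
  also have "\<dots> \<le> 1 / (real a - 1)" using assms \<open>a \<le> b\<close> by simp
  also have "\<dots> \<le> 2 / real a" using assms(1) by (simp add: field_simps)
  finally show ?thesis .
qed

definition prime_count_in :: "nat set \<Rightarrow> nat \<Rightarrow> nat" where
  "prime_count_in S n = card {p \<in> S. p dvd n}"

lemma prime_count_in_mult:
  assumes "finite S" "\<And>p. p \<in> S \<Longrightarrow> prime p" "p \<in> S" "\<not> p dvd m"
  shows "prime_count_in S (p * m) = Suc (prime_count_in S m)"
proof -
  have "{r \<in> S. r dvd p * m} = insert p {r \<in> S. r dvd m}"
  proof (intro equalityI subsetI)
    fix r assume r: "r \<in> {r \<in> S. r dvd p * m}"
    then have "prime r" using assms by auto
    then have "r dvd p \<or> r dvd m" using r by (simp add: prime_dvd_mult_iff)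
    then show "r \<in> insert p {r \<in> S. r dvd m}"
      using r assms \<open>prime r\<close> by (auto simp: primes_dvd_imp_eq)
  qed (use assms in auto)
  then show ?thesis using assms by (simp add: prime_count_in_def)
qed

lemma prime_count_in_mult_le:
  assumes "finite S" "\<And>p. p \<in> S \<Longrightarrow> prime p" "p \<in> S"
  shows "prime_count_in S (p * m) \<le> Suc (prime_count_in S m)"
proof -
  have "{r \<in> S. r dvd p * m} \<subseteq> insert p {r \<in> S. r dvd m}"
  proof
    fix r assume r: "r \<in> {r \<in> S. r dvd p * m}"
    then have "prime r" using assms by auto
    then have "r dvd p \<or> r dvd m" using r by (simp add: prime_dvd_mult_iff)
    then show "r \<in> insert p {r \<in> S. r dvd m}"
      using r assms \<open>prime r\<close> by (auto simp: primes_dvd_imp_eq)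
  qed
  then have "prime_count_in S (p * m) \<le> card (insert p {r \<in> S. r dvd m})"
    unfolding prime_count_in_def using assms(1) by (intro card_mono) auto
  also have "\<dots> \<le> Suc (prime_count_in S m)"
    using assms(1) by (simp add: prime_count_in_def card_insert_if)
  finally show ?thesis .
qed

context L_framework_divisor_bound
begin

text \<open>For p in S not dividing m the denominator is the number of primes of S dividing p * m.
  It is expressed through m alone, which is what separates the variables p and m.\<close>

definition ramare_factor :: "nat set \<Rightarrow> nat \<Rightarrow> complex" where
  "ramare_factor S m = L_coeff F m / of_nat (Suc (prime_count_in S m))"

text \<open>Ramare's identity \<open>\<lambda>(n) = \<Sum>p. \<lambda>(p) b(n / p)\<close>, with the sum over the \<open>p \<in> S\<close> dividing \<open>n\<close>, holds if some
  \<open>p \<in> S\<close> divides \<open>n\<close> and none does so twice.\<close>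

definition ramare_rest :: "nat set \<Rightarrow> nat \<Rightarrow> complex" where
  "ramare_rest S n = L_coeff F n - (\<Sum>p\<in>{p \<in> S. p dvd n}. L_coeff F p * ramare_factor S (n div p))"

lemma norm_ramare_factor_le: "norm (ramare_factor S m) \<le> norm (L_coeff F m)"
  unfolding ramare_factor_def norm_divide norm_of_nat
  by (rule order_trans[OF divide_left_mono[of 1]]) auto

context
  fixes S :: "nat set"
  assumes S: "finite S" "\<And>p. p \<in> S \<Longrightarrow> prime p" and d: "dF \<ge> 1"
begin

lemma ramare_rest_no_prime:
  assumes "\<And>p. p \<in> S \<Longrightarrow> \<not> p dvd n"
  shows "ramare_rest S n = L_coeff F n"
proof -
  have "{p \<in> S. p dvd n} = {}" using assms by auto
  then show ?thesis unfolding ramare_rest_def by (simp only: sum.empty diff_zero)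
qed

text \<open>Each of the w primes of S dividing n contributes exactly \<lambda>(n) / w to the sum
  that is subtracted.\<close>

lemma ramare_rest_squarefree:
  assumes n: "n > 0" and ex: "p0 \<in> S" "p0 dvd n" and sq: "\<And>p. p \<in> S \<Longrightarrow> \<not> p\<^sup>2 dvd n"
  shows "ramare_rest S n = 0"
proof -
  have "L_coeff F p * ramare_factor S (n div p) = L_coeff F n / of_nat (prime_count_in S n)"
    if p: "p \<in> S" "p dvd n" for p
  proof -
    obtain m where m: "n = p * m" using p by (auto elim: dvdE)
    have pr: "prime p" using S p by auto
    have ndvd: "\<not> p dvd m" using sq[OF p(1)] by (auto simp: m power2_eq_square)
    have "m > 0" "p > 0" using n m by (auto intro: Nat.gr0I)
    moreover have "coprime p m" using pr ndvd by (simp add: prime_imp_coprime)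
    ultimately have "L_coeff F n = L_coeff F p * L_coeff F m"
      unfolding m by (intro coeff_mult)
    moreover have "prime_count_in S n = Suc (prime_count_in S m)"
      unfolding m by (rule prime_count_in_mult[OF S p(1) ndvd])
    moreover have "n div p = m" using \<open>p > 0\<close> by (simp add: m)
    ultimately show ?thesis by (simp add: ramare_factor_def)
  qed
  then have "(\<Sum>p\<in>{p \<in> S. p dvd n}. L_coeff F p * ramare_factor S (n div p)) =
      (\<Sum>p\<in>{p \<in> S. p dvd n}. L_coeff F n / of_nat (prime_count_in S n))"
    by (intro sum.cong) auto
  also have "\<dots> = L_coeff F n"
  proof -
    have "prime_count_in S n > 0"
      unfolding prime_count_in_def using ex S(1) by (auto simp: card_gt_0_iff)
    then show ?thesis by (simp add: prime_count_in_def)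
  qed
  finally show ?thesis by (simp add: ramare_rest_def)
qed

text \<open>If a prime of S divides n twice, multiplicativity fails. Still each of the w primes of S
  dividing n contributes at most d tau_d(n) / w, because the cofactor keeps at least w - 1 of
  them.\<close>

lemma norm_ramare_rest_le:
  assumes n: "n > 0"
  shows "norm (ramare_rest S n) \<le> (1 + real dF) * real (divisor_fun dF n)"
proof -
  let ?t = "real (divisor_fun dF n)" and ?w = "real (prime_count_in S n)"
  have "norm (L_coeff F p * ramare_factor S (n div p)) \<le> real dF * ?t / ?w" if p: "p \<in> S" "p dvd n" for p
  proof -
    obtain m where m: "n = p * m" using p by (auto elim: dvdE)
    have pr: "prime p" using S p by auto
    have mp: "m > 0" "p > 0" using n m by (auto intro: Nat.gr0I)
    have "n div p = m" using mp by (simp add: m)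
    have "norm (ramare_factor S m) \<le> ?t / ?w"
    proof -
      have "norm (L_coeff F m) \<le> real (divisor_fun dF m)" using mp by (intro coeff_le) auto
      also have "\<dots> \<le> ?t" using divisor_fun_mono[of m n dF] n d m by simp
      finally have "norm (L_coeff F m) \<le> ?t" .
      moreover have "?w \<le> real (Suc (prime_count_in S m))"
        unfolding m using prime_count_in_mult_le[OF S p(1), of m] by (simp only: of_nat_le_iff)
      moreover have "?w > 0" unfolding prime_count_in_def using p S(1) by (auto simp: card_gt_0_iff)
      ultimately show ?thesis unfolding ramare_factor_def norm_divide norm_of_nat by (intro frac_le) auto
    qed
    then have "norm (L_coeff F p) * norm (ramare_factor S m) \<le> real dF * (?t / ?w)"
      by (intro mult_mono norm_coeff_prime_le pr) auto
    then show ?thesis using \<open>n div p = m\<close> by (simp add: norm_mult)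
  qed
  then have "norm (\<Sum>p\<in>{p \<in> S. p dvd n}. L_coeff F p * ramare_factor S (n div p)) \<le> (\<Sum>p\<in>{p \<in> S. p dvd n}. real dF * ?t / ?w)"
    by (intro sum_norm_le) auto
  also have "\<dots> \<le> real dF * ?t" by (simp add: prime_count_in_def)
  finally have "norm (\<Sum>p\<in>{p \<in> S. p dvd n}. L_coeff F p * ramare_factor S (n div p)) \<le> real dF * ?t" .
  moreover have "norm (L_coeff F n) \<le> ?t" using n by (intro coeff_le) auto
  ultimately show ?thesis
    unfolding ramare_rest_def
    using norm_triangle_ineq4[of "L_coeff F n" "\<Sum>p\<in>{p \<in> S. p dvd n}. L_coeff F p * ramare_factor S (n div p)"]
    by (simp add: algebra_simps)
qed

text \<open>For n = p^2 m one has tau_d(n) <= d^2 tau_d(m), and m runs up to X / p^2.\<close>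

lemma sum_divisor_fun_multiples_le:
  assumes p: "prime p" and X: "X \<ge> 1"
  shows "(\<Sum>n\<in>{n \<in> {1..X}. p\<^sup>2 dvd n}. (real (divisor_fun dF n))\<^sup>2) \<le>
     real dF ^ 4 * (real X * (1 + ln (real X)) ^ (dF * dF)) * (1 / (real p)\<^sup>2)"
proof -
  have pp: "p > 0" using p prime_gt_0_nat by blast
  define Y where "Y = X div p\<^sup>2"
  have eq: "{n \<in> {1..X}. p\<^sup>2 dvd n} = (\<lambda>m. p\<^sup>2 * m) ` {1..Y}"
  proof (intro equalityI subsetI)
    fix n assume "n \<in> {n \<in> {1..X}. p\<^sup>2 dvd n}"
    then have n: "p\<^sup>2 dvd n" "1 \<le> n" "n \<le> X" by auto
    from n(1) obtain m where "n = p\<^sup>2 * m" by (rule dvdE)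
    with n have m: "n = p\<^sup>2 * m" "1 \<le> n" "n \<le> X" by simp_all
    then have "m \<ge> 1" by (cases m) auto
    moreover have "m \<le> Y" using m pp by (simp add: Y_def less_eq_div_iff_mult_less_eq mult.commute)
    ultimately show "n \<in> (\<lambda>m. p\<^sup>2 * m) ` {1..Y}" using m by auto
  next
    fix n assume "n \<in> (\<lambda>m. p\<^sup>2 * m) ` {1..Y}"
    then obtain m where "n = p\<^sup>2 * m" "m \<in> {1..Y}" by (rule imageE)
    then have m: "n = p\<^sup>2 * m" "1 \<le> m" "m \<le> Y" by simp_all
    then have "p\<^sup>2 * m \<le> X" using pp by (simp add: Y_def less_eq_div_iff_mult_less_eq mult.commute)
    then show "n \<in> {n \<in> {1..X}. p\<^sup>2 dvd n}" using m pp by (auto simp: Suc_le_eq)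
  qed
  have "divisor_fun dF (p\<^sup>2) \<le> divisor_fun dF p * divisor_fun dF p"
    unfolding power2_eq_square using pp by (intro divisor_fun_mult_le) auto
  also have "\<dots> \<le> dF * dF" using divisor_fun_prime_le[OF p] by (intro mult_mono) auto
  finally have p2: "real (divisor_fun dF (p\<^sup>2)) \<le> real dF ^ 2"
    by (simp add: power2_eq_square flip: of_nat_mult)
  have inj: "inj_on (\<lambda>m. p\<^sup>2 * m) {1..Y}" using pp by (auto simp: inj_on_def)
  have "(\<Sum>n\<in>{n \<in> {1..X}. p\<^sup>2 dvd n}. (real (divisor_fun dF n))\<^sup>2) = (\<Sum>m\<in>{1..Y}. (real (divisor_fun dF (p\<^sup>2 * m)))\<^sup>2)"
    unfolding eq by (subst sum.reindex[OF inj]) simp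
  also have "\<dots> \<le> (\<Sum>m\<in>{1..Y}. real dF ^ 4 * (real (divisor_fun dF m))\<^sup>2)"
  proof (rule sum_mono)
    fix m assume "m \<in> {1..Y}"
    then have "real (divisor_fun dF (p\<^sup>2 * m)) \<le> real (divisor_fun dF (p\<^sup>2) * divisor_fun dF m)"
      using divisor_fun_mult_le[of "p\<^sup>2" m dF] pp by (simp only: of_nat_le_iff) simp
    also have "\<dots> \<le> real dF ^ 2 * real (divisor_fun dF m)"
      unfolding of_nat_mult using p2 by (intro mult_right_mono) auto
    finally have "(real (divisor_fun dF (p\<^sup>2 * m)))\<^sup>2 \<le> (real dF ^ 2 * real (divisor_fun dF m))\<^sup>2"
      by (intro power_mono) auto
    then show "(real (divisor_fun dF (p\<^sup>2 * m)))\<^sup>2 \<le> real dF ^ 4 * (real (divisor_fun dF m))\<^sup>2"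
      by (simp add: power_mult_distrib flip: power_mult)
  qed
  also have "\<dots> = real dF ^ 4 * (\<Sum>m\<in>{1..Y}. (real (divisor_fun dF m))\<^sup>2)" by (simp add: sum_distrib_left)
  also have "\<dots> \<le> real dF ^ 4 * (real X / (real p)\<^sup>2 * (1 + ln (real X)) ^ (dF * dF))"
  proof (intro mult_left_mono)
    have Yle: "real Y \<le> real X / (real p)\<^sup>2"
    proof -
      have "real (Y * p\<^sup>2) \<le> real X" unfolding Y_def of_nat_le_iff by (rule div_times_less_eq_dividend)
      then show ?thesis using pp by (simp add: pos_le_divide_eq)
    qed
    have lnX: "ln (real X) \<ge> 0" using X by simp
    show "(\<Sum>m\<in>{1..Y}. (real (divisor_fun dF m))\<^sup>2) \<le> real X / (real p)\<^sup>2 * (1 + ln (real X)) ^ (dF * dF)"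
    proof (cases "Y \<ge> 1")
      case True
      then have "(\<Sum>m\<in>{1..Y}. (real (divisor_fun dF m))\<^sup>2) \<le> real Y * (1 + ln (real Y)) ^ (dF * dF)"
        by (rule sum_divisor_fun_square_le)
      also have "\<dots> \<le> real X / (real p)\<^sup>2 * (1 + ln (real X)) ^ (dF * dF)"
      proof (intro mult_mono power_mono add_left_mono Yle)
        have "Y \<le> X" by (simp add: Y_def)
        then show "ln (real Y) \<le> ln (real X)" using True by simp
      qed (use True in auto)
      finally show ?thesis .
    next
      case False
      then show ?thesis using lnX by simp
    qed
  qed simp
  finally show ?thesis by (simp add: mult_ac)
qed

text \<open>The rest is \<lambda>(n) if n has no prime factor in S, and 0 if it has one but none
  twice. Otherwise n is a multiple of some p^2, and summing 1 / p^2 over p >= a yields 2 / a. The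
  second bound ignores this structure; it serves the short blocks, which the sieve bound does not
  reach.\<close>

lemma sum_ramare_rest_le:
  assumes X: "X \<ge> 1" and a: "a \<ge> 2" "\<And>p. p \<in> S \<Longrightarrow> a \<le> p"
  shows "(\<Sum>n\<in>{1..X}. (norm (ramare_rest S n))\<^sup>2) \<le>
      (\<Sum>n\<in>{n \<in> {1..X}. \<forall>p\<in>S. \<not> p dvd n}. (norm (L_coeff F n))\<^sup>2) +
      (1 + real dF)\<^sup>2 * real dF ^ 4 * (real X * (1 + ln (real X)) ^ (dF * dF)) * (2 / real a)"
    and "(\<Sum>n\<in>{1..X}. (norm (ramare_rest S n))\<^sup>2) \<le> (1 + real dF)\<^sup>2 * (real X * (1 + ln (real X)) ^ (dF * dF))"
proof -
  define t where "t = (\<lambda>n. (real (divisor_fun dF n))\<^sup>2)"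
  have rest: "(norm (ramare_rest S n))\<^sup>2 \<le> (1 + real dF)\<^sup>2 * t n" if "n \<in> {1..X}" for n
  proof -
    have "norm (ramare_rest S n) \<le> (1 + real dF) * real (divisor_fun dF n)" using that by (intro norm_ramare_rest_le) auto
    then have "(norm (ramare_rest S n))\<^sup>2 \<le> ((1 + real dF) * real (divisor_fun dF n))\<^sup>2" by (intro power_mono) auto
    then show ?thesis by (simp add: t_def power_mult_distrib)
  qed
  have "(\<Sum>n\<in>{1..X}. (norm (ramare_rest S n))\<^sup>2) \<le> (\<Sum>n\<in>{1..X}. (1 + real dF)\<^sup>2 * t n)"
    by (intro sum_mono rest)
  also have "\<dots> = (1 + real dF)\<^sup>2 * (\<Sum>n\<in>{1..X}. t n)" by (simp add: sum_distrib_left)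
  also have "\<dots> \<le> (1 + real dF)\<^sup>2 * (real X * (1 + ln (real X)) ^ (dF * dF))"
    unfolding t_def by (intro mult_left_mono sum_divisor_fun_square_le X) auto
  finally show "(\<Sum>n\<in>{1..X}. (norm (ramare_rest S n))\<^sup>2) \<le> (1 + real dF)\<^sup>2 * (real X * (1 + ln (real X)) ^ (dF * dF))" .
  have "(\<Sum>n\<in>{1..X}. (norm (ramare_rest S n))\<^sup>2) \<le>
      (\<Sum>n\<in>{1..X}. (if \<forall>p\<in>S. \<not> p dvd n then (norm (L_coeff F n))\<^sup>2 else 0) + (\<Sum>p\<in>S. if p\<^sup>2 dvd n then (1 + real dF)\<^sup>2 * t n else 0))"
  proof (rule sum_mono)
    fix n assume n: "n \<in> {1..X}"
    have t0: "(1 + real dF)\<^sup>2 * t n \<ge> 0" by (simp add: t_def)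
    then have nn: "(\<Sum>p\<in>S. if p\<^sup>2 dvd n then (1 + real dF)\<^sup>2 * t n else 0) \<ge> 0" by (intro sum_nonneg) auto
    consider "\<forall>p\<in>S. \<not> p dvd n" | "\<not> (\<forall>p\<in>S. \<not> p dvd n)" "\<forall>p\<in>S. \<not> p\<^sup>2 dvd n" | p where "p \<in> S" "p\<^sup>2 dvd n"
      by blast
    then show "(norm (ramare_rest S n))\<^sup>2 \<le> (if \<forall>p\<in>S. \<not> p dvd n then (norm (L_coeff F n))\<^sup>2 else 0) + (\<Sum>p\<in>S. if p\<^sup>2 dvd n then (1 + real dF)\<^sup>2 * t n else 0)"
    proof cases
      case 1
      then show ?thesis using ramare_rest_no_prime[of n] nn by simp
    next
      case 2
      then have "ramare_rest S n = 0" using n by (auto intro: ramare_rest_squarefree)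
      then show ?thesis using nn by simp
    next
      case (3 p)
      have "(norm (ramare_rest S n))\<^sup>2 \<le> (if p\<^sup>2 dvd n then (1 + real dF)\<^sup>2 * t n else 0)" using rest[OF n] 3 by simp
      also have "\<dots> \<le> (\<Sum>p\<in>S. if p\<^sup>2 dvd n then (1 + real dF)\<^sup>2 * t n else 0)"
        using 3 S(1) t0 by (intro member_le_sum[of p S "\<lambda>p. if p\<^sup>2 dvd n then (1 + real dF)\<^sup>2 * t n else 0"]) auto
      finally have "(norm (ramare_rest S n))\<^sup>2 \<le> (\<Sum>p\<in>S. if p\<^sup>2 dvd n then (1 + real dF)\<^sup>2 * t n else 0)" .
      moreover have "(0 :: real) \<le> (if \<forall>p\<in>S. \<not> p dvd n then (norm (L_coeff F n))\<^sup>2 else 0)" by simp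
      ultimately show ?thesis by linarith
    qed
  qed
  also have "\<dots> = (\<Sum>n\<in>{n \<in> {1..X}. \<forall>p\<in>S. \<not> p dvd n}. (norm (L_coeff F n))\<^sup>2) +
      (\<Sum>p\<in>S. (1 + real dF)\<^sup>2 * (\<Sum>n\<in>{n \<in> {1..X}. p\<^sup>2 dvd n}. t n))"
  proof -
    have "(\<Sum>n\<in>{1..X}. \<Sum>p\<in>S. if p\<^sup>2 dvd n then (1 + real dF)\<^sup>2 * t n else 0) =
        (\<Sum>p\<in>S. \<Sum>n\<in>{1..X}. if p\<^sup>2 dvd n then (1 + real dF)\<^sup>2 * t n else 0)" by (rule sum.swap)
    also have "\<dots> = (\<Sum>p\<in>S. (1 + real dF)\<^sup>2 * (\<Sum>n\<in>{n \<in> {1..X}. p\<^sup>2 dvd n}. t n))"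
      by (intro sum.cong refl) (simp add: sum.inter_filter[symmetric] sum_distrib_left)
    finally show ?thesis by (simp add: sum.distrib sum.inter_filter[symmetric])
  qed
  also have "(\<Sum>p\<in>S. (1 + real dF)\<^sup>2 * (\<Sum>n\<in>{n \<in> {1..X}. p\<^sup>2 dvd n}. t n)) \<le>
      (\<Sum>p\<in>S. (1 + real dF)\<^sup>2 * (real dF ^ 4 * (real X * (1 + ln (real X)) ^ (dF * dF)) * (1 / (real p)\<^sup>2)))"
    unfolding t_def by (intro sum_mono mult_left_mono sum_divisor_fun_multiples_le S X) auto
  also have "\<dots> = (1 + real dF)\<^sup>2 * real dF ^ 4 * (real X * (1 + ln (real X)) ^ (dF * dF)) * (\<Sum>p\<in>S. 1 / (real p)\<^sup>2)"
    by (simp add: sum_distrib_left mult.assoc)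
  also have "\<dots> \<le> (1 + real dF)\<^sup>2 * real dF ^ 4 * (real X * (1 + ln (real X)) ^ (dF * dF)) * (2 / real a)"
    using X a S by (intro mult_left_mono sum_inverse_square_le) auto
  finally show "(\<Sum>n\<in>{1..X}. (norm (ramare_rest S n))\<^sup>2) \<le>
      (\<Sum>n\<in>{n \<in> {1..X}. \<forall>p\<in>S. \<not> p dvd n}. (norm (L_coeff F n))\<^sup>2) +
      (1 + real dF)\<^sup>2 * real dF ^ 4 * (real X * (1 + ln (real X)) ^ (dF * dF)) * (2 / real a)" by simp
qed

lemma sum_ramare_factor_le:
  assumes X: "X \<ge> 1"
  shows "(\<Sum>n\<in>{1..X}. (norm (ramare_factor S n))\<^sup>2) \<le> real X * (1 + ln (real X)) ^ (dF * dF)"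
proof -
  have "(\<Sum>n\<in>{1..X}. (norm (ramare_factor S n))\<^sup>2) \<le> (\<Sum>n\<in>{1..X}. (real (divisor_fun dF n))\<^sup>2)"
  proof (intro sum_mono power_mono)
    fix n assume "n \<in> {1..X}"
    then show "norm (ramare_factor S n) \<le> real (divisor_fun dF n)"
      using order_trans[OF norm_ramare_factor_le[of S n] coeff_le[of n]] by simp
  qed auto
  also have "\<dots> \<le> real X * (1 + ln (real X)) ^ (dF * dF)" by (rule sum_divisor_fun_square_le[OF X])
  finally show ?thesis .
qed

text \<open>On Re s = 5 / 2 there is a factor 1 / n to spare over the exponent 3 / 2 of
  \<open>abs_series\<close>. It yields 1 / M both for the tail n > M and for the pairs with p * m >
  M, which the product of the two sums contains in excess of Ramare's identity.\<close>

lemma ramare_decomposition: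
  assumes q: "q \<ge> 2" and chi: "chi \<in> primitive_characters q" and s: "Re s = 5 / 2" and M: "M \<ge> 1"
  shows "norm (L_twist F chi s - (\<Sum>n\<in>{1..M}. ramare_rest S n * chi (int n) / of_nat n powr s) -
     (\<Sum>p\<in>S. L_coeff F p * chi (int p) / of_nat p powr s) * (\<Sum>m\<in>{1..M}. ramare_factor S m * chi (int m) / of_nat m powr s))
     \<le> 2 * abs_series\<^sup>2 / real M"
proof -
  define w where "w = (\<lambda>n. chi (int n) / of_nat n powr s)"
  define l where "l = (\<lambda>n. norm (L_coeff F n) / real n powr (3 / 2))"
  have l0: "l n \<ge> 0" for n by (simp add: l_def)
  have l_sum: "(\<Sum>n\<in>A. l n) \<le> abs_series" if "finite A" "0 \<notin> A" for A
  proof -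
    have "\<exists>K. A \<subseteq> {..<K}" using that(1) by (simp only: finite_nat_iff_bounded[symmetric])
    then obtain K where K: "A \<subseteq> {..<K}" ..
    have "(\<Sum>n\<in>A. l n) \<le> (\<Sum>n\<in>Suc ` {..<K}. l n)"
    proof (intro sum_mono2)
      show "A \<subseteq> Suc ` {..<K}"
      proof
        fix n assume "n \<in> A"
        then have "n < K" "n \<noteq> 0" using K that by (auto intro: ccontr)
        then show "n \<in> Suc ` {..<K}" by (intro image_eqI[of _ _ "n - 1"]) auto
      qed
    qed (auto simp: l0)
    also have "\<dots> = (\<Sum>n<K. l (Suc n))" by (subst sum.reindex) auto
    also have "\<dots> \<le> abs_series"
      unfolding abs_series_def l_def by (intro sum_le_suminf summable_abs_coeff) auto
    finally show ?thesis .
  qed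
  have nw: "norm (w n) \<le> 1 / real n powr (5 / 2)" if "n > 0" for n
    using norm_of_real_powr[of "real n" s] chi_norm_le[OF q chi, of "int n"] that s
    by (simp add: w_def norm_divide divide_right_mono)
  have Lw: "norm (L_coeff F n * w n) \<le> l n / real n" if "n > 0" for n
  proof -
    have "norm (L_coeff F n * w n) \<le> norm (L_coeff F n) * (1 / real n powr (5 / 2))"
      unfolding norm_mult using that by (intro mult_left_mono nw) auto
    also have "real n powr (5 / 2) = real n powr (3 / 2) * real n"
      using that powr_add[of "real n" "3 / 2" 1] by simp
    finally show ?thesis by (simp add: l_def)
  qed
  have wm: "w (p * m) = w p * w m" if "p > 0" "m > 0" for p m
    using that by (simp add: w_def dirichlet_character_mult[OF chi_dirichlet[OF q chi]] powr_times_real)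
  have "L_twist F chi s = (\<Sum>n. L_coeff F (Suc n) * w (Suc n))"
    using L_twist_series[OF q chi, of s] s by (simp add: twist_series_def twist_term_def w_def)
  moreover have smm: "summable (\<lambda>n. L_coeff F (Suc n) * w (Suc n))"
    using summable_norm_cancel[OF twist_summable[OF q chi, of s]] s by (simp add: twist_term_def w_def)
  ultimately have "L_twist F chi s - (\<Sum>n<M. L_coeff F (Suc n) * w (Suc n)) = (\<Sum>n. L_coeff F (Suc (n + M)) * w (Suc (n + M)))"
    using suminf_minus_initial_segment[OF smm, of M] by simp
  also have "norm \<dots> \<le> (\<Sum>n. l (Suc (n + M)) / real M)"
  proof (rule norm_suminf_le)
    show "norm (L_coeff F (Suc (n + M)) * w (Suc (n + M))) \<le> l (Suc (n + M)) / real M" for n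
    proof -
      have "norm (L_coeff F (Suc (n + M)) * w (Suc (n + M))) \<le> l (Suc (n + M)) / real (Suc (n + M))" by (rule Lw) simp
      also have "\<dots> \<le> l (Suc (n + M)) / real M" using M l0 by (intro divide_left_mono) auto
      finally show ?thesis .
    qed
    show "summable (\<lambda>n. l (Suc (n + M)) / real M)"
      using summable_ignore_initial_segment[OF summable_abs_coeff[of "3 / 2"], of M] unfolding l_def
      by (intro summable_divide) simp
  qed
  also have "\<dots> = (\<Sum>n. l (Suc (n + M))) / real M"
    using summable_ignore_initial_segment[OF summable_abs_coeff[of "3 / 2"], of M] unfolding l_def
    by (intro suminf_divide) simp
  also have "\<dots> \<le> abs_series / real M"
  proof (intro divide_right_mono)
    have "summable (\<lambda>n. l (Suc n))" using summable_abs_coeff[of "3 / 2"] by (simp add: l_def)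
    from suminf_split_initial_segment[OF this, of M]
    show "(\<Sum>n. l (Suc (n + M))) \<le> abs_series"
      by (simp add: abs_series_def l_def sum_nonneg)
  qed simp
  finally have tail: "norm (L_twist F chi s - (\<Sum>n\<in>{1..M}. L_coeff F n * w n)) \<le> abs_series / real M"
    by (simp add: sum.atLeast1_atMost_eq)
  define f where "f = (\<lambda>p m. (L_coeff F p * w p) * (ramare_factor S m * w m))"
  have p_pos: "p > 0" if "p \<in> S" for p using S(2)[OF that] prime_gt_0_nat by blast
  define I where "I = {(p, m) \<in> S \<times> {1..M}. p * m \<le> M}"
  have "(\<Sum>n\<in>{1..M}. (L_coeff F n - ramare_rest S n) * w n) = (\<Sum>n\<in>{1..M}. \<Sum>p\<in>{p \<in> S. p dvd n}. f p (n div p))"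
  proof (intro sum.cong refl)
    fix n assume n: "n \<in> {1..M}"
    have "(L_coeff F n - ramare_rest S n) * w n = (\<Sum>p\<in>{p \<in> S. p dvd n}. L_coeff F p * ramare_factor S (n div p) * w n)"
      by (simp add: ramare_rest_def sum_distrib_right)
    also have "\<dots> = (\<Sum>p\<in>{p \<in> S. p dvd n}. f p (n div p))"
    proof (intro sum.cong refl)
      fix p assume p: "p \<in> {p \<in> S. p dvd n}"
      then obtain m where m: "n = p * m" by (auto elim: dvdE)
      have "p > 0" "m > 0" using n m by (auto intro: Nat.gr0I)
      then show "L_coeff F p * ramare_factor S (n div p) * w n = f p (n div p)"
        using wm[of p m] by (simp add: m f_def mult_ac)
    qed
    finally show "(L_coeff F n - ramare_rest S n) * w n = (\<Sum>p\<in>{p \<in> S. p dvd n}. f p (n div p))" .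
  qed
  also have "\<dots> = (\<Sum>(n, p)\<in>(SIGMA n:{1..M}. {p \<in> S. p dvd n}). f p (n div p))"
    using S(1) by (subst sum.Sigma) auto
  also have "\<dots> = (\<Sum>(p, m)\<in>I. f p m)"
  proof (rule sum.reindex_bij_witness[of _ "\<lambda>(p, m). (p * m, p)" "\<lambda>(n, p). (p, n div p)"])
    fix a assume "a \<in> (SIGMA n:{1..M}. {p \<in> S. p dvd n})"
    then obtain n p m where a: "a = (n, p)" "n = p * m" "p \<in> S" "1 \<le> n" "n \<le> M" by (auto elim: dvdE)
    then have pm: "p > 0" "m > 0" by (auto intro: Nat.gr0I)
    then have "m \<le> n" using a by simp
    with a(5) have "m \<le> M" by linarith
    with a pm show "(case case a of (n, p) \<Rightarrow> (p, n div p) of (p, m) \<Rightarrow> (p * m, p)) = a"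
      "(case a of (n, p) \<Rightarrow> (p, n div p)) \<in> I"
      "(case case a of (n, p) \<Rightarrow> (p, n div p) of (p, m) \<Rightarrow> f p m) = (case a of (n, p) \<Rightarrow> f p (n div p))"
      by (auto simp: I_def)
  next
    fix b assume "b \<in> I"
    then obtain p m where "b = (p, m)" "p \<in> S" "1 \<le> m" "p * m \<le> M" by (auto simp: I_def)
    with p_pos show "(case case b of (p, m) \<Rightarrow> (p * m, p) of (n, p) \<Rightarrow> (p, n div p)) = b"
      "(case b of (p, m) \<Rightarrow> (p * m, p)) \<in> (SIGMA n:{1..M}. {p \<in> S. p dvd n})"
      by (auto simp: Suc_le_eq)
  qed
  finally have conv: "(\<Sum>n\<in>{1..M}. (L_coeff F n - ramare_rest S n) * w n) = (\<Sum>(p, m)\<in>I. f p m)" .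
  have prod: "(\<Sum>p\<in>S. L_coeff F p * w p) * (\<Sum>m\<in>{1..M}. ramare_factor S m * w m) = (\<Sum>(p, m)\<in>S \<times> {1..M}. f p m)"
    by (simp add: sum_product sum.cartesian_product f_def)
  have "(\<Sum>(p, m)\<in>S \<times> {1..M}. f p m) = (\<Sum>(p, m)\<in>I. f p m) + (\<Sum>(p, m)\<in>S \<times> {1..M} - I. f p m)"
    using S(1) by (subst sum.subset_diff[of I]) (auto simp: I_def)
  then have diff: "(\<Sum>(p, m)\<in>I. f p m) - (\<Sum>(p, m)\<in>S \<times> {1..M}. f p m) = - (\<Sum>(p, m)\<in>S \<times> {1..M} - I. f p m)" by simp
  have "norm (\<Sum>(p, m)\<in>S \<times> {1..M} - I. f p m) \<le> (\<Sum>(p, m)\<in>S \<times> {1..M} - I. l p * l m / real M)"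
  proof (intro sum_norm_le, clarify)
    fix p m assume pm: "p \<in> S" "m \<in> {1..M}" "(p, m) \<notin> I"
    then have gt: "p * m > M" by (auto simp: I_def)
    have "norm (ramare_factor S m * w m) \<le> norm (L_coeff F m * w m)"
      unfolding norm_mult by (intro mult_right_mono norm_ramare_factor_le) auto
    also have "\<dots> \<le> l m / real m" using pm by (intro Lw) auto
    finally have "norm (f p m) \<le> (l p / real p) * (l m / real m)"
      unfolding f_def norm_mult[of "L_coeff F p * w p"] using p_pos[OF pm(1)] l0 by (intro mult_mono Lw) auto
    also have "\<dots> = l p * l m / real (p * m)" by simp
    also have "\<dots> \<le> l p * l m / real M"
    proof (rule divide_left_mono)
      have lt: "real M < real (p * m)" using gt by (simp only: of_nat_less_iff)
      then show "real M \<le> real (p * m)" by simp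
      from lt show "0 < real (p * m) * real M" using M by (intro mult_pos_pos) linarith+
    qed (simp add: l0)
    finally show "norm (f p m) \<le> l p * l m / real M" .
  qed
  also have "\<dots> \<le> (\<Sum>(p, m)\<in>S \<times> {1..M}. l p * l m / real M)"
    using S(1) l0 by (intro sum_mono2) auto
  also have "\<dots> = (\<Sum>p\<in>S. l p) * (\<Sum>m\<in>{1..M}. l m) / real M"
    by (simp add: sum_product sum.cartesian_product sum_divide_distrib case_prod_unfold)
  also have "\<dots> \<le> abs_series * abs_series / real M"
    using S(1) p_pos l0 abs_series_ge_1 by (intro divide_right_mono mult_mono l_sum sum_nonneg) auto
  finally have cross: "norm (\<Sum>(p, m)\<in>S \<times> {1..M} - I. f p m) \<le> abs_series * abs_series / real M" .
  have "L_twist F chi s - (\<Sum>n\<in>{1..M}. ramare_rest S n * w n) - (\<Sum>p\<in>S. L_coeff F p * w p) * (\<Sum>m\<in>{1..M}. ramare_factor S m * w m) =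
    (L_twist F chi s - (\<Sum>n\<in>{1..M}. L_coeff F n * w n)) + (\<Sum>n\<in>{1..M}. (L_coeff F n - ramare_rest S n) * w n) - (\<Sum>(p, m)\<in>S \<times> {1..M}. f p m)"
    unfolding prod by (simp add: left_diff_distrib sum_subtractf)
  also have "\<dots> = (L_twist F chi s - (\<Sum>n\<in>{1..M}. L_coeff F n * w n)) - (\<Sum>(p, m)\<in>S \<times> {1..M} - I. f p m)"
    unfolding conv using diff by (simp add: algebra_simps)
  also have "norm \<dots> \<le> abs_series / real M + abs_series * abs_series / real M"
    by (intro order_trans[OF norm_triangle_ineq4] add_mono tail cross)
  also have "\<dots> \<le> abs_series * abs_series / real M + abs_series * abs_series / real M"
    using abs_series_ge_1 by (intro add_right_mono divide_right_mono) auto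
  finally show ?thesis by (simp add: w_def power2_eq_square)
qed

end

end

section \<open>Mean squares over characters\<close>

lemma weighted_Cauchy_Schwarz:
  fixes x :: "'k \<Rightarrow> complex"
  assumes "finite K" "\<And>k. k \<in> K \<Longrightarrow> w k > 0"
  shows "(norm (\<Sum>k\<in>K. x k))\<^sup>2 \<le> (\<Sum>k\<in>K. w k) * (\<Sum>k\<in>K. (norm (x k))\<^sup>2 / w k)"
proof -
  have "norm (\<Sum>k\<in>K. x k) \<le> (\<Sum>k\<in>K. norm (x k))" by (rule norm_sum)
  then have "(norm (\<Sum>k\<in>K. x k))\<^sup>2 \<le> (\<Sum>k\<in>K. norm (x k))\<^sup>2" by (intro power_mono) auto
  also have "\<dots> = (\<Sum>k\<in>K. sqrt (w k) * (norm (x k) / sqrt (w k)))\<^sup>2"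
    using assms(2) by (intro arg_cong[of _ _ "\<lambda>x. x\<^sup>2"] sum.cong refl) (simp add: less_imp_neq[symmetric])
  also have "\<dots> \<le> (\<Sum>k\<in>K. (sqrt (w k))\<^sup>2) * (\<Sum>k\<in>K. (norm (x k) / sqrt (w k))\<^sup>2)"
    by (rule Cauchy_Schwarz_ineq_sum)
  also have "(\<Sum>k\<in>K. (sqrt (w k))\<^sup>2) = (\<Sum>k\<in>K. w k)"
    using assms(2) by (intro sum.cong refl) (simp add: less_imp_le)
  also have "(\<Sum>k\<in>K. (norm (x k) / sqrt (w k))\<^sup>2) = (\<Sum>k\<in>K. (norm (x k))\<^sup>2 / w k)"
    using assms(2) by (intro sum.cong refl) (simp add: power_divide less_imp_le)
  finally show ?thesis .
qed

text \<open>The weights w are at the user's choice; for blocks of geometric growth a geometric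
  choice avoids a loss by the number of blocks.\<close>

lemma mean_square_sum_le:
  fixes x :: "'k \<Rightarrow> 'z \<Rightarrow> complex"
  assumes "finite K" "\<And>k. k \<in> K \<Longrightarrow> w k > 0"
    and le: "\<And>k. k \<in> K \<Longrightarrow> (\<Sum>z\<in>G. (norm (x k z))\<^sup>2) \<le> w k * v k"
  shows "(\<Sum>z\<in>G. (norm (\<Sum>k\<in>K. x k z))\<^sup>2) \<le> (\<Sum>k\<in>K. w k) * (\<Sum>k\<in>K. v k)"
proof -
  have "(\<Sum>z\<in>G. (norm (\<Sum>k\<in>K. x k z))\<^sup>2) \<le> (\<Sum>z\<in>G. (\<Sum>k\<in>K. w k) * (\<Sum>k\<in>K. (norm (x k z))\<^sup>2 / w k))"
    by (intro sum_mono weighted_Cauchy_Schwarz assms)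
  also have "\<dots> = (\<Sum>k\<in>K. w k) * (\<Sum>k\<in>K. (\<Sum>z\<in>G. (norm (x k z))\<^sup>2) / w k)"
    unfolding sum_distrib_left[symmetric] sum_divide_distrib by (subst sum.swap) (rule refl)
  also have "\<dots> \<le> (\<Sum>k\<in>K. w k) * (\<Sum>k\<in>K. v k)"
    using assms(2) le by (intro mult_left_mono sum_mono sum_nonneg) (auto simp: pos_divide_le_eq mult.commute less_imp_le)
  finally show ?thesis .
qed

lemma sum3_square_le: "(a + b + c)\<^sup>2 \<le> 3 * (a\<^sup>2 + b\<^sup>2 + c\<^sup>2)" for a b c :: real
proof -
  have "0 \<le> (a - b)\<^sup>2 + (b - c)\<^sup>2 + (a - c)\<^sup>2" by simp
  then show ?thesis by (simp add: power2_eq_square algebra_simps)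
qed

lemma large_sieve_block:
  assumes Q: "Q \<ge> 2" and G: "G \<subseteq> character_family Q" and \<sigma>: "\<sigma> \<ge> 0"
  shows "(\<Sum>z\<in>G. (norm (\<Sum>n\<in>{2 ^ k..<2 ^ Suc k}. a n * snd z (int n) / of_nat n powr Complex \<sigma> t))\<^sup>2)
    \<le> 100 * (Q powr (9 / 4) + 2 ^ k) * (2 ^ k) powr (- 2 * \<sigma>) * (\<Sum>n\<in>{2 ^ k..<2 ^ Suc k}. (norm (a n))\<^sup>2)"
proof -
  have "(2 :: nat) ^ Suc k = 2 ^ k + 2 ^ k" by simp
  then have set: "{2 ^ k..<2 ^ Suc k} = {2 ^ k..<2 ^ k + 2 ^ k :: nat}" by (simp only:)
  define b where "b = (\<lambda>n. a n / of_nat n powr Complex \<sigma> t)"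
  have fin: "finite (character_family Q)" by (rule character_family_finite_card(1)[OF Q])
  have "(\<Sum>z\<in>G. (norm (\<Sum>n\<in>{2 ^ k..<2 ^ Suc k}. a n * snd z (int n) / of_nat n powr Complex \<sigma> t))\<^sup>2)
     \<le> (\<Sum>z\<in>character_family Q. (norm (\<Sum>n\<in>{2 ^ k..<2 ^ Suc k}. a n * snd z (int n) / of_nat n powr Complex \<sigma> t))\<^sup>2)"
    using G fin by (intro sum_mono2) auto
  also have "\<dots> = (\<Sum>(q, chi)\<in>character_family Q. (norm (\<Sum>n\<in>{2 ^ k..<2 ^ k + 2 ^ k}. b n * chi (int n)))\<^sup>2)"
    unfolding set b_def by (intro sum.cong refl) (auto simp: case_prod_unfold intro!: arg_cong[of _ _ "\<lambda>x. (norm x)\<^sup>2"] sum.cong)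
  also have "\<dots> \<le> 100 * (Q powr (9 / 4) + real (2 ^ k)) * (\<Sum>n\<in>{2 ^ k..<2 ^ k + 2 ^ k}. (norm (b n))\<^sup>2)"
    by (rule large_sieve[OF Q])
  also have "\<dots> \<le> 100 * (Q powr (9 / 4) + real (2 ^ k)) * (\<Sum>n\<in>{2 ^ k..<2 ^ k + 2 ^ k}. (2 ^ k) powr (- 2 * \<sigma>) * (norm (a n))\<^sup>2)"
  proof (intro mult_left_mono sum_mono)
    fix n :: nat assume n: "n \<in> {2 ^ k..<2 ^ k + 2 ^ k}"
    then have "2 ^ k \<le> n" by simp
    then have nk: "(2 :: real) ^ k \<le> real n"
      by (metis of_nat_le_iff of_nat_numeral of_nat_power)
    then have n0: "real n > 0" by (rule less_le_trans[rotated]) simp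
    have "norm (b n) = norm (a n) / real n powr \<sigma>"
      using norm_of_real_powr[OF n0, of "Complex \<sigma> t"] by (simp add: b_def norm_divide)
    also have "\<dots> \<le> norm (a n) / (2 ^ k) powr \<sigma>"
      using nk \<sigma> n0 by (intro divide_left_mono powr_mono2) auto
    finally have "(norm (b n))\<^sup>2 \<le> (norm (a n) / (2 ^ k) powr \<sigma>)\<^sup>2" by (intro power_mono) auto
    also have "\<dots> = (2 ^ k) powr (- 2 * \<sigma>) * (norm (a n))\<^sup>2"
    proof -
      have 1: "((2 ^ k) powr \<sigma>)\<^sup>2 = (2 ^ k :: real) powr (2 * \<sigma>)"
        by (simp add: power2_eq_square powr_add[symmetric])
      have 2: "(2 ^ k :: real) powr (- 2 * \<sigma>) = inverse ((2 ^ k) powr (2 * \<sigma>))"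
        by (simp only: powr_minus mult_minus_left)
      show ?thesis unfolding power_divide 1 2 by (simp only: divide_inverse mult.commute)
    qed
    finally show "(norm (b n))\<^sup>2 \<le> (2 ^ k) powr (- 2 * \<sigma>) * (norm (a n))\<^sup>2" .
  qed (simp add: sum_nonneg)
  finally show ?thesis
    unfolding set by (simp only: sum_distrib_left[symmetric] mult.assoc of_nat_power of_nat_numeral)
qed

context L_framework
begin

text \<open>The approximate functional equation is squared and summed over the characters.
  Cauchy-Schwarz against the Gaussian moves the sum inside the t-integral; the hypotheses may grow
  like exp (t^2 / 4), which the kernel exp (- t^2 / 2) absorbs. The bound N <= K' Q^d turns N^c and
  N^2 into the two powers of Q, and Q^2 comes from an error 1 for each of at most 6 Q^2
  characters.\<close>

lemma mean_square_reduction: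
  assumes c: "0 < c" "c < 2"
  shows "\<exists>C>0. \<exists>Q0\<ge>2. \<forall>Q\<ge>Q0. \<forall>G\<subseteq>character_family Q. \<forall>H X X'.
     (\<forall>z\<in>G. H z holomorphic_on UNIV \<and> (\<exists>B. \<forall>w. 0 \<le> Re w \<longrightarrow> Re w \<le> 2 \<longrightarrow> norm (H z (1 / 2 + w)) \<le> B)) \<longrightarrow>
     (\<forall>t. (\<Sum>z\<in>G. (norm (H z (Complex (1 / 2 + c) t)))\<^sup>2) \<le> X * exp (t\<^sup>2 / 4)) \<longrightarrow>
     (\<forall>t. (\<Sum>z\<in>G. (norm (L_twist F (snd z) (Complex (5 / 2) t) - H z (Complex (5 / 2) t)))\<^sup>2) \<le> X' * exp (t\<^sup>2 / 4)) \<longrightarrow>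
     (\<Sum>z\<in>G. (norm (L_twist F (snd z) (1 / 2)))\<^sup>2) \<le> C * (Q powr (real dF * c) * X + Q powr (2 * real dF) * X' + Q\<^sup>2)"
proof -
  obtain C1 where C1: "C1 > 0" "\<And>q chi H B \<epsilon>. q \<ge> 2 \<Longrightarrow> chi \<in> primitive_characters q \<Longrightarrow> H holomorphic_on UNIV \<Longrightarrow>
     (\<forall>w. 0 \<le> Re w \<longrightarrow> Re w \<le> 2 \<longrightarrow> norm (H (1 / 2 + w)) \<le> B) \<Longrightarrow> \<epsilon> > 0 \<Longrightarrow>
     \<forall>\<^sub>F T in at_top. norm (L_twist F chi (1 / 2)) \<le>
        C1 * (real (L_conductor F q) powr (c / 2) * integral {- T..T} (\<lambda>t. norm (H (Complex (1 / 2 + c) t)) * exp (- (t\<^sup>2 / 2)))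
          + real (L_conductor F q) * integral {- T..T} (\<lambda>t. norm (L_twist F chi (Complex (5 / 2) t) - H (Complex (5 / 2) t)) * exp (- (t\<^sup>2 / 2)))) + \<epsilon>"
    using approximate_functional_equation[OF c] by blast
  obtain K q0 where Kq: "\<And>q chi. q \<ge> q0 \<Longrightarrow> q \<ge> 2 \<Longrightarrow> chi \<in> primitive_characters q \<Longrightarrow> real (L_conductor F q) \<le> K * real q ^ dF"
    using conductor_bound by blast
  define K' where "K' = max K 1 * 2 ^ dF"
  have K': "K' > 0" by (simp add: K'_def)
  define C where "C = 3 * C1\<^sup>2 * (K' powr c + K'\<^sup>2) * (4 * pi)\<^sup>2 + 18"
  have "C > 0" using K' by (simp add: C_def add_nonneg_pos)
  have main: "(\<Sum>z\<in>G. (norm (L_twist F (snd z) (1 / 2)))\<^sup>2) \<le> C * (Q powr (real dF * c) * X + Q powr (2 * real dF) * X' + Q\<^sup>2)"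
    if Q: "Q \<ge> max (real q0) 2" and G: "G \<subseteq> character_family Q"
      and H: "\<And>z. z \<in> G \<Longrightarrow> H z holomorphic_on UNIV \<and> (\<exists>B. \<forall>w. 0 \<le> Re w \<longrightarrow> Re w \<le> 2 \<longrightarrow> norm (H z (1 / 2 + w)) \<le> B)"
      and X: "\<And>t. (\<Sum>z\<in>G. (norm (H z (Complex (1 / 2 + c) t)))\<^sup>2) \<le> X * exp (t\<^sup>2 / 4)"
      and X': "\<And>t. (\<Sum>z\<in>G. (norm (L_twist F (snd z) (Complex (5 / 2) t) - H z (Complex (5 / 2) t)))\<^sup>2) \<le> X' * exp (t\<^sup>2 / 4)"
    for Q G H X X'
  proof -
    have Q2: "Q \<ge> 2" using Q by simp
    have fin: "finite G" using G character_family_finite_card(1)[OF Q2] finite_subset by blast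
    have cardG: "real (card G) \<le> 6 * Q\<^sup>2"
      using card_mono[OF character_family_finite_card(1)[OF Q2] G] character_family_finite_card(2)[OF Q2] by linarith
    have mem: "fst z \<ge> 2" "snd z \<in> primitive_characters (fst z)" "real (L_conductor F (fst z)) \<le> K' * Q ^ dF"
      "real (L_conductor F (fst z)) \<ge> 1" if "z \<in> G" for z
    proof -
      have z: "snd z \<in> primitive_characters (fst z)" "Q \<le> real (fst z)" "real (fst z) \<le> 2 * Q"
        using that G by (auto simp: character_family_def)
      then show 1: "fst z \<ge> 2" "snd z \<in> primitive_characters (fst z)" using Q by auto
      have "real (L_conductor F (fst z)) \<le> K * real (fst z) ^ dF" using z Q 1 by (intro Kq) auto
      also have "\<dots> \<le> max K 1 * (2 * Q) ^ dF" using z Q by (intro mult_mono power_mono) auto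
      finally show "real (L_conductor F (fst z)) \<le> K' * Q ^ dF" by (simp add: K'_def power_mult_distrib mult_ac)
      show "real (L_conductor F (fst z)) \<ge> 1" using N_pos[OF 1] by simp
    qed
    define f where "f = (\<lambda>z t. norm (H z (Complex (1 / 2 + c) t)))"
    define g where "g = (\<lambda>z t. norm (L_twist F (snd z) (Complex (5 / 2) t) - H z (Complex (5 / 2) t)))"
    define k where "k = (\<lambda>t :: real. exp (- (t\<^sup>2 / 2)))"
    have "\<forall>z\<in>G. \<forall>\<^sub>F T in at_top. norm (L_twist F (snd z) (1 / 2)) \<le>
        C1 * (real (L_conductor F (fst z)) powr (c / 2) * integral {- T..T} (\<lambda>t. f z t * k t)
          + real (L_conductor F (fst z)) * integral {- T..T} (\<lambda>t. g z t * k t)) + 1"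
      unfolding f_def g_def k_def
    proof
      fix z assume z: "z \<in> G"
      obtain B where "\<forall>w. 0 \<le> Re w \<longrightarrow> Re w \<le> 2 \<longrightarrow> norm (H z (1 / 2 + w)) \<le> B" using H[OF z] by auto
      then show "\<forall>\<^sub>F T in at_top. norm (L_twist F (snd z) (1 / 2)) \<le>
        C1 * (real (L_conductor F (fst z)) powr (c / 2) * integral {- T..T} (\<lambda>t. norm (H z (Complex (1 / 2 + c) t)) * exp (- (t\<^sup>2 / 2)))
          + real (L_conductor F (fst z)) * integral {- T..T} (\<lambda>t. norm (L_twist F (snd z) (Complex (5 / 2) t) - H z (Complex (5 / 2) t)) * exp (- (t\<^sup>2 / 2)))) + 1"
        using H[OF z] mem[OF z] by (intro C1(2)) auto
    qed
    \<comment> \<open>As G is finite, one truncation height T serves all its characters.\<close>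
    then have "\<forall>\<^sub>F T in at_top. \<forall>z\<in>G. norm (L_twist F (snd z) (1 / 2)) \<le>
        C1 * (real (L_conductor F (fst z)) powr (c / 2) * integral {- T..T} (\<lambda>t. f z t * k t)
          + real (L_conductor F (fst z)) * integral {- T..T} (\<lambda>t. g z t * k t)) + 1"
      by (rule eventually_ball_finite[OF fin])
    then obtain T where T: "\<And>z. z \<in> G \<Longrightarrow> norm (L_twist F (snd z) (1 / 2)) \<le>
        C1 * (real (L_conductor F (fst z)) powr (c / 2) * integral {- T..T} (\<lambda>t. f z t * k t)
          + real (L_conductor F (fst z)) * integral {- T..T} (\<lambda>t. g z t * k t)) + 1"
      using eventually_happens'[OF trivial_limit_at_top_linorder] by blast
    have cont_line: "continuous_on {- T..T} (\<lambda>t. u (Complex x t))" if "u holomorphic_on UNIV" for u :: "complex \<Rightarrow> complex" and x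
      by (rule continuous_on_vertical[OF holomorphic_on_imp_continuous_on[OF that]]) simp
    have cont_f: "continuous_on {- T..T} (f z)" if "z \<in> G" for z
      unfolding f_def using H[OF that] by (intro continuous_intros cont_line) auto
    have cont_g: "continuous_on {- T..T} (g z)" if "z \<in> G" for z
      unfolding g_def using H[OF that] L_twist_holomorphic[OF mem(1,2)[OF that]] by (intro continuous_intros cont_line) auto
    have cont_k: "continuous_on A k" for A unfolding k_def by (intro continuous_intros) auto
    have int_k: "integral {- T..T} k \<le> 4 * pi"
    proof -
      have "integral {- T..T} k \<le> integral {- T..T} (\<lambda>t. exp (- (t\<^sup>2 / 4)))"
        by (rule integral_le[OF integrable_continuous_real[OF cont_k] integral_gaussian_le(1)]) (simp add: k_def)
      also have "\<dots> \<le> 4 * pi" by (rule integral_gaussian_le(2))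
      finally show ?thesis .
    qed
    have CS: "(integral {- T..T} (\<lambda>t. u t * k t))\<^sup>2 \<le> 4 * pi * integral {- T..T} (\<lambda>t. (u t)\<^sup>2 * k t)"
      if "continuous_on {- T..T} u" for u
      using that cont_k int_k by (intro integral_Cauchy_Schwarz) (auto simp: k_def)
    have total: "(\<Sum>z\<in>G. (integral {- T..T} (\<lambda>t. u z t * k t))\<^sup>2) \<le> (4 * pi)\<^sup>2 * Y"
      if cu: "\<And>z. z \<in> G \<Longrightarrow> continuous_on {- T..T} (u z)" and Y: "\<And>t. (\<Sum>z\<in>G. (u z t)\<^sup>2) \<le> Y * exp (t\<^sup>2 / 4)" for u Y
    proof -
      have "0 \<le> (\<Sum>z\<in>G. (u z 0)\<^sup>2)" by (simp add: sum_nonneg)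
      then have Y0: "Y \<ge> 0" using Y[of 0] by simp
      have "(\<Sum>z\<in>G. (integral {- T..T} (\<lambda>t. u z t * k t))\<^sup>2) \<le> (\<Sum>z\<in>G. 4 * pi * integral {- T..T} (\<lambda>t. (u z t)\<^sup>2 * k t))"
        by (intro sum_mono CS cu)
      also have "\<dots> = 4 * pi * (\<Sum>z\<in>G. integral {- T..T} (\<lambda>t. (u z t)\<^sup>2 * k t))" by (simp add: sum_distrib_left)
      also have "(\<Sum>z\<in>G. integral {- T..T} (\<lambda>t. (u z t)\<^sup>2 * k t)) = integral {- T..T} (\<lambda>t. \<Sum>z\<in>G. (u z t)\<^sup>2 * k t)"
        using fin by (intro integral_sum[symmetric] integrable_continuous_real continuous_intros cu cont_k)
      also have "\<dots> \<le> integral {- T..T} (\<lambda>t. Y * exp (- (t\<^sup>2 / 4)))"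
      proof (intro integral_le)
        show "(\<lambda>t. \<Sum>z\<in>G. (u z t)\<^sup>2 * k t) integrable_on {- T..T}"
          by (intro integrable_continuous_real continuous_intros cu cont_k)
        show "(\<lambda>t. Y * exp (- (t\<^sup>2 / 4))) integrable_on {- T..T}"
          by (intro integrable_on_mult_right integral_gaussian_le)
        fix t
        have "(\<Sum>z\<in>G. (u z t)\<^sup>2 * k t) = (\<Sum>z\<in>G. (u z t)\<^sup>2) * k t" by (simp add: sum_distrib_right)
        also have "\<dots> \<le> Y * exp (t\<^sup>2 / 4) * k t" using Y by (intro mult_right_mono) (auto simp: k_def)
        also have "\<dots> = Y * exp (- (t\<^sup>2 / 4))"
        proof -
          have "exp (t\<^sup>2 / 4) * k t = exp (- (t\<^sup>2 / 4))" unfolding k_def by (simp flip: exp_add)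
          then show ?thesis by (simp only: mult.assoc)
        qed
        finally show "(\<Sum>z\<in>G. (u z t)\<^sup>2 * k t) \<le> Y * exp (- (t\<^sup>2 / 4))" .
      qed
      also have "\<dots> = Y * integral {- T..T} (\<lambda>t. exp (- (t\<^sup>2 / 4)))" by (rule integral_mult_right)
      also have "\<dots> \<le> Y * (4 * pi)" using Y0 by (intro mult_left_mono integral_gaussian_le)
      finally show ?thesis by (simp add: power2_eq_square mult_ac)
    qed
    have Xt: "(\<Sum>z\<in>G. (integral {- T..T} (\<lambda>t. f z t * k t))\<^sup>2) \<le> (4 * pi)\<^sup>2 * X"
      using cont_f X unfolding f_def by (intro total) auto
    have X't: "(\<Sum>z\<in>G. (integral {- T..T} (\<lambda>t. g z t * k t))\<^sup>2) \<le> (4 * pi)\<^sup>2 * X'"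
      using cont_g X' unfolding g_def by (intro total) auto
    have X0: "X \<ge> 0" "X' \<ge> 0"
    proof -
      have "0 \<le> (\<Sum>z\<in>G. (norm (H z (Complex (1 / 2 + c) 0)))\<^sup>2)"
        "0 \<le> (\<Sum>z\<in>G. (norm (L_twist F (snd z) (Complex (5 / 2) 0) - H z (Complex (5 / 2) 0)))\<^sup>2)"
        by (simp_all add: sum_nonneg)
      then show "X \<ge> 0" "X' \<ge> 0" using X[of 0] X'[of 0] by simp_all
    qed
    define A where "A = C1\<^sup>2 * (K' * Q ^ dF) powr c"
    define A' where "A' = C1\<^sup>2 * (K' * Q ^ dF)\<^sup>2"
    have KQ: "K' * Q ^ dF > 0" using K' Q2 by simp
    have pt: "(norm (L_twist F (snd z) (1 / 2)))\<^sup>2 \<le> 3 * (A * (integral {- T..T} (\<lambda>t. f z t * k t))\<^sup>2 + A' * (integral {- T..T} (\<lambda>t. g z t * k t))\<^sup>2 + 1)"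
      if z: "z \<in> G" for z
    proof -
      define a b where "a = integral {- T..T} (\<lambda>t. f z t * k t)" and "b = integral {- T..T} (\<lambda>t. g z t * k t)"
      define n where "n = real (L_conductor F (fst z))"
      have n: "1 \<le> n" "n \<le> K' * Q ^ dF" using mem[OF z] by (auto simp: n_def)
      have "norm (L_twist F (snd z) (1 / 2)) \<le> C1 * n powr (c / 2) * a + C1 * n * b + 1"
        using T[OF z] by (simp add: a_def b_def n_def algebra_simps)
      then have "(norm (L_twist F (snd z) (1 / 2)))\<^sup>2 \<le> (C1 * n powr (c / 2) * a + C1 * n * b + 1)\<^sup>2" by (intro power_mono) auto
      also have "\<dots> \<le> 3 * ((C1 * n powr (c / 2) * a)\<^sup>2 + (C1 * n * b)\<^sup>2 + 1\<^sup>2)" by (rule sum3_square_le)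
      also have "(C1 * n powr (c / 2) * a)\<^sup>2 = C1\<^sup>2 * n powr c * a\<^sup>2"
      proof -
        have "(n powr (c / 2))\<^sup>2 = n powr c" by (simp add: power2_eq_square flip: powr_add)
        then show ?thesis by (simp add: power_mult_distrib)
      qed
      also have "C1\<^sup>2 * n powr c * a\<^sup>2 \<le> A * a\<^sup>2"
        unfolding A_def using n c by (intro mult_right_mono mult_left_mono powr_mono2) auto
      also have "(C1 * n * b)\<^sup>2 = C1\<^sup>2 * n\<^sup>2 * b\<^sup>2" by (simp add: power_mult_distrib)
      also have "C1\<^sup>2 * n\<^sup>2 * b\<^sup>2 \<le> A' * b\<^sup>2"
        unfolding A'_def using n by (intro mult_right_mono mult_left_mono power_mono) auto
      finally show ?thesis by (simp add: a_def b_def)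
    qed
    have "(\<Sum>z\<in>G. (norm (L_twist F (snd z) (1 / 2)))\<^sup>2) \<le>
        (\<Sum>z\<in>G. 3 * (A * (integral {- T..T} (\<lambda>t. f z t * k t))\<^sup>2 + A' * (integral {- T..T} (\<lambda>t. g z t * k t))\<^sup>2 + 1))"
      by (intro sum_mono pt)
    also have "\<dots> = 3 * (A * (\<Sum>z\<in>G. (integral {- T..T} (\<lambda>t. f z t * k t))\<^sup>2) + A' * (\<Sum>z\<in>G. (integral {- T..T} (\<lambda>t. g z t * k t))\<^sup>2) + real (card G))"
      by (simp add: sum.distrib sum_distrib_left[symmetric])
    also have "\<dots> \<le> 3 * (A * ((4 * pi)\<^sup>2 * X) + A' * ((4 * pi)\<^sup>2 * X') + 6 * Q\<^sup>2)"
      using Xt X't cardG by (intro mult_left_mono add_mono) (auto simp: A_def A'_def)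
    also have "A = C1\<^sup>2 * K' powr c * Q powr (real dF * c)"
    proof -
      have "Q ^ dF = Q powr real dF" using Q2 by (intro powr_realpow[symmetric]) simp
      then show ?thesis using K' by (simp add: A_def powr_mult powr_powr)
    qed
    also have "A' = C1\<^sup>2 * K'\<^sup>2 * Q powr (2 * real dF)"
    proof -
      have "Q powr (2 * real dF) = Q powr real (2 * dF)" by simp
      also have "\<dots> = Q ^ (2 * dF)" using Q2 by (intro powr_realpow) simp
      also have "\<dots> = (Q ^ dF)\<^sup>2" by (simp add: power_mult mult.commute[of 2])
      finally show ?thesis by (simp add: A'_def power_mult_distrib)
    qed
    also have "3 * (C1\<^sup>2 * K' powr c * Q powr (real dF * c) * ((4 * pi)\<^sup>2 * X) + C1\<^sup>2 * K'\<^sup>2 * Q powr (2 * real dF) * ((4 * pi)\<^sup>2 * X') + 6 * Q\<^sup>2)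
      = (3 * C1\<^sup>2 * K' powr c * (4 * pi)\<^sup>2) * (Q powr (real dF * c) * X) + (3 * C1\<^sup>2 * K'\<^sup>2 * (4 * pi)\<^sup>2) * (Q powr (2 * real dF) * X') + 18 * Q\<^sup>2"
      by (simp only: distrib_left mult_ac)
    also have "\<dots> \<le> C * (Q powr (real dF * c) * X) + C * (Q powr (2 * real dF) * X') + C * Q\<^sup>2"
    proof (intro add_mono mult_right_mono)
      have "3 * C1\<^sup>2 * K' powr c * (4 * pi)\<^sup>2 \<ge> 0" "3 * C1\<^sup>2 * K'\<^sup>2 * (4 * pi)\<^sup>2 \<ge> 0" by simp_all
      moreover have "C = 3 * C1\<^sup>2 * K' powr c * (4 * pi)\<^sup>2 + 3 * C1\<^sup>2 * K'\<^sup>2 * (4 * pi)\<^sup>2 + 18"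
        by (simp only: C_def distrib_left distrib_right)
      ultimately show "3 * C1\<^sup>2 * K' powr c * (4 * pi)\<^sup>2 \<le> C" "3 * C1\<^sup>2 * K'\<^sup>2 * (4 * pi)\<^sup>2 \<le> C" "18 \<le> C" by linarith+
    qed (use X0 in auto)
    finally show ?thesis by (simp only: distrib_left)
  qed
  show ?thesis
  proof (rule exI[of _ C], rule conjI[OF \<open>C > 0\<close>], rule exI[of _ "max (real q0) 2"], rule conjI, simp, intro allI impI)
    fix Q G H X X'
    assume "max (real q0) 2 \<le> Q" "G \<subseteq> character_family Q"
      "\<forall>z\<in>G. H z holomorphic_on UNIV \<and> (\<exists>B. \<forall>w. 0 \<le> Re w \<longrightarrow> Re w \<le> 2 \<longrightarrow> norm (H z (1 / 2 + w)) \<le> B)"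
      "\<forall>t. (\<Sum>z\<in>G. (norm (H z (Complex (1 / 2 + c) t)))\<^sup>2) \<le> X * exp (t\<^sup>2 / 4)"
      "\<forall>t. (\<Sum>z\<in>G. (norm (L_twist F (snd z) (Complex (5 / 2) t) - H z (Complex (5 / 2) t)))\<^sup>2) \<le> X' * exp (t\<^sup>2 / 4)"
    then show "(\<Sum>z\<in>G. (norm (L_twist F (snd z) (1 / 2)))\<^sup>2) \<le> C * (Q powr (real dF * c) * X + Q powr (2 * real dF) * X' + Q\<^sup>2)"
      by (intro main[where H = H]) blast+
  qed
qed

end

section \<open>Positivity of the zero count\<close>

context L_framework_divisor_bound
begin

text \<open>The Euler product excludes zeros with Re s > 1, so those counted lie in a compact
  rectangle and are finite in number; a sum over an infinite set would be 0 by convention. Each zero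
  has order at least 1, since the twist does not vanish identically.\<close>

lemma zero_count_pos:
  assumes q: "q \<ge> 2" and chi: "chi \<in> primitive_characters q"
  shows "zero_count F chi \<sigma> T \<ge> (if \<exists>s. Re s \<ge> \<sigma> \<and> \<bar>Im s\<bar> \<le> T \<and> L_twist F chi s = 0 then 1 else 0)"
proof -
  define Z where "Z = {s. Re s \<ge> \<sigma> \<and> \<bar>Im s\<bar> \<le> T \<and> L_twist F chi s = 0}"
  have hol: "L_twist F chi holomorphic_on A" for A by (rule L_twist_holomorphic[OF q chi])
  have fz: "finite {s \<in> K. L_twist F chi s = 0}" if "compact K" for K
  proof (cases "L_twist F chi constant_on UNIV")
    case True
    then obtain y where y: "\<And>s. L_twist F chi s = y" by (auto simp: constant_on_def)
    have "y \<noteq> 0" using L_twist_nonzero[OF q chi, of 2] y by simp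
    then show ?thesis using y by simp
  next
    case False
    then show ?thesis using that hol by (intro holomorphic_compact_finite_zeros[of _ UNIV]) auto
  qed
  have "Z \<subseteq> {s \<in> cbox (Complex \<sigma> (- T)) (Complex 1 T). L_twist F chi s = 0}"
    using L_twist_nonzero[OF q chi] by (force simp: Z_def in_cbox_complex_iff not_less[symmetric])
  then have finZ: "finite Z" by (rule finite_subset[OF _ fz[OF compact_cbox]])
  have freq: "frequently (\<lambda>z. L_twist F chi z \<noteq> 0) (at s)" for s
  proof (rule ccontr)
    assume "\<not> frequently (\<lambda>z. L_twist F chi z \<noteq> 0) (at s)"
    then have "\<forall>\<^sub>F z in at s. L_twist F chi z = 0" by (simp add: frequently_def)
    then obtain d where d: "d > 0" "\<And>z. z \<noteq> s \<Longrightarrow> dist z s < d \<Longrightarrow> L_twist F chi z = 0"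
      by (auto simp: eventually_at)
    have "ball s d \<subseteq> insert s {z \<in> cball s d. L_twist F chi z = 0}"
      using d(2) by (auto simp: dist_commute less_imp_le)
    moreover have "finite (insert s {z \<in> cball s d. L_twist F chi z = 0})" using fz[of "cball s d"] by simp
    ultimately have "finite (ball s d)" by (rule finite_subset)
    then show False using uncountable_ball[OF d(1), of s] countable_finite by blast
  qed
  have "zorder (L_twist F chi) s > 0" if "s \<in> Z" for s
    using zorder_pos_iff[OF hol open_UNIV UNIV_I freq] that by (simp add: Z_def)
  then have ge: "zorder (L_twist F chi) s \<ge> 1" if "s \<in> Z" for s using that by force
  then have "(\<Sum>s\<in>Z. 1) \<le> zero_count F chi \<sigma> T"
    unfolding zero_count_def Z_def[symmetric] by (intro sum_mono) auto
  then have "int (card Z) \<le> zero_count F chi \<sigma> T" by simp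
  moreover have "(if \<exists>s. Re s \<ge> \<sigma> \<and> \<bar>Im s\<bar> \<le> T \<and> L_twist F chi s = 0 then 1 else 0) \<le> int (card Z)"
  proof (cases "Z = {}")
    case False
    then have "card Z > 0" using finZ by (simp add: card_gt_0_iff)
    then show ?thesis by simp
  qed (auto simp: Z_def)
  ultimately show ?thesis by linarith
qed

end

section \<open>Dyadic decompositions\<close>

lemma two_power_powr: "((2 :: real) ^ k) powr x = 2 powr (real k * x)"
  by (simp add: powr_realpow[symmetric] powr_powr)

lemma two_power_eq_powr: "(2 :: real) ^ k = 2 powr real k"
  by (simp add: powr_realpow)

lemma dyadic_exponent: "((2 :: real) ^ k) powr (- 2 * \<sigma>) * 2 ^ k = 2 powr (real k * (1 - 2 * \<sigma>))"
proof -
  have "((2 :: real) ^ k) powr (- 2 * \<sigma>) * 2 ^ k = 2 powr (real k * (- 2 * \<sigma>)) * 2 powr real k"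
    by (simp only: two_power_powr two_power_eq_powr[symmetric])
  then show ?thesis by (simp add: powr_add[symmetric] algebra_simps)
qed

lemma geometric_sum_le:
  fixes r :: real
  assumes "r > 1"
  shows "(\<Sum>k\<le>n. r ^ k) \<le> r / (r - 1) * r ^ n"
proof -
  have "(\<Sum>k\<le>n. r ^ k) = (r ^ Suc n - 1) / (r - 1)"
    using assms by (simp only: lessThan_Suc_atMost[symmetric]) (subst geometric_sum, auto)
  also have "\<dots> \<le> r ^ Suc n / (r - 1)" using assms by (intro divide_right_mono) auto
  finally show ?thesis by simp
qed

lemma geometric_tail_le:
  fixes m n :: nat
  shows "(\<Sum>k\<in>{m<..n}. (1 / 2 :: real) ^ k) \<le> (1 / 2) ^ m"
proof (cases "m \<le> n")
  case True
  have "(\<Sum>k\<in>{m<..n}. (1 / 2 :: real) ^ k) = (1 / 2) ^ m - (1 / 2) ^ n"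
    using True
  proof (induction n rule: dec_induct)
    case (step n)
    have "{m<..Suc n} = insert (Suc n) {m<..n}" using step by auto
    with step show ?case by simp
  qed simp
  then show ?thesis by simp
qed simp

lemma sum_dyadic_blocks:
  fixes f :: "nat \<Rightarrow> 'a :: comm_monoid_add"
  shows "(\<Sum>n\<in>{1..<2 ^ K}. f n) = (\<Sum>k<K. \<Sum>n\<in>{2 ^ k..<2 ^ Suc k}. f n)"
proof (induction K)
  case (Suc K)
  have "{1..<2 ^ Suc K} = {1..<2 ^ K} \<union> {2 ^ K..<2 ^ Suc K :: nat}"
    by (auto simp: Suc_le_eq intro: less_le_trans[of _ "2 ^ K"])
  then have "(\<Sum>n\<in>{1..<2 ^ Suc K}. f n) = (\<Sum>n\<in>{1..<2 ^ K}. f n) + (\<Sum>n\<in>{2 ^ K..<2 ^ Suc K}. f n)"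
    by (simp only:) (rule sum.union_disjoint, auto)
  with Suc show ?case by simp
qed simp

lemma sum_prime_range_blocks:
  fixes f :: "nat \<Rightarrow> 'a :: comm_monoid_add"
  assumes "a \<le> b"
  shows "(\<Sum>p\<in>prime_range (2 ^ a) (2 ^ b). f p) = (\<Sum>i\<in>{a..<b}. \<Sum>p\<in>prime_range (2 ^ i) (2 ^ Suc i). f p)"
  using assms
proof (induction b rule: dec_induct)
  case base
  have "prime_range (2 ^ a) (2 ^ a) = {}" by (auto simp: prime_range_def)
  then show ?case by simp
next
  case (step b)
  have ab: "(2 :: nat) ^ a \<le> 2 ^ b" using step by (intro power_increasing) auto
  have bb: "(2 :: nat) ^ b \<le> 2 ^ Suc b" by simp
  have "prime_range (2 ^ a) (2 ^ Suc b) = prime_range (2 ^ a) (2 ^ b) \<union> prime_range (2 ^ b) (2 ^ Suc b)"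
    unfolding prime_range_def by (auto simp del: power_Suc intro: order_trans[OF ab] less_le_trans[OF _ bb])
  then have "(\<Sum>p\<in>prime_range (2 ^ a) (2 ^ Suc b). f p) =
      (\<Sum>p\<in>prime_range (2 ^ a) (2 ^ b). f p) + (\<Sum>p\<in>prime_range (2 ^ b) (2 ^ Suc b). f p)"
    by (simp only:) (rule sum.union_disjoint, auto simp: prime_range_def)
  with step show ?case by simp
qed

lemma pair_sum_mean_square:
  fixes x :: "'p \<Rightarrow> 'z \<Rightarrow> complex"
  assumes fin: "finite A" and card: "real (card A) \<le> n"
    and le: "\<And>p. p \<in> A \<Longrightarrow> (\<Sum>z\<in>G. (norm (x p z))\<^sup>2) \<le> v" and v: "v \<ge> 0"
  shows "(\<Sum>z\<in>G. (norm (\<Sum>p\<in>A. x p z))\<^sup>2) \<le> n\<^sup>2 * v"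
proof -
  have "(\<Sum>z\<in>G. (norm (\<Sum>p\<in>A. x p z))\<^sup>2) \<le> (\<Sum>p\<in>A. 1) * (\<Sum>p\<in>A. v)"
    by (rule mean_square_sum_le[OF fin]) (use le in auto)
  also have "\<dots> = (real (card A))\<^sup>2 * v" by (simp add: power2_eq_square)
  also have "\<dots> \<le> n\<^sup>2 * v" using card v by (intro mult_right_mono power_mono) auto
  finally show ?thesis .
qed

lemma mean_square_add_le:
  fixes x y :: "'z \<Rightarrow> complex"
  assumes "(\<Sum>z\<in>G. (norm (x z))\<^sup>2) \<le> u" "(\<Sum>z\<in>G. (norm (y z))\<^sup>2) \<le> v"
  shows "(\<Sum>z\<in>G. (norm (x z + y z))\<^sup>2) \<le> 2 * u + 2 * v"
proof -
  have "(norm (x z + y z))\<^sup>2 \<le> 2 * (norm (x z))\<^sup>2 + 2 * (norm (y z))\<^sup>2" for z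
  proof -
    have "(norm (x z + y z))\<^sup>2 \<le> (norm (x z) + norm (y z))\<^sup>2" by (intro power_mono norm_triangle_ineq) auto
    also have "\<dots> \<le> 2 * (norm (x z))\<^sup>2 + 2 * (norm (y z))\<^sup>2"
      using sum_squares_bound[of "norm (x z)" "norm (y z)"] by (simp add: power2_eq_square algebra_simps)
    finally show ?thesis .
  qed
  then have "(\<Sum>z\<in>G. (norm (x z + y z))\<^sup>2) \<le> (\<Sum>z\<in>G. 2 * (norm (x z))\<^sup>2 + 2 * (norm (y z))\<^sup>2)"
    by (rule sum_mono)
  also have "\<dots> = 2 * (\<Sum>z\<in>G. (norm (x z))\<^sup>2) + 2 * (\<Sum>z\<in>G. (norm (y z))\<^sup>2)"
    by (simp add: sum.distrib sum_distrib_left)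
  finally show ?thesis using assms by linarith
qed

section \<open>Mean squares of dyadic blocks over the characters\<close>

context L_framework_divisor_bound
begin

definition rest_block :: "nat set \<Rightarrow> nat \<Rightarrow> (nat \<times> (int \<Rightarrow> complex)) \<Rightarrow> complex \<Rightarrow> complex" where
  "rest_block S k z s = (\<Sum>n\<in>{2 ^ k..<2 ^ Suc k}. ramare_rest S n * snd z (int n) / of_nat n powr s)"

definition factor_block :: "nat set \<Rightarrow> nat \<Rightarrow> (nat \<times> (int \<Rightarrow> complex)) \<Rightarrow> complex \<Rightarrow> complex" where
  "factor_block S k z s = (\<Sum>n\<in>{2 ^ k..<2 ^ Suc k}. ramare_factor S n * snd z (int n) / of_nat n powr s)"

definition prime_block :: "nat \<Rightarrow> (nat \<times> (int \<Rightarrow> complex)) \<Rightarrow> complex \<Rightarrow> complex" where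
  "prime_block i z s = (\<Sum>p\<in>prime_range (2 ^ i) (2 ^ Suc i). L_coeff F p * snd z (int p) / of_nat p powr s)"

text \<open>A product of members of block i and block j lies between 2^(i + j) and 2^(i + j + 2). So
  i + j <= k0 replaces the cutoff p m <= 2^k0 while every product remains a prime block times a
  factor block.\<close>

definition head_pairs :: "nat \<Rightarrow> nat \<Rightarrow> nat \<Rightarrow> nat \<Rightarrow> (nat \<times> nat) set" where
  "head_pairs i1 i2 J k0 = {(i, j). i \<in> {i1..<i2} \<and> j \<le> J \<and> i + j \<le> k0}"

definition tail_pairs :: "nat \<Rightarrow> nat \<Rightarrow> nat \<Rightarrow> nat \<Rightarrow> (nat \<times> nat) set" where
  "tail_pairs i1 i2 J k0 = {(i, j). i \<in> {i1..<i2} \<and> j \<le> J \<and> k0 < i + j}"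

text \<open>The constant of \<open>geometric_sum_le\<close> for the ratio 2^(1 / 50) of the weights
  in \<open>rest_head_mean_square\<close>.\<close>

definition head_constant :: real where "head_constant = 2 powr (1 / 50) / (2 powr (1 / 50) - 1)"

context
  fixes Q :: real and G :: "(nat \<times> (int \<Rightarrow> complex)) set" and S :: "nat set" and i1 i2 k0 J :: nat and E1 E2 a t :: real
  assumes Q: "Q \<ge> 2" and G: "G \<subseteq> character_family Q"
    and R2: "\<And>k. k \<le> J \<Longrightarrow> (\<Sum>n\<in>{2 ^ k..<2 ^ Suc k}. (norm (ramare_rest S n))\<^sup>2) \<le> 2 ^ k * E2"
    and R1: "\<And>k. k \<le> J \<Longrightarrow> i2 \<le> k \<Longrightarrow> (\<Sum>n\<in>{2 ^ k..<2 ^ Suc k}. (norm (ramare_rest S n))\<^sup>2) \<le> 2 ^ k * E1"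
    and F2: "\<And>k. k \<le> J \<Longrightarrow> (\<Sum>n\<in>{2 ^ k..<2 ^ Suc k}. (norm (ramare_factor S n))\<^sup>2) \<le> 2 ^ k * E2"
    and E: "E1 \<ge> 0" "E1 \<le> E2" "a \<ge> 0" and k0J: "k0 \<le> J"
begin

text \<open>E2 stands for a bound that loses a power of the logarithm but holds for every block. E1
  carries the saving of the sieve and is available only for k >= i2, because (A3) asks that the
  sieving primes do not exceed the length of the sum.\<close>

lemma rest_block_mean_square:
  assumes "k \<le> J" "\<sigma> \<ge> 0"
  shows "(\<Sum>z\<in>G. (norm (rest_block S k z (Complex \<sigma> t)))\<^sup>2) \<le> 100 * (Q powr (9 / 4) + 2 ^ k) * 2 powr (real k * (1 - 2 * \<sigma>)) * E2"
    and "i2 \<le> k \<Longrightarrow> (\<Sum>z\<in>G. (norm (rest_block S k z (Complex \<sigma> t)))\<^sup>2) \<le> 100 * (Q powr (9 / 4) + 2 ^ k) * 2 powr (real k * (1 - 2 * \<sigma>)) * E1"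
proof -
  have *: "(\<Sum>z\<in>G. (norm (rest_block S k z (Complex \<sigma> t)))\<^sup>2) \<le> 100 * (Q powr (9 / 4) + 2 ^ k) * 2 powr (real k * (1 - 2 * \<sigma>)) * E"
    if "(\<Sum>n\<in>{2 ^ k..<2 ^ Suc k}. (norm (ramare_rest S n))\<^sup>2) \<le> 2 ^ k * E" for E
  proof -
    have "(\<Sum>z\<in>G. (norm (rest_block S k z (Complex \<sigma> t)))\<^sup>2) \<le>
       100 * (Q powr (9 / 4) + 2 ^ k) * (2 ^ k) powr (- 2 * \<sigma>) * (\<Sum>n\<in>{2 ^ k..<2 ^ Suc k}. (norm (ramare_rest S n))\<^sup>2)"
      unfolding rest_block_def by (rule large_sieve_block[OF Q G assms(2)])
    also have "\<dots> \<le> 100 * (Q powr (9 / 4) + 2 ^ k) * (2 ^ k) powr (- 2 * \<sigma>) * (2 ^ k * E)"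
      by (intro mult_left_mono that) auto
    also have "\<dots> = 100 * (Q powr (9 / 4) + 2 ^ k) * ((2 ^ k) powr (- 2 * \<sigma>) * 2 ^ k) * E" by (simp only: mult.assoc)
    also have "(2 ^ k) powr (- 2 * \<sigma>) * 2 ^ k = 2 powr (real k * (1 - 2 * \<sigma>))"
      by (rule dyadic_exponent)
    finally show ?thesis .
  qed
  show "(\<Sum>z\<in>G. (norm (rest_block S k z (Complex \<sigma> t)))\<^sup>2) \<le> 100 * (Q powr (9 / 4) + 2 ^ k) * 2 powr (real k * (1 - 2 * \<sigma>)) * E2"
    by (rule *[OF R2[OF assms(1)]])
  show "(\<Sum>z\<in>G. (norm (rest_block S k z (Complex \<sigma> t)))\<^sup>2) \<le> 100 * (Q powr (9 / 4) + 2 ^ k) * 2 powr (real k * (1 - 2 * \<sigma>)) * E1" if "i2 \<le> k"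
    by (rule *[OF R1[OF assms(1) that]])
qed

text \<open>The prime block is bounded pointwise and only the other factor goes through the large
  sieve. That factor has length 2^j instead of 2^(i + j), so the sieve term Q^(9 / 4) is multiplied
  by 2^i; this is why the primes stop at a small power of Q.\<close>

lemma product_block_mean_square:
  assumes "j \<le> J" "\<sigma> \<ge> 0"
    and P: "\<And>z. z \<in> G \<Longrightarrow> (norm (prime_block i z (Complex \<sigma> t)))\<^sup>2 \<le> 2 powr (real i * (2 - 2 * \<sigma>)) * a"
  shows "(\<Sum>z\<in>G. (norm (prime_block i z (Complex \<sigma> t) * factor_block S j z (Complex \<sigma> t)))\<^sup>2) \<le>
     100 * a * E2 * ((Q powr (9 / 4) * 2 ^ i + 2 ^ (i + j)) * 2 powr (real (i + j) * (1 - 2 * \<sigma>)))"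
proof -
  have "(\<Sum>z\<in>G. (norm (prime_block i z (Complex \<sigma> t) * factor_block S j z (Complex \<sigma> t)))\<^sup>2) =
      (\<Sum>z\<in>G. (norm (prime_block i z (Complex \<sigma> t)))\<^sup>2 * (norm (factor_block S j z (Complex \<sigma> t)))\<^sup>2)"
    by (simp add: norm_mult power_mult_distrib)
  also have "\<dots> \<le> (\<Sum>z\<in>G. (2 powr (real i * (2 - 2 * \<sigma>)) * a) * (norm (factor_block S j z (Complex \<sigma> t)))\<^sup>2)"
    by (intro sum_mono mult_right_mono P) auto
  also have "\<dots> = (2 powr (real i * (2 - 2 * \<sigma>)) * a) * (\<Sum>z\<in>G. (norm (factor_block S j z (Complex \<sigma> t)))\<^sup>2)"
    by (simp add: sum_distrib_left)
  also have "\<dots> \<le> (2 powr (real i * (2 - 2 * \<sigma>)) * a) * (100 * (Q powr (9 / 4) + 2 ^ j) * (2 ^ j) powr (- 2 * \<sigma>) * (2 ^ j * E2))"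
  proof (intro mult_left_mono)
    have "(\<Sum>z\<in>G. (norm (factor_block S j z (Complex \<sigma> t)))\<^sup>2) \<le>
       100 * (Q powr (9 / 4) + 2 ^ j) * (2 ^ j) powr (- 2 * \<sigma>) * (\<Sum>n\<in>{2 ^ j..<2 ^ Suc j}. (norm (ramare_factor S n))\<^sup>2)"
      unfolding factor_block_def by (rule large_sieve_block[OF Q G assms(2)])
    also have "\<dots> \<le> 100 * (Q powr (9 / 4) + 2 ^ j) * (2 ^ j) powr (- 2 * \<sigma>) * (2 ^ j * E2)"
      using assms(1) by (intro mult_left_mono F2) auto
    finally show "(\<Sum>z\<in>G. (norm (factor_block S j z (Complex \<sigma> t)))\<^sup>2) \<le> 100 * (Q powr (9 / 4) + 2 ^ j) * (2 ^ j) powr (- 2 * \<sigma>) * (2 ^ j * E2)" .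
  qed (use E in auto)
  also have "\<dots> = 100 * a * E2 * ((Q powr (9 / 4) + 2 ^ j) * (2 powr (real i * (2 - 2 * \<sigma>)) * (2 ^ j) powr (- 2 * \<sigma>) * 2 ^ j))"
    by (simp only: mult_ac)
  also have "2 powr (real i * (2 - 2 * \<sigma>)) * (2 ^ j) powr (- 2 * \<sigma>) * 2 ^ j = 2 ^ i * 2 powr (real (i + j) * (1 - 2 * \<sigma>))"
  proof -
    have "2 powr (real i * (2 - 2 * \<sigma>)) = 2 ^ i * 2 powr (real i * (1 - 2 * \<sigma>))"
      using dyadic_exponent[of i \<sigma>] by (simp add: powr_add[symmetric] powr_realpow[symmetric] algebra_simps)
    moreover have "2 powr (real (i + j) * (1 - 2 * \<sigma>)) = 2 powr (real i * (1 - 2 * \<sigma>)) * 2 powr (real j * (1 - 2 * \<sigma>))"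
      by (simp add: powr_add[symmetric] algebra_simps)
    moreover have "(2 ^ j) powr (- 2 * \<sigma>) * 2 ^ j = 2 powr (real j * (1 - 2 * \<sigma>))"
      by (rule dyadic_exponent)
    ultimately show ?thesis by (simp add: mult.assoc)
  qed
  also have "(Q powr (9 / 4) + 2 ^ j) * (2 ^ i * 2 powr (real (i + j) * (1 - 2 * \<sigma>))) =
      (Q powr (9 / 4) * 2 ^ i + 2 ^ (i + j)) * 2 powr (real (i + j) * (1 - 2 * \<sigma>))"
    by (simp add: power_add algebra_simps)
  finally show ?thesis .
qed

lemma E2_nonneg: "E2 \<ge> 0"
  using E by simp

lemma pairs_card: "finite (head_pairs i1 i2 J k0)" "finite (tail_pairs i1 i2 J k0)"
  "real (card (head_pairs i1 i2 J k0)) \<le> real (i2 * (J + 1))" "real (card (tail_pairs i1 i2 J k0)) \<le> real (i2 * (J + 1))"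
proof -
  have sub: "head_pairs i1 i2 J k0 \<subseteq> {..<i2} \<times> {..J}" "tail_pairs i1 i2 J k0 \<subseteq> {..<i2} \<times> {..J}"
    by (auto simp: head_pairs_def tail_pairs_def)
  have c: "card ({..<i2} \<times> {..J}) = i2 * (J + 1)" by (simp add: card_cartesian_product)
  show "finite (head_pairs i1 i2 J k0)" "finite (tail_pairs i1 i2 J k0)"
    using sub by (auto intro: finite_subset)
  have "card (head_pairs i1 i2 J k0) \<le> i2 * (J + 1)" "card (tail_pairs i1 i2 J k0) \<le> i2 * (J + 1)"
    unfolding c[symmetric] by (rule card_mono[OF _ sub(1)], simp) (rule card_mono[OF _ sub(2)], simp)
  then show "real (card (head_pairs i1 i2 J k0)) \<le> real (i2 * (J + 1))" "real (card (tail_pairs i1 i2 J k0)) \<le> real (i2 * (J + 1))"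
    by (simp_all only: of_nat_le_iff)
qed

text \<open>The blocks grow geometrically with \<open>k\<close>, so geometric weights in the Cauchy--Schwarz inequality avoid the loss
  of a factor \<open>k0\<close>, which would exceed the saving in \<open>E1\<close>.\<close>

lemma rest_head_mean_square:
  "(\<Sum>z\<in>G. (norm (\<Sum>k\<le>k0. rest_block S k z (Complex (26 / 50) t)))\<^sup>2) \<le>
    100 * head_constant * (3 * 2 powr (real k0 * (48 / 50)) * E1 + (real k0 + 1) * (Q powr (9 / 4) + 2 ^ i2) * E2 * 2 powr (real k0 / 50))"
proof -
  define y where "y = Q powr (9 / 4)"
  have y0: "y \<ge> 0" by (simp add: y_def)
  \<comment> \<open>The weights grow towards k0 with ratio 2^(1 / 50). The sharp blocks grow like
    2^(48 k / 50), so the sharp part of v still grows with ratio 2^(47 / 50), and both geometric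
    sums are dominated by k = k0.\<close>
  define w where "w = (\<lambda>k. 2 powr ((real k - real k0) / 50))"
  define g where "g = (\<lambda>k::nat. 2 powr (real k * (47 / 50)) :: real)"
  define v where "v = (\<lambda>k. 100 * (2 powr (real k0 / 50) * g k * E1 + (y + 2 ^ i2) * E2 * 2 powr (real k0 / 50)))"
  have main: "(\<Sum>z\<in>G. (norm (\<Sum>k\<le>k0. rest_block S k z (Complex (26 / 50) t)))\<^sup>2) \<le> (\<Sum>k\<le>k0. w k) * (\<Sum>k\<le>k0. v k)"
  proof (rule mean_square_sum_le)
    fix k assume "k \<in> {..k0}"
    then have k: "k \<le> k0" "k \<le> J" using k0J by auto
    define V where "V = (\<Sum>z\<in>G. (norm (rest_block S k z (Complex (26 / 50) t)))\<^sup>2)"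
    define e where "e = 2 powr (real k * (1 - 2 * (26 / 50)))"
    have "e \<le> 2 powr 0" unfolding e_def by (intro powr_mono) auto
    then have e: "e \<ge> 0" "e \<le> 1" by (auto simp: e_def)
    have ke: "2 ^ k * e = 2 powr (real k * (48 / 50))"
      unfolding e_def two_power_eq_powr by (simp add: powr_add[symmetric] field_simps)
    have wv: "w k * v k = 100 * (2 powr (real k * (48 / 50)) * E1 + (y + 2 ^ i2) * E2 * 2 powr (real k / 50))"
    proof -
      have a: "w k * 2 powr (real k0 / 50) = 2 powr (real k / 50)"
        unfolding w_def by (simp add: powr_add[symmetric] field_simps)
      have b: "2 powr (real k / 50) * g k = 2 powr (real k * (48 / 50))"
        unfolding g_def by (simp add: powr_add[symmetric] field_simps)
      have "w k * v k = 100 * ((w k * 2 powr (real k0 / 50)) * g k * E1 + (y + 2 ^ i2) * E2 * (w k * 2 powr (real k0 / 50)))"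
        unfolding v_def by (simp add: algebra_simps)
      then show ?thesis unfolding a b .
    qed
    \<comment> \<open>One bound for both ranges of k: the full length 2^k meets only the sharp E1,
      while E2 is multiplied by y + 2^i2 at most.\<close>
    have "V \<le> 100 * (2 ^ k * E1 + (y + 2 ^ i2) * E2) * e"
    proof (cases "i2 \<le> k")
      case True
      have "V \<le> 100 * (y + 2 ^ k) * e * E1"
        using rest_block_mean_square(2)[OF k(2) _ True, of "26 / 50"] by (simp add: V_def y_def e_def)
      also have "\<dots> = 100 * (2 ^ k * E1 + y * E1) * e" by (simp add: algebra_simps)
      also have "\<dots> \<le> 100 * (2 ^ k * E1 + (y + 2 ^ i2) * E2) * e"
        using E y0 e E2_nonneg by (intro mult_right_mono mult_left_mono add_left_mono mult_mono) auto
      finally show ?thesis .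
    next
      case False
      have "V \<le> 100 * (y + 2 ^ k) * e * E2"
        using rest_block_mean_square(1)[OF k(2), of "26 / 50"] by (simp add: V_def y_def e_def)
      also have "\<dots> = 100 * (0 + (y + 2 ^ k) * E2) * e" by (simp add: algebra_simps)
      also have "\<dots> \<le> 100 * (2 ^ k * E1 + (y + 2 ^ i2) * E2) * e"
        using E y0 e E2_nonneg False by (intro mult_right_mono mult_left_mono add_mono power_increasing) auto
      finally show ?thesis .
    qed
    also have "\<dots> = 100 * (2 ^ k * e * E1 + (y + 2 ^ i2) * E2 * e)" by (simp add: algebra_simps)
    also have "\<dots> \<le> 100 * (2 powr (real k * (48 / 50)) * E1 + (y + 2 ^ i2) * E2 * 2 powr (real k / 50))"
    proof -
      have "e \<le> 2 powr (real k / 50)" unfolding e_def by (intro powr_mono) auto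
      then show ?thesis unfolding ke
        using E2_nonneg y0 by (intro mult_left_mono add_left_mono) auto
    qed
    finally show "(\<Sum>z\<in>G. (norm (rest_block S k z (Complex (26 / 50) t)))\<^sup>2) \<le> w k * v k"
      by (simp add: V_def wv)
  qed (auto simp: w_def)
  have sw: "(\<Sum>k\<le>k0. w k) \<le> head_constant"
  proof -
    have p: "(2 powr (1 / 50)) ^ k = (2 :: real) powr (real k / 50)" for k :: nat
      by (subst powr_realpow[symmetric]) (auto simp: powr_powr)
    have "w k = 2 powr (- (real k0 / 50)) * (2 powr (1 / 50)) ^ k" for k
      unfolding w_def p by (simp add: powr_add[symmetric] field_simps)
    then have "(\<Sum>k\<le>k0. w k) = 2 powr (- (real k0 / 50)) * (\<Sum>k\<le>k0. (2 powr (1 / 50)) ^ k)"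
      by (simp add: sum_distrib_left)
    also have "\<dots> \<le> 2 powr (- (real k0 / 50)) * (head_constant * (2 powr (1 / 50)) ^ k0)"
      unfolding head_constant_def by (intro mult_left_mono geometric_sum_le) auto
    also have "\<dots> = head_constant * (2 powr (- (real k0 / 50)) * 2 powr (real k0 / 50))"
      unfolding p by (simp only: mult_ac)
    also have "2 powr (- (real k0 / 50)) * 2 powr (real k0 / 50) = (1 :: real)"
      by (simp add: powr_add[symmetric])
    finally show ?thesis by simp
  qed
  have sg: "(\<Sum>k\<le>k0. g k) \<le> 3 * g k0"
  proof -
    define r :: real where "r = 2 powr (47 / 50)"
    have g: "g k = r ^ k" for k
      unfolding g_def r_def by (subst powr_realpow[symmetric]) (auto simp: powr_powr mult.commute)
    \<comment> \<open>The ratio 3 / 2 makes r / (r - 1) <= 3; it is checked by comparing 50th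
      powers.\<close>
    have r: "r \<ge> 3 / 2"
    proof (rule ccontr)
      assume "\<not> r \<ge> 3 / 2"
      then have "r ^ 50 < (3 / 2) ^ 50" by (intro power_strict_mono) (auto simp: r_def)
      moreover have "r ^ 50 = 2 powr 47"
        unfolding r_def by (subst powr_realpow[symmetric]) (auto simp: powr_powr)
      moreover have "(2 :: real) powr 47 = 2 ^ 47" using powr_realpow[of 2 47] by simp
      moreover have "(3 / 2 :: real) ^ 50 < 2 ^ 47" by (simp add: power_divide)
      ultimately show False by simp
    qed
    have "(\<Sum>k\<le>k0. g k) \<le> r / (r - 1) * r ^ k0" unfolding g using r by (intro geometric_sum_le) auto
    also have "\<dots> \<le> 3 * r ^ k0" using r by (intro mult_right_mono) (auto simp: field_simps)
    finally show ?thesis by (simp add: g)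
  qed
  have sv: "(\<Sum>k\<le>k0. v k) \<le> 100 * (3 * 2 powr (real k0 * (48 / 50)) * E1 + (real k0 + 1) * (y + 2 ^ i2) * E2 * 2 powr (real k0 / 50))"
  proof -
    have "(\<Sum>k\<le>k0. v k) = 100 * (2 powr (real k0 / 50) * (\<Sum>k\<le>k0. g k) * E1 + (real k0 + 1) * ((y + 2 ^ i2) * E2 * 2 powr (real k0 / 50)))"
      unfolding v_def by (simp add: sum.distrib sum_distrib_left sum_distrib_right algebra_simps)
    also have "\<dots> \<le> 100 * (2 powr (real k0 / 50) * (3 * g k0) * E1 + (real k0 + 1) * ((y + 2 ^ i2) * E2 * 2 powr (real k0 / 50)))"
      using sg E by (intro mult_left_mono add_right_mono mult_right_mono) auto
    also have "2 powr (real k0 / 50) * (3 * g k0) = 3 * 2 powr (real k0 * (48 / 50))"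
      unfolding g_def by (simp add: powr_add[symmetric] field_simps)
    finally show ?thesis by (simp add: mult.assoc)
  qed
  have "(\<Sum>k\<le>k0. w k) * (\<Sum>k\<le>k0. v k) \<le> head_constant *
      (100 * (3 * 2 powr (real k0 * (48 / 50)) * E1 + (real k0 + 1) * (y + 2 ^ i2) * E2 * 2 powr (real k0 / 50)))"
  proof (intro mult_mono sw sv)
    have "(2 :: real) powr 0 \<le> 2 powr (1 / 50)" by (intro powr_mono) auto
    then show "0 \<le> head_constant" unfolding head_constant_def by (intro divide_nonneg_nonneg) auto
    show "0 \<le> (\<Sum>k\<le>k0. v k)" unfolding v_def g_def using E E2_nonneg y0 by (intro sum_nonneg) auto
  qed
  with main show ?thesis unfolding y_def by (simp add: mult_ac)
qed

text \<open>A plain Cauchy-Schwarz over the pairs is enough here: in the application their number is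
  at most a power of the logarithm, which the saving in a absorbs.\<close>

lemma product_head_mean_square:
  assumes P: "\<And>z i. z \<in> G \<Longrightarrow> i \<in> {i1..<i2} \<Longrightarrow> (norm (prime_block i z (Complex (26 / 50) t)))\<^sup>2 \<le> 2 powr (real i * (2 - 2 * (26 / 50))) * a"
  shows "(\<Sum>z\<in>G. (norm (\<Sum>p\<in>head_pairs i1 i2 J k0. prime_block (fst p) z (Complex (26 / 50) t) * factor_block S (snd p) z (Complex (26 / 50) t)))\<^sup>2) \<le>
    (real (i2 * (J + 1)))\<^sup>2 * (100 * a * E2 * (Q powr (9 / 4) * 2 ^ i2 + 2 powr (real k0 * (48 / 50))))"
proof (rule pair_sum_mean_square[OF pairs_card(1) pairs_card(3)])
  fix p assume "p \<in> head_pairs i1 i2 J k0"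
  then obtain i j where ij: "p = (i, j)" "i \<in> {i1..<i2}" "j \<le> J" "i + j \<le> k0"
    by (auto simp: head_pairs_def)
  define e where "e = 2 powr (real (i + j) * (1 - 2 * (26 / 50)))"
  have "e \<le> 2 powr 0" unfolding e_def by (intro powr_mono) auto
  then have e: "e \<ge> 0" "e \<le> 1" by (auto simp: e_def)
  have ke: "2 ^ (i + j) * e = 2 powr (real (i + j) * (48 / 50))"
    unfolding e_def two_power_eq_powr by (simp add: powr_add[symmetric] field_simps)
  have "(\<Sum>z\<in>G. (norm (prime_block i z (Complex (26 / 50) t) * factor_block S j z (Complex (26 / 50) t)))\<^sup>2) \<le>
     100 * a * E2 * ((Q powr (9 / 4) * 2 ^ i + 2 ^ (i + j)) * e)"
    unfolding e_def by (rule product_block_mean_square) (use ij P in auto)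
  also have "\<dots> = 100 * a * E2 * (Q powr (9 / 4) * 2 ^ i * e + 2 powr (real (i + j) * (48 / 50)))"
    by (simp only: ke[symmetric] distrib_right)
  also have "\<dots> \<le> 100 * a * E2 * (Q powr (9 / 4) * 2 ^ i2 + 2 powr (real k0 * (48 / 50)))"
  proof (intro mult_left_mono add_mono)
    have "Q powr (9 / 4) * 2 ^ i * e \<le> Q powr (9 / 4) * 2 ^ i * 1" using e by (intro mult_left_mono) auto
    also have "\<dots> \<le> Q powr (9 / 4) * 2 ^ i2"
      using ij by (simp del: power_increasing_iff add: mult_left_mono power_increasing)
    finally show "Q powr (9 / 4) * 2 ^ i * e \<le> Q powr (9 / 4) * 2 ^ i2" .
    show "2 powr (real (i + j) * (48 / 50)) \<le> (2 :: real) powr (real k0 * (48 / 50))"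
      using ij(4) by (intro powr_mono) auto
  qed (use E E2_nonneg in auto)
  finally show "(\<Sum>z\<in>G. (norm (prime_block (fst p) z (Complex (26 / 50) t) * factor_block S (snd p) z (Complex (26 / 50) t)))\<^sup>2) \<le>
      100 * a * E2 * (Q powr (9 / 4) * 2 ^ i2 + 2 powr (real k0 * (48 / 50)))"
    by (simp add: ij)
qed (use E E2_nonneg in auto)

text \<open>At Re s = 5 / 2 the factor 2^(- 4 k) makes the blocks decay like 2^(- 3 k) once 2^k
  exceeds Q^(9 / 4). All k > k0 satisfy k >= i2, so only the sharp bound E1 occurs.\<close>

lemma rest_tail_mean_square:
  assumes y: "Q powr (9 / 4) \<le> 2 ^ Suc k0" and i2: "i2 \<le> Suc k0"
  shows "(\<Sum>z\<in>G. (norm (\<Sum>k\<in>{k0<..J}. rest_block S k z (Complex (5 / 2) t)))\<^sup>2) \<le> 200 * E1 * (1 / 2) ^ (3 * k0)"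
proof -
  define w :: "nat \<Rightarrow> real" where "w = (\<lambda>k. (1 / 2) ^ k)"
  define u where "u = 200 * E1 * (1 / 2) ^ k0"
  have u: "u \<ge> 0" using E by (simp add: u_def)
  have "(\<Sum>z\<in>G. (norm (\<Sum>k\<in>{k0<..J}. rest_block S k z (Complex (5 / 2) t)))\<^sup>2) \<le> (\<Sum>k\<in>{k0<..J}. w k) * (\<Sum>k\<in>{k0<..J}. u * w k)"
  proof (rule mean_square_sum_le)
    fix k assume "k \<in> {k0<..J}"
    then have k: "Suc k0 \<le> k" "k \<le> J" "i2 \<le> k" using i2 by auto
    have yk: "Q powr (9 / 4) \<le> 2 ^ k" by (rule order_trans[OF y]) (use k in \<open>intro power_increasing, auto\<close>)
    have "2 powr (real k * (1 - 2 * (5 / 2))) = (2 powr real k) powr (- 4)" by (simp add: powr_powr)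
    also have "\<dots> = inverse ((2 ^ k) ^ 4)"
      using powr_realpow[of "2 ^ k" 4] by (simp add: powr_minus powr_realpow)
    finally have ex: "2 powr (real k * (1 - 2 * (5 / 2))) = inverse (((2::real) ^ k) ^ 4)" .
    have "(\<Sum>z\<in>G. (norm (rest_block S k z (Complex (5 / 2) t)))\<^sup>2) \<le> 100 * (Q powr (9 / 4) + 2 ^ k) * inverse ((2 ^ k) ^ 4) * E1"
      using rest_block_mean_square(2)[OF k(2) _ k(3), of "5 / 2"] unfolding ex by simp
    also have "\<dots> \<le> 100 * (2 ^ k + 2 ^ k) * inverse ((2 ^ k) ^ 4) * E1"
      using yk E by (intro mult_right_mono mult_left_mono add_right_mono) auto
    also have "\<dots> = 200 * E1 * (1 / 2) ^ k * (w k * w k)"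
      unfolding w_def by (simp add: field_simps power_one_over power4_eq_xxxx)
    also have "\<dots> \<le> u * (w k * w k)"
      unfolding u_def using E k by (intro mult_right_mono mult_left_mono power_decreasing) (auto simp: w_def)
    finally show "(\<Sum>z\<in>G. (norm (rest_block S k z (Complex (5 / 2) t)))\<^sup>2) \<le> w k * (u * w k)" by (simp only: mult_ac)
  qed (auto simp: w_def)
  also have "\<dots> = u * ((\<Sum>k\<in>{k0<..J}. w k) * (\<Sum>k\<in>{k0<..J}. w k))"
    by (simp add: sum_distrib_left[symmetric] mult_ac)
  also have "\<dots> \<le> u * ((1 / 2) ^ k0 * (1 / 2) ^ k0)"
    unfolding w_def by (intro mult_left_mono mult_mono geometric_tail_le sum_nonneg u) auto
  also have "\<dots> = 200 * E1 * (1 / 2) ^ (3 * k0)"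
  proof -
    have three: "3 * k0 = k0 + (k0 + k0)" by simp
    show ?thesis unfolding u_def three power_add by (simp only: mult_ac)
  qed
  finally show ?thesis .
qed

text \<open>The decay is that of \<open>rest_tail_mean_square\<close>; the factor 2^i2 in the
  condition on k0 accounts for the shorter polynomial that goes through the sieve.\<close>

lemma product_tail_mean_square:
  assumes P: "\<And>z i. z \<in> G \<Longrightarrow> i \<in> {i1..<i2} \<Longrightarrow> (norm (prime_block i z (Complex (5 / 2) t)))\<^sup>2 \<le> 2 powr (real i * (2 - 2 * (5 / 2))) * a"
    and y: "Q powr (9 / 4) * 2 ^ i2 \<le> 2 ^ Suc k0"
  shows "(\<Sum>z\<in>G. (norm (\<Sum>p\<in>tail_pairs i1 i2 J k0. prime_block (fst p) z (Complex (5 / 2) t) * factor_block S (snd p) z (Complex (5 / 2) t)))\<^sup>2) \<le>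
    (real (i2 * (J + 1)))\<^sup>2 * (200 * a * E2 * (1 / 2) ^ (3 * k0))"
proof (rule pair_sum_mean_square[OF pairs_card(2) pairs_card(4)])
  fix p assume "p \<in> tail_pairs i1 i2 J k0"
  then obtain i j where ij: "p = (i, j)" "i \<in> {i1..<i2}" "j \<le> J" "k0 < i + j"
    by (auto simp: tail_pairs_def)
  define k where "k = i + j"
  have k: "Suc k0 \<le> k" using ij by (simp add: k_def)
  have "2 powr (real k * (1 - 2 * (5 / 2))) = (2 powr real k) powr (- 4)" by (simp add: powr_powr)
  also have "\<dots> = inverse ((2 ^ k) ^ 4)"
    using powr_realpow[of "2 ^ k" 4] by (simp add: powr_minus powr_realpow)
  finally have ex: "2 powr (real k * (1 - 2 * (5 / 2))) = inverse (((2::real) ^ k) ^ 4)" .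
  have "Q powr (9 / 4) * 2 ^ i \<le> Q powr (9 / 4) * 2 ^ i2"
    using ij by (simp del: power_increasing_iff add: mult_left_mono power_increasing)
  also have "\<dots> \<le> 2 ^ Suc k0" by (rule y)
  also have "\<dots> \<le> 2 ^ k" using k by (intro power_increasing) auto
  finally have yk: "Q powr (9 / 4) * 2 ^ i \<le> 2 ^ k" .
  have "(\<Sum>z\<in>G. (norm (prime_block i z (Complex (5 / 2) t) * factor_block S j z (Complex (5 / 2) t)))\<^sup>2) \<le>
     100 * a * E2 * ((Q powr (9 / 4) * 2 ^ i + 2 ^ k) * inverse ((2 ^ k) ^ 4))"
  proof -
    have "(\<Sum>z\<in>G. (norm (prime_block i z (Complex (5 / 2) t) * factor_block S j z (Complex (5 / 2) t)))\<^sup>2) \<le>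
       100 * a * E2 * ((Q powr (9 / 4) * 2 ^ i + 2 ^ (i + j)) * 2 powr (real (i + j) * (1 - 2 * (5 / 2))))"
      by (rule product_block_mean_square) (use ij P in auto)
    then show ?thesis unfolding k_def[symmetric] ex .
  qed
  also have "\<dots> \<le> 100 * a * E2 * ((2 ^ k + 2 ^ k) * inverse ((2 ^ k) ^ 4))"
    using yk E E2_nonneg by (intro mult_left_mono mult_right_mono add_right_mono) auto
  also have "\<dots> = 200 * a * E2 * (1 / 2) ^ (3 * k)"
    by (simp add: field_simps power_one_over power4_eq_xxxx power3_eq_cube power_mult mult.commute[of 3])
  also have "\<dots> \<le> 200 * a * E2 * (1 / 2) ^ (3 * k0)"
    using k E E2_nonneg by (intro mult_left_mono power_decreasing) auto
  finally show "(\<Sum>z\<in>G. (norm (prime_block (fst p) z (Complex (5 / 2) t) * factor_block S (snd p) z (Complex (5 / 2) t)))\<^sup>2) \<le>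
      200 * a * E2 * (1 / 2) ^ (3 * k0)"
    by (simp add: ij)
qed (use E E2_nonneg in auto)

end

end

section \<open>The range of the sieving primes and the size of their character sums\<close>

text \<open>The primes between \<open>2\<close> to the power \<open>sieve_lower \<eta> Q\<close> and \<open>2\<close> to the power \<open>sieve_upper Q\<close> are large enough for a
  zero-free strip of width \<open>ln Q powr (\<delta> - 1)\<close> with \<open>\<delta> > \<eta>\<close> to give cancellation, and in (A3) they save \<open>ln Q powr \<eta>\<close>.\<close>

definition sieve_lower :: "real \<Rightarrow> real \<Rightarrow> nat" where
  "sieve_lower \<eta> Q = nat \<lceil>ln Q powr (1 - \<eta>)\<rceil>"

definition sieve_upper :: "real \<Rightarrow> nat" where
  "sieve_upper Q = nat \<lfloor>ln Q / 100\<rfloor>"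

lemma eventually_compose_ln: "eventually P at_top \<Longrightarrow> eventually (\<lambda>Q :: real. P (ln Q)) at_top"
  by (rule eventually_compose_filterlim[OF _ ln_at_top])

text \<open>The exponent \<open>sieve_lower \<eta> Q - 1\<close> appears because the bound for a
  block starting at 2^i uses initial sums of length down to 2^i - 1, which is at least 2^(i -
  1).\<close>

lemma eventually_sieve_range:
  assumes "0 < \<eta>" "\<eta> < 1"
  shows "\<forall>\<^sub>F Q in at_top. 2 \<le> sieve_lower \<eta> Q \<and> sieve_lower \<eta> Q \<le> sieve_upper Q \<and>
     real (sieve_lower \<eta> Q) \<le> 2 * ln Q powr (1 - \<eta>) \<and> ln Q / 200 \<le> real (sieve_upper Q) \<and>
     real (sieve_upper Q) \<le> ln Q / 100 \<and> exp (ln Q powr (1 - \<eta>) / 2) \<le> 2 ^ (sieve_lower \<eta> Q - 1) \<and>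
     2 ^ sieve_upper Q \<le> Q powr (1 / 100)"
proof -
  have "\<forall>\<^sub>F l :: real in at_top. l powr (1 - \<eta>) \<ge> 4 \<and> 400 * l powr (1 - \<eta>) \<le> l \<and> l \<ge> 200"
    using assms by (intro eventually_conj; real_asymp)
  then have "\<forall>\<^sub>F Q :: real in at_top. ln Q powr (1 - \<eta>) \<ge> 4 \<and> 400 * ln Q powr (1 - \<eta>) \<le> ln Q \<and> ln Q \<ge> 200"
    by (rule eventually_compose_ln)
  with eventually_gt_at_top[of 0] show ?thesis
  proof eventually_elim
    case (elim Q)
    define u where "u = ln Q powr (1 - \<eta>)"
    have u: "u \<ge> 4" "400 * u \<le> ln Q" "ln Q \<ge> 200" "Q > 0" using elim by (auto simp: u_def)
    have lo: "u \<le> real (sieve_lower \<eta> Q)" "real (sieve_lower \<eta> Q) \<le> u + 1"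
      using u unfolding sieve_lower_def u_def[symmetric] by linarith+
    have up: "real (sieve_upper Q) \<le> ln Q / 100" "ln Q / 100 - 1 \<le> real (sieve_upper Q)"
      using u unfolding sieve_upper_def by linarith+
    have "real (sieve_lower \<eta> Q) \<le> real (sieve_upper Q)" "real 2 \<le> real (sieve_lower \<eta> Q)"
      using lo up u by linarith+
    then have lu: "sieve_lower \<eta> Q \<le> sieve_upper Q" "2 \<le> sieve_lower \<eta> Q" by (simp_all only: of_nat_le_iff)
    \<comment> \<open>u / 2 <= 2 / 3 (u - 1) is the condition u >= 4, and 2 / 3 is a lower bound for
      ln 2.\<close>
    have "u / 2 \<le> 2 / 3 * (u - 1)" using u by simp
    also have "\<dots> \<le> ln 2 * (u - 1)" using u ln2_ge_two_thirds by (intro mult_right_mono) auto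
    also have "\<dots> \<le> ln 2 * real (sieve_lower \<eta> Q - 1)"
      using lo lu by (intro mult_left_mono) (auto simp: of_nat_diff)
    finally have "exp (u / 2) \<le> exp (real (sieve_lower \<eta> Q - 1) * ln 2)" by (simp add: mult.commute)
    also have "\<dots> = 2 ^ (sieve_lower \<eta> Q - 1)" by (simp only: exp_of_nat_mult) simp
    finally have ex: "exp (u / 2) \<le> 2 ^ (sieve_lower \<eta> Q - 1)" .
    have "0 \<le> ln Q" using u by linarith
    then have Q1: "1 \<le> Q" using u(4) by simp
    have "(2 :: real) ^ sieve_upper Q = exp (real (sieve_upper Q) * ln 2)" by (simp only: exp_of_nat_mult) simp
    also have "\<dots> \<le> exp (ln Q / 100 * 1)"
      using up u Q1 ln_2_less_1 by (intro iffD2[OF exp_le_cancel_iff] mult_mono) auto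
    also have "\<dots> = Q powr (1 / 100)" using u by (simp add: powr_def)
    finally have "2 ^ sieve_upper Q \<le> Q powr (1 / 100)" .
    with u lo up lu ex show ?case unfolding u_def by auto
  qed
qed

lemma exp_add_square_ge_1: "exp ((t :: real)\<^sup>2 / 4) \<ge> 1"
  by simp

context L_framework_divisor_bound
begin

lemma norm_prime_block_trivial:
  assumes chi: "dirichlet_character (fst z) (snd z)" and \<sigma>: "\<sigma> \<ge> 0"
  shows "norm (prime_block i z (Complex \<sigma> t)) \<le> real dF * (2 ^ i * (2 ^ i) powr (- \<sigma>))"
proof -
  have "norm (prime_block i z (Complex \<sigma> t)) \<le> (\<Sum>p\<in>prime_range (2 ^ i) (2 ^ Suc i). real dF * (2 ^ i) powr (- \<sigma>))"
    unfolding prime_block_def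
  proof (rule sum_norm_le)
    fix p assume p: "p \<in> prime_range (2 ^ i) (2 ^ Suc i)"
    then have pp: "prime p" "2 ^ i \<le> p" by (auto simp: prime_range_def)
    have p0: "p > 0" using pp by (simp add: prime_gt_0_nat)
    have "real (2 ^ i) \<le> real p" using pp(2) by (simp only: of_nat_le_iff)
    then have "(2 ^ i) powr \<sigma> \<le> real p powr \<sigma>" using \<sigma> by (intro powr_mono2) auto
    then have pw: "real p powr (- \<sigma>) \<le> (2 ^ i) powr (- \<sigma>)"
      unfolding powr_minus by (intro le_imp_inverse_le) auto
    have n: "norm (of_nat p powr Complex \<sigma> t) = real p powr \<sigma>"
      using p0 norm_powr_real_powr[of "complex_of_nat p" "Complex \<sigma> t"] by simp
    have "norm (L_coeff F p * snd z (int p) / of_nat p powr Complex \<sigma> t) = norm (L_coeff F p) * norm (snd z (int p)) * real p powr (- \<sigma>)"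
      unfolding norm_divide norm_mult n by (simp add: powr_minus divide_inverse)
    also have "\<dots> \<le> real dF * 1 * (2 ^ i) powr (- \<sigma>)"
      using norm_coeff_prime_le[OF pp(1)] dirichlet_character_norm_le[OF chi] pw
      by (intro mult_mono) auto
    finally show "norm (L_coeff F p * snd z (int p) / of_nat p powr Complex \<sigma> t) \<le> real dF * (2 ^ i) powr (- \<sigma>)" by simp
  qed
  also have "\<dots> = real (card (prime_range (2 ^ i) (2 ^ Suc i))) * (real dF * (2 ^ i) powr (- \<sigma>))" by simp
  also have "\<dots> \<le> 2 ^ i * (real dF * (2 ^ i) powr (- \<sigma>))"
  proof (intro mult_right_mono)
    have "card (prime_range (2 ^ i) (2 ^ Suc i)) \<le> card {2 ^ i..<(2::nat) ^ Suc i}"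
      by (intro card_mono) (auto simp: prime_range_def)
    then have "card (prime_range (2 ^ i) (2 ^ Suc i)) \<le> 2 ^ i" by simp
    then show "real (card (prime_range (2 ^ i) (2 ^ Suc i))) \<le> 2 ^ i" by (simp only: of_nat_le_iff[symmetric, where 'a = real] of_nat_power of_nat_numeral)
  qed auto
  finally show ?thesis by (simp add: mult_ac)
qed

lemma square_dyadic: "((2 :: real) ^ i * (2 ^ i) powr (- \<sigma>))\<^sup>2 = 2 powr (real i * (2 - 2 * \<sigma>))"
proof -
  have "(2 :: real) ^ i * (2 ^ i) powr (- \<sigma>) = 2 powr (real i * (1 - \<sigma>))"
    unfolding two_power_powr by (simp add: powr_realpow[symmetric] powr_add[symmetric] algebra_simps)
  then show ?thesis by (simp add: power2_eq_square powr_add[symmetric] algebra_simps)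
qed

text \<open>If |t| > ln Q, the factor exp (t^2 / 4) alone exceeds every fixed power of ln Q and the
  trivial bound suffices. Otherwise |t| <= Q / 4 and \<open>norm_prime_sum_le\<close> applies with h
  = x (ln Q)^(- B): since x >= exp ((ln Q)^(1 - \<eta>) / 2), the gain x^(- \<beta> / 2) is at most
  exp (- c (ln Q)^(\<delta> - \<eta>)). So B may be as large as desired.\<close>

lemma prime_block_bound:
  assumes \<eta>: "0 < \<eta>" "\<eta> < \<delta>" and \<delta>: "\<delta> < 1" and C': "C' > 0" and B: "B \<ge> 0"
  shows "\<exists>K\<ge>0. \<forall>\<^sub>F Q in at_top. \<forall>z\<in>character_family Q.
     (\<forall>s. Re s > 1 - ln Q powr (\<delta> - 1) / C' \<longrightarrow> \<bar>Im s\<bar> < Q \<longrightarrow> L_twist F (snd z) s \<noteq> 0) \<longrightarrow>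
     (\<forall>\<sigma>\<ge>0. \<forall>t. \<forall>i\<in>{sieve_lower \<eta> Q..<sieve_upper Q}. (norm (prime_block i z (Complex \<sigma> t)))\<^sup>2
        \<le> 2 powr (real i * (2 - 2 * \<sigma>)) * (K * ln Q powr (- 2 * B) * exp (t\<^sup>2 / 4)))"
    (is "\<exists>K\<ge>0. \<forall>\<^sub>F Q in at_top. ?P K Q")
proof -
  obtain C where C: "C \<ge> 1" and ext: "\<And>q chi \<beta> Q. q \<ge> 2 \<Longrightarrow> chi \<in> primitive_characters q \<Longrightarrow> 0 < \<beta> \<Longrightarrow> \<beta> \<le> 1 / 4 \<Longrightarrow> Q \<ge> 4 \<Longrightarrow>
     (\<And>s. Re s > 1 - \<beta> \<Longrightarrow> \<bar>Im s\<bar> < Q \<Longrightarrow> L_twist F chi s \<noteq> 0) \<Longrightarrow>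
     (\<exists>f. f holomorphic_on {s. Re s > 1 - \<beta> \<and> \<bar>Im s\<bar> < Q} \<and>
        (\<forall>s. Re s > 1 \<longrightarrow> \<bar>Im s\<bar> < Q \<longrightarrow> f s = prime_series chi s) \<and>
        (\<forall>s. 1 - \<beta> / 2 \<le> Re s \<longrightarrow> Re s \<le> 2 \<longrightarrow> \<bar>Im s\<bar> \<le> Q / 2 \<longrightarrow>
           norm (f s) \<le> C * (1 + ln (real (L_conductor F q)) + ln (1 + Q)) / \<beta>))"
    using prime_series_extension by blast
  obtain K' q0 where K': "\<And>q chi. q \<ge> q0 \<Longrightarrow> q \<ge> 2 \<Longrightarrow> chi \<in> primitive_characters q \<Longrightarrow>
      real (L_conductor F q) \<le> K' * real q ^ dF"
    using conductor_bound by blast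
  \<comment> \<open>With this constant the bound M for the continued prime series is at most D1 (ln
    Q)^(2 - \<delta>): one logarithm from conductor and height, and (ln Q)^(1 - \<delta>) from 1 /
    \<beta>. The exponent is below 2, so eventually M <= (ln Q)^2.\<close>
  define D1 where "D1 = C * C' * (\<bar>ln K'\<bar> + 2 * real dF + 3)"
  have D1: "D1 > 0" unfolding D1_def using C C' by (intro mult_pos_pos) auto
  define c where "c = 1 / (4 * C')"
  have c: "c > 0" using C' by (simp add: c_def)
  define e where "e = \<delta> - \<eta>"
  have e: "e > 0" using \<eta> by (simp add: e_def)
  have A: "\<forall>\<^sub>F l :: real in at_top. l powr (\<delta> - 1) \<le> C' / 4 \<and> l \<ge> 1 \<and> l \<ge> abs_series \<and> D1 * l powr (2 - \<delta>) \<le> l\<^sup>2"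
    using \<delta> \<eta> C' D1 by (intro eventually_conj; real_asymp)
  \<comment> \<open>The exponent 2 B + 2 collects x^2 / h^2 = (ln Q)^(2 B) and the bound (ln Q)^2
    for M. The second exponential bounds x / Q for x <= Q^(1 / 100).\<close>
  have A2: "\<forall>\<^sub>F l :: real in at_top. 6000 * l powr (2 * B + 2) * (exp (- c * l powr e) + exp (- (99 / 100) * l)) \<le> 1"
  proof -
    have m: "\<forall>\<^sub>F m :: real in at_top. 12000 * m powr ((2 * B + 2) / e) * exp (- c * m) \<le> 1"
      using c by real_asymp
    have fl: "filterlim (\<lambda>l :: real. l powr e) at_top at_top" using e by real_asymp
    have "\<forall>\<^sub>F l :: real in at_top. 12000 * l powr (2 * B + 2) * exp (- (99 / 100) * l) \<le> 1"
      by real_asymp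
    with eventually_compose_filterlim[OF m fl] show ?thesis
    proof eventually_elim
      case (elim l)
      have "(l powr e) powr ((2 * B + 2) / e) = l powr (2 * B + 2)" using e by (simp add: powr_powr)
      with elim show ?case by (simp only: distrib_left)
    qed
  qed
  have e': "1 - \<eta> > 0" using \<eta> \<delta> by simp
  define e1 where "e1 = 1 - \<eta>"
  have A3: "\<forall>\<^sub>F l :: real in at_top. l powr B \<le> exp (l powr e1 / 2)"
    using e' e1_def[symmetric] by (simp only: ) real_asymp
  have A4: "\<forall>\<^sub>F l :: real in at_top. 1 \<le> l powr (- 2 * B) * exp (l\<^sup>2 / 4)"
    by real_asymp
  have A5: "\<forall>\<^sub>F Q :: real in at_top. Q \<ge> 8 \<and> Q \<ge> real q0 \<and> ln Q \<le> Q / 4"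
    by (intro eventually_conj; real_asymp)
  \<comment> \<open>The factor 4 is 2 from partial summation times 2 from x <= 2^(i + 1).\<close>
  define Kp where "Kp = (4 * (1 + 2 * real dF))\<^sup>2"
  show ?thesis
  proof (intro exI[of _ Kp] conjI)
    show "Kp \<ge> 0" by (simp add: Kp_def)
    have "\<eta> < 1" using \<eta> \<delta> by simp
    from eventually_sieve_range[OF \<eta>(1) this] eventually_compose_ln[OF A] eventually_compose_ln[OF A2]
      eventually_compose_ln[OF A3] eventually_compose_ln[OF A4] A5
    show "\<forall>\<^sub>F Q in at_top. ?P Kp Q"
    proof eventually_elim
      case (elim Q)
      define l where "l = ln Q"
      define \<beta> where "\<beta> = l powr (\<delta> - 1) / C'"
      define lo where "lo = sieve_lower \<eta> Q"
      define up where "up = sieve_upper Q"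
      have l: "l \<ge> 1" "l \<ge> abs_series" "D1 * l powr (2 - \<delta>) \<le> l\<^sup>2" using elim by (auto simp: l_def)
      have Q: "Q \<ge> 8" "Q \<ge> real q0" "l \<le> Q / 4" using elim by (auto simp: l_def)
      have \<beta>: "\<beta> > 0" "\<beta> \<le> 1 / 4" using elim l C' by (auto simp: \<beta>_def l_def field_simps)
      have range: "2 \<le> lo" "lo \<le> up" "exp (l powr e1 / 2) \<le> 2 ^ (lo - 1)" "2 ^ up \<le> Q powr (1 / 100)"
        using elim by (auto simp: lo_def up_def l_def e1_def)
      have small: "6000 * l powr (2 * B + 2) * (exp (- c * l powr e) + exp (- (99 / 100) * l)) \<le> 1"
        and lB: "l powr B \<le> exp (l powr e1 / 2)" and big: "1 \<le> l powr (- 2 * B) * exp (l\<^sup>2 / 4)"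
        using elim by (auto simp: l_def)
      have Qe: "Q = exp l" using Q by (simp add: l_def)
      show ?case
      proof (intro ballI impI allI)
        fix z \<sigma> t i
        assume z: "z \<in> character_family Q" and zf: "\<forall>s. Re s > 1 - ln Q powr (\<delta> - 1) / C' \<longrightarrow> \<bar>Im s\<bar> < Q \<longrightarrow> L_twist F (snd z) s \<noteq> 0"
          and \<sigma>: "(0 :: real) \<le> \<sigma>" and i: "i \<in> {sieve_lower \<eta> Q..<sieve_upper Q}"
        obtain q chi where zq: "z = (q, chi)" by (cases z)
        have q: "Q \<le> real q" "real q \<le> 2 * Q" and chi: "chi \<in> primitive_characters q"
          using z by (auto simp: character_family_def zq)
        have q2: "q \<ge> 2" and q0: "q \<ge> q0" using q Q by linarith+
        have i: "lo \<le> i" "i < up" using i by (auto simp: lo_def up_def)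
        have dc: "dirichlet_character (fst z) (snd z)" using chi by (simp add: zq primitive_characters_def)
        have "(norm (prime_block i z (Complex \<sigma> t)))\<^sup>2 \<le> (4 * (1 + 2 * real dF))\<^sup>2 * (2 powr (real i * (2 - 2 * \<sigma>)) * (l powr (- 2 * B) * exp (t\<^sup>2 / 4)))"
        proof (cases "\<bar>t\<bar> \<le> l")
          case False
          have "(norm (prime_block i z (Complex \<sigma> t)))\<^sup>2 \<le> (real dF * (2 ^ i * (2 ^ i) powr (- \<sigma>)))\<^sup>2"
            by (intro power_mono norm_prime_block_trivial[OF dc \<sigma>]) auto
          also have "\<dots> = (real dF)\<^sup>2 * (2 powr (real i * (2 - 2 * \<sigma>)) * 1)"
            by (simp only: power_mult_distrib[of "real dF"] square_dyadic mult_1_right)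
          also have "\<dots> \<le> (4 * (1 + 2 * real dF))\<^sup>2 * (2 powr (real i * (2 - 2 * \<sigma>)) * (l powr (- 2 * B) * exp (t\<^sup>2 / 4)))"
          proof (intro mult_mono power_mono)
            have "l\<^sup>2 \<le> t\<^sup>2" using False l by (intro abs_le_square_iff[THEN iffD1]) auto
            then have "l powr (- 2 * B) * exp (l\<^sup>2 / 4) \<le> l powr (- 2 * B) * exp (t\<^sup>2 / 4)"
              by (intro mult_left_mono) auto
            with big show "1 \<le> l powr (- 2 * B) * exp (t\<^sup>2 / 4)" by linarith
          qed auto
          finally show ?thesis .
        next
          case True
          define M where "M = C * (1 + ln (real (L_conductor F q)) + ln (1 + Q)) / \<beta>"
          obtain f where f: "f holomorphic_on {s. Re s > 1 - \<beta> \<and> \<bar>Im s\<bar> < Q}"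
            "\<And>s. Re s > 1 \<Longrightarrow> \<bar>Im s\<bar> < Q \<Longrightarrow> f s = prime_series chi s"
            "\<And>s. 1 - \<beta> / 2 \<le> Re s \<Longrightarrow> Re s \<le> 2 \<Longrightarrow> \<bar>Im s\<bar> \<le> Q / 2 \<Longrightarrow> norm (f s) \<le> M"
          proof -
            have zf': "L_twist F chi s \<noteq> 0" if "Re s > 1 - \<beta>" "\<bar>Im s\<bar> < Q" for s
              using zf that by (simp add: zq \<beta>_def l_def)
            have "Q \<ge> 4" using Q by simp
            from ext[OF q2 chi \<beta> this zf'] show ?thesis
              unfolding M_def[symmetric] by (blast intro: that)
          qed
          have "M \<le> l\<^sup>2"
          proof -
            have N: "real (L_conductor F q) \<ge> 1" using conductor_pos[OF q2 chi] by simp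
            have Nle: "real (L_conductor F q) \<le> K' * real q ^ dF" by (rule K'[OF q0 q2 chi])
            have qpos: "real q > 0" using q2 by simp
            have K0: "K' > 0"
            proof (rule ccontr)
              assume "\<not> K' > 0"
              then have "K' * real q ^ dF \<le> 0" by (intro mult_nonpos_nonneg) auto
              with N Nle show False by linarith
            qed
            have lq: "ln (real q) \<le> 1 + l"
            proof -
              have "ln (real q) \<le> ln (2 * Q)" using q qpos by (intro ln_mono) auto
              also have "\<dots> = ln 2 + l" using Q by (simp add: ln_mult l_def)
              finally show ?thesis using ln_2_less_1 by linarith
            qed
            have "ln (real (L_conductor F q)) \<le> ln (K' * real q ^ dF)" using N Nle by (intro ln_mono) auto
            also have "\<dots> = ln K' + real dF * ln (real q)" using K0 qpos by (simp add: ln_mult ln_realpow)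
            also have "\<dots> \<le> \<bar>ln K'\<bar> + real dF * (1 + l)" using lq by (intro add_mono mult_left_mono) auto
            finally have lN: "ln (real (L_conductor F q)) \<le> \<bar>ln K'\<bar> + real dF * (1 + l)" .
            have "ln (1 + Q) \<le> ln (2 * Q)" using Q by (intro ln_mono) auto
            also have "\<dots> = ln 2 + l" using Q by (simp add: ln_mult l_def)
            finally have l1: "ln (1 + Q) \<le> 1 + l" using ln_2_less_1 by linarith
            have "1 + ln (real (L_conductor F q)) + ln (1 + Q) \<le> (\<bar>ln K'\<bar> + real dF + 2) * 1 + (real dF + 1) * l"
              using lN l1 by (simp add: algebra_simps)
            also have "\<dots> \<le> (\<bar>ln K'\<bar> + real dF + 2) * l + (real dF + 1) * l"
              using l by (intro add_right_mono mult_left_mono) auto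
            also have "\<dots> = (\<bar>ln K'\<bar> + 2 * real dF + 3) * l" by (simp add: algebra_simps)
            finally have b: "1 + ln (real (L_conductor F q)) + ln (1 + Q) \<le> (\<bar>ln K'\<bar> + 2 * real dF + 3) * l" .
            have "M \<le> C * ((\<bar>ln K'\<bar> + 2 * real dF + 3) * l) / \<beta>"
              unfolding M_def using b C \<beta> by (intro divide_right_mono mult_left_mono) auto
            also have "\<dots> = D1 * (l / l powr (\<delta> - 1))" unfolding \<beta>_def D1_def using C' by (simp add: field_simps)
            also have "l / l powr (\<delta> - 1) = l powr (2 - \<delta>)"
            proof -
              have "l powr 1 / l powr (\<delta> - 1) = l powr (2 - \<delta>)" by (simp only: powr_diff[symmetric]) (simp add: algebra_simps)
              then show ?thesis using l by simp
            qed
            finally show ?thesis using l by linarith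
          qed
          then have aM: "abs_series + M \<le> 2 * l\<^sup>2"
            using l self_le_power[of l 2] by simp
          define w where "w = exp (- c * l powr e) + exp (- (99 / 100) * l)"
          have sum_le: "norm (\<Sum>n\<in>{1..k}. shifted_coeff chi t n) \<le> (1 + 2 * real dF) * (2 ^ Suc i * l powr (- B))"
            if k: "2 ^ i - 1 \<le> k" "k < 2 ^ Suc i" for k
          proof -
            define x where "x = real k"
            have i1: "i \<ge> 1" using i range by linarith
            have "(2 :: nat) ^ (lo - 1) \<le> 2 ^ (i - 1)" using i by (intro power_increasing) auto
            also have "\<dots> \<le> 2 ^ i - 1"
            proof -
              have "(2 :: nat) ^ i = 2 * 2 ^ (i - 1)" using i1 by (cases i) auto
              moreover have "(2 :: nat) ^ (i - 1) \<ge> 1" by simp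
              ultimately show ?thesis by linarith
            qed
            finally have "2 ^ (lo - 1) \<le> k" using k by linarith
            then have "real (2 ^ (lo - 1)) \<le> real k" by (simp only: of_nat_le_iff)
            then have "2 ^ (lo - 1) \<le> real k" by (simp only: of_nat_power of_nat_numeral)
            then have x_ge: "exp (l powr e1 / 2) \<le> x" unfolding x_def by (rule order_trans[OF range(3)])
            have xB: "l powr B \<le> x" using lB x_ge by linarith
            have lB0: "l powr B > 0" using l by simp
            then have x0: "x > 0" using xB by linarith
            have kle: "k \<le> 2 ^ Suc i" using k by simp
            have x_le': "x \<le> 2 ^ Suc i" using kle unfolding x_def
              by (simp only: of_nat_le_iff[symmetric, where 'a = real] of_nat_power of_nat_numeral)
            also have "\<dots> \<le> 2 ^ up" using i by (intro power_increasing) auto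
            finally have x_up: "x \<le> Q powr (1 / 100)" using range(4) by linarith
            \<comment> \<open>The terms between x and x + h cost 2 dF h, which is already of the
              size aimed at; h >= 1 holds because x exceeds (ln Q)^B.\<close>
            define h where "h = x * l powr (- B)"
            have h1: "h \<ge> 1" using xB lB0 by (simp add: h_def powr_minus field_simps)
            have "l powr (- B) \<le> l powr 0" using l B by (intro powr_mono) auto
            then have "l powr (- B) \<le> 1" using l by simp
            then have hx: "h \<le> x" unfolding h_def using x0 by (intro mult_left_le) auto
            have t: "\<bar>t\<bar> \<le> Q / 4" using True Q by linarith
            have fl: "nat \<lfloor>x\<rfloor> = k" by (simp add: x_def)
            have pw: "x powr (2 - \<beta> / 2) + x ^ 3 / Q \<le> x\<^sup>2 * w"
            proof -
              have "x powr (2 - \<beta> / 2) = x powr 2 * x powr (- (\<beta> / 2))" by (simp add: powr_add[symmetric])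
              also have "x powr 2 = x\<^sup>2" using x0 by simp
              also have "x powr (- (\<beta> / 2)) \<le> exp (l powr e1 / 2) powr (- (\<beta> / 2))"
                using x_ge \<beta> by (intro powr_mono2') auto
              also have "\<dots> = exp (- (\<beta> * l powr e1 / 4))" by (simp add: powr_def field_simps)
              also have "\<beta> * l powr e1 / 4 = c * l powr e"
              proof -
                have "l powr (\<delta> - 1) * l powr e1 = l powr e" by (simp add: powr_add[symmetric] e_def e1_def)
                then show ?thesis using C' by (simp add: \<beta>_def c_def field_simps)
              qed
              finally have a: "x powr (2 - \<beta> / 2) \<le> x\<^sup>2 * exp (- c * l powr e)" by (simp add: mult_left_mono)
              have "x / Q \<le> Q powr (1 / 100) / Q" using x_up Q by (intro divide_right_mono) auto
              also have "\<dots> = exp (- (99 / 100) * l)" unfolding Qe by (simp add: powr_def exp_diff[symmetric] field_simps)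
              finally have b: "x\<^sup>2 * (x / Q) \<le> x\<^sup>2 * exp (- (99 / 100) * l)" by (intro mult_left_mono) auto
              have "x ^ 3 / Q = x\<^sup>2 * (x / Q)" by (simp add: power3_eq_cube power2_eq_square)
              with a b show ?thesis unfolding w_def distrib_left by (simp only: add_mono)
            qed
            have "norm (\<Sum>n\<in>{1..nat \<lfloor>x\<rfloor>}. shifted_coeff chi t n) \<le>
              3000 * (abs_series + M) * (x powr (2 - \<beta> / 2) + x ^ 3 / Q) / h + 2 * real dF * h"
              by (rule norm_prime_sum_le[OF q2 chi f \<beta> Q(1) t h1 hx])
            also have "3000 * (abs_series + M) * (x powr (2 - \<beta> / 2) + x ^ 3 / Q) / h \<le> 3000 * (2 * l\<^sup>2) * (x\<^sup>2 * w) / h"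
            proof (intro divide_right_mono mult_mono[OF _ pw])
              show "3000 * (abs_series + M) \<le> 3000 * (2 * l\<^sup>2)" by (rule mult_left_mono[OF aM]) simp
              show "0 \<le> x powr (2 - \<beta> / 2) + x ^ 3 / Q" using x0 Q by (intro add_nonneg_nonneg divide_nonneg_nonneg) auto
            qed (use h1 in auto)
            also have "3000 * (2 * l\<^sup>2) * (x\<^sup>2 * w) / h = h * (6000 * l powr (2 * B + 2) * w)"
            proof -
              have "l powr (B + B + 2) = l powr B * l powr B * l powr 2" by (simp only: powr_add)
              then have "l powr (2 * B + 2) = (l powr B)\<^sup>2 * l\<^sup>2" using l by (simp add: power2_eq_square)
              then show ?thesis using x0 lB0 unfolding h_def powr_minus by (simp add: field_simps power2_eq_square)
            qed
            also have "\<dots> \<le> h * 1" using small h1 unfolding w_def[symmetric] by (intro mult_left_mono) auto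
            finally have "norm (\<Sum>n\<in>{1..k}. shifted_coeff chi t n) \<le> (1 + 2 * real dF) * h"
              unfolding fl by (simp add: algebra_simps)
            also have "\<dots> \<le> (1 + 2 * real dF) * (2 ^ Suc i * l powr (- B))"
              unfolding h_def using x_le' by (intro mult_left_mono mult_right_mono) auto
            finally show ?thesis .
          qed
          have "prime_block i z (Complex \<sigma> t) = (\<Sum>n\<in>{2 ^ i..<2 ^ Suc i}. prime_coeff chi n / of_nat n powr Complex \<sigma> t)"
            unfolding prime_block_def by (rule sum.mono_neutral_cong_left) (auto simp: prime_range_def prime_coeff_def zq)
          moreover have "norm (\<Sum>n\<in>{2 ^ i..<2 ^ Suc i}. prime_coeff chi n / of_nat n powr Complex \<sigma> t) \<le>
            2 * ((1 + 2 * real dF) * (2 ^ Suc i * l powr (- B))) * real (2 ^ i) powr (- \<sigma>)"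
            by (rule norm_prime_block_le[OF q2 chi _ _ \<sigma> sum_le]) auto
          ultimately have "norm (prime_block i z (Complex \<sigma> t)) \<le> (4 * (1 + 2 * real dF)) * l powr (- B) * (2 ^ i * (2 ^ i) powr (- \<sigma>))"
            by (simp add: algebra_simps)
          then have "(norm (prime_block i z (Complex \<sigma> t)))\<^sup>2 \<le> ((4 * (1 + 2 * real dF)) * l powr (- B) * (2 ^ i * (2 ^ i) powr (- \<sigma>)))\<^sup>2"
            by (intro power_mono) auto
          also have "\<dots> = (4 * (1 + 2 * real dF))\<^sup>2 * (2 powr (real i * (2 - 2 * \<sigma>)) * (l powr (- B))\<^sup>2)"
            unfolding power_mult_distrib[of "4 * (1 + 2 * real dF) * l powr (- B)" "2 ^ i * (2 ^ i) powr (- \<sigma>)"]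
              power_mult_distrib[of "4 * (1 + 2 * real dF)" "l powr (- B)"] square_dyadic
            by (simp only: mult_ac)
          also have "(l powr (- B))\<^sup>2 = l powr (- 2 * B)" by (simp add: power2_eq_square powr_add[symmetric])
          also have "(4 * (1 + 2 * real dF))\<^sup>2 * (2 powr (real i * (2 - 2 * \<sigma>)) * l powr (- 2 * B)) \<le>
              (4 * (1 + 2 * real dF))\<^sup>2 * (2 powr (real i * (2 - 2 * \<sigma>)) * (l powr (- 2 * B) * exp (t\<^sup>2 / 4)))"
            using mult_left_mono[OF exp_add_square_ge_1[of t], of "l powr (- 2 * B)"]
            by (intro mult_left_mono) auto
          finally show ?thesis .
        qed
        then show "(norm (prime_block i z (Complex \<sigma> t)))\<^sup>2 \<le> 2 powr (real i * (2 - 2 * \<sigma>)) * (Kp * ln Q powr (- 2 * B) * exp (t\<^sup>2 / 4))"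
          unfolding Kp_def l_def by (simp only: mult_ac)
      qed
    qed
  qed
qed

end

section \<open>The head of the series as approximant, and its remainder\<close>

lemma dirichlet_polynomial_holomorphic:
  assumes "\<And>n. n \<in> A \<Longrightarrow> n \<ge> 1"
  shows "(\<lambda>s. \<Sum>n\<in>A. a n / of_nat n powr s) holomorphic_on UNIV"
proof (intro holomorphic_intros)
  fix n s assume "n \<in> A"
  then have "n \<ge> 1" by (rule assms)
  then show "of_nat n powr s \<noteq> 0" by simp
qed

lemma norm_dirichlet_polynomial_le:
  assumes "\<And>n. n \<in> A \<Longrightarrow> n \<ge> 1" and s: "Re s \<ge> 0"
  shows "norm (\<Sum>n\<in>A. a n / of_nat n powr s) \<le> (\<Sum>n\<in>A. norm (a n))"
proof (rule sum_norm_le)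
  fix n assume "n \<in> A"
  then have n: "n \<ge> 1" by (rule assms)
  have "norm (of_nat n powr s) = real n powr Re s" using n norm_powr_real_powr[of "complex_of_nat n" s] by simp
  moreover have "real n powr Re s \<ge> 1" using n s by (intro ge_one_powr_ge_zero) auto
  ultimately show "norm (a n / of_nat n powr s) \<le> norm (a n)"
    unfolding norm_divide by (intro divide_le_eq[THEN iffD2]) (auto intro: mult_right_le_one_le simp: mult_le_cancel_left1)
qed

context L_framework_divisor_bound
begin

lemma block_holomorphic:
  "rest_block S k z holomorphic_on UNIV" "factor_block S k z holomorphic_on UNIV" "prime_block i z holomorphic_on UNIV"
proof -
  have "rest_block S k z = (\<lambda>s. \<Sum>n\<in>{2 ^ k..<2 ^ Suc k}. ramare_rest S n * snd z (int n) / of_nat n powr s)"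
    by (rule ext) (simp add: rest_block_def)
  then show "rest_block S k z holomorphic_on UNIV"
    using dirichlet_polynomial_holomorphic[of "{2 ^ k..<2 ^ Suc k}"] by (simp add: Suc_le_eq[symmetric] order_trans[OF one_le_power])
  have "factor_block S k z = (\<lambda>s. \<Sum>n\<in>{2 ^ k..<2 ^ Suc k}. ramare_factor S n * snd z (int n) / of_nat n powr s)"
    by (rule ext) (simp add: factor_block_def)
  then show "factor_block S k z holomorphic_on UNIV"
    using dirichlet_polynomial_holomorphic[of "{2 ^ k..<2 ^ Suc k}"] by (simp add: Suc_le_eq[symmetric] order_trans[OF one_le_power])
  have "prime_block i z = (\<lambda>s. \<Sum>n\<in>prime_range (2 ^ i) (2 ^ Suc i). L_coeff F n * snd z (int n) / of_nat n powr s)"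
    by (rule ext) (simp add: prime_block_def)
  moreover have "n \<ge> 1" if "n \<in> prime_range (2 ^ i) (2 ^ Suc i)" for n
    using that prime_ge_1_nat by (auto simp: prime_range_def)
  ultimately show "prime_block i z holomorphic_on UNIV"
    using dirichlet_polynomial_holomorphic[of "prime_range (2 ^ i) (2 ^ Suc i)"] by simp
qed

lemma block_bounded:
  "\<exists>B\<ge>0. \<forall>s. Re s \<ge> 0 \<longrightarrow> norm (rest_block S k z s) \<le> B"
  "\<exists>B\<ge>0. \<forall>s. Re s \<ge> 0 \<longrightarrow> norm (factor_block S k z s) \<le> B"
  "\<exists>B\<ge>0. \<forall>s. Re s \<ge> 0 \<longrightarrow> norm (prime_block i z s) \<le> B"
proof -
  have b: "n \<ge> 1" if "n \<in> {2 ^ k..<2 ^ Suc k}" for n :: nat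
  proof -
    have "(1 :: nat) \<le> 2 ^ k" by simp
    also have "\<dots> \<le> n" using that by simp
    finally show ?thesis .
  qed
  have p: "n \<ge> 1" if "n \<in> prime_range (2 ^ i) (2 ^ Suc i)" for n
    using that prime_ge_1_nat by (auto simp: prime_range_def)
  show "\<exists>B\<ge>0. \<forall>s. Re s \<ge> 0 \<longrightarrow> norm (rest_block S k z s) \<le> B"
    unfolding rest_block_def
    by (rule exI[of _ "\<Sum>n\<in>{2 ^ k..<2 ^ Suc k}. norm (ramare_rest S n * snd z (int n))"])
       (intro conjI allI impI sum_nonneg norm_dirichlet_polynomial_le norm_ge_zero b)
  show "\<exists>B\<ge>0. \<forall>s. Re s \<ge> 0 \<longrightarrow> norm (factor_block S k z s) \<le> B"
    unfolding factor_block_def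
    by (rule exI[of _ "\<Sum>n\<in>{2 ^ k..<2 ^ Suc k}. norm (ramare_factor S n * snd z (int n))"])
       (intro conjI allI impI sum_nonneg norm_dirichlet_polynomial_le norm_ge_zero b)
  show "\<exists>B\<ge>0. \<forall>s. Re s \<ge> 0 \<longrightarrow> norm (prime_block i z s) \<le> B"
    unfolding prime_block_def
    by (rule exI[of _ "\<Sum>n\<in>prime_range (2 ^ i) (2 ^ Suc i). norm (L_coeff F n * snd z (int n))"])
       (intro conjI allI impI sum_nonneg norm_dirichlet_polynomial_le norm_ge_zero p)
qed

text \<open>This is the approximant H for \<open>approximate_functional_equation\<close>. Both
  summands are cut along dyadic blocks, so every product keeps a full prime block as a factor, the
  object for which cancellation is known.\<close>

definition head_polynomial :: "nat set \<Rightarrow> nat \<Rightarrow> nat \<Rightarrow> nat \<Rightarrow> nat \<Rightarrow> (nat \<times> (int \<Rightarrow> complex)) \<Rightarrow> complex \<Rightarrow> complex" where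
  "head_polynomial S i1 i2 J k0 z s = (\<Sum>k\<le>k0. rest_block S k z s) +
     (\<Sum>p\<in>head_pairs i1 i2 J k0. prime_block (fst p) z s * factor_block S (snd p) z s)"

lemma head_polynomial_holomorphic: "head_polynomial S i1 i2 J k0 z holomorphic_on UNIV"
proof -
  have "head_polynomial S i1 i2 J k0 z = (\<lambda>s. (\<Sum>k\<le>k0. rest_block S k z s) +
     (\<Sum>p\<in>head_pairs i1 i2 J k0. prime_block (fst p) z s * factor_block S (snd p) z s))"
    by (rule ext) (simp add: head_polynomial_def)
  then show ?thesis by (simp only:) (intro holomorphic_intros block_holomorphic)
qed

lemma head_polynomial_bounded: "\<exists>B. \<forall>w. 0 \<le> Re w \<longrightarrow> Re w \<le> 2 \<longrightarrow> norm (head_polynomial S i1 i2 J k0 z (1 / 2 + w)) \<le> B"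
proof -
  from block_bounded(1)[of S _ z] obtain R where R: "\<And>k s. Re s \<ge> 0 \<Longrightarrow> norm (rest_block S k z s) \<le> R k"
    by metis
  from block_bounded(2)[of S _ z] obtain T where T: "\<And>k s. Re s \<ge> 0 \<Longrightarrow> norm (factor_block S k z s) \<le> T k"
    by metis
  from block_bounded(3)[of _ z] obtain P where P: "\<And>k s. Re s \<ge> 0 \<Longrightarrow> norm (prime_block k z s) \<le> P k"
    by metis
  have "norm (head_polynomial S i1 i2 J k0 z (1 / 2 + w)) \<le> (\<Sum>k\<le>k0. R k) + (\<Sum>p\<in>head_pairs i1 i2 J k0. P (fst p) * T (snd p))"
    if w: "0 \<le> Re w" for w
    unfolding head_polynomial_def
  proof (intro order_trans[OF norm_triangle_ineq] add_mono sum_norm_le R)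
    fix p
    show "norm (prime_block (fst p) z (1 / 2 + w) * factor_block S (snd p) z (1 / 2 + w)) \<le> P (fst p) * T (snd p)"
      unfolding norm_mult using w by (intro mult_mono P T order_trans[OF norm_ge_zero P]) auto
  qed (use w in auto)
  then show ?thesis by blast
qed

lemma sum_pairs_split:
  fixes f :: "nat \<Rightarrow> nat \<Rightarrow> complex"
  shows "(\<Sum>i\<in>{i1..<i2}. \<Sum>j\<le>J. f i j) = (\<Sum>p\<in>head_pairs i1 i2 J k0. f (fst p) (snd p)) + (\<Sum>p\<in>tail_pairs i1 i2 J k0. f (fst p) (snd p))"
proof -
  have fin: "finite (head_pairs i1 i2 J k0)" "finite (tail_pairs i1 i2 J k0)"
    by (rule finite_subset[of _ "{i1..<i2} \<times> {..J}"]; auto simp: head_pairs_def tail_pairs_def)+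
  have "(\<Sum>i\<in>{i1..<i2}. \<Sum>j\<le>J. f i j) = (\<Sum>p\<in>{i1..<i2} \<times> {..J}. f (fst p) (snd p))"
    by (simp add: sum.cartesian_product split_def)
  also have "{i1..<i2} \<times> {..J} = head_pairs i1 i2 J k0 \<union> tail_pairs i1 i2 J k0"
    by (auto simp: head_pairs_def tail_pairs_def)
  also have "(\<Sum>p\<in>\<dots>. f (fst p) (snd p)) = (\<Sum>p\<in>head_pairs i1 i2 J k0. f (fst p) (snd p)) + (\<Sum>p\<in>tail_pairs i1 i2 J k0. f (fst p) (snd p))"
    by (rule sum.union_disjoint[OF fin]) (auto simp: head_pairs_def tail_pairs_def)
  finally show ?thesis .
qed

lemma tail_decomposition:
  assumes q: "q \<ge> 2" and chi: "chi \<in> primitive_characters q" and s: "Re s = 5 / 2" and i: "i1 \<le> i2" and k0: "k0 \<le> J"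
    and S: "S = prime_range (2 ^ i1) (2 ^ i2)" and d: "dF \<ge> 1"
  defines "z \<equiv> (q, chi)"
  shows "norm (L_twist F chi s - head_polynomial S i1 i2 J k0 z s - ((\<Sum>k\<in>{k0<..J}. rest_block S k z s) +
     (\<Sum>p\<in>tail_pairs i1 i2 J k0. prime_block (fst p) z s * factor_block S (snd p) z s))) \<le> 2 * abs_series\<^sup>2 / 2 ^ J"
proof -
  \<comment> \<open>With 2^(J + 1) - 1 the range {1..M} is exactly the union of the blocks 0, ...,
    J.\<close>
  define M :: nat where "M = 2 ^ Suc J - 1"
  have M: "{1..M} = {1..<2 ^ Suc J}" "2 ^ J \<le> M"
  proof -
    have "(2 :: nat) ^ J \<ge> 1" by simp
    then show "{1..M} = {1..<2 ^ Suc J}" "2 ^ J \<le> M" unfolding M_def by auto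
  qed
  have M1: "M \<ge> 1" by (rule order_trans[OF _ M(2)]) simp
  have r: "(\<Sum>n\<in>{1..M}. ramare_rest S n * chi (int n) / of_nat n powr s) = (\<Sum>k\<le>J. rest_block S k z s)"
    unfolding M sum_dyadic_blocks rest_block_def z_def by (simp add: lessThan_Suc_atMost)
  have r2: "(\<Sum>k\<le>J. rest_block S k z s) = (\<Sum>k\<le>k0. rest_block S k z s) + (\<Sum>k\<in>{k0<..J}. rest_block S k z s)"
  proof -
    have "{..J} = {..k0} \<union> {k0<..J}" using k0 by auto
    then show ?thesis by (simp only:) (rule sum.union_disjoint, auto)
  qed
  have f: "(\<Sum>n\<in>{1..M}. ramare_factor S n * chi (int n) / of_nat n powr s) = (\<Sum>j\<le>J. factor_block S j z s)"
    unfolding M sum_dyadic_blocks factor_block_def z_def by (simp add: lessThan_Suc_atMost)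
  have p: "(\<Sum>p\<in>S. L_coeff F p * chi (int p) / of_nat p powr s) = (\<Sum>i\<in>{i1..<i2}. prime_block i z s)"
    unfolding S sum_prime_range_blocks[OF i] prime_block_def z_def by simp
  have "norm (L_twist F chi s - (\<Sum>n\<in>{1..M}. ramare_rest S n * chi (int n) / of_nat n powr s) -
     (\<Sum>p\<in>S. L_coeff F p * chi (int p) / of_nat p powr s) * (\<Sum>m\<in>{1..M}. ramare_factor S m * chi (int m) / of_nat m powr s))
     \<le> 2 * abs_series\<^sup>2 / real M"
    by (rule ramare_decomposition[OF _ _ _ q chi s M1]) (use d in \<open>auto simp: S prime_range_def\<close>)
  also have "(\<Sum>p\<in>S. L_coeff F p * chi (int p) / of_nat p powr s) * (\<Sum>m\<in>{1..M}. ramare_factor S m * chi (int m) / of_nat m powr s) =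
      (\<Sum>i\<in>{i1..<i2}. \<Sum>j\<le>J. prime_block i z s * factor_block S j z s)"
    unfolding p f by (rule sum_product)
  also have "\<dots> = (\<Sum>p\<in>head_pairs i1 i2 J k0. prime_block (fst p) z s * factor_block S (snd p) z s) +
      (\<Sum>p\<in>tail_pairs i1 i2 J k0. prime_block (fst p) z s * factor_block S (snd p) z s)"
    by (rule sum_pairs_split)
  also have "2 * abs_series\<^sup>2 / real M \<le> 2 * abs_series\<^sup>2 / 2 ^ J"
  proof (intro divide_left_mono)
    have "real (2 ^ J) \<le> real M" using M(2) by (simp only: of_nat_le_iff)
    then show "2 ^ J \<le> real M" by simp
  qed (use M1 in auto)
  finally show ?thesis unfolding r r2 head_polynomial_def by (simp add: algebra_simps)
qed

definition sieve_bound :: "real \<Rightarrow> bool" where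
  "sieve_bound K \<longleftrightarrow> (\<forall>P1 P2 X :: real. 2 \<le> P1 \<longrightarrow> P1 \<le> P2 \<longrightarrow> P2 \<le> X \<longrightarrow>
     (\<Sum>n\<in>{n :: nat. 1 \<le> n \<and> real n \<le> X \<and> coprime n (\<Prod>p\<in>{p :: nat. prime p \<and> P1 \<le> real p \<and> real p \<le> P2}. p)}.
        (norm (L_coeff F n))\<^sup>2) \<le> K * (X * (ln P1 / ln P2)))"

text \<open>The first bound is (A3) with P1 = 2^i1 and P2 = 2^i2, where ln P1 / ln P2 = i1 / i2,
  plus the multiples of squares, which save 2^i1. (A3) requires P2 <= X, hence i2 <= k.\<close>

lemma block_coefficients:
  assumes A3: "sieve_bound K3"
    and i: "2 \<le> i1" "i1 \<le> i2" and S: "S = prime_range (2 ^ i1) (2 ^ i2)" and L: "1 + ln (2 ^ Suc k) \<le> L" and d1: "dF \<ge> 1"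
  shows "i2 \<le> k \<Longrightarrow> (\<Sum>n\<in>{2 ^ k..<2 ^ Suc k}. (norm (ramare_rest S n))\<^sup>2) \<le>
      2 ^ k * (2 * K3 * (real i1 / real i2) + 4 * (1 + real dF)\<^sup>2 * real dF ^ 4 * L ^ (dF * dF) / 2 ^ i1)"
    and "(\<Sum>n\<in>{2 ^ k..<2 ^ Suc k}. (norm (ramare_rest S n))\<^sup>2) \<le> 2 ^ k * (2 * (1 + real dF)\<^sup>2 * L ^ (dF * dF))"
    and "(\<Sum>n\<in>{2 ^ k..<2 ^ Suc k}. (norm (ramare_factor S n))\<^sup>2) \<le> 2 ^ k * (2 * (1 + real dF)\<^sup>2 * L ^ (dF * dF))"
proof -
  define X :: nat where "X = 2 ^ Suc k"
  have X: "X \<ge> 1" "real X = 2 * 2 ^ k" by (auto simp: X_def)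
  have lX: "(1 + ln (real X)) ^ (dF * dF) \<le> L ^ (dF * dF)"
  proof (intro power_mono)
    show "0 \<le> 1 + ln (real X)" using X(1) by simp
    show "1 + ln (real X) \<le> L" using L by (simp add: X_def)
  qed
  have block: "(\<Sum>n\<in>{2 ^ k..<2 ^ Suc k}. (norm (g n))\<^sup>2) \<le> (\<Sum>n\<in>{1..X}. (norm (g n))\<^sup>2)" for g :: "nat \<Rightarrow> complex"
  proof (rule sum_mono2)
    show "{2 ^ k..<2 ^ Suc k} \<subseteq> {1..X}"
    proof
      fix n :: nat assume n: "n \<in> {2 ^ k..<2 ^ Suc k}"
      have "(1 :: nat) \<le> 2 ^ k" by simp
      also have "\<dots> \<le> n" using n by simp
      finally show "n \<in> {1..X}" using n by (simp add: X_def)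
    qed
  qed auto
  have Sfin: "finite S" and Sp: "\<And>p. p \<in> S \<Longrightarrow> prime p" by (auto simp: S prime_range_def finite_subset)
  show "(\<Sum>n\<in>{2 ^ k..<2 ^ Suc k}. (norm (ramare_rest S n))\<^sup>2) \<le> 2 ^ k * (2 * (1 + real dF)\<^sup>2 * L ^ (dF * dF))"
  proof -
    have "(\<Sum>n\<in>{1..X}. (norm (ramare_rest S n))\<^sup>2) \<le> (1 + real dF)\<^sup>2 * (real X * (1 + ln (real X)) ^ (dF * dF))"
      by (rule sum_ramare_rest_le(2)[OF Sfin Sp d1 X(1), of 2]) (auto simp: Sp prime_ge_2_nat)
    also have "\<dots> \<le> (1 + real dF)\<^sup>2 * (real X * L ^ (dF * dF))" using lX by (intro mult_left_mono) auto
    finally show ?thesis using block[of "ramare_rest S"] X(2) by (simp add: mult_ac)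
  qed
  show "(\<Sum>n\<in>{2 ^ k..<2 ^ Suc k}. (norm (ramare_factor S n))\<^sup>2) \<le> 2 ^ k * (2 * (1 + real dF)\<^sup>2 * L ^ (dF * dF))"
  proof -
    have "(\<Sum>n\<in>{1..X}. (norm (ramare_factor S n))\<^sup>2) \<le> real X * (1 + ln (real X)) ^ (dF * dF)"
      by (rule sum_ramare_factor_le[OF Sfin Sp d1 X(1)])
    also have "\<dots> \<le> real X * L ^ (dF * dF)" using lX by (intro mult_left_mono) auto
    also have "\<dots> \<le> (1 + real dF)\<^sup>2 * (real X * L ^ (dF * dF))"
    proof -
      have "(0 :: real) \<le> (1 + ln (real X)) ^ (dF * dF)" using X(1) by (intro zero_le_power) auto
      then have "0 \<le> real X * L ^ (dF * dF)" using lX by (intro mult_nonneg_nonneg) auto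
      moreover have "1 \<le> (1 + real dF)\<^sup>2" by (intro one_le_power) auto
      ultimately show ?thesis using mult_right_mono[of 1 "(1 + real dF)\<^sup>2" "real X * L ^ (dF * dF)"] by simp
    qed
    finally show ?thesis using block[of "ramare_factor S"] X(2) by (simp add: mult_ac)
  qed
  show "(\<Sum>n\<in>{2 ^ k..<2 ^ Suc k}. (norm (ramare_rest S n))\<^sup>2) \<le>
      2 ^ k * (2 * K3 * (real i1 / real i2) + 4 * (1 + real dF)\<^sup>2 * real dF ^ 4 * L ^ (dF * dF) / 2 ^ i1)" if k: "i2 \<le> k"
  proof -
    define N where "N = {n :: nat. 1 \<le> n \<and> real n \<le> real X \<and>
        coprime n (\<Prod>p\<in>{p :: nat. prime p \<and> (2 ^ i1 :: real) \<le> real p \<and> real p \<le> 2 ^ i2}. p)}"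
    have a2: "(2 :: nat) \<le> 2 ^ i1" using i by (intro self_le_power[of 2 i1]) auto
    have "(\<Sum>n\<in>{1..X}. (norm (ramare_rest S n))\<^sup>2) \<le>
      (\<Sum>n\<in>{n \<in> {1..X}. \<forall>p\<in>S. \<not> p dvd n}. (norm (L_coeff F n))\<^sup>2) +
      (1 + real dF)\<^sup>2 * real dF ^ 4 * (real X * (1 + ln (real X)) ^ (dF * dF)) * (2 / real (2 ^ i1))"
      by (rule sum_ramare_rest_le(1)[OF Sfin Sp d1 X(1) a2]) (auto simp: S prime_range_def)
    also have "(\<Sum>n\<in>{n \<in> {1..X}. \<forall>p\<in>S. \<not> p dvd n}. (norm (L_coeff F n))\<^sup>2) \<le> (\<Sum>n\<in>N. (norm (L_coeff F n))\<^sup>2)"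
    proof (rule sum_mono2)
      show "finite N" by (rule finite_subset[of _ "{..X}"]) (auto simp: N_def)
      show "{n \<in> {1..X}. \<forall>p\<in>S. \<not> p dvd n} \<subseteq> N"
      proof
        fix n assume n: "n \<in> {n \<in> {1..X}. \<forall>p\<in>S. \<not> p dvd n}"
        have "coprime n p" if "prime p" "(2 ^ i1 :: real) \<le> real p" "real p \<le> 2 ^ i2" for p :: nat
        proof -
          have le: "2 ^ i1 \<le> p" "p \<le> 2 ^ i2"
            using that(2,3) by (simp_all only: of_nat_le_iff[symmetric, where 'a = real] of_nat_power of_nat_numeral)
          \<comment> \<open>\<open>prime_range\<close> omits its upper end while the product in (A3)
            includes it. As a power of 2 with exponent at least 2 is not prime, the two sets of
            primes agree.\<close>
          have "p \<noteq> 2 ^ i2"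
          proof
            assume "p = 2 ^ i2"
            with that(1) have "prime ((2 :: nat) ^ i2)" by simp
            then have "i2 = 1" by (simp only: prime_power_iff)
            with i show False by simp
          qed
          then have "p \<in> S" using le that(1) by (simp add: S prime_range_def)
          then have "\<not> p dvd n" using n by simp
          then show ?thesis using prime_imp_coprime[OF that(1)] by (simp add: coprime_commute)
        qed
        then have "coprime n (\<Prod>p\<in>{p :: nat. prime p \<and> (2 ^ i1 :: real) \<le> real p \<and> real p \<le> 2 ^ i2}. p)"
          by (intro prod_coprime_right) auto
        then show "n \<in> N" using n by (simp add: N_def)
      qed
    qed auto
    also have "(\<Sum>n\<in>N. (norm (L_coeff F n))\<^sup>2) \<le> K3 * (real X * (ln (2 ^ i1) / ln (2 ^ i2)))"
      unfolding N_def
    proof (rule A3[unfolded sieve_bound_def, rule_format])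
      show "(2 :: real) \<le> 2 ^ i1" using i by (intro self_le_power[of 2 i1]) auto
      show "(2 :: real) ^ i1 \<le> 2 ^ i2" using i by (intro power_increasing) auto
      show "(2 :: real) ^ i2 \<le> real X" unfolding X_def of_nat_power using k by (simp del: power_Suc) 
    qed
    also have "ln (2 ^ i1) / ln (2 ^ i2 :: real) = real i1 / real i2" by (simp add: ln_realpow)
    also have "(1 + real dF)\<^sup>2 * real dF ^ 4 * (real X * (1 + ln (real X)) ^ (dF * dF)) * (2 / real (2 ^ i1)) \<le>
        (1 + real dF)\<^sup>2 * real dF ^ 4 * (real X * L ^ (dF * dF)) * (2 / real (2 ^ i1))"
      using lX by (intro mult_right_mono mult_left_mono) auto
    finally have "(\<Sum>n\<in>{2 ^ k..<2 ^ Suc k}. (norm (ramare_rest S n))\<^sup>2) \<le> K3 * (real X * (real i1 / real i2)) +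
        (1 + real dF)\<^sup>2 * real dF ^ 4 * (real X * L ^ (dF * dF)) * (2 / real (2 ^ i1))"
      using block[of "ramare_rest S"] by linarith
    then show ?thesis unfolding X(2) by (simp add: algebra_simps)
  qed
qed

end

section \<open>The mean square over characters without zeros near the line Re s = 1\<close>

lemma eventually_powr_le_exp:
  fixes c :: real
  assumes "k > 0" "e > 0"
  shows "\<forall>\<^sub>F l :: real in at_top. c * l powr \<alpha> \<le> exp (k * l powr e)"
proof -
  define b where "b = \<bar>c\<bar> + 1"
  have b: "b > 0" by (simp add: b_def add_nonneg_pos)
  have m: "\<forall>\<^sub>F m :: real in at_top. b * m powr (\<alpha> / e) \<le> exp (k * m)"
    using b assms by real_asymp
  have fl: "filterlim (\<lambda>l :: real. l powr e) at_top at_top" using assms by real_asymp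
  from eventually_compose_filterlim[OF m fl] show ?thesis
  proof eventually_elim
    case (elim l)
    have "c * l powr \<alpha> \<le> b * l powr \<alpha>" by (intro mult_right_mono) (auto simp: b_def)
    moreover have "(l powr e) powr (\<alpha> / e) = l powr \<alpha>" using assms by (simp add: powr_powr)
    ultimately show ?case using elim by simp
  qed
qed

definition head_length :: "real \<Rightarrow> nat" where
  "head_length Z = nat \<lfloor>log 2 Z\<rfloor>"

lemma head_length_bounds:
  assumes "Z \<ge> 1"
  shows "2 ^ head_length Z \<le> Z" "Z < 2 ^ Suc (head_length Z)" "real (head_length Z) * ln 2 \<le> ln Z"
proof -
  have lg: "log 2 Z \<ge> 0" using assms by simp
  have h: "real (head_length Z) \<le> log 2 Z" "log 2 Z < real (Suc (head_length Z))"
    using lg unfolding head_length_def by linarith+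
  have Z: "2 powr log 2 Z = Z" using assms by simp
  have "2 powr real (head_length Z) \<le> 2 powr log 2 Z" using h by (intro powr_mono) auto
  then show "2 ^ head_length Z \<le> Z" using Z by (simp add: powr_realpow)
  have "2 powr log 2 Z < 2 powr real (Suc (head_length Z))" using h by (intro powr_less_mono) auto
  then show "Z < 2 ^ Suc (head_length Z)" using Z by (simp only: powr_realpow[of 2, simplified])
  have "real (head_length Z) * ln 2 \<le> log 2 Z * ln 2" using h by (intro mult_right_mono) auto
  then show "real (head_length Z) * ln 2 \<le> ln Z" by (simp add: log_def)
qed

context L_framework_divisor_bound
begin

text \<open>Z = Q^(d / 2) is the effective length. Thanks to d >= 5 the sieve terms are smaller than
  the main ones by a fixed power of Z. What remains are the integers coprime to the sieving primes,
  where (A3) saves (ln Q)^(- \<eta>), and the products, where \<open>prime_block_bound\<close> saves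
  any power of ln Q and B is taken large enough to leave the same (ln Q)^(- \<eta>).\<close>

lemma good_characters_mean_square:
  assumes \<eta>: "0 < \<eta>" "\<eta> < \<delta>" and \<delta>: "\<delta> < 1" and C': "C' > 0" and d: "dF \<ge> 5"
    and A3: "sieve_bound K3"
  shows "\<exists>K. \<forall>\<^sub>F Q in at_top. \<forall>G\<subseteq>character_family Q.
     (\<forall>z\<in>G. \<forall>s. Re s > 1 - ln Q powr (\<delta> - 1) / C' \<longrightarrow> \<bar>Im s\<bar> < Q \<longrightarrow> L_twist F (snd z) s \<noteq> 0) \<longrightarrow>
     (\<Sum>z\<in>G. (norm (L_twist F (snd z) (1 / 2)))\<^sup>2) \<le> K * (Q powr (real dF / 2) * ln Q powr (- \<eta>))"
    (is "\<exists>K. \<forall>\<^sub>F Q in at_top. ?P K Q")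
proof -
  define D where "D = real (dF * dF)"
  \<comment> \<open>Chosen so that the losses, l^4 for the square of the number of pairs and l^D in
    E2, reduce the saving l^(- 2 B) to exactly l^(- \<eta>); see \<open>lg\<close>.\<close>
  define B where "B = (D + 4 + \<eta>) / 2"
  have B0: "B \<ge> 0" using \<eta> by (simp add: B_def D_def)
  define d' where "d' = real dF"
  have d': "d' \<ge> 5" using d by (simp add: d'_def)
  have d1: "dF \<ge> 1" using d by simp
  have "(0 :: real) < 1 / 50" "(1 / 50 :: real) < 2" by simp_all
  from mean_square_reduction[OF this]
  obtain C Q0 where C: "C > 0" and Q0: "Q0 \<ge> 2" and red0: "\<forall>Q\<ge>Q0. \<forall>G\<subseteq>character_family Q. \<forall>H X X'.
     (\<forall>z\<in>G. H z holomorphic_on UNIV \<and> (\<exists>B. \<forall>w. 0 \<le> Re w \<longrightarrow> Re w \<le> 2 \<longrightarrow> norm (H z (1 / 2 + w)) \<le> B)) \<longrightarrow>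
     (\<forall>t. (\<Sum>z\<in>G. (norm (H z (Complex (1 / 2 + 1 / 50) t)))\<^sup>2) \<le> X * exp (t\<^sup>2 / 4)) \<longrightarrow>
     (\<forall>t. (\<Sum>z\<in>G. (norm (L_twist F (snd z) (Complex (5 / 2) t) - H z (Complex (5 / 2) t)))\<^sup>2) \<le> X' * exp (t\<^sup>2 / 4)) \<longrightarrow>
     (\<Sum>z\<in>G. (norm (L_twist F (snd z) (1 / 2)))\<^sup>2) \<le> C * (Q powr (real dF * (1 / 50)) * X + Q powr (2 * real dF) * X' + Q\<^sup>2)"
    by (elim exE conjE) (rule that)
  note red = red0[rule_format]
  obtain Kp where Kp: "Kp \<ge> 0" and PB: "\<forall>\<^sub>F Q in at_top. \<forall>z\<in>character_family Q.
     (\<forall>s. Re s > 1 - ln Q powr (\<delta> - 1) / C' \<longrightarrow> \<bar>Im s\<bar> < Q \<longrightarrow> L_twist F (snd z) s \<noteq> 0) \<longrightarrow>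
     (\<forall>\<sigma>\<ge>0. \<forall>t. \<forall>i\<in>{sieve_lower \<eta> Q..<sieve_upper Q}. (norm (prime_block i z (Complex \<sigma> t)))\<^sup>2
        \<le> 2 powr (real i * (2 - 2 * \<sigma>)) * (Kp * ln Q powr (- 2 * B) * exp (t\<^sup>2 / 4)))"
    using prime_block_bound[OF \<eta> \<delta> C' B0] by (elim exE conjE) (rule that)
  have hc: "head_constant \<ge> 0"
  proof -
    have "(2 :: real) powr 0 \<le> 2 powr (1 / 50)" by (intro powr_mono) auto
    then show ?thesis unfolding head_constant_def by (intro divide_nonneg_nonneg) auto
  qed
  \<comment> \<open>800 is twice 400, the quotient of the constants in the bounds 2 l^(1 - \<eta>)
    for i1 and l / 200 for i2; the summand 1 is for the multiples of squares.\<close>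
  define KE1 where "KE1 = 800 * \<bar>K3\<bar> + 1"
  define KE2 where "KE2 = 2 * (1 + d')\<^sup>2 * (d' + 4) ^ (dF * dF)"
  define c2 where "c2 = 4 * (1 + d')\<^sup>2 * d' ^ 4 * (d' + 4) ^ (dF * dF)"
  define Kb where "Kb = (2 * d' + 3)\<^sup>2"
  define KX where "KX = 200 * head_constant * (3 * KE1 + 1) + 400 * Kb * Kp * KE2"
  define KX' where "KX' = 6400 * (KE1 + Kb * Kp * KE2) + 2"
  have KE: "KE1 \<ge> 1" "KE2 > 0" "c2 \<ge> 0" "Kb \<ge> 0" using d' by (auto simp: KE1_def KE2_def c2_def Kb_def)
  have \<eta>1: "\<eta> < 1" using \<eta> \<delta> by simp
  have ev1: "\<forall>\<^sub>F l :: real in at_top. l \<ge> 1" by (rule eventually_ge_at_top)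
  have e1: "1 - \<eta> > 0" using \<eta>1 by simp
  have ev2: "\<forall>\<^sub>F l :: real in at_top. c2 * l powr (D + \<eta>) \<le> exp (1 / 2 * l powr (1 - \<eta>))"
    by (rule eventually_powr_le_exp) (use e1 in auto)
  have ev3: "\<forall>\<^sub>F l :: real in at_top. KE1 * l powr (- \<eta>) \<le> KE2"
    using KE \<eta> by real_asymp
  have ev4: "\<forall>\<^sub>F l :: real in at_top. (d' + 1) * 2 * KE2 * l powr (D + 1 + \<eta>) \<le> exp (3 / 100 * l powr 1)"
    by (rule eventually_powr_le_exp) auto
  have ev5: "\<forall>\<^sub>F l :: real in at_top. (24 * abs_series ^ 4) * l powr \<eta> \<le> exp (1 / 5 * l powr 1)"
    by (rule eventually_powr_le_exp) auto
  have ev6: "\<forall>\<^sub>F l :: real in at_top. 1 * l powr \<eta> \<le> exp (1 / 5 * l powr 1)"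
    by (rule eventually_powr_le_exp) auto
  show ?thesis
  proof (rule exI[of _ "C * (KX + KX' + 1)"])
    from eventually_ge_at_top[of Q0] eventually_sieve_range[OF \<eta>(1) \<eta>1] PB
      eventually_compose_ln[OF ev1] eventually_compose_ln[OF ev2] eventually_compose_ln[OF ev3]
      eventually_compose_ln[OF ev4] eventually_compose_ln[OF ev5] eventually_compose_ln[OF ev6]
    show "\<forall>\<^sub>F Q in at_top. ?P (C * (KX + KX' + 1)) Q"
    proof eventually_elim
      case (elim Q)
      note range = elim(2) and pb = elim(3)
      define l where "l = ln Q"
      have l1: "l \<ge> 1" using elim by (simp add: l_def)
      have Q2: "Q \<ge> 2" using elim Q0 by simp
      define Z where "Z = Q powr (d' / 2)"
      have Z1: "Z \<ge> 1" unfolding Z_def using Q2 d' by (intro ge_one_powr_ge_zero) auto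
      have Z0: "Z > 0" using Z1 by simp
      \<comment> \<open>The place where d >= 5 counts: Q is at most Z^(2 / 5), so the sieve term
        Q^(9 / 4) is at most Z^(9 / 10).\<close>
      have QZ: "Q powr x \<le> Z powr (2 * x / 5)" if "x \<ge> 0" for x
      proof -
        have "5 * x \<le> d' * x" using d' that by (intro mult_right_mono) auto
        then have "x \<le> d' / 2 * (2 * x / 5)" by simp
        then have "Q powr x \<le> Q powr (d' / 2 * (2 * x / 5))" using Q2 by (intro powr_mono) auto
        then show ?thesis by (simp add: Z_def powr_powr)
      qed
      have expZ: "exp (x * l) \<le> Z powr x" if "x \<ge> 0" for x
      proof -
        have "exp (x * l) = Q powr x" using Q2 by (simp add: l_def powr_def)
        also have "\<dots> \<le> Q powr (d' / 2 * x)"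
        proof (intro powr_mono)
          have "1 * x \<le> d' / 2 * x" using d' that by (intro mult_right_mono) auto
          then show "x \<le> d' / 2 * x" by simp
        qed (use Q2 in auto)
        finally show ?thesis by (simp add: Z_def powr_powr)
      qed
      define g where "g = l powr (- \<eta>)"
      have g0: "g > 0" using l1 by (simp add: g_def)
      have cond2: "c2 * l powr (D + \<eta>) \<le> exp (l powr (1 - \<eta>) / 2)"
        and cond3: "KE1 * g \<le> KE2"
        and cond4: "(d' + 1) * 2 * KE2 * l powr (D + 1 + \<eta>) \<le> exp (3 / 100 * l)"
        and cond5: "24 * abs_series ^ 4 * l powr \<eta> \<le> exp (1 / 5 * l)"
        and cond6: "l powr \<eta> \<le> exp (1 / 5 * l)"
        using elim l1 by (auto simp: l_def g_def)
      define i1 where "i1 = sieve_lower \<eta> Q"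
      define i2 where "i2 = sieve_upper Q"
      have i: "2 \<le> i1" "i1 \<le> i2" "real i1 \<le> 2 * l powr (1 - \<eta>)" "l / 200 \<le> real i2" "real i2 \<le> l / 100"
        "exp (l powr (1 - \<eta>) / 2) \<le> 2 ^ (i1 - 1)" "2 ^ i2 \<le> Q powr (1 / 100)"
        using range by (auto simp: i1_def i2_def l_def)
      define k0 where "k0 = head_length Z"
      \<comment> \<open>With this choice 2^J is at least Z^2. The remainder beyond 2^J is then
        O(Z^(- 2)) for each character, and its square, times at most 6 Q^2 characters, is smaller
        than Z^(- 3) by a power of Z.\<close>
      define J where "J = 2 * k0 + 2"
      have k0J: "k0 \<le> J" by (simp add: J_def)
      have k0: "2 ^ k0 \<le> Z" "Z < 2 ^ Suc k0" "real k0 * ln 2 \<le> ln Z"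
        unfolding k0_def by (rule head_length_bounds[OF Z1])+
      have lZ: "ln Z = d' / 2 * l" using Q2 by (simp add: Z_def l_def ln_powr)
      have k0l: "real k0 \<le> d' * l"
      proof -
        have "real k0 * (1 / 2) \<le> real k0 * ln 2" using ln2_ge_two_thirds by (intro mult_left_mono) auto
        then show ?thesis using k0(3) lZ by linarith
      qed
      define S where "S = prime_range (2 ^ i1) (2 ^ i2)"
      define L where "L = (d' + 4) * l"
      have Lk: "1 + ln (2 ^ Suc k) \<le> L" if "k \<le> J" for k
      proof -
        have "ln ((2 :: real) ^ Suc k) = real (Suc k) * ln 2" by (rule ln_realpow)
        also have "\<dots> \<le> (2 * real k0 + 3) * ln 2" using that by (intro mult_right_mono) (auto simp: J_def)
        also have "\<dots> = 2 * (real k0 * ln 2) + 3 * ln 2" by (simp add: algebra_simps)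
        also have "\<dots> \<le> d' * l + 3 * 1" using k0(3) lZ ln_2_less_1 by linarith
        finally have "1 + ln ((2 :: real) ^ Suc k) \<le> d' * l + 4 * 1" by simp
        also have "\<dots> \<le> d' * l + 4 * l" using l1 by simp
        finally show ?thesis by (simp add: L_def distrib_right)
      qed
      have LD: "L ^ (dF * dF) = (d' + 4) ^ (dF * dF) * l powr D"
        unfolding L_def D_def using l1 by (simp add: power_mult_distrib powr_realpow del: of_nat_mult)
      define E1 where "E1 = KE1 * g"
      define E2 where "E2 = KE2 * l powr D"
      have lD1: "l powr D \<ge> 1" using l1 by (intro ge_one_powr_ge_zero) (auto simp: D_def)
      have E2ge: "KE2 \<le> E2" unfolding E2_def using lD1 KE mult_left_mono[of 1 "l powr D" KE2] by simp
      have E: "E1 \<ge> 0" "E1 \<le> E2" "E2 \<ge> 0" using KE g0 cond3 E2ge by (auto simp: E1_def)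
      have R2: "(\<Sum>n\<in>{2 ^ k..<2 ^ Suc k}. (norm (ramare_rest S n))\<^sup>2) \<le> 2 ^ k * E2" if "k \<le> J" for k
        using block_coefficients(2)[OF A3 i(1,2) S_def Lk[OF that] d1] unfolding LD d'_def[symmetric]
        by (simp add: E2_def KE2_def mult.assoc)
      have F2: "(\<Sum>n\<in>{2 ^ k..<2 ^ Suc k}. (norm (ramare_factor S n))\<^sup>2) \<le> 2 ^ k * E2" if "k \<le> J" for k
        using block_coefficients(3)[OF A3 i(1,2) S_def Lk[OF that] d1] unfolding LD d'_def[symmetric]
        by (simp add: E2_def KE2_def mult.assoc)
      have R1: "(\<Sum>n\<in>{2 ^ k..<2 ^ Suc k}. (norm (ramare_rest S n))\<^sup>2) \<le> 2 ^ k * E1" if k: "k \<le> J" "i2 \<le> k" for k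
      proof -
        have le: "(\<Sum>n\<in>{2 ^ k..<2 ^ Suc k}. (norm (ramare_rest S n))\<^sup>2) \<le>
          2 ^ k * (2 * K3 * (real i1 / real i2) + 4 * (1 + d')\<^sup>2 * d' ^ 4 * L ^ (dF * dF) / 2 ^ i1)"
          using block_coefficients(1)[OF A3 i(1,2) S_def Lk[OF k(1)] d1 k(2)] unfolding d'_def .
        have "real i1 / real i2 \<le> (2 * l powr (1 - \<eta>)) / (l / 200)"
          using i l1 by (intro frac_le) auto
        also have "\<dots> = 400 * (l powr (1 - \<eta>) / l powr 1)" using l1 by simp
        also have "l powr (1 - \<eta>) / l powr 1 = g" by (simp only: powr_diff[symmetric] g_def) simp
        finally have "\<bar>K3\<bar> * (real i1 / real i2) \<le> \<bar>K3\<bar> * (400 * g)" by (intro mult_left_mono) auto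
        moreover have "K3 * (real i1 / real i2) \<le> \<bar>K3\<bar> * (real i1 / real i2)" by (intro mult_right_mono) auto
        ultimately have a: "2 * K3 * (real i1 / real i2) \<le> 800 * \<bar>K3\<bar> * g" by simp
        have "(2 :: real) ^ (i1 - 1) \<le> 2 ^ i1" by (intro power_increasing) auto
        then have "exp (l powr (1 - \<eta>) / 2) \<le> 2 ^ i1" using i(6) by linarith
        then have "c2 * l powr (D + \<eta>) \<le> 2 ^ i1" using cond2 by linarith
        then have "c2 * l powr (D + \<eta>) / 2 ^ i1 \<le> 1" by (simp add: divide_le_eq)
        then have "c2 * l powr (D + \<eta>) / 2 ^ i1 * g \<le> 1 * g" using g0 by (intro mult_right_mono) auto
        moreover have "l powr (D + \<eta>) * g = l powr D" by (simp add: g_def powr_add[symmetric])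
        ultimately have "c2 * l powr D / 2 ^ i1 \<le> g" by (simp add: field_simps)
        then have b: "4 * (1 + d')\<^sup>2 * d' ^ 4 * L ^ (dF * dF) / 2 ^ i1 \<le> g"
          unfolding LD c2_def by (simp add: mult_ac)
        have "2 * K3 * (real i1 / real i2) + 4 * (1 + d')\<^sup>2 * d' ^ 4 * L ^ (dF * dF) / 2 ^ i1 \<le> E1"
          using a b by (simp add: E1_def KE1_def distrib_right)
        then have "2 ^ k * (2 * K3 * (real i1 / real i2) + 4 * (1 + d')\<^sup>2 * d' ^ 4 * L ^ (dF * dF) / 2 ^ i1) \<le> 2 ^ k * E1"
          by (intro mult_left_mono) auto
        with le show ?thesis by linarith
      qed
      define y where "y = Q powr (9 / 4)"
      \<comment> \<open>The mean square at Re s = 1 / 2 + 1 / 50 of a sum of length Z has size Z^(1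
        - 2 / 50). The factor Q^(d / 50) = Z^(1 / 25) of \<open>mean_square_reduction\<close>
        restores Z.\<close>
      define W where "W = Z powr (24 / 25)"
      have W0: "W > 0" using Z0 by (simp add: W_def)
      have y0: "y \<ge> 0" by (simp add: y_def)
      have y_le: "y \<le> Z powr (9 / 10)" using QZ[of "9 / 4"] by (simp add: y_def)
      have i2_le: "2 ^ i2 \<le> Z powr (1 / 250)" using i(7) QZ[of "1 / 100"] by simp
      have yi2: "y * 2 ^ i2 \<le> Z powr (91 / 100)"
      proof -
        have "y * 2 ^ i2 \<le> Z powr (9 / 10) * Z powr (1 / 250)" using y_le i2_le by (intro mult_mono) auto
        also have "\<dots> = Z powr (9 / 10 + 1 / 250)" by (simp only: powr_add)
        also have "\<dots> \<le> Z powr (91 / 100)" using Z1 by (intro powr_mono) auto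
        finally show ?thesis .
      qed
      have yi2': "y + 2 ^ i2 \<le> 2 * Z powr (91 / 100)"
      proof -
        have "Z powr (9 / 10) \<le> Z powr (91 / 100)" "Z powr (1 / 250) \<le> Z powr (91 / 100)" using Z1 by (intro powr_mono; simp)+
        then show ?thesis using y_le i2_le by linarith
      qed
      have Z91: "Z powr (91 / 100) \<le> Z"
        using Z1 powr_mono[of "91 / 100" 1 Z] by simp
      have ty: "y * 2 ^ i2 \<le> 2 ^ Suc k0" using yi2 Z91 k0(2) by linarith
      have ty': "y \<le> 2 ^ Suc k0"
      proof -
        have "y * 1 \<le> y * 2 ^ i2" using y0 by (intro mult_left_mono) auto
        then show ?thesis using ty by linarith
      qed
      have ti: "i2 \<le> Suc k0"
      proof -
        have "Z powr (1 / 250) \<le> Z" using Z1 powr_mono[of "1 / 250" 1 Z] by simp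
        then have "(2 :: real) ^ i2 < 2 ^ Suc k0" using i2_le k0(2) by linarith
        then have "i2 < Suc k0" by (rule power_less_imp_less_exp[rotated]) simp
        then show ?thesis by simp
      qed
      define n2 where "n2 = (real (i2 * (J + 1)))\<^sup>2"
      have n2: "n2 \<le> Kb * l powr 4"
      proof -
        have "real (J + 1) \<le> 2 * (d' * l) + 3 * l" using k0l l1 by (simp add: J_def)
        then have "real i2 * real (J + 1) \<le> l * ((2 * d' + 3) * l)"
          using i(5) l1 d' by (intro mult_mono) (auto simp: distrib_right)
        then have "n2 \<le> (l * ((2 * d' + 3) * l))\<^sup>2" unfolding n2_def of_nat_mult by (intro power_mono) auto
        also have "\<dots> = Kb * l ^ 4" by (simp add: Kb_def power_mult_distrib power4_eq_xxxx power2_eq_square)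
        also have "l ^ 4 = l powr 4" using l1 by simp
        finally show ?thesis .
      qed
      have lg: "l powr 4 * l powr (- 2 * B) * l powr D = g"
        unfolding g_def B_def by (simp add: powr_add[symmetric] field_simps)
      define ta where "ta = (\<lambda>t. Kp * l powr (- 2 * B) * exp (t\<^sup>2 / 4))"
      have ta0: "ta t \<ge> 0" for t using Kp by (simp add: ta_def)
      have n2a: "n2 * (ta t * E2) \<le> Kb * Kp * KE2 * g * exp (t\<^sup>2 / 4)" for t
      proof -
        have "n2 * (ta t * E2) \<le> Kb * l powr 4 * (ta t * E2)" using n2 ta0 E by (intro mult_right_mono mult_nonneg_nonneg) auto
        also have "\<dots> = Kb * Kp * KE2 * (l powr 4 * l powr (- 2 * B) * l powr D) * exp (t\<^sup>2 / 4)"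
          unfolding ta_def E2_def by (simp only: mult_ac)
        finally show ?thesis unfolding lg .
      qed
      show ?case
      proof (intro allI impI)
        fix G assume G: "G \<subseteq> character_family Q"
          and zf: "\<forall>z\<in>G. \<forall>s. Re s > 1 - ln Q powr (\<delta> - 1) / C' \<longrightarrow> \<bar>Im s\<bar> < Q \<longrightarrow> L_twist F (snd z) s \<noteq> 0"
        have P: "(norm (prime_block i z (Complex \<sigma> t)))\<^sup>2 \<le> 2 powr (real i * (2 - 2 * \<sigma>)) * ta t"
          if "z \<in> G" "i \<in> {i1..<i2}" "\<sigma> \<ge> 0" for z i \<sigma> t
          using pb zf G that unfolding i1_def i2_def ta_def l_def by blast
        have finG: "finite G" "real (card G) \<le> 6 * Q\<^sup>2"
        proof -
          show "finite G" using character_family_finite_card(1)[OF Q2] G by (rule finite_subset[rotated])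
          have "card G \<le> card (character_family Q)" using character_family_finite_card(1)[OF Q2] G by (rule card_mono)
          then show "real (card G) \<le> 6 * Q\<^sup>2" using character_family_finite_card(2)[OF Q2] by linarith
        qed
        define H where "H = head_polynomial S i1 i2 J k0"
        have exp1: "exp ((t :: real)\<^sup>2 / 4) \<ge> 1" for t by simp
        have head: "(\<Sum>z\<in>G. (norm (H z (Complex (1 / 2 + 1 / 50) t)))\<^sup>2) \<le> KX * W * g * exp (t\<^sup>2 / 4)" for t
        proof -
          define s where "s = Complex (26 / 50) t"
          define p48 where "p48 = 2 powr (real k0 * (48 / 50))"
          have p48: "p48 \<le> W" "p48 \<ge> 0"
          proof -
            have "p48 = (2 ^ k0) powr (24 / 25)" unfolding p48_def two_power_powr by simp
            also have "\<dots> \<le> W" unfolding W_def using k0 by (intro powr_mono2) auto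
            finally show "p48 \<le> W" .
          qed (simp add: p48_def)
          have p50: "2 powr (real k0 / 50) \<le> Z powr (1 / 50)"
          proof -
            have "2 powr (real k0 / 50) = (2 ^ k0) powr (1 / 50)" unfolding two_power_powr by simp
            also have "\<dots> \<le> Z powr (1 / 50)" using k0 by (intro powr_mono2) auto
            finally show ?thesis .
          qed
          \<comment> \<open>The crude terms have size Z^(91 / 100 + 1 / 50) = Z^(93 / 100) up to
            powers of l. The gap of 3 / 100 to W absorbs these powers and leaves room for the factor
            g.\<close>
          have rem: "(real k0 + 1) * (y + 2 ^ i2) * E2 * 2 powr (real k0 / 50) \<le> W * g"
          proof -
            have "(real k0 + 1) \<le> (d' + 1) * l" using k0l l1 by (simp add: distrib_right)
            then have "(real k0 + 1) * (y + 2 ^ i2) * E2 * 2 powr (real k0 / 50) \<le>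
                ((d' + 1) * l) * (2 * Z powr (91 / 100)) * E2 * Z powr (1 / 50)"
              using yi2' p50 E y0 d' l1 by (intro mult_mono) auto
            also have "\<dots> = ((d' + 1) * 2 * KE2 * (l powr D * l powr 1)) * (Z powr (91 / 100) * Z powr (1 / 50))"
              unfolding E2_def using l1 by (simp add: mult_ac)
            also have "\<dots> = ((d' + 1) * 2 * KE2 * l powr (D + 1 + \<eta>)) * g * Z powr (93 / 100)"
            proof -
              have a: "l powr D * l powr 1 = l powr (D + 1 + \<eta>) * g"
                unfolding g_def by (simp only: powr_add[symmetric]) simp
              have b: "Z powr (91 / 100) * Z powr (1 / 50) = Z powr (93 / 100)"
                by (simp only: powr_add[symmetric]) simp
              show ?thesis unfolding a b by (simp only: mult_ac)
            qed
            also have "\<dots> \<le> exp (3 / 100 * l) * g * Z powr (93 / 100)" using cond4 g0 by (intro mult_right_mono) auto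
            also have "\<dots> \<le> Z powr (3 / 100) * g * Z powr (93 / 100)" using expZ[of "3 / 100"] g0 by (intro mult_right_mono) auto
            also have "\<dots> = W * g" unfolding W_def by (simp add: powr_add[symmetric] mult_ac)
            finally show ?thesis .
          qed
          have A: "(\<Sum>z\<in>G. (norm (\<Sum>k\<le>k0. rest_block S k z s))\<^sup>2) \<le> 100 * head_constant * ((3 * KE1 + 1) * (W * g))"
          proof -
            have "(\<Sum>z\<in>G. (norm (\<Sum>k\<le>k0. rest_block S k z s))\<^sup>2) \<le>
              100 * head_constant * (3 * p48 * E1 + (real k0 + 1) * (y + 2 ^ i2) * E2 * 2 powr (real k0 / 50))"
              unfolding s_def y_def p48_def
              by (rule rest_head_mean_square[OF Q2 G R2 R1 F2 E(1,2) ta0[of 0] k0J])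
            also have "\<dots> \<le> 100 * head_constant * (3 * W * E1 + W * g)"
              using hc p48 E rem by (intro mult_left_mono add_mono mult_right_mono) auto
            also have "\<dots> = 100 * head_constant * ((3 * KE1 + 1) * (W * g))" by (simp add: E1_def algebra_simps)
            finally show ?thesis .
          qed
          have Bd: "(\<Sum>z\<in>G. (norm (\<Sum>p\<in>head_pairs i1 i2 J k0. prime_block (fst p) z s * factor_block S (snd p) z s))\<^sup>2) \<le>
              200 * (Kb * Kp * KE2 * g * exp (t\<^sup>2 / 4)) * W"
          proof -
            have "(\<Sum>z\<in>G. (norm (\<Sum>p\<in>head_pairs i1 i2 J k0. prime_block (fst p) z s * factor_block S (snd p) z s))\<^sup>2) \<le>
              n2 * (100 * ta t * E2 * (y * 2 ^ i2 + p48))"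
              unfolding s_def y_def p48_def n2_def
              by (rule product_head_mean_square[OF Q2 G R2 R1 F2 E(1,2) ta0 k0J]) (assumption | rule P | simp)+
            also have "\<dots> = 100 * (n2 * (ta t * E2)) * (y * 2 ^ i2 + p48)" by (simp only: mult_ac)
            also have "\<dots> \<le> 100 * (Kb * Kp * KE2 * g * exp (t\<^sup>2 / 4)) * (2 * W)"
            proof (rule mult_mono)
              show "100 * (n2 * (ta t * E2)) \<le> 100 * (Kb * Kp * KE2 * g * exp (t\<^sup>2 / 4))"
                by (rule mult_left_mono[OF n2a]) simp
              have "Z powr (91 / 100) \<le> W" unfolding W_def using Z1 by (intro powr_mono) auto
              then show "y * 2 ^ i2 + p48 \<le> 2 * W" using yi2 p48 by linarith
              show "0 \<le> y * 2 ^ i2 + p48" using y0 p48 by simp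
              show "0 \<le> 100 * (Kb * Kp * KE2 * g * exp (t\<^sup>2 / 4))" using KE Kp g0 by simp
            qed
            finally show ?thesis by simp
          qed
          have "(\<Sum>z\<in>G. (norm (H z s))\<^sup>2) \<le> 2 * (100 * head_constant * ((3 * KE1 + 1) * (W * g))) + 2 * (200 * (Kb * Kp * KE2 * g * exp (t\<^sup>2 / 4)) * W)"
            unfolding H_def head_polynomial_def by (rule mean_square_add_le[OF A Bd])
          also have "\<dots> \<le> 2 * (100 * head_constant * ((3 * KE1 + 1) * (W * g))) * exp (t\<^sup>2 / 4) + 2 * (200 * (Kb * Kp * KE2 * g * exp (t\<^sup>2 / 4)) * W)"
          proof -
            have "0 \<le> 2 * (100 * head_constant * ((3 * KE1 + 1) * (W * g)))" using hc KE W0 g0 by simp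
            from mult_left_mono[OF exp1[of t] this] show ?thesis by linarith
          qed
          also have "\<dots> = KX * W * g * exp (t\<^sup>2 / 4)" by (simp add: KX_def algebra_simps)
          finally show ?thesis by (simp add: s_def)
        qed
        have tail: "(\<Sum>z\<in>G. (norm (L_twist F (snd z) (Complex (5 / 2) t) - H z (Complex (5 / 2) t)))\<^sup>2) \<le> KX' * Z powr (- 3) * g * exp (t\<^sup>2 / 4)" for t
        proof -
          define s where "s = Complex (5 / 2) t"
          have Z3: "(1 / 2) ^ (3 * k0) \<le> 8 * Z powr (- 3)"
          proof -
            have "Z ^ 3 \<le> (2 ^ Suc k0) ^ 3" using k0 Z0 by (intro power_mono) auto
            also have "\<dots> = 8 * 2 ^ (3 * k0)" by (simp add: power_mult_distrib power_mult[symmetric] mult.commute)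
            finally have le: "Z ^ 3 \<le> 8 * 2 ^ (3 * k0)" .
            have "Z powr (- 3) = 1 / Z ^ 3" using Z0 by (simp add: powr_minus divide_inverse)
            moreover have "(1 / 2 :: real) ^ (3 * k0) = 1 / 2 ^ (3 * k0)" by (rule power_one_over)
            moreover have "1 / 2 ^ (3 * k0) \<le> 8 * (1 / Z ^ 3)" using le Z0 by (simp add: field_simps)
            ultimately show ?thesis by (simp only:)
          qed
          have A: "(\<Sum>z\<in>G. (norm (\<Sum>k\<in>{k0<..J}. rest_block S k z s))\<^sup>2) \<le> 1600 * KE1 * g * Z powr (- 3)"
          proof -
            have "(\<Sum>z\<in>G. (norm (\<Sum>k\<in>{k0<..J}. rest_block S k z s))\<^sup>2) \<le> 200 * E1 * (1 / 2) ^ (3 * k0)"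
              unfolding s_def using ty' ti unfolding y_def
              by (intro rest_tail_mean_square[OF Q2 G R2 R1 F2 E(1,2) ta0[of 0] k0J]) auto
            also have "\<dots> \<le> 200 * E1 * (8 * Z powr (- 3))" using Z3 E by (intro mult_left_mono) auto
            finally show ?thesis by (simp add: E1_def)
          qed
          have Bd: "(\<Sum>z\<in>G. (norm (\<Sum>p\<in>tail_pairs i1 i2 J k0. prime_block (fst p) z s * factor_block S (snd p) z s))\<^sup>2) \<le>
              1600 * (Kb * Kp * KE2 * g * exp (t\<^sup>2 / 4)) * Z powr (- 3)"
          proof -
            have "(\<Sum>z\<in>G. (norm (\<Sum>p\<in>tail_pairs i1 i2 J k0. prime_block (fst p) z s * factor_block S (snd p) z s))\<^sup>2) \<le>
              n2 * (200 * ta t * E2 * (1 / 2) ^ (3 * k0))"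
              unfolding s_def n2_def
              by (rule product_tail_mean_square[OF Q2 G R2 R1 F2 E(1,2) ta0 k0J _ ty[unfolded y_def]]) (assumption | rule P | simp)+
            also have "\<dots> = 200 * (n2 * (ta t * E2)) * (1 / 2) ^ (3 * k0)" by (simp only: mult_ac)
            also have "\<dots> \<le> 200 * (Kb * Kp * KE2 * g * exp (t\<^sup>2 / 4)) * (8 * Z powr (- 3))"
              using KE Kp g0 Z3 by (intro mult_mono mult_left_mono n2a) auto
            finally show ?thesis by simp
          qed
          define T where "T = (\<lambda>z. (\<Sum>k\<in>{k0<..J}. rest_block S k z s) + (\<Sum>p\<in>tail_pairs i1 i2 J k0. prime_block (fst p) z s * factor_block S (snd p) z s))"
          define R where "R = (\<lambda>z. L_twist F (snd z) s - H z s - T z)"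
          have T: "(\<Sum>z\<in>G. (norm (T z))\<^sup>2) \<le> 2 * (1600 * KE1 * g * Z powr (- 3)) + 2 * (1600 * (Kb * Kp * KE2 * g * exp (t\<^sup>2 / 4)) * Z powr (- 3))"
            unfolding T_def by (rule mean_square_add_le[OF A Bd])
          have J2: "Z\<^sup>2 \<le> 2 ^ J"
          proof -
            have "Z\<^sup>2 \<le> (2 ^ Suc k0)\<^sup>2" using k0 Z0 by (intro power_mono) auto
            also have "\<dots> = 2 ^ J" by (simp add: J_def power_mult[symmetric] power_add[symmetric] mult.commute power_mult_distrib)
            finally show ?thesis .
          qed
          have R: "(\<Sum>z\<in>G. (norm (R z))\<^sup>2) \<le> Z powr (- 3) * g"
          proof -
            have "(\<Sum>z\<in>G. (norm (R z))\<^sup>2) \<le> (\<Sum>z\<in>G. (2 * abs_series\<^sup>2 / Z\<^sup>2)\<^sup>2)"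
            proof (intro sum_mono power_mono norm_ge_zero)
              fix z assume "z \<in> G"
              then obtain q chi where z: "z = (q, chi)" "Q \<le> real q" "chi \<in> primitive_characters q"
                using G by (auto simp: character_family_def)
              have q2: "q \<ge> 2" using z(2) Q2 by linarith
              have "norm (R z) \<le> 2 * abs_series\<^sup>2 / 2 ^ J"
                unfolding R_def T_def H_def z(1) snd_conv
                by (rule tail_decomposition[OF q2 z(3) _ i(2) k0J S_def d1]) (simp add: s_def)
              also have "\<dots> \<le> 2 * abs_series\<^sup>2 / Z\<^sup>2" using J2 Z0 by (intro divide_left_mono) auto
              finally show "norm (R z) \<le> 2 * abs_series\<^sup>2 / Z\<^sup>2" .
            qed
            also have "\<dots> = real (card G) * (4 * abs_series ^ 4 / Z ^ 4)" by (simp add: power_divide power_mult_distrib power_mult[symmetric])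
            also have "\<dots> \<le> (6 * Q\<^sup>2) * (4 * abs_series ^ 4 / Z ^ 4)"
              using finG Z0 by (intro mult_right_mono) auto
            also have "\<dots> \<le> (6 * Z powr (4 / 5)) * (4 * abs_series ^ 4 / Z ^ 4)"
            proof -
              have "Q\<^sup>2 \<le> Z powr (4 / 5)" using QZ[of 2] Q2 by simp
              then show ?thesis using Z0 by (intro mult_right_mono mult_left_mono) auto
            qed
            also have "\<dots> = 24 * abs_series ^ 4 * (Z powr (4 / 5) / Z powr 4)" using Z0 by simp
            \<comment> \<open>The number of characters and the remainder together give Z^(- 3) times
              Z^(- 1 / 5), and the spare Z^(- 1 / 5) pays for l^\<eta> and the constant.\<close>
            also have "Z powr (4 / 5) / Z powr 4 = Z powr (- 3) * Z powr (- (1 / 5))" by (simp only: powr_diff[symmetric] powr_add[symmetric]) simp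
            also have "24 * abs_series ^ 4 * (Z powr (- 3) * Z powr (- (1 / 5))) = Z powr (- 3) * g * ((24 * abs_series ^ 4 * l powr \<eta>) * Z powr (- (1 / 5)))"
              using l1 by (simp add: g_def powr_minus)
            also have "\<dots> \<le> Z powr (- 3) * g * (Z powr (1 / 5) * Z powr (- (1 / 5)))"
              using cond5 expZ[of "1 / 5"] g0 by (intro mult_left_mono mult_right_mono) auto
            also have "\<dots> = Z powr (- 3) * g" using Z0 by (simp add: powr_minus)
            finally show ?thesis .
          qed
          have "(\<Sum>z\<in>G. (norm (L_twist F (snd z) s - H z s))\<^sup>2) = (\<Sum>z\<in>G. (norm (T z + R z))\<^sup>2)" by (simp add: R_def)
          also have "\<dots> \<le> 2 * (2 * (1600 * KE1 * g * Z powr (- 3)) + 2 * (1600 * (Kb * Kp * KE2 * g * exp (t\<^sup>2 / 4)) * Z powr (- 3))) + 2 * (Z powr (- 3) * g)"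
            by (rule mean_square_add_le[OF T R])
          also have "\<dots> = (6400 * KE1 + 2) * (Z powr (- 3) * g) * 1 + 6400 * (Kb * Kp * KE2) * (Z powr (- 3) * g) * exp (t\<^sup>2 / 4)"
            by (simp add: algebra_simps)
          also have "\<dots> \<le> (6400 * KE1 + 2) * (Z powr (- 3) * g) * exp (t\<^sup>2 / 4) + 6400 * (Kb * Kp * KE2) * (Z powr (- 3) * g) * exp (t\<^sup>2 / 4)"
            using exp1[of t] KE g0 by (intro add_right_mono mult_left_mono) auto
          also have "\<dots> = KX' * Z powr (- 3) * g * exp (t\<^sup>2 / 4)" by (simp add: KX'_def algebra_simps)
          finally show ?thesis by (simp add: s_def)
        qed
        have "(\<Sum>z\<in>G. (norm (L_twist F (snd z) (1 / 2)))\<^sup>2) \<le>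
          C * (Q powr (real dF * (1 / 50)) * (KX * W * g) + Q powr (2 * real dF) * (KX' * Z powr (- 3) * g) + Q\<^sup>2)"
        proof (rule red[OF _ G _ head tail])
          show "Q \<ge> Q0" using elim by simp
          show "H z holomorphic_on UNIV \<and> (\<exists>B. \<forall>w. 0 \<le> Re w \<longrightarrow> Re w \<le> 2 \<longrightarrow> norm (H z (1 / 2 + w)) \<le> B)" for z
            unfolding H_def using head_polynomial_holomorphic head_polynomial_bounded by blast
        qed
        \<comment> \<open>All three terms are brought to the size Z * g: Z^(1 / 25) W = Z, Q^(2 d)
          Z^(- 3) = Z^4 Z^(- 3) = Z, and Q^2 <= Z^(4 / 5) leaves Z^(1 / 5) to cover
          l^\<eta>.\<close>
        also have "\<dots> \<le> C * (KX * (Z * g) + KX' * (Z * g) + Z * g)"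
        proof (intro mult_left_mono add_mono)
          have "Q powr (real dF * (1 / 50)) = Z powr (1 / 25)" by (simp add: Z_def powr_powr d'_def)
          moreover have "Z powr (1 / 25) * W = Z" unfolding W_def using Z0 by (simp add: powr_add[symmetric])
          ultimately have "Q powr (real dF * (1 / 50)) * (KX * W * g) = KX * (Z * g)" by (metis mult.assoc mult.left_commute)
          then show "Q powr (real dF * (1 / 50)) * (KX * W * g) \<le> KX * (Z * g)" by (rule eq_refl)
          have "Q powr (2 * real dF) = Z powr 4" unfolding Z_def by (simp only: powr_powr) (simp add: d'_def)
          moreover have "Z powr 4 * Z powr (- 3) = Z" using Z0 by (simp only: powr_add[symmetric]) simp
          ultimately have "Q powr (2 * real dF) * (KX' * Z powr (- 3) * g) = KX' * (Z * g)" by (metis mult.assoc mult.left_commute)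
          then show "Q powr (2 * real dF) * (KX' * Z powr (- 3) * g) \<le> KX' * (Z * g)" by (rule eq_refl)
          have "Q\<^sup>2 \<le> Z powr (4 / 5)" using QZ[of 2] Q2 by simp
          also have "\<dots> = Z powr (4 / 5) * (l powr \<eta> * g)" using l1 by (simp add: g_def powr_minus)
          also have "\<dots> \<le> Z powr (4 / 5) * (Z powr (1 / 5) * g)"
            using cond6 expZ[of "1 / 5"] g0 by (intro mult_left_mono mult_right_mono) auto
          also have "\<dots> = (Z powr (4 / 5) * Z powr (1 / 5)) * g" by simp
          also have "Z powr (4 / 5) * Z powr (1 / 5) = Z" using Z0 by (simp only: powr_add[symmetric]) simp
          finally show "Q\<^sup>2 \<le> Z * g" .
        qed (use C in auto)
        also have "\<dots> = C * (KX + KX' + 1) * (Z * g)" by (simp add: algebra_simps)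
        finally show "(\<Sum>z\<in>G. (norm (L_twist F (snd z) (1 / 2)))\<^sup>2) \<le> C * (KX + KX' + 1) * (Q powr (real dF / 2) * ln Q powr (- \<eta>))"
          by (simp add: Z_def g_def l_def d'_def)
      qed
    qed
  qed
qed

end

section \<open>Adding the characters with zeros near the line Re s = 1\<close>

context L_framework_divisor_bound
begin

text \<open>With l = ln Q, (A5') at \<sigma> = 1 - \<beta> and T = Q allows at most |Kz| exp
  (l^\<delta>) l^A bad characters, because C' \<beta> l = l^\<delta>. By (A6) each contributes at
  most Q^(d / 2) exp (- 2 l^\<delta>) up to a constant, so one exponential remains and beats every
  power of l. (A5') and (A6) are hypotheses on the given Q inside the eventual statement, which
  makes K independent of Q.\<close>

lemma all_characters_mean_square:
  fixes A K3 Kz Kh :: real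
  assumes \<eta>: "0 < \<eta>" "\<eta> < \<delta>" and \<delta>: "\<delta> < 1" and C': "C' > 0" and d: "dF \<ge> 5"
    and A3: "sieve_bound K3"
  shows "\<exists>K. \<forall>\<^sub>F Q in at_top.
     (\<forall>\<sigma> T :: real. 1 - 1 / 2024 < \<sigma> \<longrightarrow> \<sigma> < 1 \<longrightarrow> 1 \<le> T \<longrightarrow> T \<le> Q \<longrightarrow>
        real_of_int (\<Sum>z\<in>character_family Q. zero_count F (snd z) \<sigma> T) \<le> Kz * Q powr (C' * (1 - \<sigma>)) * ln Q powr A) \<longrightarrow>
     (\<forall>z\<in>character_family Q.
        norm (L_twist F (snd z) (1 / 2)) \<le> Kh * (real (fst z) powr (real dF / 4) / exp (ln (real (fst z)) powr \<delta>))) \<longrightarrow>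
     (\<Sum>z\<in>character_family Q. (norm (L_twist F (snd z) (1 / 2)))\<^sup>2) \<le> K * (Q powr (real dF / 2) * ln Q powr (- \<eta>))"
    (is "\<exists>K. \<forall>\<^sub>F Q in at_top. ?P K Q")
proof -
  obtain Kg where good: "\<forall>\<^sub>F Q in at_top. \<forall>G\<subseteq>character_family Q.
     (\<forall>z\<in>G. \<forall>s. Re s > 1 - ln Q powr (\<delta> - 1) / C' \<longrightarrow> \<bar>Im s\<bar> < Q \<longrightarrow> L_twist F (snd z) s \<noteq> 0) \<longrightarrow>
     (\<Sum>z\<in>G. (norm (L_twist F (snd z) (1 / 2)))\<^sup>2) \<le> Kg * (Q powr (real dF / 2) * ln Q powr (- \<eta>))"
    using good_characters_mean_square[OF \<eta> \<delta> C' d A3] by (elim exE) (rule that)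
  have \<delta>0: "\<delta> > 0" using \<eta> by simp
  define K where "K = \<bar>Kz\<bar> * (Kh\<^sup>2 * 2 powr (real dF / 2))"
  \<comment> \<open>Eventually \<beta> < 1 / 2024, so that 1 - \<beta> lies in the range of (A5');
    this is where \<delta> < 1 enters.\<close>
  have ev1: "\<forall>\<^sub>F l :: real in at_top. l powr (\<delta> - 1) < C' / 2024 \<and> l \<ge> 1"
    using \<delta> C' by (intro eventually_conj; real_asymp)
  have ev2: "\<forall>\<^sub>F l :: real in at_top. K * l powr (A + \<eta>) \<le> exp (1 * l powr \<delta>)"
    by (rule eventually_powr_le_exp) (use \<delta>0 in auto)
  show ?thesis
  proof (rule exI[of _ "Kg + 1"])
    from eventually_ge_at_top[of 2] good eventually_compose_ln[OF ev1] eventually_compose_ln[OF ev2]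
    show "\<forall>\<^sub>F Q in at_top. ?P (Kg + 1) Q"
    proof eventually_elim
      case (elim Q)
      note gd = elim(2)
      define l where "l = ln Q"
      define \<beta> where "\<beta> = l powr (\<delta> - 1) / C'"
      have Q2: "Q \<ge> 2" and l1: "l \<ge> 1" and \<beta>le: "l powr (\<delta> - 1) < C' / 2024"
        and cond: "K * l powr (A + \<eta>) \<le> exp (l powr \<delta>)"
        using elim by (auto simp: l_def)
      have \<beta>: "0 < \<beta>" "\<beta> < 1 / 2024" using \<beta>le l1 C' by (auto simp: \<beta>_def field_simps)
      define Fam where "Fam = character_family Q"
      have fin: "finite Fam" unfolding Fam_def by (rule character_family_finite_card(1)[OF Q2])
      define Bd where "Bd = {z \<in> Fam. \<exists>s. Re s > 1 - \<beta> \<and> \<bar>Im s\<bar> < Q \<and> L_twist F (snd z) s = 0}"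
      show ?case
      proof (intro impI)
        assume A5: "\<forall>\<sigma> T :: real. 1 - 1 / 2024 < \<sigma> \<longrightarrow> \<sigma> < 1 \<longrightarrow> 1 \<le> T \<longrightarrow> T \<le> Q \<longrightarrow>
            real_of_int (\<Sum>z\<in>character_family Q. zero_count F (snd z) \<sigma> T) \<le> Kz * Q powr (C' * (1 - \<sigma>)) * ln Q powr A"
          and A6: "\<forall>z\<in>character_family Q.
            norm (L_twist F (snd z) (1 / 2)) \<le> Kh * (real (fst z) powr (real dF / 4) / exp (ln (real (fst z)) powr \<delta>))"
        have fam: "fst z \<ge> 2" "Q \<le> real (fst z)" "real (fst z) \<le> 2 * Q" "snd z \<in> primitive_characters (fst z)" if "z \<in> Fam" for z
        proof -
          show q: "Q \<le> real (fst z)" "real (fst z) \<le> 2 * Q" "snd z \<in> primitive_characters (fst z)"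
            using that by (auto simp: Fam_def character_family_def)
          show "fst z \<ge> 2" using q Q2 by linarith
        qed
        \<comment> \<open>Every bad character has at least one counted zero, and the counts of the
          other characters are nonnegative.\<close>
        have "real (card Bd) = (\<Sum>z\<in>Fam. if z \<in> Bd then 1 else 0)"
          using fin by (subst sum.If_cases) (auto simp: Bd_def Int_def intro!: arg_cong[of _ _ card])
        also have "\<dots> \<le> (\<Sum>z\<in>Fam. real_of_int (zero_count F (snd z) (1 - \<beta>) Q))"
        proof (rule sum_mono)
          fix z assume z: "z \<in> Fam"
          have "zero_count F (snd z) (1 - \<beta>) Q \<ge> (if \<exists>s. Re s \<ge> 1 - \<beta> \<and> \<bar>Im s\<bar> \<le> Q \<and> L_twist F (snd z) s = 0 then 1 else 0)"
            by (rule zero_count_pos[OF fam(1,4)[OF z]])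
          moreover have "\<exists>s. Re s \<ge> 1 - \<beta> \<and> \<bar>Im s\<bar> \<le> Q \<and> L_twist F (snd z) s = 0" if "z \<in> Bd"
            using that unfolding Bd_def by (auto intro: less_imp_le)
          ultimately show "(if z \<in> Bd then 1 else 0) \<le> real_of_int (zero_count F (snd z) (1 - \<beta>) Q)"
            by (auto split: if_splits)
        qed
        also have "\<dots> = real_of_int (\<Sum>z\<in>character_family Q. zero_count F (snd z) (1 - \<beta>) Q)"
          by (simp add: Fam_def)
        also have "\<dots> \<le> Kz * Q powr (C' * (1 - (1 - \<beta>))) * ln Q powr A"
          using A5[rule_format, of "1 - \<beta>" Q] \<beta> Q2 by simp
        also have "\<dots> \<le> \<bar>Kz\<bar> * Q powr (C' * (1 - (1 - \<beta>))) * ln Q powr A"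
          by (intro mult_right_mono) auto
        also have "Q powr (C' * (1 - (1 - \<beta>))) = exp (l powr \<delta>)"
        proof -
          have "C' * (1 - (1 - \<beta>)) * l = l powr (\<delta> - 1) * l powr 1" using C' l1 by (simp add: \<beta>_def)
          also have "\<dots> = l powr \<delta>" by (simp only: powr_add[symmetric]) simp
          finally show ?thesis using Q2 by (simp add: powr_def l_def)
        qed
        finally have card: "real (card Bd) \<le> \<bar>Kz\<bar> * exp (l powr \<delta>) * l powr A" by (simp add: l_def)
        define v where "v = Kh\<^sup>2 * 2 powr (real dF / 2) * (Q powr (real dF / 2) * exp (- 2 * l powr \<delta>))"
        have v0: "v \<ge> 0" by (simp add: v_def)
        have bad_le: "(norm (L_twist F (snd z) (1 / 2)))\<^sup>2 \<le> v" if z: "z \<in> Bd" for z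
        proof -
          have zF: "z \<in> Fam" using z by (simp add: Bd_def)
          define q where "q = real (fst z)"
          have q: "Q \<le> q" "q \<le> 2 * Q" using fam[OF zF] by (auto simp: q_def)
          have "ln Q \<le> ln q" using q Q2 by (intro ln_mono) auto
          then have lq: "l powr \<delta> \<le> ln q powr \<delta>" using l1 \<delta>0 by (intro powr_mono2) (auto simp: l_def)
          have "norm (L_twist F (snd z) (1 / 2)) \<le> Kh * (q powr (real dF / 4) / exp (ln q powr \<delta>))"
            using A6 zF by (simp add: Fam_def q_def)
          then have "(norm (L_twist F (snd z) (1 / 2)))\<^sup>2 \<le> (Kh * (q powr (real dF / 4) / exp (ln q powr \<delta>)))\<^sup>2"
            by (intro power_mono) auto
          also have "\<dots> = Kh\<^sup>2 * ((q powr (real dF / 4))\<^sup>2 * exp (- 2 * ln q powr \<delta>))"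
          proof -
            have "exp (- 2 * ln q powr \<delta>) = inverse (exp (ln q powr \<delta>)) * inverse (exp (ln q powr \<delta>))"
              by (simp only: exp_minus[symmetric] exp_add[symmetric]) simp
            then show ?thesis by (simp only: power2_eq_square divide_inverse mult_ac)
          qed
          also have "(q powr (real dF / 4))\<^sup>2 = q powr (real dF / 2)"
            by (simp add: power2_eq_square powr_add[symmetric])
          also have "Kh\<^sup>2 * (q powr (real dF / 2) * exp (- 2 * ln q powr \<delta>)) \<le> Kh\<^sup>2 * ((2 * Q) powr (real dF / 2) * exp (- 2 * l powr \<delta>))"
            using q Q2 lq by (intro mult_left_mono mult_mono powr_mono2) auto
          also have "\<dots> = v" unfolding v_def using Q2 by (simp add: powr_mult)
          finally show ?thesis .
        qed
        have bad: "(\<Sum>z\<in>Bd. (norm (L_twist F (snd z) (1 / 2)))\<^sup>2) \<le> Q powr (real dF / 2) * l powr (- \<eta>)"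
        proof -
          have "(\<Sum>z\<in>Bd. (norm (L_twist F (snd z) (1 / 2)))\<^sup>2) \<le> (\<Sum>z\<in>Bd. v)" by (intro sum_mono bad_le)
          also have "\<dots> = real (card Bd) * v" by simp
          also have "\<dots> \<le> (\<bar>Kz\<bar> * exp (l powr \<delta>) * l powr A) * v" using card v0 by (rule mult_right_mono)
          also have "\<dots> = Q powr (real dF / 2) * ((K * l powr A) * (exp (l powr \<delta>) * exp (- 2 * l powr \<delta>)))"
            unfolding v_def K_def by (simp only: mult_ac)
          also have "exp (l powr \<delta>) * exp (- 2 * l powr \<delta>) = exp (- (l powr \<delta>))" by (simp only: exp_add[symmetric]) simp
          also have "K * l powr A = (K * l powr (A + \<eta>)) * l powr (- \<eta>)" by (simp add: powr_add[symmetric])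
          also have "Q powr (real dF / 2) * ((K * l powr (A + \<eta>)) * l powr (- \<eta>) * exp (- (l powr \<delta>))) \<le>
              Q powr (real dF / 2) * (exp (l powr \<delta>) * l powr (- \<eta>) * exp (- (l powr \<delta>)))"
            using cond by (intro mult_left_mono mult_right_mono) auto
          also have "\<dots> = Q powr (real dF / 2) * l powr (- \<eta>)" by (simp add: exp_minus)
          finally show ?thesis .
        qed
        have "(\<Sum>z\<in>Fam - Bd. (norm (L_twist F (snd z) (1 / 2)))\<^sup>2) \<le> Kg * (Q powr (real dF / 2) * ln Q powr (- \<eta>))"
        proof (rule gd[rule_format])
          show "Fam - Bd \<subseteq> character_family Q" by (auto simp: Fam_def)
          fix z s assume "z \<in> Fam - Bd" "Re s > 1 - ln Q powr (\<delta> - 1) / C'" "\<bar>Im s\<bar> < Q"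
          then show "L_twist F (snd z) s \<noteq> 0" unfolding Bd_def \<beta>_def l_def by blast
        qed
        moreover have "(\<Sum>z\<in>Fam. (norm (L_twist F (snd z) (1 / 2)))\<^sup>2) =
            (\<Sum>z\<in>Fam - Bd. (norm (L_twist F (snd z) (1 / 2)))\<^sup>2) + (\<Sum>z\<in>Bd. (norm (L_twist F (snd z) (1 / 2)))\<^sup>2)"
          by (rule sum.subset_diff[OF _ fin]) (auto simp: Bd_def)
        ultimately show "(\<Sum>z\<in>character_family Q. (norm (L_twist F (snd z) (1 / 2)))\<^sup>2) \<le> (Kg + 1) * (Q powr (real dF / 2) * ln Q powr (- \<eta>))"
          using bad by (simp add: Fam_def l_def distrib_right)
      qed
    qed
  qed
qed

end

section \<open>From large Q to all Q >= 2\<close>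

lemma sum_character_family:
  fixes f :: "nat \<Rightarrow> (int \<Rightarrow> complex) \<Rightarrow> 'a :: comm_monoid_add"
  assumes "Q \<ge> 2"
  shows "(\<Sum>q\<in>{q :: nat. Q \<le> real q \<and> real q \<le> 2 * Q}. \<Sum>chi\<in>primitive_characters q. f q chi) =
     (\<Sum>z\<in>character_family Q. f (fst z) (snd z))"
proof -
  have "finite (primitive_characters q)" if "Q \<le> real q" for q
    using that assms by (intro primitive_characters_finite_card(1)) (cases q; simp)
  then show ?thesis unfolding character_family_def
    by (subst sum.Sigma) (auto simp: finite_moduli split_def)
qed

lemma powr_bounded_on_interval:
  fixes a b x \<eta> :: real
  assumes "0 < a" "a \<le> x" "x \<le> b"
  shows "x powr \<eta> \<le> a powr \<eta> + b powr \<eta>"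
proof (cases "\<eta> \<ge> 0")
  case True
  then have "x powr \<eta> \<le> b powr \<eta>" using assms by (intro powr_mono2) auto
  then show ?thesis by (simp add: add_increasing)
next
  case False
  then have "x powr \<eta> \<le> a powr \<eta>" using assms by (intro powr_mono2') auto
  then show ?thesis by (simp add: add_increasing2)
qed

text \<open>(A5') and (A6) are required for the Q in question, with constants K5 and K6 fixed in
  advance. The constant K is chosen before Q, which expresses the uniformity of the
  conclusion.\<close>

theorem theorem1p5:
  fixes F :: L_datum and d :: nat
    and \<delta> \<eta> \<epsilon> C' A K5 K6 :: real
  assumes framework: "L_framework F"
    and degree: "L_degree F = d" "d \<ge> 5"
    and delta: "0 < \<delta>" "\<delta> < 1"
    and A1: "\<forall>n\<ge>1. norm (L_coeff F n) \<le> real (divisor_fun d n)"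
    and A2: "\<epsilon> > 0"
      "\<exists>K X0. \<forall>X Y :: real. X \<ge> 2 \<longrightarrow> X \<ge> X0 \<longrightarrow> X powr (1 - \<epsilon>) \<le> Y \<longrightarrow> Y \<le> X \<longrightarrow>
         (\<Sum>n\<in>{n :: nat. X \<le> real n \<and> real n \<le> X + Y}. (norm (L_coeff F n))\<^sup>2) \<le> K * Y"
    and A3: "\<exists>K. \<forall>P1 P2 X :: real. 2 \<le> P1 \<longrightarrow> P1 \<le> P2 \<longrightarrow> P2 \<le> X \<longrightarrow>
         (\<Sum>n\<in>{n :: nat. 1 \<le> n \<and> real n \<le> X \<and>
                 coprime n (\<Prod>p\<in>{p :: nat. prime p \<and> P1 \<le> real p \<and> real p \<le> P2}. p)}.
            (norm (L_coeff F n))\<^sup>2) \<le> K * (X * (ln P1 / ln P2))"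
    and A5_constants: "C' > 0" "A > 0"
    and eta: "\<eta> < \<delta>"
  shows "\<exists>K. \<forall>Q :: real. Q \<ge> 2 \<longrightarrow>
     \<comment> \<open>(A5')\<close>
     (\<forall>\<sigma> T :: real. 1 - 1 / 2024 < \<sigma> \<longrightarrow> \<sigma> < 1 \<longrightarrow> 1 \<le> T \<longrightarrow> T \<le> Q \<longrightarrow>
        real_of_int (\<Sum>q\<in>{q :: nat. Q \<le> real q \<and> real q \<le> 2 * Q}.
          \<Sum>chi\<in>primitive_characters q. zero_count F chi \<sigma> T)
        \<le> K5 * Q powr (C' * (1 - \<sigma>)) * ln Q powr A) \<longrightarrow>
     \<comment> \<open>(A6)\<close>
     (\<forall>q :: nat. Q \<le> real q \<longrightarrow> real q \<le> 2 * Q \<longrightarrow> (\<forall>chi\<in>primitive_characters q.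
        norm (L_twist F chi (1 / 2)) \<le> K6 * (real q powr (real d / 4) / exp (ln (real q) powr \<delta>)))) \<longrightarrow>
     (\<Sum>q\<in>{q :: nat. Q \<le> real q \<and> real q \<le> 2 * Q}.
        \<Sum>chi\<in>primitive_characters q. (norm (L_twist F chi (1 / 2)))\<^sup>2)
     \<le> K * (Q powr (real d / 2) / ln Q powr \<eta>)"
proof -
  interpret L_framework F by (rule framework)
  interpret L_framework_divisor_bound F
    by unfold_locales (use A1 degree in auto)
  obtain K3 where K3: "sieve_bound K3"
    using A3 by (elim exE) (rule that, unfold sieve_bound_def, assumption)
  \<comment> \<open>A positive exponent between \<eta> and \<delta>: the mean square bound asks for
    a positive one, while the given \<eta> may be 0 or negative. For ln Q >= 1 the larger exponent
    gives the stronger bound.\<close>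
  define \<eta>' where "\<eta>' = (max \<eta> 0 + \<delta>) / 2"
  have \<eta>': "0 < \<eta>'" "\<eta>' < \<delta>" "\<eta> \<le> \<eta>'" using delta eta by (auto simp: \<eta>'_def max_def)
  have d5: "L_degree F \<ge> 5" using degree by simp
  obtain Kb Q0 where Kb: "\<forall>Q\<ge>Q0.
     (\<forall>\<sigma> T :: real. 1 - 1 / 2024 < \<sigma> \<longrightarrow> \<sigma> < 1 \<longrightarrow> 1 \<le> T \<longrightarrow> T \<le> Q \<longrightarrow>
        real_of_int (\<Sum>z\<in>character_family Q. zero_count F (snd z) \<sigma> T) \<le> K5 * Q powr (C' * (1 - \<sigma>)) * ln Q powr A) \<longrightarrow>
     (\<forall>z\<in>character_family Q.
        norm (L_twist F (snd z) (1 / 2)) \<le> K6 * (real (fst z) powr (real (L_degree F) / 4) / exp (ln (real (fst z)) powr \<delta>))) \<longrightarrow>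
     (\<Sum>z\<in>character_family Q. (norm (L_twist F (snd z) (1 / 2)))\<^sup>2) \<le> Kb * (Q powr (real (L_degree F) / 2) * ln Q powr (- \<eta>'))"
    using all_characters_mean_square[where Kz = K5 and Kh = K6 and A = A, OF \<eta>'(1,2) delta(2) A5_constants(1) d5 K3]
    unfolding eventually_at_top_linorder by (elim exE) (rule that)
  define Q1 where "Q1 = max Q0 (exp 1)"
  \<comment> \<open>For Q below Q1 only moduli up to 2 Q1 occur, so the left side is at most the
    fixed number W. U bounds \<open>ln Q powr \<eta>\<close> for such Q, whatever the sign of
    \<eta>, so that U times the right-hand side is at least 1.\<close>
  define W where "W = (\<Sum>q\<in>{2..nat \<lceil>2 * Q1\<rceil>}. \<Sum>chi\<in>primitive_characters q. (norm (L_twist F chi (1 / 2)))\<^sup>2)"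
  have W0: "W \<ge> 0" unfolding W_def by (intro sum_nonneg) auto
  define U where "U = ln 2 powr \<eta> + ln Q1 powr \<eta>"
  have U0: "U \<ge> 0" by (simp add: U_def)
  show ?thesis
  proof (intro exI[of _ "\<bar>Kb\<bar> + W * U"] allI impI)
    fix Q :: real
    assume Q: "Q \<ge> 2"
      and A5: "\<forall>\<sigma> T :: real. 1 - 1 / 2024 < \<sigma> \<longrightarrow> \<sigma> < 1 \<longrightarrow> 1 \<le> T \<longrightarrow> T \<le> Q \<longrightarrow>
        real_of_int (\<Sum>q\<in>{q :: nat. Q \<le> real q \<and> real q \<le> 2 * Q}.
          \<Sum>chi\<in>primitive_characters q. zero_count F chi \<sigma> T)
        \<le> K5 * Q powr (C' * (1 - \<sigma>)) * ln Q powr A"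
      and A6: "\<forall>q :: nat. Q \<le> real q \<longrightarrow> real q \<le> 2 * Q \<longrightarrow> (\<forall>chi\<in>primitive_characters q.
        norm (L_twist F chi (1 / 2)) \<le> K6 * (real q powr (real d / 4) / exp (ln (real q) powr \<delta>)))"
    define R where "R = Q powr (real d / 2) / ln Q powr \<eta>"
    have lnQ: "ln Q > 0" using Q by simp
    then have lp: "ln Q powr \<eta> > 0" by simp
    then have R0: "R > 0" using Q by (simp add: R_def)
    have "(\<Sum>q\<in>{q :: nat. Q \<le> real q \<and> real q \<le> 2 * Q}. \<Sum>chi\<in>primitive_characters q. (norm (L_twist F chi (1 / 2)))\<^sup>2)
      \<le> \<bar>Kb\<bar> * R + W * U * R"
    proof (cases "Q \<ge> Q1")
      case True
      have Qe: "Q \<ge> exp 1" and Q0: "Q \<ge> Q0" using True by (simp_all add: Q1_def)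
      have l1: "ln Q \<ge> 1" using Qe Q by (simp add: ln_ge_iff)
      have big: "(\<Sum>z\<in>character_family Q. (norm (L_twist F (snd z) (1 / 2)))\<^sup>2) \<le> Kb * (Q powr (real (L_degree F) / 2) * ln Q powr (- \<eta>'))"
      proof (rule mp[OF spec[OF Kb] Q0, rule_format])
        fix \<sigma> T :: real assume *: "1 - 1 / 2024 < \<sigma>" "\<sigma> < 1" "1 \<le> T" "T \<le> Q"
        show "real_of_int (\<Sum>z\<in>character_family Q. zero_count F (snd z) \<sigma> T) \<le> K5 * Q powr (C' * (1 - \<sigma>)) * ln Q powr A"
          using A5[rule_format, OF *] by (simp only: sum_character_family[OF Q])
      next
        fix z assume "z \<in> character_family Q"
        then show "norm (L_twist F (snd z) (1 / 2)) \<le> K6 * (real (fst z) powr (real (L_degree F) / 4) / exp (ln (real (fst z)) powr \<delta>))"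
          using A6 degree(1) by (auto simp: character_family_def)
      qed
      have "Kb * (Q powr (real d / 2) * ln Q powr (- \<eta>')) \<le> \<bar>Kb\<bar> * (Q powr (real d / 2) * ln Q powr (- \<eta>))"
        using l1 \<eta>' by (intro mult_mono mult_left_mono powr_mono) auto
      also have "\<dots> = \<bar>Kb\<bar> * R" by (simp only: R_def powr_minus divide_inverse)
      finally have "(\<Sum>z\<in>character_family Q. (norm (L_twist F (snd z) (1 / 2)))\<^sup>2) \<le> \<bar>Kb\<bar> * R"
        using big degree(1) by simp
      moreover have "0 \<le> W * U * R" using W0 U0 R0 by simp
      ultimately show ?thesis unfolding sum_character_family[OF Q, of "\<lambda>q chi. (norm (L_twist F chi (1 / 2)))\<^sup>2"] by linarith
    next
      case False
      have "(\<Sum>q\<in>{q :: nat. Q \<le> real q \<and> real q \<le> 2 * Q}. \<Sum>chi\<in>primitive_characters q. (norm (L_twist F chi (1 / 2)))\<^sup>2) \<le> W"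
        unfolding W_def
      proof (rule sum_mono2)
        show "{q :: nat. Q \<le> real q \<and> real q \<le> 2 * Q} \<subseteq> {2..nat \<lceil>2 * Q1\<rceil>}"
        proof
          fix q :: nat assume "q \<in> {q :: nat. Q \<le> real q \<and> real q \<le> 2 * Q}"
          then have "Q \<le> real q" "real q \<le> 2 * Q" by auto
          then have "2 \<le> real q" "real q \<le> 2 * Q1" using Q False by linarith+
          then show "q \<in> {2..nat \<lceil>2 * Q1\<rceil>}" by simp linarith
        qed
      qed (auto intro: sum_nonneg)
      also have "W = W * 1" by simp
      also have "\<dots> \<le> W * (U * R)"
      proof (rule mult_left_mono[OF _ W0])
        have "ln Q powr \<eta> \<le> U" unfolding U_def
          using Q False by (intro powr_bounded_on_interval) auto
        moreover have "1 \<le> Q powr (real d / 2)" using Q by (intro ge_one_powr_ge_zero) auto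
        ultimately have "1 * ln Q powr \<eta> \<le> Q powr (real d / 2) * U" using lp by (intro mult_mono) auto
        then show "1 \<le> U * R" using lp by (simp add: R_def field_simps)
      qed
      finally have "(\<Sum>q\<in>{q :: nat. Q \<le> real q \<and> real q \<le> 2 * Q}. \<Sum>chi\<in>primitive_characters q. (norm (L_twist F chi (1 / 2)))\<^sup>2) \<le> W * U * R"
        by (simp add: mult.assoc)
      moreover have "0 \<le> \<bar>Kb\<bar> * R" using R0 by simp
      ultimately show ?thesis by linarith
    qed
    then show "(\<Sum>q\<in>{q :: nat. Q \<le> real q \<and> real q \<le> 2 * Q}. \<Sum>chi\<in>primitive_characters q. (norm (L_twist F chi (1 / 2)))\<^sup>2)
      \<le> (\<bar>Kb\<bar> + W * U) * (Q powr (real d / 2) / ln Q powr \<eta>)"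
      by (simp only: R_def distrib_right)
  qed
qed

end
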